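(* Suppose that $\{u,z\}\in\mathcal X\times\mathcal Y$ is a stationary point of the Lagrangian functional $\mathcal L$, i.e. $\mathcal L_u(u,z)(\psi)+\mathcal L_z(u,z)(\varphi)=0$ for all $\{\psi,\varphi\}\in\mathcal X\times\mathcal Y$. Let $\{u_{kh},z_{kh}\}\in\mathcal X_{kh}^{r,p}\times\mathcal X_{kh}^{r,p}$ denote its stabilized Galerkin approximation, i.e. $u_{kh}$ solves the stabilized discrete primal problem and $z_{kh}$ solves the stabilized discrete dual problem. Then, neglecting the higher order error terms, for arbitrary $\varphi_{kh}\in\mathcal X_{kh}^{r,p}$ there holds as a linear approximation the cell-wise error representation $$\begin{aligned}\mathcal J(u)-\mathcal J(u_{kh})\doteq{}&\int_0^T\sum_{K\in\mathcal T_h}\Big\{\langle\mathcal R(u_{kh}),z-\varphi_{kh}\rangle_K-\delta_K\langle\mathcal R(u_{kh}),\boldsymbol b\cdot\nabla\varphi_{kh}\rangle_K-\langle\mathcal E(u_{kh}),z-\varphi_{kh}\rangle_{\partial K}\Big\}\,\mathrm dt\\&-\langle u_{kh,0}^+-u_0,z(t_0)-\varphi_{kh,0}^+\rangle_\Omega-\sum_{m=2}^M\langle[u_{kh}]_{m-1},z(t_{m-1})-\varphi_{kh,m-1}^+\rangle_\Omega\\&+\sum_{K\in\mathcal T_h}\delta_K\langle u_{kh,0}^+-u_0,\boldsymbol b\cdot\nabla\varphi_{kh,0}^+\rangle_K+\sum_{m=2}^M\sum_{K\in\mathcal T_h}\delta_K\langle[u_{kh}]_{m-1},\boldsymbol b\cdot\nabla\varphi_{kh,m-1}^+\rangle_K,\end{aligned}$$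 where "$\doteq$" means equality once the neglected terms are added to the right-hand side: $\mathcal J(u)-\mathcal J(u_{kh})$ equals the right-hand side plus $\mathcal R_{\mathcal J}+\frac12\Delta\rho_{\mathcal J}$ with, for $e=u-u_{kh}$, $$\mathcal R_{\mathcal J}=\frac12\int_0^1\mathcal J'''(u_{kh}+se)(e,e,e)\,s(s-1)\,\mathrm ds,\qquad\Delta\rho_{\mathcal J}=-\int_0^1\mathcal J''(u_{kh}+se)(e,e)\,\mathrm ds.$$ The cell- and edge-wise residuals are defined by $$\mathcal R(u_{kh})|_K:=f-\partial_tu_{kh}-\boldsymbol b\cdot\nabla u_{kh}+\nabla\cdot(\varepsilon\nabla u_{kh})-\alpha u_{kh},$$ $$\mathcal E(u_{kh})|_\Gamma:=\begin{cases}\frac12\boldsymbol n\cdot[\varepsilon\nabla u_{kh}]&\text{if }\Gamma\subset\partial K\setminus\partial\Omega,\\0&\text{if }\Gamma\subset\partial\Omega,\end{cases}$$ where $[\nabla u_{kh}]:=\nabla u_{kh}|_{\Gamma\cap K'}-\nabla u_{kh}|_{\Gamma\cap K}$ is the jump of $\nabla u_{kh}$ over the inner edge $\Gamma$ (shared by $K$ and its neighbour $K'$) with unit normal vector $\boldsymbol n$ pointing from $K'$ to $K$.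
   Context: **Data.** $\Omega\subset\mathbb R^d$, $d\in\{2,3\}$, is a bounded polygonal/polyhedral domain, $I=(0,T]$. The coefficients satisfy $\alpha\ge 0$ constant, $\varepsilon>0$ constant, $\boldsymbol b\in H^1(\Omega)^d\cap L^\infty(\Omega)^d$ with $\nabla\cdot\boldsymbol b=0$ a.e.; $f\in L^2(0,T;H^{-1}(\Omega))$ (element-wise $L^2$ products with $f$ below are assumed to make sense), $u_0\in L^2(\Omega)$. The underlying problem is $\partial_tu+\boldsymbol b\cdot\nabla u-\nabla\cdot(\varepsilon\nabla u)+\alpha u=f$ in $\Omega\times(0,T]$, $u=0$ on $\partial\Omega\times(0,T]$, $u(0)=u_0$. **Notation.** $\langle\cdot,\cdot\rangle=\langle\cdot,\cdot\rangle_\Omega$ is the $L^2(\Omega)$ inner product (or the $H^{-1}$–$H^1_0$ duality pairing where needed), $\langle\cdot,\cdot\rangle_K$, $\langle\cdot,\cdot\rangle_{\partial K}$ the $L^2(K)$, $L^2(\partial K)$ inner products, $\langle\langle v,w\rangle\rangle=\int_0^T\langle v,w\rangle\,\mathrm dt$. Time grid $0=t_0<t_1<\dots<t_M=T$, $I_m=(t_{m-1},t_m]$, $k_m=t_m-t_{m-1}$. One-sided limits $v_m^\pm=\lim_{s\to0,\,s>0}v(t_m\pm s)$, jumps in time $[v]_m=v_m^+-v_m^-$. For piecewise-in-time functions, the values at $0$ and $T$ occurring in the forms below are understood as $v(0)=v_0^+$, $v(T)=v_M^-=v_T^-$. **Spaces.** $\mathcal X=\{v\in L^2(0,T;H^1_0(\Omega)):\partial_tv\in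 L^2(0,T;H^{-1}(\Omega))\}$. $\mathcal Y=\{v\in L^2(0,T;H^1_0(\Omega)): v|_{I_m}\in C(\overline{I_m};H^1_0(\Omega))\text{ for all }m\}$ (i.e. $v|_{I_m}$ has a continuous extension to $\overline{I_m}$). $\mathcal T_h=\{K\}$ is a conforming decomposition of $\Omega$ into triangles/tetrahedra; $\mathcal V_h^p=\{v\in H^1_0(\Omega)\cap C(\overline\Omega):v|_K\in\mathcal P_p(K)\ \forall K\in\mathcal T_h\}$; $\mathcal V_h^{p,m}$ is such a space for the time interval $I_m$ (the mesh may differ between the $I_m$; $\mathcal T_h$ denotes the mesh of the respective interval). For integers $r\ge0$, $p\ge1$, $\mathcal X_{kh}^{r,p}$ is the space of functions $v_{kh}$ with $v_{kh}|_{I_m}\in\mathcal P_r(I_m;\mathcal V_h^{p,m})$ (polynomials in time of degree at most $r$ with values in $\mathcal V_h^{p,m}$), $m=1,\dots,M$, and $v_{kh}(0)\in\mathcal V_h^p$. One has $\mathcal X_{kh}^{r,p}\subset\mathcal Y$. **Target functional.** $\mathcal J:\mathcal Y\to\mathbb R$ is Fréchet differentiable, as often as derivatives of it are used, and is also evaluated on $\mathcal X+\mathcal X_{kh}^{r,p}$. Its derivative has an $L^2$ representation: for each $v$ there is $j(v)\in L^2(0,T;L^2(\Omega))$ with $\mathcal J'(v)(\varphi)=\langle\langle j(v),\varphi\rangle\rangle$. **Forms.** $F(\varphi)=\langle\langle f,\varphi\rangle\rangle$, $a(v)(\varphi)=\langle\langle\boldsymbol b\cdot\nabla v,\varphi\rangle\rangle+\langle\langle\varepsilon\nabla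 v,\nabla\varphi\rangle\rangle+\langle\langle\alpha v,\varphi\rangle\rangle$, $$A(v)(\varphi)=\sum_{m=1}^M\int_{I_m}\langle\partial_tv,\varphi\rangle\,\mathrm dt+a(v)(\varphi)+\sum_{m=2}^M\langle[v]_{m-1},\varphi_{m-1}^+\rangle,$$ $$A^\ast(z)(\psi)=-\sum_{m=1}^M\int_{I_m}\langle\partial_tz,\psi\rangle\,\mathrm dt-\langle\langle\boldsymbol b\cdot\nabla z,\psi\rangle\rangle+\langle\langle\varepsilon\nabla z,\nabla\psi\rangle\rangle+\langle\langle\alpha z,\psi\rangle\rangle-\sum_{m=2}^M\langle[z]_{m-1},\psi_{m-1}^-\rangle.$$ Stabilization (SUPG) forms, with positive parameters $\delta_K,\delta_K^\ast$ ($\delta_K\sim\min\{h_K/(p\|\boldsymbol b\|_{L^\infty(K)}),\,h_K^2/(p^4\varepsilon),\,1/(k_m+\alpha),\,(k_m+\alpha)/\alpha^2\}$, where $h_K$ is the diameter of $K$): $$S(u_{kh})(\varphi_{kh})=\sum_{m=1}^M\int_{I_m}\sum_K\delta_K\langle R(u_{kh}),\boldsymbol b\cdot\nabla\varphi_{kh}\rangle_K\,\mathrm dt+\sum_{m=2}^M\sum_K\delta_K\langle[u_{kh}]_{m-1},\boldsymbol b\cdot\nabla\varphi_{kh,m-1}^+\rangle_K+\sum_K\delta_K\langle u_{kh,0}^+-u_0,\boldsymbol b\cdot\nabla\varphi_{kh,0}^+\rangle_K,$$ $R(u_{kh})=\partial_tu_{kh}+\boldsymbol b\cdot\nabla u_{kh}-\nabla\cdot(\varepsilon\nabla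 u_{kh})+\alpha u_{kh}-f$ (not to be confused with $\mathcal R(u_{kh})$ of the claim); $$S^\ast(z_{kh})(\psi_{kh})=\sum_{m=1}^M\int_{I_m}\sum_K\delta_K^\ast\langle R^\ast(z_{kh}),-\boldsymbol b\cdot\nabla\psi_{kh}\rangle_K\,\mathrm dt-\sum_{m=2}^M\sum_K\delta_K^\ast\langle[z_{kh}]_{m-1},-\boldsymbol b\cdot\nabla\psi_{kh,m-1}^-\rangle_K+\sum_K\delta_K^\ast\langle z_{kh,M}^-,-\boldsymbol b\cdot\nabla\psi_{kh,M}^-\rangle_K,$$ $R^\ast(z_{kh})=-\partial_tz_{kh}-\boldsymbol b\cdot\nabla z_{kh}-\nabla\cdot(\varepsilon\nabla z_{kh})+\alpha z_{kh}-j(u_{kh})$ (residuals taken element-wise). **Lagrangian.** $\mathcal L:(\mathcal X+\mathcal X_{kh}^{r,p})\times\mathcal Y\to\mathbb R$, $$\mathcal L(u,z)=\mathcal J(u)+F(z)-\sum_{m=1}^M\int_{I_m}\langle\partial_tu,z\rangle\,\mathrm dt-a(u)(z)-\sum_{m=2}^M\langle[u]_{m-1},z_{m-1}^+\rangle-\langle u(0)-u_0,z(0)\rangle,$$ $\mathcal L_u,\mathcal L_z$ being its partial derivatives. For a stationary point $\{u,z\}$, $u$ is the weak solution of the primal problem and $z\in\mathcal X\cap\mathcal Y$ is the solution of the dual problem $-\langle\langle\partial_tz,\psi\rangle\rangle-\langle\langle\boldsymbol b\cdot\nabla z,\psi\rangle\rangle+\langle\langle\varepsilon\nabla z,\nabla\psi\rangle\rangle+\langle\langle\alpha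 z,\psi\rangle\rangle+\langle z(T),\psi(T)\rangle=\mathcal J'(u)(\psi)$ for all $\psi\in\mathcal Y$; $u,z\in C([0,T];L^2(\Omega))$. **Discrete problems.** Stabilized discrete primal problem: $u_{kh}\in\mathcal X_{kh}^{r,p}$ with $A(u_{kh})(\varphi_{kh})+S(u_{kh})(\varphi_{kh})+\langle u_{kh,0}^+,\varphi_{kh,0}^+\rangle=F(\varphi_{kh})+\langle u_0,\varphi_{kh,0}^+\rangle$ for all $\varphi_{kh}\in\mathcal X_{kh}^{r,p}$. Stabilized discrete dual problem: $z_{kh}\in\mathcal X_{kh}^{r,p}$ with $A^\ast(z_{kh})(\psi_{kh})+S^\ast(z_{kh})(\psi_{kh})+\langle z_{kh,M}^-,\psi_{kh,M}^-\rangle=\mathcal J'(u_{kh})(\psi_{kh})$ for all $\psi_{kh}\in\mathcal X_{kh}^{r,p}$. *)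

theory Defs
  imports "HOL-Analysis.Analysis"
begin

section \<open>Lebesgue and Sobolev spaces\<close>

text \<open>Elements of function spaces are represented by functions on the whole type; only the values
  (almost everywhere) on the set in question matter.\<close>

definition L2 :: "'a::euclidean_space set \<Rightarrow> ('a \<Rightarrow> 'b::euclidean_space) set" where
  "L2 S = {v \<in> borel_measurable (lebesgue_on S). integrable (lebesgue_on S) (\<lambda>x. (norm (v x))\<^sup>2)}"

definition ip :: "'a::euclidean_space set \<Rightarrow> ('a \<Rightarrow> 'b::euclidean_space) \<Rightarrow> ('a \<Rightarrow> 'b) \<Rightarrow> real" where
  "ip S v w = (\<integral>x. v x \<bullet> w x \<partial>lebesgue_on S)"

definition L2n :: "'a::euclidean_space set \<Rightarrow> ('a \<Rightarrow> 'b::euclidean_space) \<Rightarrow> real" where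
  "L2n S v = sqrt (ip S v v)"

primrec Ck :: "nat \<Rightarrow> ('a::euclidean_space \<Rightarrow> real) \<Rightarrow> bool" where
  "Ck 0 f \<longleftrightarrow> continuous_on UNIV f"
| "Ck (Suc k) f \<longleftrightarrow> f differentiable_on UNIV \<and>
     (\<forall>i\<in>Basis. Ck k (\<lambda>x. frechet_derivative f (at x) i))"

definition test_fun :: "'a::euclidean_space set \<Rightarrow> ('a \<Rightarrow> real) set" where
  "test_fun S = {\<phi>. (\<forall>k. Ck k \<phi>) \<and> compact (closure {x. \<phi> x \<noteq> 0}) \<and> closure {x. \<phi> x \<noteq> 0} \<subseteq> S}"

definition grad :: "('a::euclidean_space \<Rightarrow> real) \<Rightarrow> 'a \<Rightarrow> 'a" where
  "grad v x = (\<Sum>i\<in>Basis. frechet_derivative v (at x) i *\<^sub>R i)"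

definition divg :: "('a::euclidean_space \<Rightarrow> 'a) \<Rightarrow> 'a \<Rightarrow> real" where
  "divg w x = (\<Sum>i\<in>Basis. frechet_derivative w (at x) i \<bullet> i)"

definition has_wgrad :: "'a::euclidean_space set \<Rightarrow> ('a \<Rightarrow> real) \<Rightarrow> ('a \<Rightarrow> 'a) \<Rightarrow> bool" where
  "has_wgrad S v g \<longleftrightarrow> g \<in> L2 S \<and>
     (\<forall>\<phi>\<in>test_fun S. (\<integral>x. v x *\<^sub>R grad \<phi> x \<partial>lebesgue_on S) = - (\<integral>x. \<phi> x *\<^sub>R g x \<partial>lebesgue_on S))"

definition wgrad :: "'a::euclidean_space set \<Rightarrow> ('a \<Rightarrow> real) \<Rightarrow> 'a \<Rightarrow> 'a" where
  "wgrad S v = (SOME g. has_wgrad S v g)"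

definition H1 :: "'a::euclidean_space set \<Rightarrow> ('a \<Rightarrow> real) set" where
  "H1 S = {v \<in> L2 S. \<exists>g. has_wgrad S v g}"

definition H1n :: "'a::euclidean_space set \<Rightarrow> ('a \<Rightarrow> real) \<Rightarrow> real" where
  "H1n S v = sqrt ((L2n S v)\<^sup>2 + (L2n S (wgrad S v))\<^sup>2)"

definition H10 :: "'a::euclidean_space set \<Rightarrow> ('a \<Rightarrow> real) set" where
  "H10 S = {v \<in> H1 S. \<exists>\<phi>. (\<forall>n::nat. \<phi> n \<in> test_fun S) \<and> (\<lambda>n. H1n S (\<lambda>x. \<phi> n x - v x)) \<longlonglongrightarrow> 0}"

definition Hm1 :: "'a::euclidean_space set \<Rightarrow> (('a \<Rightarrow> real) \<Rightarrow> real) set" where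
  "Hm1 S = {l. (\<forall>v\<in>H10 S. \<forall>w\<in>H10 S. \<forall>c. l (\<lambda>x. v x + c * w x) = l v + c * l w) \<and>
              (\<exists>C. \<forall>v\<in>H10 S. \<bar>l v\<bar> \<le> C * H1n S v)}"

definition Hm1n :: "'a::euclidean_space set \<Rightarrow> (('a \<Rightarrow> real) \<Rightarrow> real) \<Rightarrow> real" where
  "Hm1n S l = (SUP v\<in>{v \<in> H10 S. H1n S v \<le> 1}. \<bar>l v\<bar>)"


section \<open>Functions of time with values in a space\<close>

text \<open>A value space is given by a set V of real functions and a (semi)norm N on it. Taking the argument
  type 'b to be 'a covers the spaces over the domain, taking it to be 'a => real covers the dual
  space Hm1.\<close>

definition strongly_measurable ::
    "real set \<Rightarrow> ('b \<Rightarrow> real) set \<Rightarrow> (('b \<Rightarrow> real) \<Rightarrow> real) \<Rightarrow> (real \<Rightarrow> 'b \<Rightarrow> real) \<Rightarrow> bool" where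
  "strongly_measurable S V N v \<longleftrightarrow>
     (\<exists>s. (\<forall>n::nat. simple_function (lebesgue_on S) (s n) \<and> s n ` S \<subseteq> V) \<and>
          (AE t in lebesgue_on S. (\<lambda>n. N (\<lambda>x. s n t x - v t x)) \<longlonglongrightarrow> 0))"

definition Lbochner ::
    "nat \<Rightarrow> real set \<Rightarrow> ('b \<Rightarrow> real) set \<Rightarrow> (('b \<Rightarrow> real) \<Rightarrow> real) \<Rightarrow> (real \<Rightarrow> 'b \<Rightarrow> real) set" where
  "Lbochner q S V N = {v. (AE t in lebesgue_on S. v t \<in> V) \<and> strongly_measurable S V N v \<and>
     integrable (lebesgue_on S) (\<lambda>t. N (v t) ^ q)}"

definition cont_into ::
    "('b \<Rightarrow> real) set \<Rightarrow> (('b \<Rightarrow> real) \<Rightarrow> real) \<Rightarrow> real set \<Rightarrow> (real \<Rightarrow> 'b \<Rightarrow> real) \<Rightarrow> bool" where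
  "cont_into V N S v \<longleftrightarrow> (\<forall>t\<in>S. v t \<in> V \<and> ((\<lambda>s. N (\<lambda>x. v s x - v t x)) \<longlongrightarrow> 0) (at t within S))"

text \<open>Weak time derivative on the interval from c to d, with values in Hm1.\<close>

definition has_tderiv ::
    "'a::euclidean_space set \<Rightarrow> real \<Rightarrow> real \<Rightarrow> (real \<Rightarrow> 'a \<Rightarrow> real) \<Rightarrow> (real \<Rightarrow> ('a \<Rightarrow> real) \<Rightarrow> real) \<Rightarrow> bool" where
  "has_tderiv \<Omega> c d v g \<longleftrightarrow> g \<in> Lbochner 2 {c<..d} (Hm1 \<Omega>) (Hm1n \<Omega>) \<and>
     (\<forall>\<phi>\<in>H10 \<Omega>. \<forall>\<eta>\<in>test_fun {c<..<d}.
        (\<integral>t. deriv \<eta> t * ip \<Omega> (v t) \<phi> \<partial>lebesgue_on {c<..d}) = - (\<integral>t. \<eta> t * g t \<phi> \<partial>lebesgue_on {c<..d}))"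

definition tderiv ::
    "'a::euclidean_space set \<Rightarrow> real \<Rightarrow> real \<Rightarrow> (real \<Rightarrow> 'a \<Rightarrow> real) \<Rightarrow> real \<Rightarrow> ('a \<Rightarrow> real) \<Rightarrow> real" where
  "tderiv \<Omega> c d v = (SOME g. has_tderiv \<Omega> c d v g)"

text \<open>One-sided limits in time, taken in L2; for functions with values in H10 that converge in H10
  this is the same class. The limits are representatives of L2 classes, so their gradient has to be
  taken as wgrad.\<close>

definition rlim :: "'a::euclidean_space set \<Rightarrow> (real \<Rightarrow> 'a \<Rightarrow> real) \<Rightarrow> real \<Rightarrow> 'a \<Rightarrow> real" where
  "rlim \<Omega> v \<tau> = (SOME w. w \<in> L2 \<Omega> \<and> ((\<lambda>t. L2n \<Omega> (\<lambda>x. v t x - w x)) \<longlongrightarrow> 0) (at_right \<tau>))"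

definition llim :: "'a::euclidean_space set \<Rightarrow> (real \<Rightarrow> 'a \<Rightarrow> real) \<Rightarrow> real \<Rightarrow> 'a \<Rightarrow> real" where
  "llim \<Omega> v \<tau> = (SOME w. w \<in> L2 \<Omega> \<and> ((\<lambda>t. L2n \<Omega> (\<lambda>x. v t x - w x)) \<longlongrightarrow> 0) (at_left \<tau>))"

definition tjump :: "'a::euclidean_space set \<Rightarrow> (real \<Rightarrow> 'a \<Rightarrow> real) \<Rightarrow> real \<Rightarrow> 'a \<Rightarrow> real" where
  "tjump \<Omega> v \<tau> x = rlim \<Omega> v \<tau> x - llim \<Omega> v \<tau> x"

definition axpy :: "real \<Rightarrow> (real \<Rightarrow> 'a \<Rightarrow> real) \<Rightarrow> (real \<Rightarrow> 'a \<Rightarrow> real) \<Rightarrow> real \<Rightarrow> 'a \<Rightarrow> real" where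
  "axpy c h v = (\<lambda>t x. v t x + c * h t x)"


section \<open>Data of the continuous and the discrete problem\<close>

text \<open>Field dlt D m K is the parameter of the cell K of the mesh of the m-th time interval
  (dlts for the dual problem). The time intervals are numbered from 1; msh D 0 is the mesh of
  the initial time.\<close>

record 'a setting =
  Om :: "'a set"
  vel :: "'a \<Rightarrow> 'a"
  eps :: real
  alp :: real
  rhs :: "real \<Rightarrow> 'a \<Rightarrow> real"
  ini :: "'a \<Rightarrow> real"
  nstep :: nat
  node :: "nat \<Rightarrow> real"
  msh :: "nat \<Rightarrow> 'a set set"
  tdeg :: nat
  xdeg :: nat
  dlt :: "nat \<Rightarrow> 'a set \<Rightarrow> real"
  dlts :: "nat \<Rightarrow> 'a set \<Rightarrow> real"

definition Tend :: "'a setting \<Rightarrow> real" where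
  "Tend D = node D (nstep D)"

definition slab :: "'a setting \<Rightarrow> nat \<Rightarrow> real set" where
  "slab D m = {node D (m - 1)<..node D m}"

text \<open>The condition on the interior says that the domain lies on one side of its boundary (no slits).\<close>

definition polyhedral_domain :: "'a::euclidean_space set \<Rightarrow> bool" where
  "polyhedral_domain \<Omega> \<longleftrightarrow> open \<Omega> \<and> connected \<Omega> \<and> bounded \<Omega> \<and> \<Omega> \<noteq> {} \<and> interior (closure \<Omega>) = \<Omega> \<and>
     (\<exists>P. finite P \<and> (\<forall>p\<in>P. polytope p) \<and> closure \<Omega> = \<Union>P)"

text \<open>The right-hand side is a square integrable function of time with values in Hm1. That the
  element-wise L2 products with it make sense means that it is given by functions in L2,
  integrably in time.\<close>

definition data_ok :: "'a::euclidean_space setting \<Rightarrow> bool" where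
  "data_ok D \<longleftrightarrow> polyhedral_domain (Om D) \<and> 0 \<le> alp D \<and> 0 < eps D \<and>
     (\<forall>i\<in>Basis. (\<lambda>x. vel D x \<bullet> i) \<in> H1 (Om D)) \<and>
     (\<exists>C. AE x in lebesgue_on (Om D). norm (vel D x) \<le> C) \<and>
     (AE x in lebesgue_on (Om D). (\<Sum>i\<in>Basis. wgrad (Om D) (\<lambda>y. vel D y \<bullet> i) x \<bullet> i) = 0) \<and>
     (\<lambda>t \<phi>. ip (Om D) (rhs D t) \<phi>) \<in> Lbochner 2 {0<..Tend D} (Hm1 (Om D)) (Hm1n (Om D)) \<and>
     rhs D \<in> Lbochner 1 {0<..Tend D} (L2 (Om D)) (L2n (Om D)) \<and>
     ini D \<in> L2 (Om D)"

definition conforming_mesh :: "'a::euclidean_space set \<Rightarrow> 'a set set \<Rightarrow> bool" where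
  "conforming_mesh \<Omega> \<T> \<longleftrightarrow> triangulation \<T> \<and> (\<forall>K\<in>\<T>. int DIM('a) simplex K) \<and> \<Union>\<T> = closure \<Omega>"

definition Linf_norm :: "'a::euclidean_space set \<Rightarrow> ('a \<Rightarrow> 'a) \<Rightarrow> real" where
  "Linf_norm S b = Inf {C. 0 \<le> C \<and> (AE x in lebesgue_on S. norm (b x) \<le> C)}"

text \<open>The size of the stabilization parameters; in ereal a positive number divided by 0 is infinite, so a
  term with vanishing denominator drops out of the minimum.\<close>

definition supg_size :: "'a::euclidean_space setting \<Rightarrow> nat \<Rightarrow> 'a set \<Rightarrow> ereal" where
  "supg_size D m K =
     (let h = diameter K; k = node D m - node D (m - 1); p = real (xdeg D) in
      Min {ereal h / ereal (p * Linf_norm K (vel D)), ereal (h\<^sup>2) / ereal (p ^ 4 * eps D),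
           1 / ereal (k + alp D), ereal (k + alp D) / ereal ((alp D)\<^sup>2)})"

definition discretization_ok :: "'a::euclidean_space setting \<Rightarrow> bool" where
  "discretization_ok D \<longleftrightarrow> 1 \<le> nstep D \<and> node D 0 = 0 \<and> (\<forall>m<nstep D. node D m < node D (Suc m)) \<and>
     (\<forall>m\<le>nstep D. conforming_mesh (Om D) (msh D m)) \<and> 1 \<le> xdeg D \<and>
     (\<forall>m\<in>{1..nstep D}. \<forall>K\<in>msh D m. 0 < dlt D m K \<and> 0 < dlts D m K) \<and>
     (\<exists>c C. 0 < c \<and> 0 < C \<and> (\<forall>m\<in>{1..nstep D}. \<forall>K\<in>msh D m.
        ereal c * supg_size D m K \<le> ereal (dlt D m K) \<and> ereal (dlt D m K) \<le> ereal C * supg_size D m K))"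


section \<open>Function spaces in space and time\<close>

text \<open>The elements of the space X are represented by their unique representatives that are continuous
  functions of time with values in L2. This gives a meaning to the values at single times.\<close>

definition X_space :: "'a::euclidean_space setting \<Rightarrow> (real \<Rightarrow> 'a \<Rightarrow> real) set" where
  "X_space D = {v \<in> Lbochner 2 {0<..Tend D} (H10 (Om D)) (H1n (Om D)).
     (\<exists>g. has_tderiv (Om D) 0 (Tend D) v g) \<and> cont_into (L2 (Om D)) (L2n (Om D)) {0..Tend D} v}"

definition Y_space :: "'a::euclidean_space setting \<Rightarrow> (real \<Rightarrow> 'a \<Rightarrow> real) set" where
  "Y_space D = {v \<in> Lbochner 2 {0<..Tend D} (H10 (Om D)) (H1n (Om D)).
     \<forall>m\<in>{1..nstep D}. \<exists>w. cont_into (H10 (Om D)) (H1n (Om D)) {node D (m - 1)..node D m} w \<and>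
       (\<forall>t\<in>slab D m. v t = w t)}"

definition poly_space :: "nat \<Rightarrow> ('a::euclidean_space \<Rightarrow> real) set" where
  "poly_space p = {q. \<exists>c. \<forall>x. q x =
     (\<Sum>\<beta> | \<beta> \<in> Basis \<rightarrow>\<^sub>E {..p} \<and> sum \<beta> Basis \<le> p. c \<beta> * (\<Prod>i\<in>Basis. (x \<bullet> i) ^ \<beta> i))}"

definition Vh :: "'a::euclidean_space set \<Rightarrow> nat \<Rightarrow> 'a set set \<Rightarrow> ('a \<Rightarrow> real) set" where
  "Vh \<Omega> p \<T> = {v \<in> H10 \<Omega>. continuous_on (closure \<Omega>) v \<and> (\<forall>K\<in>\<T>. \<exists>q\<in>poly_space p. \<forall>x\<in>K. v x = q x)}"

definition Xkh :: "'a::euclidean_space setting \<Rightarrow> (real \<Rightarrow> 'a \<Rightarrow> real) set" where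
  "Xkh D = {v. v 0 \<in> Vh (Om D) (xdeg D) (msh D 0) \<and>
     (\<forall>m\<in>{1..nstep D}. \<exists>w. (\<forall>l\<le>tdeg D. w l \<in> Vh (Om D) (xdeg D) (msh D m)) \<and>
        (\<forall>t\<in>slab D m. \<forall>x\<in>closure (Om D). v t x = (\<Sum>l\<le>tdeg D. t ^ l * w l x)))}"

definition X_plus_Xkh :: "'a::euclidean_space setting \<Rightarrow> (real \<Rightarrow> 'a \<Rightarrow> real) set" where
  "X_plus_Xkh D = {axpy 1 w v |v w. v \<in> X_space D \<and> w \<in> Xkh D}"


section \<open>Target functional\<close>

definition seminorm_on :: "(real \<Rightarrow> 'a \<Rightarrow> real) set \<Rightarrow> ((real \<Rightarrow> 'a \<Rightarrow> real) \<Rightarrow> real) \<Rightarrow> bool" where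
  "seminorm_on W N \<longleftrightarrow> (\<forall>v\<in>W. 0 \<le> N v) \<and> (\<forall>v\<in>W. \<forall>c. N (\<lambda>t x. c * v t x) = \<bar>c\<bar> * N v) \<and>
     (\<forall>v\<in>W. \<forall>w\<in>W. N (axpy 1 w v) \<le> N v + N w)"

text \<open>Frechet differentiability on the space W with seminorm N of a map G whose values are functionals
  on the set Q, normed by the smallest C with |G v k| <= C om k for all k. For a real-valued map, Q is
  the one-point set and om is 1.\<close>

definition has_frechet_on ::
    "(real \<Rightarrow> 'a \<Rightarrow> real) set \<Rightarrow> ((real \<Rightarrow> 'a \<Rightarrow> real) \<Rightarrow> real) \<Rightarrow> 'k set \<Rightarrow> ('k \<Rightarrow> real) \<Rightarrow>
     ((real \<Rightarrow> 'a \<Rightarrow> real) \<Rightarrow> 'k \<Rightarrow> real) \<Rightarrow>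
     ((real \<Rightarrow> 'a \<Rightarrow> real) \<Rightarrow> (real \<Rightarrow> 'a \<Rightarrow> real) \<Rightarrow> 'k \<Rightarrow> real) \<Rightarrow> bool" where
  "has_frechet_on W N Q om G G' \<longleftrightarrow> (\<forall>v\<in>W.
     (\<forall>k\<in>Q. \<forall>h\<in>W. \<forall>h'\<in>W. \<forall>c. G' v (axpy c h' h) k = G' v h k + c * G' v h' k) \<and>
     (\<exists>C. \<forall>h\<in>W. \<forall>k\<in>Q. \<bar>G' v h k\<bar> \<le> C * N h * om k) \<and>
     (\<forall>e>0. \<exists>d>0. \<forall>h\<in>W. N h < d \<longrightarrow>
        (\<forall>k\<in>Q. \<bar>G (axpy 1 h v) k - G v k - G' v h k\<bar> \<le> e * N h * om k)))"

text \<open>J is three times differentiable with derivatives J1, J2, J3.\<close>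

definition thrice_differentiable_on where
  "thrice_differentiable_on W N J J1 J2 J3 \<longleftrightarrow> seminorm_on W N \<and>
     has_frechet_on W N {()} (\<lambda>_. 1) (\<lambda>v _. J v) (\<lambda>v h _. J1 v h) \<and>
     has_frechet_on W N W N J1 J2 \<and>
     has_frechet_on W N (W \<times> W) (\<lambda>(h, k). N h * N k)
       (\<lambda>v (h, k). J2 v h k) (\<lambda>v l (h, k). J3 v l h k)"

definition st_ip :: "'a::euclidean_space setting \<Rightarrow> (real \<Rightarrow> 'a \<Rightarrow> 'b::euclidean_space) \<Rightarrow> (real \<Rightarrow> 'a \<Rightarrow> 'b) \<Rightarrow> real" where
  "st_ip D v w = (\<integral>t. ip (Om D) (v t) (w t) \<partial>lebesgue_on {0<..Tend D})"

definition L2_represented_on where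
  "L2_represented_on D W J1 j \<longleftrightarrow> (\<forall>v\<in>W. j v \<in> Lbochner 2 {0<..Tend D} (L2 (Om D)) (L2n (Om D)) \<and>
     (\<forall>\<phi>\<in>W. J1 v \<phi> = st_ip D (j v) \<phi>))"

text \<open>The functional is differentiable on Y and on X + Xkh, each with its own norm.\<close>

definition target_functional where
  "target_functional D NY NX J J1 J2 J3 j \<longleftrightarrow>
     thrice_differentiable_on (Y_space D) NY J J1 J2 J3 \<and> L2_represented_on D (Y_space D) J1 j \<and>
     thrice_differentiable_on (X_plus_Xkh D) NX J J1 J2 J3 \<and> L2_represented_on D (X_plus_Xkh D) J1 j"


section \<open>Variational forms and Lagrangian\<close>

definition b_grad :: "'a::euclidean_space setting \<Rightarrow> ('a \<Rightarrow> real) \<Rightarrow> 'a \<Rightarrow> real" where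
  "b_grad D v x = vel D x \<bullet> wgrad (Om D) v x"

definition F_form :: "'a::euclidean_space setting \<Rightarrow> (real \<Rightarrow> 'a \<Rightarrow> real) \<Rightarrow> real" where
  "F_form D \<phi> = st_ip D (rhs D) \<phi>"

definition a_form :: "'a::euclidean_space setting \<Rightarrow> (real \<Rightarrow> 'a \<Rightarrow> real) \<Rightarrow> (real \<Rightarrow> 'a \<Rightarrow> real) \<Rightarrow> real" where
  "a_form D v \<phi> = st_ip D (\<lambda>t. b_grad D (v t)) \<phi>
     + st_ip D (\<lambda>t x. eps D *\<^sub>R wgrad (Om D) (v t) x) (\<lambda>t. wgrad (Om D) (\<phi> t))
     + st_ip D (\<lambda>t x. alp D * v t x) \<phi>"

definition tpairing :: "'a::euclidean_space setting \<Rightarrow> (real \<Rightarrow> 'a \<Rightarrow> real) \<Rightarrow> (real \<Rightarrow> 'a \<Rightarrow> real) \<Rightarrow> real" where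
  "tpairing D v \<phi> = (\<Sum>m=1..nstep D.
     \<integral>t. tderiv (Om D) (node D (m - 1)) (node D m) v t (\<phi> t) \<partial>lebesgue_on (slab D m))"

definition A_form :: "'a::euclidean_space setting \<Rightarrow> (real \<Rightarrow> 'a \<Rightarrow> real) \<Rightarrow> (real \<Rightarrow> 'a \<Rightarrow> real) \<Rightarrow> real" where
  "A_form D v \<phi> = tpairing D v \<phi> + a_form D v \<phi>
     + (\<Sum>m=2..nstep D. ip (Om D) (tjump (Om D) v (node D (m - 1))) (rlim (Om D) \<phi> (node D (m - 1))))"

definition As_form :: "'a::euclidean_space setting \<Rightarrow> (real \<Rightarrow> 'a \<Rightarrow> real) \<Rightarrow> (real \<Rightarrow> 'a \<Rightarrow> real) \<Rightarrow> real" where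
  "As_form D z \<psi> = - tpairing D z \<psi> - st_ip D (\<lambda>t. b_grad D (z t)) \<psi>
     + st_ip D (\<lambda>t x. eps D *\<^sub>R wgrad (Om D) (z t) x) (\<lambda>t. wgrad (Om D) (\<psi> t))
     + st_ip D (\<lambda>t x. alp D * z t x) \<psi>
     - (\<Sum>m=2..nstep D. ip (Om D) (tjump (Om D) z (node D (m - 1))) (llim (Om D) \<psi> (node D (m - 1))))"

text \<open>Residuals of discrete functions, pointwise in the interior of the space-time cells, where these
  functions are polynomials (all other points form a null set).\<close>

definition supg_res :: "'a::euclidean_space setting \<Rightarrow> (real \<Rightarrow> 'a \<Rightarrow> real) \<Rightarrow> real \<Rightarrow> 'a \<Rightarrow> real" where
  "supg_res D u t x = deriv (\<lambda>s. u s x) t + b_grad D (u t) x - divg (\<lambda>y. eps D *\<^sub>R grad (u t) y) x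
     + alp D * u t x - rhs D t x"

definition supg_dual_res :: "'a::euclidean_space setting \<Rightarrow> (real \<Rightarrow> 'a \<Rightarrow> real) \<Rightarrow> (real \<Rightarrow> 'a \<Rightarrow> real) \<Rightarrow> real \<Rightarrow> 'a \<Rightarrow> real" where
  "supg_dual_res D g z t x = - deriv (\<lambda>s. z s x) t - b_grad D (z t) x - divg (\<lambda>y. eps D *\<^sub>R grad (z t) y) x
     + alp D * z t x - g t x"

text \<open>In the jump terms, the cells and parameters are those of the time interval to which the one-sided
  limit of the test function belongs: the m-th one for S and the (m-1)-st one for S*.\<close>

definition S_form :: "'a::euclidean_space setting \<Rightarrow> (real \<Rightarrow> 'a \<Rightarrow> real) \<Rightarrow> (real \<Rightarrow> 'a \<Rightarrow> real) \<Rightarrow> real" where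
  "S_form D u \<phi> =
     (\<Sum>m=1..nstep D. \<integral>t. (\<Sum>K\<in>msh D m. dlt D m K * ip K (supg_res D u t) (b_grad D (\<phi> t))) \<partial>lebesgue_on (slab D m))
     + (\<Sum>m=2..nstep D. \<Sum>K\<in>msh D m. dlt D m K *
          ip K (tjump (Om D) u (node D (m - 1))) (b_grad D (rlim (Om D) \<phi> (node D (m - 1)))))
     + (\<Sum>K\<in>msh D 1. dlt D 1 K * ip K (\<lambda>x. rlim (Om D) u 0 x - ini D x) (b_grad D (rlim (Om D) \<phi> 0)))"

definition Ss_form ::
    "'a::euclidean_space setting \<Rightarrow> (real \<Rightarrow> 'a \<Rightarrow> real) \<Rightarrow> (real \<Rightarrow> 'a \<Rightarrow> real) \<Rightarrow> (real \<Rightarrow> 'a \<Rightarrow> real) \<Rightarrow> real" where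
  "Ss_form D g z \<psi> =
     (\<Sum>m=1..nstep D. \<integral>t. (\<Sum>K\<in>msh D m. dlts D m K * ip K (supg_dual_res D g z t) (\<lambda>x. - b_grad D (\<psi> t) x)) \<partial>lebesgue_on (slab D m))
     - (\<Sum>m=2..nstep D. \<Sum>K\<in>msh D (m - 1). dlts D (m - 1) K *
          ip K (tjump (Om D) z (node D (m - 1))) (\<lambda>x. - b_grad D (llim (Om D) \<psi> (node D (m - 1))) x))
     + (\<Sum>K\<in>msh D (nstep D). dlts D (nstep D) K *
          ip K (llim (Om D) z (Tend D)) (\<lambda>x. - b_grad D (llim (Om D) \<psi> (Tend D)) x))"

definition Lagr ::
    "'a::euclidean_space setting \<Rightarrow> ((real \<Rightarrow> 'a \<Rightarrow> real) \<Rightarrow> real) \<Rightarrow> (real \<Rightarrow> 'a \<Rightarrow> real) \<Rightarrow> (real \<Rightarrow> 'a \<Rightarrow> real) \<Rightarrow> real" where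
  "Lagr D J u z = J u + F_form D z - tpairing D u z - a_form D u z
     - (\<Sum>m=2..nstep D. ip (Om D) (tjump (Om D) u (node D (m - 1))) (rlim (Om D) z (node D (m - 1))))
     - ip (Om D) (\<lambda>x. rlim (Om D) u 0 x - ini D x) (rlim (Om D) z 0)"

definition Lagr_u where
  "Lagr_u D J u z \<psi> = deriv (\<lambda>s. Lagr D J (axpy s \<psi> u) z) 0"

definition Lagr_z where
  "Lagr_z D J u z \<phi> = deriv (\<lambda>s. Lagr D J u (axpy s \<phi> z)) 0"

definition stationary_point where
  "stationary_point D J u z \<longleftrightarrow> u \<in> X_space D \<and> z \<in> Y_space D \<and>
     (\<forall>\<psi>\<in>X_space D. \<forall>\<phi>\<in>Y_space D. Lagr_u D J u z \<psi> + Lagr_z D J u z \<phi> = 0)"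

definition discrete_primal_solution where
  "discrete_primal_solution D u \<longleftrightarrow> u \<in> Xkh D \<and> (\<forall>\<phi>\<in>Xkh D.
     A_form D u \<phi> + S_form D u \<phi> + ip (Om D) (rlim (Om D) u 0) (rlim (Om D) \<phi> 0)
     = F_form D \<phi> + ip (Om D) (ini D) (rlim (Om D) \<phi> 0))"

definition discrete_dual_solution where
  "discrete_dual_solution D J1 j u z \<longleftrightarrow> z \<in> Xkh D \<and> (\<forall>\<psi>\<in>Xkh D.
     As_form D z \<psi> + Ss_form D (j u) z \<psi> + ip (Om D) (llim (Om D) z (Tend D)) (llim (Om D) \<psi> (Tend D))
     = J1 u \<psi>)"


section \<open>Cell and edge residuals\<close>

definition cell_res :: "'a::euclidean_space setting \<Rightarrow> (real \<Rightarrow> 'a \<Rightarrow> real) \<Rightarrow> real \<Rightarrow> 'a \<Rightarrow> real" where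
  "cell_res D u t x = rhs D t x - deriv (\<lambda>s. u s x) t - b_grad D (u t) x
     + divg (\<lambda>y. eps D *\<^sub>R grad (u t) y) x - alp D * u t x"

text \<open>Surface measure of a flat facet: the measure of a part of the facet is the Lebesgue measure of the
  orthogonal cylinder of height 1 over it. The choice of the unit normal is irrelevant.\<close>

definition facet_measure :: "'a::euclidean_space set \<Rightarrow> 'a measure" where
  "facet_measure \<Gamma> =
     (let n = SOME n. norm n = 1 \<and> (\<forall>x\<in>\<Gamma>. \<forall>y\<in>\<Gamma>. n \<bullet> (y - x) = 0) in
      distr (lebesgue_on {x + s *\<^sub>R n |x s. x \<in> \<Gamma> \<and> 0 \<le> s \<and> s \<le> 1}) borel (closest_point (affine hull \<Gamma>)))"

text \<open>The trace on a facet: the continuous extension, from the dense subspace of test functions to H10, of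
  the restriction to the facet.\<close>

definition facet_trace :: "'a::euclidean_space set \<Rightarrow> 'a set \<Rightarrow> ('a \<Rightarrow> real) \<Rightarrow> 'a \<Rightarrow> real" where
  "facet_trace \<Omega> \<Gamma> v = (SOME g. g \<in> borel_measurable borel \<and> integrable (facet_measure \<Gamma>) (\<lambda>x. (g x)\<^sup>2) \<and>
     (\<exists>\<phi>. (\<forall>n::nat. \<phi> n \<in> test_fun \<Omega>) \<and> (\<lambda>n. H1n \<Omega> (\<lambda>x. \<phi> n x - v x)) \<longlonglongrightarrow> 0 \<and>
          (\<lambda>n. \<integral>x. (\<phi> n x - g x)\<^sup>2 \<partial>facet_measure \<Gamma>) \<longlonglongrightarrow> 0))"

text \<open>The unit normal of the facet that points into K, i.e. from the neighbour K' to K.\<close>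

definition inner_normal :: "'a::euclidean_space set \<Rightarrow> 'a set \<Rightarrow> 'a" where
  "inner_normal K \<Gamma> = (THE n. norm n = 1 \<and> (\<forall>x\<in>\<Gamma>. \<forall>y\<in>\<Gamma>. n \<bullet> (y - x) = 0) \<and> (\<forall>x\<in>\<Gamma>. \<forall>y\<in>K. 0 \<le> n \<bullet> (y - x)))"

text \<open>The gradient on the closed cell K as seen from K.\<close>

definition cell_grad :: "'a::euclidean_space set \<Rightarrow> ('a \<Rightarrow> real) \<Rightarrow> 'a \<Rightarrow> 'a" where
  "cell_grad K v x = Lim (at x within interior K) (grad v)"

definition edge_res ::
    "'a::euclidean_space setting \<Rightarrow> 'a set set \<Rightarrow> 'a set \<Rightarrow> 'a set \<Rightarrow> ('a \<Rightarrow> real) \<Rightarrow> 'a \<Rightarrow> real" where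
  "edge_res D \<T> K \<Gamma> v x =
     (if \<Gamma> \<subseteq> frontier (Om D) then 0
      else let K' = THE K'. K' \<in> \<T> \<and> K' \<noteq> K \<and> \<Gamma> facet_of K' in
        1 / 2 * (inner_normal K \<Gamma> \<bullet> (eps D *\<^sub>R cell_grad K' v x - eps D *\<^sub>R cell_grad K v x)))"

definition edge_pairing ::
    "'a::euclidean_space setting \<Rightarrow> 'a set set \<Rightarrow> 'a set \<Rightarrow> ('a \<Rightarrow> real) \<Rightarrow> ('a \<Rightarrow> real) \<Rightarrow> real" where
  "edge_pairing D \<T> K v w = (\<Sum>\<Gamma> | \<Gamma> facet_of K.
     \<integral>x. edge_res D \<T> K \<Gamma> v x * facet_trace (Om D) \<Gamma> w x \<partial>facet_measure \<Gamma>)"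


section \<open>Neglected terms of higher order\<close>

text \<open>The integrals over the parameter s are Henstock-Kurzweil integrals, which extend the Lebesgue
  integral and exist without continuity of the last derivative.\<close>

definition R_J where
  "R_J J3 u e = 1 / 2 * integral {0..1} (\<lambda>s. J3 (axpy s e u) e e e * (s * (s - 1)))"

definition Delta_rho_J where
  "Delta_rho_J J2 u e = - integral {0..1} (\<lambda>s. J2 (axpy s e u) e e)"

end

theory Submission
 imports Defs
begin

text \<open>The trapezoidal rule along the segment from the discrete to the continuous solution gives
 J u - J ukh = J1 u e + R_J + 1/2 Delta_rho_J. Stationarity in z, tested with z itself, evaluates J1 u u, and
 stationarity in u is the dual equation. The latter cannot be tested with ukh, which jumps at the nodes; it
 is tested with products of a power of t, a steep ramp in time and a finite element function. In the limit of
 steep ramps, left-continuity of z turns the ramps into the jump terms of J1 u ukh. Subtracting the discrete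
 primal problem tested with phi_kh leaves the residual of ukh tested with z - phi_kh, and integration by parts
 on each cell produces the cell and edge residuals. Because traces on facets are limits of test functions, the
 integration by parts is done for test functions first and carried over by a trace inequality. The divergence
 theorem on a simplex is obtained edge by edge: translating the simplex along an edge exchanges thin layers at
 two of its facets, and the layers converge to the facets.\<close>

text \<open>The obstacle is that \<open>z\<close> is only known to lie in \<open>Y_space\<close>:
  membership allows jumps at the nodes and says nothing about a time derivative, so no integration
  by parts in time can be performed on \<open>z\<close>. Every time derivative stays on the other
  factor, and the dual equation is available for test functions in \<open>X_space\<close> only. What
  carries it over to discrete functions is the representation of \<open>J1 u\<close> by
  \<open>j u\<close>: for a fixed spatial function \<open>w\<close> the dual equation becomes an
  identity between integrals over time, which can be cut down to a single slab. Slabs contain their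
  right end point, so members of \<open>Y_space\<close> are continuous from the left at the nodes.
  Ramps that climb before a node pick out this value, which is why the jumps of \<open>ukh\<close>
  meet \<open>z (node D (m - 1))\<close> and not a right-hand limit. Weak gradients, weak time
  derivatives and one-sided limits are choices that are determined up to null sets, so they enter
  only through identities that hold almost everywhere.\<close>

lemmas integral_cong = Bochner_Integration.integral_cong
lemmas integrable_bound = Bochner_Integration.integrable_bound
lemmas integrable_add = Bochner_Integration.integrable_add
lemmas integral_add = Bochner_Integration.integral_add
lemmas integral_sum = Bochner_Integration.integral_sum
lemmas integrable_diff = Bochner_Integration.integrable_diff
lemmas integral_diff = Bochner_Integration.integral_diff
lemmas integral_nonneg = Bochner_Integration.integral_nonneg
lemmas integrable_sum = Bochner_Integration.integrable_sum
lemmas integrable_cong = Bochner_Integration.integrable_cong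
lemmas integrable_mult_right = Bochner_Integration.integrable_mult_right
lemmas integrable_restrict_UNIV = Lebesgue_Measure.integrable_restrict_UNIV
lemmas integral_restrict_UNIV = Lebesgue_Measure.integral_restrict_UNIV

abbreviation (input) leb where "leb \<equiv> lebesgue_on"
abbreviation (input) fmeas where "fmeas \<equiv> facet_measure"

abbreviation (input) seq_tends :: "(nat \<Rightarrow> 'a::topological_space) \<Rightarrow> 'a \<Rightarrow> bool" (infix "---->" 60) where
 "X ----> l \<equiv> X \<longlonglongrightarrow> l"

text \<open>Rests on the completeness of Lebesgue measure; extension by 0 moves the question from
  \<open>S\<close> to the whole space, where completeness is available.\<close>

lemma borel_measurable_lebesgue_on_AE:
 fixes f g :: "'a::euclidean_space \<Rightarrow> 'b::euclidean_space"
 assumes S: "S \<in> sets lebesgue" and ae: "AE x in leb S. f x = g x"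
  and f: "f \<in> borel_measurable (leb S)"
 shows "g \<in> borel_measurable (leb S)"
proof -
 have "AE x in lebesgue. x \<in> S \<longrightarrow> f x = g x"
  using ae S by (simp add: AE_restrict_space_iff)
 then have "AE x in lebesgue. (if x \<in> S then f x else 0) = (if x \<in> S then g x else 0)"
  by eventually_elim simp
 moreover have "(%x. if x \<in> S then f x else 0) \<in> borel_measurable lebesgue"
  using f S by (rule borel_measurable_if_I)
 ultimately have "(%x. if x \<in> S then g x else 0) \<in> borel_measurable lebesgue"
  by (rule borel_measurable_AE[rotated])
 then show ?thesis by (rule borel_measurable_if_D)
qed

lemma lebesgue_on_integrable_cong_AE:
 fixes f g :: "'a::euclidean_space \<Rightarrow> 'b::euclidean_space"
 assumes S: "S \<in> sets lebesgue" and ae: "AE x in leb S. f x = g x"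
  and f: "integrable (leb S) f"
 shows "integrable (leb S) g"
 by (rule integrable_cong_AE_imp[OF f borel_measurable_lebesgue_on_AE[OF S ae borel_measurable_integrable[OF f]] ae])

text \<open>No measurability is assumed: if one of the two functions fails to be measurable, so does
  the other, and both integrals take the default value 0.\<close>

lemma lebesgue_on_integral_cong_AE:
 fixes f g :: "'a::euclidean_space \<Rightarrow> 'b::euclidean_space"
 assumes S: "S \<in> sets lebesgue" and ae: "AE x in leb S. f x = g x"
 shows "integral\<^sup>L (leb S) f = integral\<^sup>L (leb S) g"
proof -
 have ae': "AE x in leb S. g x = f x"
  using ae by eventually_elim simp
 show ?thesis
 proof (cases "f \<in> borel_measurable (leb S)")
  case True
  show ?thesis
   by (rule integral_cong_AE[OF True borel_measurable_lebesgue_on_AE[OF S ae True] ae])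
 next
  case False
  have "integral\<^sup>L (leb S) f = 0"
   using False by (intro not_integrable_integral_eq) (blast dest: borel_measurable_integrable)
  moreover have "g \<notin> borel_measurable (leb S)"
   using False borel_measurable_lebesgue_on_AE[OF S ae'] by blast
  then have "integral\<^sup>L (leb S) g = 0"
   by (intro not_integrable_integral_eq) (blast dest: borel_measurable_integrable)
  ultimately show ?thesis by simp
 qed
qed

section \<open>Square-integrable functions\<close>

lemma L2_measurable: "v \<in> L2 S ==> v \<in> borel_measurable (leb S)"
 by (simp add: L2_def)

lemma L2_square_integrable: "v \<in> L2 S ==> integrable (leb S) (%x. (norm (v x))\<^sup>2)"
 by (simp add: L2_def)

lemma L2I:
 assumes "v \<in> borel_measurable (leb S)" "integrable (leb S) g" "\<And>x. x \<in> S ==> (norm (v x))\<^sup>2 \<le> g x"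
 shows "v \<in> L2 S"
 unfolding L2_def
proof (intro CollectI conjI assms(1))
 show "integrable (leb S) (%x. (norm (v x))\<^sup>2)"
 proof (rule integrable_bound[OF assms(2)])
  show "(%x. (norm (v x))\<^sup>2) \<in> borel_measurable (leb S)" using assms(1) by measurable
  show "AE x in leb S. norm ((norm (v x))\<^sup>2) \<le> norm (g x)"
  proof (rule AE_I2)
   fix x assume "x \<in> space (leb S)"
   then have "(norm (v x))\<^sup>2 \<le> g x" using assms(3) by simp
   then show "norm ((norm (v x))\<^sup>2) \<le> norm (g x)" by simp
  qed
 qed
qed

lemma L2_inner_integrable:
 assumes "v \<in> L2 S" "w \<in> L2 S" shows "integrable (leb S) (%x. v x \<bullet> w x)"
proof (rule integrable_bound)
 show "integrable (leb S) (%x. (norm (v x))\<^sup>2 + (norm (w x))\<^sup>2)"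
  using assms by (intro integrable_add L2_square_integrable)
 show "(%x. v x \<bullet> w x) \<in> borel_measurable (leb S)"
  using assms L2_measurable by measurable
 show "AE x in leb S. norm (v x \<bullet> w x) \<le> norm ((norm (v x))\<^sup>2 + (norm (w x))\<^sup>2)"
 proof (rule AE_I2)
  fix x
  have "norm (v x \<bullet> w x) \<le> norm (v x) * norm (w x)" by (simp add: Cauchy_Schwarz_ineq2)
  also have "\<dots> \<le> (norm (v x))\<^sup>2 + (norm (w x))\<^sup>2"
   using sum_squares_bound[of "norm (v x)" "norm (w x)"] mult_nonneg_nonneg[OF norm_ge_zero norm_ge_zero, of "v x" "w x"]
   by linarith
  finally show "norm (v x \<bullet> w x) \<le> norm ((norm (v x))\<^sup>2 + (norm (w x))\<^sup>2)" by simp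
 qed
qed

lemma L2_lincomb:
 assumes v: "v \<in> L2 S" and w: "w \<in> L2 S" shows "(%x. v x + c *\<^sub>R w x) \<in> L2 S"
proof (rule L2I)
 show "(%x. v x + c *\<^sub>R w x) \<in> borel_measurable (leb S)"
  using assms L2_measurable by measurable
 show "integrable (leb S) (%x. (norm (v x))\<^sup>2 + 2 * c * (v x \<bullet> w x) + c\<^sup>2 * (norm (w x))\<^sup>2)"
  using assms by (intro integrable_add L2_square_integrable integrable_mult_right L2_inner_integrable)
 show "(norm (v x + c *\<^sub>R w x))\<^sup>2 \<le> (norm (v x))\<^sup>2 + 2 * c * (v x \<bullet> w x) + c\<^sup>2 * (norm (w x))\<^sup>2" for x
  unfolding power2_norm_eq_inner
  by (simp add: inner_add_left inner_add_right inner_commute power2_eq_square algebra_simps)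
qed

lemma L2_zero: "(%x. 0) \<in> L2 S" by (simp add: L2_def)

lemma L2_scaleR: "w \<in> L2 S ==> (%x. c *\<^sub>R w x) \<in> L2 S"
 using L2_lincomb[OF L2_zero, of w S c] by simp

lemma L2_add: "v \<in> L2 S ==> w \<in> L2 S ==> (%x. v x + w x) \<in> L2 S"
 using L2_lincomb[of v S w 1] by simp

lemma L2_diff: "v \<in> L2 S ==> w \<in> L2 S ==> (%x. v x - w x) \<in> L2 S"
 using L2_lincomb[of v S w "-1"] by simp

lemma L2_mult_left:
 fixes w :: "'a::euclidean_space \<Rightarrow> real" shows "w \<in> L2 S ==> (%x. c * w x) \<in> L2 S"
 using L2_scaleR[of w S c] by simp

lemma L2_axpy:
 fixes w :: "'a::euclidean_space \<Rightarrow> real" shows "v \<in> L2 S ==> w \<in> L2 S ==> (%x. v x + c * w x) \<in> L2 S"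
 using L2_lincomb[of v S w c] by simp

lemma L2_sum: "(\<And>i. i \<in> A ==> v i \<in> L2 S) ==> (%x. \<Sum>i\<in>A. v i x) \<in> L2 S"
 by (induction A rule: infinite_finite_induct) (auto simp: L2_zero L2_add)

lemma L2_cong_AE:
 fixes v w :: "'a::euclidean_space \<Rightarrow> 'b::euclidean_space"
 assumes S: "S \<in> sets lebesgue" and ae: "AE x in leb S. v x = w x" and v: "v \<in> L2 S" shows "w \<in> L2 S"
 unfolding L2_def
proof (intro CollectI conjI)
 show "w \<in> borel_measurable (leb S)"
  by (rule borel_measurable_lebesgue_on_AE[OF S ae L2_measurable[OF v]])
 show "integrable (leb S) (%x. (norm (w x))\<^sup>2)"
  by (rule lebesgue_on_integrable_cong_AE[OF S _ L2_square_integrable[OF v]]) (use ae in eventually_elim, simp)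
qed

lemma ip_cong_AE:
 assumes S: "S \<in> sets lebesgue" and "AE x in leb S. v x = v' x" "AE x in leb S. w x = w' x"
 shows "ip S v w = ip S v' w'"
 unfolding ip_def
proof (rule lebesgue_on_integral_cong_AE[OF S])
 show "AE x in leb S. v x \<bullet> w x = v' x \<bullet> w' x" using assms(2,3) by eventually_elim simp
qed

lemma ip_cong: "(\<And>x. x \<in> S ==> v x = v' x) ==> (\<And>x. x \<in> S ==> w x = w' x) ==> ip S v w = ip S v' w'"
 unfolding ip_def by (intro integral_cong) auto

lemma ip_commute: "ip S v w = ip S w v"
 by (simp add: ip_def inner_commute)

lemma ip_lincomb_left: "v \<in> L2 S ==> v' \<in> L2 S ==> w \<in> L2 S ==>
  ip S (%x. v x + c *\<^sub>R v' x) w = ip S v w + c * ip S v' w"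
 unfolding ip_def using L2_inner_integrable[of v S w] L2_inner_integrable[of v' S w]
 by (simp add: inner_add_left)

lemma ip_lincomb_right: "v \<in> L2 S ==> v' \<in> L2 S ==> w \<in> L2 S ==>
  ip S w (%x. v x + c *\<^sub>R v' x) = ip S w v + c * ip S w v'"
 using ip_lincomb_left[of v S v' w c] by (simp add: ip_commute[of S w])

lemma ip_add_left: "v \<in> L2 S ==> v' \<in> L2 S ==> w \<in> L2 S ==> ip S (%x. v x + v' x) w = ip S v w + ip S v' w"
 using ip_lincomb_left[of v S v' w 1] by simp

lemma ip_diff_left: "v \<in> L2 S ==> v' \<in> L2 S ==> w \<in> L2 S ==> ip S (%x. v x - v' x) w = ip S v w - ip S v' w"
 using ip_lincomb_left[of v S v' w "-1"] by simp

lemma ip_add_right: "v \<in> L2 S ==> v' \<in> L2 S ==> w \<in> L2 S ==> ip S w (%x. v x + v' x) = ip S w v + ip S w v'"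
 using ip_lincomb_right[of v S v' w 1] by simp

lemma ip_diff_right: "v \<in> L2 S ==> v' \<in> L2 S ==> w \<in> L2 S ==> ip S w (%x. v x - v' x) = ip S w v - ip S w v'"
 using ip_lincomb_right[of v S v' w "-1"] by simp

lemma ip_scaleR_left: "ip S (%x. c *\<^sub>R v x) w = c * ip S v w"
 by (simp add: ip_def)

lemma ip_scaleR_right: "ip S w (%x. c *\<^sub>R v x) = c * ip S w v"
 by (simp add: ip_def)

lemma ip_mult_left: fixes v :: "'a::euclidean_space \<Rightarrow> real" shows "ip S (%x. c * v x) w = c * ip S v w"
 by (simp add: ip_def mult.assoc)

lemma ip_mult_right: fixes v :: "'a::euclidean_space \<Rightarrow> real" shows "ip S w (%x. c * v x) = c * ip S w v"
 by (simp add: ip_def algebra_simps)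

lemma ip_uminus_left: "ip S (%x. - v x) w = - ip S v w"
 by (simp add: ip_def)

lemma ip_zero_left [simp]: "ip S (%x. 0) w = 0" by (simp add: ip_def)
lemma ip_sum_left:
 assumes "\<And>i. i \<in> A ==> v i \<in> L2 S" "w \<in> L2 S"
 shows "ip S (%x. \<Sum>i\<in>A. v i x) w = (\<Sum>i\<in>A. ip S (v i) w)"
 unfolding ip_def inner_sum_left using assms by (intro integral_sum L2_inner_integrable)

lemma ip_sum_right:
 assumes "\<And>i. i \<in> A ==> v i \<in> L2 S" "w \<in> L2 S"
 shows "ip S w (%x. \<Sum>i\<in>A. v i x) = (\<Sum>i\<in>A. ip S w (v i))"
 unfolding ip_def inner_sum_right using assms by (intro integral_sum L2_inner_integrable)

lemma ip_self_nonneg: "0 \<le> ip S v v"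
 unfolding ip_def by (rule integral_nonneg) simp

lemma L2n_nonneg: "0 \<le> L2n S v"
 by (simp add: L2n_def ip_self_nonneg)

lemma L2n_power2: "(L2n S v)\<^sup>2 = ip S v v"
 by (simp add: L2n_def ip_self_nonneg)

text \<open>The common core of both Cauchy-Schwarz inequalities below, with \<open>A\<close> and
  \<open>C\<close> as squared norms and \<open>B\<close> as mixed product. The degenerate case
  \<open>C = 0\<close> has to be covered because the norms are seminorms.\<close>

lemma discriminant_nonneg:
 fixes A B C :: real
 assumes C: "0 \<le> C" and q: "\<And>t. 0 \<le> A + 2 * t * B + t\<^sup>2 * C"
 shows "B\<^sup>2 \<le> A * C"
proof (cases "C = 0")
 case True
 have "B = 0"
 proof (rule ccontr)
  assume "B \<noteq> 0"
  \<comment> \<open>This choice of \<open>t\<close> makes the remaining affine expression equal to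
    \<open>A - (A + 1) = -1\<close>.\<close>
  then have "2 * (- (A + 1) / (2 * B)) * B = - (A + 1)" by (simp add: field_simps)
  then show False using q[of "- (A + 1) / (2 * B)"] True by simp
 qed
 then show ?thesis using True by simp
next
 case False
 have "0 \<le> (A + 2 * (- B / C) * B + (- B / C)\<^sup>2 * C) * C" using q[of "- B / C"] C by (intro mult_nonneg_nonneg)
 also have "\<dots> = A * C - B\<^sup>2" using False by (simp add: power2_eq_square field_simps)
 finally show ?thesis by simp
qed

lemma ip_Cauchy_Schwarz:
 assumes "v \<in> L2 S" "w \<in> L2 S" shows "\<bar>ip S v w\<bar> \<le> L2n S v * L2n S w"
proof -
 have "(ip S v w)\<^sup>2 \<le> ip S v v * ip S w w"
 proof (rule discriminant_nonneg[OF ip_self_nonneg])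
  fix t
  have m: "(%x. v x + t *\<^sub>R w x) \<in> L2 S" using assms by (rule L2_lincomb)
  have "0 \<le> ip S (%x. v x + t *\<^sub>R w x) (%x. v x + t *\<^sub>R w x)" by (rule ip_self_nonneg)
  also have "\<dots> = ip S v v + 2 * t * ip S v w + t\<^sup>2 * ip S w w"
   using assms m by (simp add: ip_lincomb_left ip_lincomb_right ip_commute[of S w v] power2_eq_square algebra_simps)
  finally show "0 \<le> ip S v v + 2 * t * ip S v w + t\<^sup>2 * ip S w w" .
 qed
 also have "\<dots> = (L2n S v * L2n S w)\<^sup>2" by (simp add: power_mult_distrib L2n_power2)
 finally have "\<bar>ip S v w\<bar> \<le> \<bar>L2n S v * L2n S w\<bar>" by (simp only: abs_le_square_iff)
 then show ?thesis by (simp add: L2n_nonneg)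
qed

lemma L2n_triangle:
 assumes "v \<in> L2 S" "w \<in> L2 S" shows "L2n S (%x. v x + w x) \<le> L2n S v + L2n S w"
proof (rule power2_le_imp_le)
 have m: "(%x. v x + w x) \<in> L2 S" using assms by (rule L2_add)
 have "(L2n S (%x. v x + w x))\<^sup>2 = ip S v v + 2 * ip S v w + ip S w w"
  using assms m by (simp add: L2n_power2 ip_add_left ip_add_right ip_commute[of S w v])
 also have "\<dots> \<le> ip S v v + 2 * (L2n S v * L2n S w) + ip S w w"
  using ip_Cauchy_Schwarz[OF assms] by simp
 also have "\<dots> = (L2n S v + L2n S w)\<^sup>2" by (simp add: L2n_power2[symmetric] power2_eq_square algebra_simps)
 finally show "(L2n S (%x. v x + w x))\<^sup>2 \<le> (L2n S v + L2n S w)\<^sup>2" .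
qed (simp add: L2n_nonneg)

lemma L2n_scaleR: "L2n S (%x. c *\<^sub>R v x) = \<bar>c\<bar> * L2n S v"
 by (simp add: L2n_def ip_scaleR_left ip_scaleR_right real_sqrt_mult flip: mult.assoc)

lemma L2n_mult: fixes v :: "'a::euclidean_space \<Rightarrow> real" shows "L2n S (%x. c * v x) = \<bar>c\<bar> * L2n S v"
 using L2n_scaleR[of S c v] by simp

lemma L2n_cong_AE:
 assumes S: "S \<in> sets lebesgue" and "AE x in leb S. v x = v' x" shows "L2n S v = L2n S v'"
 using ip_cong_AE[OF S assms(2,2)] by (simp add: L2n_def)

lemma L2n_eq_0:
 assumes v: "v \<in> L2 S" and "L2n S v = 0" shows "AE x in leb S. v x = 0"
proof -
 have "(LINT x|leb S. v x \<bullet> v x) = 0"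
  using assms(2) ip_self_nonneg[of S v] by (simp add: L2n_def ip_def)
 then have "AE x in leb S. v x \<bullet> v x = 0"
  by (subst (asm) integral_nonneg_eq_0_iff_AE) (auto intro: L2_inner_integrable v)
 then show ?thesis by simp
qed

lemma lebesgue_on_integrable_subset:
 fixes f :: "'a::euclidean_space \<Rightarrow> 'b::euclidean_space"
 assumes f: "integrable (leb S) f" and T: "T \<subseteq> S" "T \<in> sets lebesgue" and S: "S \<in> sets lebesgue"
 shows "integrable (leb T) f"
proof -
 have "integrable lebesgue (%x. if x \<in> S then f x else 0)"
  using f integrable_restrict_UNIV[OF S, of f] by blast
 then have "integrable lebesgue (%x. indicator T x *\<^sub>R (if x \<in> S then f x else 0))"
  by (rule integrable_mult_indicator[OF T(2)])
 also have "(%x. indicator T x *\<^sub>R (if x \<in> S then f x else 0)) = (%x. if x \<in> T then f x else 0)"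
  using T(1) by (auto simp: indicator_def fun_eq_iff)
 finally show ?thesis using integrable_restrict_UNIV[OF T(2), of f] by blast
qed

lemma L2_subset:
 assumes v: "v \<in> L2 S" and T: "T \<subseteq> S" "T \<in> sets lebesgue" and S: "S \<in> sets lebesgue"
 shows "v \<in> L2 T"
proof -
 have "integrable (leb T) (%x. (norm (v x))\<^sup>2)"
  using L2_square_integrable[OF v] T S by (rule lebesgue_on_integrable_subset)
 then show ?thesis using L2_measurable[OF v] T by (auto simp: L2_def intro: measurable_restrict_mono)
qed

lemma L2n_mono_set:
 assumes v: "v \<in> L2 S" and T: "T \<subseteq> S" "T \<in> sets lebesgue" and S: "S \<in> sets lebesgue"
 shows "L2n T v \<le> L2n S v"
 unfolding L2n_def ip_def
proof (rule real_sqrt_le_mono, rule integral_mono_lebesgue_on_AE[OF _ _ _ T(1,2) S])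
 show "integrable (leb S) (%x. v x \<bullet> v x)" using v by (intro L2_inner_integrable)
qed auto

lemma tendsto_ip_left:
 assumes v: "\<And>n. v n \<in> L2 S" "v' \<in> L2 S" and w: "w \<in> L2 S"
  and lim: "((%n. L2n S (%x. v n x - v' x)) \<longlongrightarrow> 0) F"
 shows "((%n. ip S (v n) w) \<longlongrightarrow> ip S v' w) F"
proof -
 have "((%n. ip S (v n) w - ip S v' w) \<longlongrightarrow> 0) F"
 proof (rule Lim_null_comparison)
  show "\<forall>\<^sub>F n in F. norm (ip S (v n) w - ip S v' w) \<le> L2n S (%x. v n x - v' x) * L2n S w"
  proof (rule always_eventually, rule allI)
   fix n
   have "ip S (v n) w - ip S v' w = ip S (%x. v n x - v' x) w" using v w by (simp add: ip_diff_left)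
   then show "norm (ip S (v n) w - ip S v' w) \<le> L2n S (%x. v n x - v' x) * L2n S w"
    using ip_Cauchy_Schwarz[OF L2_diff[OF v] w] by simp
  qed
  show "((%n. L2n S (%x. v n x - v' x) * L2n S w) \<longlongrightarrow> 0) F"
   using tendsto_mult_right[OF lim, of "L2n S w"] by simp
 qed
 then show ?thesis by (simp add: LIM_zero_iff)
qed

text \<open>Controls the transport term, with the velocity as \<open>b\<close> and a weak gradient
  as \<open>w\<close>. The bound contains \<open>\<bar>M\<bar>\<close> since \<open>M\<close> may be
  negative when \<open>S\<close> is a null set.\<close>

lemma L2_bounded_mult:
 fixes b w :: "'a::euclidean_space \<Rightarrow> 'b::euclidean_space"
 assumes S: "S \<in> sets lebesgue" and b: "b \<in> borel_measurable (leb S)" "AE x in leb S. norm (b x) \<le> M"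
  and w: "w \<in> L2 S"
 shows "(%x. b x \<bullet> w x) \<in> L2 S" "L2n S (%x. b x \<bullet> w x) \<le> \<bar>M\<bar> * L2n S w"
proof -
 have m: "(%x. b x \<bullet> w x) \<in> borel_measurable (leb S)"
  using b(1) L2_measurable[OF w] by measurable
 have i: "integrable (leb S) (%x. M\<^sup>2 * (norm (w x))\<^sup>2)"
  using L2_square_integrable[OF w] by simp
 have ae: "AE x in leb S. (norm (b x \<bullet> w x))\<^sup>2 \<le> M\<^sup>2 * (norm (w x))\<^sup>2"
  using b(2)
 proof eventually_elim
  fix x assume "norm (b x) \<le> M"
  have "norm (b x \<bullet> w x) \<le> norm (b x) * norm (w x)" by (simp add: Cauchy_Schwarz_ineq2)
  also have "\<dots> \<le> M * norm (w x)" using \<open>norm (b x) \<le> M\<close> by (rule mult_right_mono) simp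
  finally have "(norm (b x \<bullet> w x))\<^sup>2 \<le> (M * norm (w x))\<^sup>2" by (rule power_mono) simp
  then show "(norm (b x \<bullet> w x))\<^sup>2 \<le> M\<^sup>2 * (norm (w x))\<^sup>2" by (simp add: power_mult_distrib)
 qed
 have i2: "integrable (leb S) (%x. (norm (b x \<bullet> w x))\<^sup>2)"
 proof (rule integrable_bound[OF i])
  show "(%x. (norm (b x \<bullet> w x))\<^sup>2) \<in> borel_measurable (leb S)" using m by measurable
  show "AE x in leb S. norm ((norm (b x \<bullet> w x))\<^sup>2) \<le> norm (M\<^sup>2 * (norm (w x))\<^sup>2)"
   using ae by eventually_elim simp
 qed
 show L: "(%x. b x \<bullet> w x) \<in> L2 S" using m i2 by (simp add: L2_def)
 have "ip S (%x. b x \<bullet> w x) (%x. b x \<bullet> w x) \<le> M\<^sup>2 * ip S w w"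
 proof -
  have "ip S (%x. b x \<bullet> w x) (%x. b x \<bullet> w x) = (LINT x|leb S. (norm (b x \<bullet> w x))\<^sup>2)"
   by (simp add: ip_def power2_eq_square)
  also have "\<dots> \<le> (LINT x|leb S. M\<^sup>2 * (norm (w x))\<^sup>2)" by (rule integral_mono_AE[OF i2 i ae])
  also have "\<dots> = M\<^sup>2 * ip S w w" by (simp add: ip_def power2_norm_eq_inner)
  finally show ?thesis .
 qed
 then have "L2n S (%x. b x \<bullet> w x) \<le> sqrt (M\<^sup>2 * ip S w w)" unfolding L2n_def by (rule real_sqrt_le_mono)
 then show "L2n S (%x. b x \<bullet> w x) \<le> \<bar>M\<bar> * L2n S w" by (simp add: L2n_def real_sqrt_mult)
qed

lemma L2_bounded:
 assumes "S \<in> lmeasurable" "b \<in> borel_measurable (leb S)" "\<And>x. x \<in> S ==> norm (b x) \<le> M"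
 shows "b \<in> L2 S"
proof (rule L2I[OF assms(2)])
 show "integrable (leb S) (%x. M\<^sup>2)"
 proof -
  interpret finite_measure "leb S"
   using assms(1) by (rule finite_measure_lebesgue_on)
  show ?thesis by simp
 qed
 show "(norm (b x))\<^sup>2 \<le> M\<^sup>2" if "x \<in> S" for x using assms(3)[OF that] by (rule power_mono) simp
qed

section \<open>Test functions\<close>

lemma frechet_derivative_eq: "(f has_derivative f') (at x) ==> frechet_derivative f (at x) = f'"
 by (rule frechet_derivative_at[symmetric])

lemma Ck_SucI:
 assumes "\<And>x. (f has_derivative f' x) (at x)" "\<And>i. i \<in> Basis ==> Ck k (%x. f' x i)"
 shows "Ck (Suc k) f"
proof -
 have "f differentiable_on UNIV"
  using assms(1) by (auto simp: differentiable_on_def differentiable_def)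
 moreover have "frechet_derivative f (at x) = f' x" for x
  using assms(1) by (rule frechet_derivative_eq)
 ultimately show ?thesis using assms(2) by simp
qed

lemma Ck_Suc_has_derivative:
 assumes "Ck (Suc k) f" shows "(f has_derivative frechet_derivative f (at x)) (at x)"
 using assms by (simp add: differentiable_on_def frechet_derivative_works)

lemma Ck_SucD: "Ck (Suc k) f ==> Ck k f"
proof (induction k arbitrary: f)
 case 0
 then show ?case by (simp add: differentiable_imp_continuous_on)
next
 case (Suc k)
 have "\<forall>i\<in>Basis. Ck k (%x. frechet_derivative f (at x) i)"
  using Suc.IH Suc.prems by auto
 then show ?case using Suc.prems by simp
qed

lemma Ck_continuous: "Ck k f ==> continuous_on S f"
proof -
 have "Ck k f ==> continuous_on UNIV f"
  by (induction k) (auto dest: Ck_SucD simp del: Ck.simps(2))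
 then show "Ck k f ==> continuous_on S f" using continuous_on_subset by blast
qed

lemma Ck_const: "Ck k (%x. c)"
proof (induction k arbitrary: c)
 case (Suc k)
 show ?case by (rule Ck_SucI[where f' = "%x y. 0"]) (auto intro: Suc derivative_eq_intros)
qed simp

lemma Ck_add: "Ck k f ==> Ck k g ==> Ck k (%x. f x + g x)"
proof (induction k arbitrary: f g)
 case 0 then show ?case by (auto intro: continuous_intros)
next
 case (Suc k)
 show ?case
 proof (rule Ck_SucI)
  show "((%x. f x + g x) has_derivative (%y. frechet_derivative f (at x) y + frechet_derivative g (at x) y)) (at x)" for x
   by (intro has_derivative_add Ck_Suc_has_derivative[OF Suc.prems(1)] Ck_Suc_has_derivative[OF Suc.prems(2)])
  show "Ck k (%x. frechet_derivative f (at x) i + frechet_derivative g (at x) i)" if "i \<in> Basis" for i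
   using Suc that by auto
 qed
qed

lemma Ck_mult: "Ck k f ==> Ck k g ==> Ck k (%x. f x * g x)"
proof (induction k arbitrary: f g)
 case 0 then show ?case by (auto intro: continuous_intros)
next
 case (Suc k)
 show ?case
 proof (rule Ck_SucI)
  show "((%x. f x * g x) has_derivative (%y. f x * frechet_derivative g (at x) y + frechet_derivative f (at x) y * g x)) (at x)" for x
   by (intro has_derivative_mult Ck_Suc_has_derivative[OF Suc.prems(1)] Ck_Suc_has_derivative[OF Suc.prems(2)])
  show "Ck k (%x. f x * frechet_derivative g (at x) i + frechet_derivative f (at x) i * g x)" if "i \<in> Basis" for i
   using Suc that Ck_SucD[OF Suc.prems(1)] Ck_SucD[OF Suc.prems(2)] by (auto intro!: Ck_add)
 qed
qed

lemma Ck_prod: "(\<And>i. i \<in> A ==> Ck k (f i)) ==> Ck k (%x. \<Prod>i\<in>A. f i x)"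
 by (induction A rule: infinite_finite_induct) (auto intro: Ck_const Ck_mult)

text \<open>Each partial derivative is a constant times the same construction applied to the
  derivative of \<open>\<eta>\<close>, so the induction on \<open>k\<close> stays within functions
  of this form.\<close>

lemma Ck_affine:
 fixes a :: "'a::euclidean_space"
 shows "Ck k \<eta> ==> Ck k (%x. \<eta> (a \<bullet> x + b))"
proof (induction k arbitrary: \<eta>)
 case 0 then show ?case by (auto intro!: continuous_on_compose2[of UNIV \<eta>] continuous_intros)
next
 case (Suc k)
 show ?case
 proof (rule Ck_SucI)
  show "((%x. \<eta> (a \<bullet> x + b)) has_derivative (%y. frechet_derivative \<eta> (at (a \<bullet> x + b)) (a \<bullet> y))) (at x)" for x
   by (rule has_derivative_compose[OF _ Ck_Suc_has_derivative[OF Suc.prems], where f = "%x. a \<bullet> x + b"])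
    (auto intro!: derivative_eq_intros)
  have lin: "frechet_derivative \<eta> (at t) s = s * frechet_derivative \<eta> (at t) 1" for t s
   using linear_scale[OF has_derivative_linear[OF Ck_Suc_has_derivative[OF Suc.prems, of t]], of s 1] by simp
  show "Ck k (%x. frechet_derivative \<eta> (at (a \<bullet> x + b)) (a \<bullet> i))" if "i \<in> Basis" for i
   unfolding lin[of _ "a \<bullet> i"] using Suc.prems by (intro Ck_mult Ck_const Suc.IH) simp
 qed
qed

text \<open>For \<open>p = 1\<close> this is the classical smooth function
  \<open>exp (- 1 / t)\<close>, continued by 0. The polynomial factor closes the family under
  differentiation: with \<open>s = 1 / t\<close>, the derivative of \<open>p(s) exp(-s)\<close> in
  \<open>t\<close> is \<open>s^2 (p - p')(s) exp(-s)\<close>, and \<open>[:0, 0, 1:]\<close> stands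
  for \<open>s^2\<close>.\<close>

definition flat :: "real poly \<Rightarrow> real \<Rightarrow> real" where
 "flat p t = (if 0 < t then poly p (inverse t) * exp (- inverse t) else 0)"

text \<open>Induction over the coefficients of \<open>p\<close>; the free exponent \<open>k\<close>
  absorbs the factor \<open>s\<close> that each step produces.\<close>

lemma poly_exp_tendsto_0: "((%s. s ^ k * poly p s * exp (- s)) \<longlongrightarrow> (0::real)) at_top"
proof (induction p arbitrary: k)
 case (pCons a p)
 have "((%s. a * (s ^ k / exp s) + s ^ Suc k * poly p s * exp (- s)) \<longlongrightarrow> a * 0 + 0) at_top"
  by (intro tendsto_intros tendsto_power_div_exp_0 pCons.IH)
 then show ?case by (simp add: exp_minus divide_inverse algebra_simps)
qed simp

lemma flat_has_derivative:
 "(flat p has_real_derivative flat ([:0, 0, 1:] * (p - pderiv p)) t) (at t)"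
proof (cases "t = 0")
 case False
 show ?thesis
 proof (cases "0 < t")
  case True
  have "((%t. poly p (inverse t) * exp (- inverse t)) has_real_derivative
    flat ([:0, 0, 1:] * (p - pderiv p)) t) (at t)"
   using True by (auto intro!: derivative_eq_intros DERIV_chain'[OF _ poly_DERIV]
    simp: flat_def power2_eq_square field_simps)
  moreover have "\<forall>\<^sub>F x in nhds t. flat p x = poly p (inverse x) * exp (- inverse x)"
   using eventually_nhds_in_open[of "{0<..}" t] True by (auto simp: flat_def elim!: eventually_mono)
  ultimately show ?thesis by (subst DERIV_cong_ev[OF refl _ refl]) auto
 next
  case neg: False
  have "\<forall>\<^sub>F x in nhds t. flat p x = 0"
   using eventually_nhds_in_open[of "{..<0}" t] False neg by (auto simp: flat_def elim!: eventually_mono)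
  then show ?thesis using neg by (subst DERIV_cong_ev[OF refl _ refl]) (auto simp: flat_def)
 qed
next
 case True
 have "((%h. flat p h / h) \<longlongrightarrow> 0) (at_right 0)"
 proof -
  \<comment> \<open>The power 1 is the factor \<open>1 / h\<close> of the difference quotient at 0,
    so that the decay lemma applies with \<open>s = 1 / h\<close>.\<close>
  have "((%h. inverse h ^ 1 * poly p (inverse h) * exp (- inverse h)) \<longlongrightarrow> 0) (at_right 0)"
   by (rule filterlim_compose[OF poly_exp_tendsto_0 filterlim_inverse_at_top_right])
  moreover have "\<forall>\<^sub>F h in at_right 0. inverse h ^ 1 * poly p (inverse h) * exp (- inverse h) = flat p h / h"
   by (auto simp: flat_def divide_inverse eventually_at_right_less eventually_at_filter)
  ultimately show ?thesis by (rule Lim_transform_eventually)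
 qed
 moreover have "((%h. flat p h / h) \<longlongrightarrow> 0) (at_left 0)"
  by (rule tendsto_eventually) (auto simp: flat_def eventually_at_filter)
 ultimately have "((%h. flat p h / h) \<longlongrightarrow> 0) (at 0)"
  by (simp add: filterlim_at_split)
 then show ?thesis using True by (simp add: DERIV_def flat_def)
qed

lemma Ck_flat: "Ck k (flat p)"
proof (induction k arbitrary: p)
 case 0
 show ?case
  using DERIV_isCont[OF flat_has_derivative] by (auto intro!: continuous_at_imp_continuous_on)
next
 case (Suc k)
 show ?case
 proof (rule Ck_SucI)
  show "(flat p has_derivative (%y. flat ([:0, 0, 1:] * (p - pderiv p)) t * y)) (at t)" for t
   using flat_has_derivative[of p t] by (simp add: has_field_derivative_def)
  show "Ck k (%x. flat ([:0, 0, 1:] * (p - pderiv p)) x * i)" for i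
   by (intro Ck_mult Ck_const Suc)
 qed
qed

lemma flat_1_bounds: "0 \<le> flat 1 t" "flat 1 t \<le> 1" "flat 1 t \<noteq> 0 \<longleftrightarrow> 0 < t"
 by (auto simp: flat_def)

lemma flat_1_limit: "(%n. flat 1 (real n * t)) ----> (if 0 < t then 1 else 0)"
proof (cases "0 < t")
 case True
 have "(%n. exp (- (inverse (real n) * inverse t))) ----> exp (- (0 * inverse t))"
  by (intro tendsto_intros lim_inverse_n)
 moreover have "\<forall>\<^sub>F n in sequentially. exp (- (inverse (real n) * inverse t)) = flat 1 (real n * t)"
  using eventually_gt_at_top[of 0] by eventually_elim (use True in \<open>simp add: flat_def\<close>)
 ultimately show ?thesis using True by (auto intro: Lim_transform_eventually)
next
 case False
 then have "flat 1 (real n * t) = 0" for n by (simp add: flat_def mult_le_0_iff zero_less_mult_iff)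
 then show ?thesis using False by simp
qed

text \<open>A product of two one-sided cutoffs per coordinate. Growing \<open>n\<close> steepens
  them towards the indicator of the open box while the values stay between 0 and 1, as dominated
  convergence requires.\<close>

definition box_bump :: "'a::euclidean_space \<Rightarrow> 'a \<Rightarrow> nat \<Rightarrow> 'a \<Rightarrow> real" where
 "box_bump a b n x = (\<Prod>i\<in>Basis. flat 1 (real n * (x \<bullet> i - a \<bullet> i)) * flat 1 (real n * (b \<bullet> i - x \<bullet> i)))"

lemma box_bump_bounds: "0 \<le> box_bump a b n x" "box_bump a b n x \<le> 1"
 by (auto simp: box_bump_def flat_1_bounds intro!: prod_nonneg prod_le_1 mult_le_one)

lemma box_bump_nonzero: "box_bump a b n x \<noteq> 0 ==> x \<in> box a b"
 by (auto simp: box_bump_def mem_box flat_1_bounds(3) zero_less_mult_iff)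

lemma box_bump_limit: "(%n. box_bump a b n x) ----> indicator (box a b) x"
proof -
 have "(%n. box_bump a b n x) ----> (\<Prod>i\<in>Basis. (if 0 < x \<bullet> i - a \<bullet> i then 1 else 0) * (if 0 < b \<bullet> i - x \<bullet> i then 1 else 0))"
  unfolding box_bump_def by (intro tendsto_intros flat_1_limit)
 also have "(\<Prod>i\<in>Basis. (if 0 < x \<bullet> i - a \<bullet> i then 1 else 0) * (if 0 < b \<bullet> i - x \<bullet> i then 1 else 0)) = (indicator (box a b) x :: real)"
  by (auto simp: indicator_def mem_box prod_zero_iff intro!: prod.neutral)
 finally show ?thesis .
qed

lemma test_funI:
 assumes "\<And>k. Ck k \<phi>" "compact T" "T \<subseteq> S" "\<And>x. \<phi> x \<noteq> 0 ==> x \<in> T"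
 shows "\<phi> \<in> test_fun S"
proof -
 have "closure {x. \<phi> x \<noteq> 0} \<subseteq> T" using assms by (intro closure_minimal compact_imp_closed) auto
 moreover from this have "compact (closure {x. \<phi> x \<noteq> 0})"
  using assms(2) by (metis closed_closure compact_Int_closed inf.absorb2)
 ultimately show ?thesis using assms by (auto simp: test_fun_def)
qed

lemma box_bump_test_fun: "cbox a b \<subseteq> S ==> box_bump a b n \<in> test_fun S"
proof (rule test_funI[OF _ compact_cbox])
 show "Ck k (box_bump a b n)" for k
 proof -
  have eq: "box_bump a b n = (%x. \<Prod>i\<in>Basis. flat 1 ((real n *\<^sub>R i) \<bullet> x + - (real n * (a \<bullet> i))) * flat 1 ((- real n *\<^sub>R i) \<bullet> x + real n * (b \<bullet> i)))"
   by (rule ext) (simp add: box_bump_def algebra_simps inner_commute)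
  show ?thesis unfolding eq by (intro Ck_prod Ck_mult Ck_affine Ck_flat)
 qed
qed (auto dest: box_bump_nonzero simp: box_subset_cbox[THEN subsetD])

text \<open>Outside the closure of its set of nonzero values the function vanishes on a whole
  neighbourhood, hence its gradient vanishes there too.\<close>

lemma test_funE:
 assumes "\<phi> \<in> test_fun S"
 obtains T where "compact T" "T \<subseteq> S" "\<And>x. x \<notin> T ==> \<phi> x = 0" "\<And>x. x \<notin> T ==> grad \<phi> x = 0"
proof
 let ?T = "closure {x. \<phi> x \<noteq> 0}"
 show "compact ?T" "?T \<subseteq> S" using assms by (auto simp: test_fun_def)
 show "\<phi> x = 0" if "x \<notin> ?T" for x using that closure_subset[of "{x. \<phi> x \<noteq> 0}"] by blast
 show "grad \<phi> x = 0" if "x \<notin> ?T" for x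
 proof -
  have "(\<phi> has_derivative (%y. 0)) (at x)"
  proof (rule has_derivative_transform_within_open[of "%x. 0"])
   show "open (- ?T)" by (intro open_Compl closed_closure)
   show "x \<in> - ?T" using that by simp
   show "0 = \<phi> y" if "y \<in> - ?T" for y using that closure_subset[of "{x. \<phi> x \<noteq> 0}"] by auto
  qed simp
  then show ?thesis by (simp add: grad_def frechet_derivative_eq)
 qed
qed

lemma test_fun_Ck: "\<phi> \<in> test_fun S ==> Ck k \<phi>"
 by (simp add: test_fun_def)

lemma test_fun_mono: "S \<subseteq> T ==> test_fun S \<subseteq> test_fun T"
 by (auto simp: test_fun_def)

lemma test_fun_axpy:
 assumes "\<phi> \<in> test_fun S" "\<psi> \<in> test_fun S" shows "(%x. \<phi> x + c * \<psi> x) \<in> test_fun S"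
proof -
 let ?T = "closure {x. \<phi> x \<noteq> 0} \<union> closure {x. \<psi> x \<noteq> 0}"
 show ?thesis
 proof (rule test_funI[of _ ?T])
  show "Ck k (%x. \<phi> x + c * \<psi> x)" for k using assms by (intro Ck_add Ck_mult Ck_const test_fun_Ck)
  show "compact ?T" "?T \<subseteq> S" using assms by (auto simp: test_fun_def)
  show "x \<in> ?T" if "\<phi> x + c * \<psi> x \<noteq> 0" for x
  proof -
   have "x \<in> {x. \<phi> x \<noteq> 0} \<union> {x. \<psi> x \<noteq> 0}" using that by auto
   then show ?thesis using closure_subset[of "{x. \<phi> x \<noteq> 0}"] closure_subset[of "{x. \<psi> x \<noteq> 0}"] by blast
  qed
 qed
qed

lemma test_fun_zero: "(%x. 0) \<in> test_fun S"
 by (rule test_funI[OF Ck_const compact_empty]) auto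

lemma has_derivative_grad:
 assumes "(f has_derivative f') (at x)" shows "(f has_derivative (%y. grad f x \<bullet> y)) (at x)"
proof -
 have "f' y = grad f x \<bullet> y" for y
 proof -
  have "f' y = f' (\<Sum>i\<in>Basis. (y \<bullet> i) *\<^sub>R i)" by (simp add: euclidean_representation)
  also have "\<dots> = (\<Sum>i\<in>Basis. (y \<bullet> i) * f' i)"
   using has_derivative_linear[OF assms] by (simp add: linear_sum linear_scale)
  finally show ?thesis by (simp add: grad_def frechet_derivative_eq[OF assms] inner_sum_left inner_commute[of y] mult.commute)
 qed
 then show ?thesis using assms by (metis (full_types) ext)
qed

lemma grad_eqI: "(f has_derivative (%y. g \<bullet> y)) (at x) ==> grad f x = g"
 by (simp add: grad_def frechet_derivative_eq euclidean_representation)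

lemma test_fun_has_derivative: "\<phi> \<in> test_fun S ==> (\<phi> has_derivative (%y. grad \<phi> x \<bullet> y)) (at x)"
 using has_derivative_grad[OF Ck_Suc_has_derivative[OF test_fun_Ck[of \<phi> S "Suc 0"]]] by simp

lemma test_fun_grad_continuous:
 assumes "\<phi> \<in> test_fun S" shows "continuous_on T (grad \<phi>)"
proof -
 have "continuous_on T (%x. frechet_derivative \<phi> (at x) i)" if "i \<in> Basis" for i
  using test_fun_Ck[OF assms, of "Suc 0"] that continuous_on_subset by (auto simp: )
 then show ?thesis unfolding grad_def[abs_def] by (intro continuous_intros) auto
qed

lemma test_fun_continuous: "\<phi> \<in> test_fun S ==> continuous_on T \<phi>"
 by (rule Ck_continuous[OF test_fun_Ck])

text \<open>Lebesgue differentiation: at almost every \<open>x\<close> the value is the limit of the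
  means over the cubes \<open>cbox x (x + h *\<^sub>R One)\<close>, and these lie in the open set
  \<open>S\<close> once \<open>h\<close> is small.\<close>

lemma zero_integral_boxes_imp_zero:
 fixes f :: "'a::euclidean_space \<Rightarrow> 'b::euclidean_space"
 assumes S: "open S" and f: "integrable (leb S) f"
  and z: "\<And>a b. cbox a b \<subseteq> S ==> (LINT x|leb (cbox a b). f x) = 0"
 shows "AE x in leb S. f x = 0"
proof -
 have Sl: "S \<in> sets lebesgue" using S by simp
 define F where "F x = (if x \<in> S then f x else 0)" for x
 have F: "integrable lebesgue F"
  unfolding F_def using f integrable_restrict_UNIV[OF Sl] by blast
 have Fc: "integrable (leb (cbox a b)) F" for a b
  using lebesgue_on_integrable_subset[of UNIV F "cbox a b"] F by (simp add: lebesgue_on_UNIV_eq)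
 have "F integrable_on cbox a b" for a b
  using has_integral_integral_lebesgue_on[OF Fc] by (auto simp: integrable_on_def)
 then obtain N where N: "negligible N" "\<And>x e. [|x \<notin> N; 0 < e|] ==>
   \<exists>d>0. \<forall>h. 0 < h \<and> h < d \<longrightarrow> norm (integral (cbox x (x + h *\<^sub>R One)) F /\<^sub>R h ^ DIM('a) - F x) < e"
  using integrable_ccontinuous_explicit by metis
 have "F x = 0" if xN: "x \<notin> N" and xS: "x \<in> S" for x
 proof (rule ccontr)
  assume "F x \<noteq> 0"
  then obtain d where d: "0 < d" "\<And>h. 0 < h ==> h < d ==> norm (integral (cbox x (x + h *\<^sub>R One)) F /\<^sub>R h ^ DIM('a) - F x) < norm (F x)"
   using N(2)[OF xN, of "norm (F x)"] by auto
  obtain r where r: "0 < r" "ball x r \<subseteq> S" using S xS openE by blast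
  \<comment> \<open>The first bound makes \<open>h < d\<close>; the second keeps the cube inside
    \<open>ball x r\<close>, because its diagonal has length \<open>h * norm One\<close>.\<close>
  define h where "h = min (d / 2) (r / (2 * (norm (One :: 'a) + 1)))"
  have no: "0 < norm (One :: 'a) + 1" using norm_ge_zero[of "One :: 'a"] by linarith
  have h: "0 < h" "h < d" using d(1) r(1) no by (auto simp: h_def)
  have sub: "cbox x (x + h *\<^sub>R One) \<subseteq> S"
  proof
   fix y assume y: "y \<in> cbox x (x + h *\<^sub>R One)"
   have "norm (y - x) \<le> norm (h *\<^sub>R One :: 'a)"
    using y by (intro norm_le_componentwise) (auto simp: mem_box inner_diff_left inner_add_left)
   also have "\<dots> = h * norm (One :: 'a)" using h by simp
   also have "\<dots> \<le> h * (norm (One :: 'a) + 1)" using h by (intro mult_left_mono) auto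
   also have "\<dots> \<le> (r / (2 * (norm (One :: 'a) + 1))) * (norm (One :: 'a) + 1)"
    using no by (intro mult_right_mono) (auto simp: h_def)
   also have "\<dots> = r / 2"
   proof -
    have "(r / (2 * a)) * a = r / 2" if "0 < a" for a using that by simp
    from this[OF no] show ?thesis .
   qed
   finally have "dist x y < r" using r by (simp add: dist_norm norm_minus_commute)
   then show "y \<in> S" using r by auto
  qed
  have "integral (cbox x (x + h *\<^sub>R One)) F = (LINT y|leb (cbox x (x + h *\<^sub>R One)). F y)"
   using has_integral_integral_lebesgue_on[OF Fc] by (simp add: integral_unique)
  also have "\<dots> = (LINT y|leb (cbox x (x + h *\<^sub>R One)). f y)"
   using sub by (intro integral_cong) (auto simp: F_def)
  also have "\<dots> = 0" using z sub by blast
  finally show False using d(2)[OF h] by simp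
 qed
 then have "AE x in lebesgue. x \<in> S \<longrightarrow> f x = 0"
  using N(1) by (intro AE_I'[of N]) (auto simp: negligible_iff_null_sets F_def)
 then show ?thesis using Sl by (simp add: AE_restrict_space_iff)
qed

text \<open>Smooth bumps converge to indicators of boxes, so a function orthogonal to all test
  functions has vanishing integral over every box in \<open>S\<close>.\<close>

lemma fundamental_lemma:
 fixes f :: "'a::euclidean_space \<Rightarrow> 'b::euclidean_space"
 assumes S: "open S" and f: "integrable (leb S) f"
  and z: "\<And>\<phi>. \<phi> \<in> test_fun S ==> (LINT x|leb S. \<phi> x *\<^sub>R f x) = 0"
 shows "AE x in leb S. f x = 0"
proof (rule zero_integral_boxes_imp_zero[OF S f])
 fix a b :: 'a assume ab: "cbox a b \<subseteq> S"
 have Sl: "S \<in> sets lebesgue" using S by simp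
 have fm: "f \<in> borel_measurable (leb S)" using f by auto
 have "(%n. LINT x|leb S. box_bump a b n x *\<^sub>R f x) ----> (LINT x|leb S. indicator (box a b) x *\<^sub>R f x)"
 proof (rule integral_dominated_convergence[where w = "%x. norm (f x)"])
  show "integrable (leb S) (%x. norm (f x))" using f by (rule integrable_norm)
  show "(%x. indicator (box a b) x *\<^sub>R f x) \<in> borel_measurable (leb S)"
   using fm ab box_subset_cbox[of a b]
   by (intro borel_measurable_scaleR borel_measurable_indicator) (auto simp: sets_restrict_space_iff Sl)
  show "(%x. box_bump a b n x *\<^sub>R f x) \<in> borel_measurable (leb S)" for n
   by (intro borel_measurable_scaleR[OF _ fm] continuous_imp_measurable_on_sets_lebesgue Sl
     test_fun_continuous[OF box_bump_test_fun[OF ab, of n]])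
  show "AE x in leb S. (%n. box_bump a b n x *\<^sub>R f x) ----> indicator (box a b) x *\<^sub>R f x"
   by (intro AE_I2 tendsto_intros box_bump_limit)
  show "AE x in leb S. norm (box_bump a b n x *\<^sub>R f x) \<le> norm (f x)" for n
   using box_bump_bounds[of a b n] by (intro AE_I2) (auto intro!: mult_left_le_one_le)
 qed
 then have "(LINT x|leb S. indicator (box a b) x *\<^sub>R f x) = 0"
  using z[OF box_bump_test_fun[OF ab]] by (simp add: LIMSEQ_const_iff)
 moreover have "(LINT x|leb S. indicator (box a b) x *\<^sub>R f x) = (LINT x|leb (cbox a b). f x)"
 proof -
  have "AE x in lebesgue. x \<notin> cbox a b - box a b"
   using negligible_frontier_interval[of a b] by (intro AE_not_in) (simp add: negligible_iff_null_sets)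
  then have "AE x in lebesgue. x \<in> S \<longrightarrow> indicator (box a b) x *\<^sub>R f x = (if x \<in> cbox a b then f x else 0)"
   by eventually_elim (auto simp: indicator_def box_subset_cbox[THEN subsetD])
  then have "(LINT x|leb S. indicator (box a b) x *\<^sub>R f x) = (LINT x|leb S. (if x \<in> cbox a b then f x else 0))"
   by (intro lebesgue_on_integral_cong_AE[OF Sl]) (simp add: AE_restrict_space_iff Sl)
  also have "\<dots> = (LINT x|leb (cbox a b). f x)"
   by (rule integral_restrict[OF ab]) (auto simp: Sl)
  finally show ?thesis .
 qed
 ultimately show "(LINT x|leb (cbox a b). f x) = 0" by simp
qed

section \<open>The divergence theorem on a simplex\<close>

text \<open>Barycentric coordinates \<open>bc v\<close> of a simplex with vertex set
  \<open>C\<close>, taken as affine functions on the whole space with constant gradients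
  \<open>gr v\<close>. In this form the facet opposite \<open>v\<close>, its hyperplane, its normal
  and the distance to it are all expressed by \<open>bc v\<close> and \<open>gr v\<close>.\<close>

locale barycentric =
 fixes C :: "'a::euclidean_space set" and bc :: "'a \<Rightarrow> 'a \<Rightarrow> real" and gr :: "'a \<Rightarrow> 'a"
 assumes finC: "finite C"
  and card2: "2 \<le> card C"
  and bc_add: "v \<in> C ==> bc v (x + y) = bc v x + gr v \<bullet> y"
  and bc_vertex: "v \<in> C ==> w \<in> C ==> bc v w = (if v = w then 1 else 0)"
  and bc_sum: "(\<Sum>v\<in>C. bc v x) = 1"
  and bc_rep: "(\<Sum>v\<in>C. bc v x *\<^sub>R v) = x"
begin

lemma bc_eq: "v \<in> C ==> bc v x = bc v 0 + gr v \<bullet> x"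
 using bc_add[of v 0 x] by simp

lemma bc_diff: "v \<in> C ==> bc v x - bc v y = gr v \<bullet> (x - y)"
 using bc_add[of v y "x - y"] by simp

lemma bc_affine_combination:
 assumes v: "v \<in> C" and W: "finite W" "sum u W = 1"
 shows "bc v (\<Sum>w\<in>W. u w *\<^sub>R w) = (\<Sum>w\<in>W. u w * bc v w)"
proof -
 have "(\<Sum>w\<in>W. u w * bc v w) = (\<Sum>w\<in>W. u w * bc v 0 + u w * (gr v \<bullet> w))"
 proof (intro sum.cong refl)
  fix w
  show "u w * bc v w = u w * bc v 0 + u w * (gr v \<bullet> w)"
   by (subst bc_eq[OF v]) (simp add: algebra_simps)
 qed
 also have "\<dots> = bc v 0 + gr v \<bullet> (\<Sum>w\<in>W. u w *\<^sub>R w)"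
  using W by (simp add: sum.distrib sum_distrib_right[symmetric] inner_sum_right)
 finally show ?thesis using bc_eq[OF v, of "\<Sum>w\<in>W. u w *\<^sub>R w"] by linarith
qed

lemma convex_hull_eq: "convex hull C = {x. \<forall>v\<in>C. 0 \<le> bc v x}"
proof (intro set_eqI iffI CollectI)
 fix x assume "x \<in> convex hull C"
 then obtain u where u: "\<forall>w\<in>C. 0 \<le> u w" "sum u C = 1" "(\<Sum>w\<in>C. u w *\<^sub>R w) = x"
  by (auto simp: convex_hull_finite[OF finC])
 show "\<forall>v\<in>C. 0 \<le> bc v x"
  using u bc_affine_combination[OF _ finC u(2)] bc_vertex by (auto intro!: sum_nonneg)
next
 fix x assume "x \<in> {x. \<forall>v\<in>C. 0 \<le> bc v x}"
 then show "x \<in> convex hull C"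
  using bc_sum[of x] bc_rep[of x] by (auto simp: convex_hull_finite[OF finC] intro!: exI[of _ "%v. bc v x"])
qed

lemma bc_rep_facet:
 assumes "v \<in> C" "bc v x = 0"
 shows "(\<Sum>w\<in>C - {v}. bc w x) = 1" "(\<Sum>w\<in>C - {v}. bc w x *\<^sub>R w) = x"
 using assms bc_sum[of x] bc_rep[of x] sum.remove[OF finC, of v "%w. bc w x"]
  sum.remove[OF finC, of v "%w. bc w x *\<^sub>R w"] by auto

lemma affine_hull_facet:
 assumes v: "v \<in> C"
 shows "affine hull (convex hull (C - {v})) = {x. bc v x = 0}"
proof -
 have "affine hull (C - {v}) = {x. bc v x = 0}"
 proof (intro set_eqI iffI CollectI)
  fix x assume "x \<in> affine hull (C - {v})"
  then obtain u where u: "sum u (C - {v}) = 1" "(\<Sum>w\<in>C - {v}. u w *\<^sub>R w) = x"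
   using finC by (auto simp: affine_hull_finite)
  have "(\<Sum>w\<in>C - {v}. u w * bc v w) = 0"
   using v by (intro sum.neutral) (auto simp: bc_vertex)
  then show "bc v x = 0"
   using bc_affine_combination[OF v _ u(1)] u(2) finC by simp
 next
  fix x assume "x \<in> {x. bc v x = 0}"
  then show "x \<in> affine hull (C - {v})"
   using bc_rep_facet[OF v, of x] finC by (auto simp: affine_hull_finite intro!: exI[of _ "%v. bc v x"])
 qed
 then show ?thesis by (simp add: affine_hull_convex_hull)
qed

lemma facet_eq:
 assumes v: "v \<in> C"
 shows "convex hull (C - {v}) = {x \<in> convex hull C. bc v x = 0}"
proof (intro set_eqI iffI)
 fix x assume x: "x \<in> convex hull (C - {v})"
 then have "x \<in> convex hull C" using hull_mono[of "C - {v}" C] by blast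
 moreover have "x \<in> affine hull (convex hull (C - {v}))" using x by (rule hull_inc)
 ultimately show "x \<in> {x \<in> convex hull C. bc v x = 0}" using affine_hull_facet[OF v] by auto
next
 fix x assume "x \<in> {x \<in> convex hull C. bc v x = 0}"
 then show "x \<in> convex hull (C - {v})"
  using bc_rep_facet[OF v, of x] finC
  by (auto simp: convex_hull_finite convex_hull_eq intro!: exI[of _ "%v. bc v x"])
qed

lemma ex_other_vertex: "v \<in> C ==> \<exists>w\<in>C. w \<noteq> v"
 using card2 finC by (metis card_le_Suc0_iff_eq not_less_eq_eq numeral_2_eq_2)

lemma gr_nonzero:
 assumes v: "v \<in> C" shows "gr v \<noteq> 0"
proof
 assume "gr v = 0"
 obtain w where "w \<in> C" "w \<noteq> v" using ex_other_vertex v by blast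
 then show False
  using bc_diff[OF v, of v w] bc_vertex v \<open>gr v = 0\<close> by auto
qed

text \<open>Since \<open>bc v\<close> rises from 0 on the facet opposite \<open>v\<close> to 1 at
  \<open>v\<close>, this unit normal points into the simplex. This is the source of the minus signs
  in the divergence theorems below.\<close>

definition nrm where "nrm v = gr v /\<^sub>R norm (gr v)"

lemma norm_nrm: "v \<in> C ==> norm (nrm v) = 1"
 using gr_nonzero by (simp add: nrm_def)

lemma bc_gr: "v \<in> C ==> bc v x = norm (gr v) * (nrm v \<bullet> x - (- bc v 0 / norm (gr v)))"
 using gr_nonzero[of v] by (simp add: nrm_def bc_eq[of v x] field_simps)

lemma gr_sum: "(\<Sum>w\<in>C. gr w \<bullet> y) = 0"
proof -
 have "(\<Sum>w\<in>C. gr w \<bullet> y) = (\<Sum>w\<in>C. bc w y - bc w 0)"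
  using bc_diff[of _ y 0] by (intro sum.cong) auto
 then show ?thesis by (simp add: sum_subtractf bc_sum)
qed

text \<open>This is \<open>bc_rep\<close> differentiated in the direction \<open>y\<close>;
  subtracting \<open>w0\<close> costs nothing because the coefficients sum to 0. Every direction
  thus becomes a combination of edges from \<open>w0\<close>, which later reduces the divergence
  theorem to edge directions.\<close>

lemma gr_rep: "(\<Sum>w\<in>C. (gr w \<bullet> y) *\<^sub>R (w - w0)) = y"
proof -
 have "y = (\<Sum>w\<in>C. bc w y *\<^sub>R w) - (\<Sum>w\<in>C. bc w 0 *\<^sub>R w)" by (simp only: bc_rep) simp
 also have "\<dots> = (\<Sum>w\<in>C. (bc w y - bc w 0) *\<^sub>R w)" by (simp add: sum_subtractf algebra_simps)
 also have "\<dots> = (\<Sum>w\<in>C. (gr w \<bullet> y) *\<^sub>R w)" using bc_diff[of _ y 0] by (intro sum.cong) auto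
 finally have "y = (\<Sum>w\<in>C. (gr w \<bullet> y) *\<^sub>R w)" .
 moreover have "(\<Sum>w\<in>C. (gr w \<bullet> y) *\<^sub>R w0) = 0" by (simp add: scaleR_sum_left[symmetric] gr_sum)
 ultimately show ?thesis by (simp add: sum_subtractf scaleR_diff_right)
qed

text \<open>In the edge expansion based at a vertex \<open>w0\<close> of the facet, every edge
  except \<open>v - w0\<close> is orthogonal to \<open>n\<close>.\<close>

lemma perp_facet_multiple:
 assumes v: "v \<in> C" and n: "\<And>w w'. w \<in> C - {v} ==> w' \<in> C - {v} ==> n \<bullet> (w - w') = 0"
 shows "\<exists>c. n = c *\<^sub>R gr v"
proof -
 obtain w0 where w0: "w0 \<in> C" "w0 \<noteq> v" using ex_other_vertex v by blast
 have "n \<bullet> y = (n \<bullet> (v - w0)) * (gr v \<bullet> y)" for y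
 proof -
  have "n \<bullet> y = (\<Sum>w\<in>C. (gr w \<bullet> y) * (n \<bullet> (w - w0)))"
   by (subst gr_rep[of y w0, symmetric]) (simp only: inner_sum_right inner_scaleR_right)
  also have "\<dots> = (\<Sum>w\<in>{v}. (gr w \<bullet> y) * (n \<bullet> (w - w0)))"
   using n w0 v finC by (intro sum.mono_neutral_right) auto
  finally show ?thesis by simp
 qed
 then have "n = (n \<bullet> (v - w0)) *\<^sub>R gr v"
  unfolding euclidean_eq_iff[of n] inner_scaleR_left by blast
 then show ?thesis by blast
qed

text \<open>\<open>facet_measure\<close> takes its unit normal by choice; this leaves only the sign
  open.\<close>

lemma unit_normal_facet:
 assumes v: "v \<in> C" and "norm n = 1"
  and n: "\<And>w w'. w \<in> convex hull (C - {v}) ==> w' \<in> convex hull (C - {v}) ==> n \<bullet> (w' - w) = 0"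
 shows "n = nrm v \<or> n = - nrm v"
proof -
 obtain c where c: "n = c *\<^sub>R gr v"
  using perp_facet_multiple[OF v] n hull_inc by metis
 with \<open>norm n = 1\<close> have "\<bar>c\<bar> * norm (gr v) = 1" by simp
 then have "\<bar>c\<bar> = inverse (norm (gr v))" using gr_nonzero[OF v] by (simp add: field_simps)
 then have "c = inverse (norm (gr v)) \<or> c = - inverse (norm (gr v))" by linarith
 then show ?thesis by (auto simp: c nrm_def)
qed

lemma nrm_facet:
 assumes v: "v \<in> C" and "x \<in> convex hull (C - {v})" "y \<in> convex hull C"
 shows "nrm v \<bullet> (y - x) = bc v y / norm (gr v)"
 using assms facet_eq[OF v] bc_diff[OF v, of y x] by (simp add: nrm_def divide_inverse mult.commute)

lemma facet_nonempty: "v \<in> C ==> convex hull (C - {v}) \<noteq> {}"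
 using ex_other_vertex by auto

lemma inner_normal_facet:
 assumes v: "v \<in> C"
 shows "inner_normal (convex hull C) (convex hull (C - {v})) = nrm v"
 unfolding inner_normal_def
proof (rule the_equality)
 have sub: "convex hull (C - {v}) \<subseteq> convex hull C" by (rule hull_mono) auto
 show "norm (nrm v) = 1 \<and> (\<forall>x\<in>convex hull (C - {v}). \<forall>y\<in>convex hull (C - {v}). nrm v \<bullet> (y - x) = 0) \<and>
  (\<forall>x\<in>convex hull (C - {v}). \<forall>y\<in>convex hull C. 0 \<le> nrm v \<bullet> (y - x))"
  using norm_nrm[OF v] nrm_facet[OF v] sub facet_eq[OF v] convex_hull_eq v by (auto simp: subset_iff)
 fix n assume n: "norm n = 1 \<and> (\<forall>x\<in>convex hull (C - {v}). \<forall>y\<in>convex hull (C - {v}). n \<bullet> (y - x) = 0) \<and>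
  (\<forall>x\<in>convex hull (C - {v}). \<forall>y\<in>convex hull C. 0 \<le> n \<bullet> (y - x))"
 then have "n = nrm v \<or> n = - nrm v" using unit_normal_facet[OF v] by blast
 \<comment> \<open>The vertex \<open>v\<close> decides the sign: it lies in the cell and has
   \<open>bc v v = 1\<close>.\<close>
 moreover have "n \<noteq> - nrm v"
 proof
  assume a: "n = - nrm v"
  obtain x where x: "x \<in> convex hull (C - {v})" using facet_nonempty[OF v] by blast
  have vK: "v \<in> convex hull C" using v by (rule hull_inc)
  have "nrm v \<bullet> (v - x) = 1 / norm (gr v)" using nrm_facet[OF v x vK] bc_vertex[OF v v] by simp
  moreover have "0 \<le> n \<bullet> (v - x)" using n x vK by blast
  moreover have "n \<bullet> (v - x) = - (nrm v \<bullet> (v - x))" unfolding a by (simp add: inner_minus_left)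
  ultimately show False using gr_nonzero[OF v] by (simp add: divide_le_0_iff)
 qed
 ultimately show "n = nrm v" by blast
qed

end

text \<open>The edges \<open>w - a\<close> from one vertex form a basis. Its dual functionals are
  the coordinates of the vertices other than \<open>a\<close>, and the coordinate of
  \<open>a\<close> is whatever makes the sum equal to 1.\<close>

lemma simplex_barycentric:
 fixes K :: "'a::euclidean_space set"
 assumes K: "int DIM('a) simplex K"
 obtains C bc gr where "barycentric C bc gr" "K = convex hull C" "\<not> affine_dependent C"
proof -
 obtain C where C: "\<not> affine_dependent C" "int (card C) = int DIM('a) + 1" "K = convex hull C"
  using K by (auto simp: simplex_def)
 have fin: "finite C" using C(1) aff_independent_finite by blast
 have card: "card C = DIM('a) + 1" using C(2) by simp
 then obtain a where a: "a \<in> C" by fastforce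
 define B where "B = (%w. w - a) ` (C - {a})"
 have indB: "independent B"
  using C(1) a affine_dependent_iff_dependent2[OF a] by (simp add: B_def image_def Setcompr_eq_image)
 have injB: "inj_on (%w. w - a) (C - {a})" by (auto simp: inj_on_def)
 have cardB: "card B = DIM('a)"
  using card a fin by (simp add: B_def card_image[OF injB])
 have spanB: "span B = UNIV"
  using card_eq_dim[of B UNIV] indB cardB fin by (auto simp: B_def dim_UNIV)
 have "\<exists>f. linear f \<and> (\<forall>w\<in>C - {a}. f (w - a) = (if v = w then 1 else 0 :: real))" for v
 proof -
  obtain f where f: "linear f" "\<forall>x\<in>B. f x = (if v = x + a then 1 else 0 :: real)"
   using linear_independent_extend[OF indB, of "%x. if v = x + a then 1 else 0 :: real"] by blast
  then show ?thesis by (intro exI[of _ f]) (auto simp: B_def)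
 qed
 then obtain f where f: "\<And>v. linear (f v)" "\<And>v w. w \<in> C - {a} ==> f v (w - a) = (if v = w then 1 else 0 :: real)"
  by metis
 define g0 where "g0 v = adjoint (f v) 1" for v
 have g0: "f v y = g0 v \<bullet> y" for v y
  using adjoint_works[OF f(1)[of v], of y 1] by (simp add: g0_def inner_commute)
 define gr where "gr v = (if v = a then - (\<Sum>w\<in>C - {a}. g0 w) else g0 v)" for v
 define bc where "bc v x = (if v = a then 1 else 0) + gr v \<bullet> (x - a)" for v x
 have "gr a \<bullet> y = - (\<Sum>w\<in>C - {a}. gr w \<bullet> y)" for y
 proof -
  have "(\<Sum>w\<in>C - {a}. gr w \<bullet> y) = (\<Sum>w\<in>C - {a}. g0 w \<bullet> y)" by (intro sum.cong) (auto simp: gr_def)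
  then show ?thesis by (simp add: gr_def inner_sum_left)
 qed
 note gra = this
 have rep: "(\<Sum>w\<in>C - {a}. (gr w \<bullet> y) *\<^sub>R (w - a)) = y" for y
 proof -
  have lin: "linear (%y. \<Sum>w\<in>C - {a}. (gr w \<bullet> y) *\<^sub>R (w - a))"
   by (rule linearI) (simp_all add: inner_add_right scaleR_add_left sum.distrib scaleR_sum_right)
  have onB: "(\<Sum>w\<in>C - {a}. (gr w \<bullet> b) *\<^sub>R (w - a)) = id b" if "b \<in> B" for b
  proof -
   obtain v where v: "v \<in> C - {a}" "b = v - a" using \<open>b \<in> B\<close> by (auto simp: B_def)
   have "(\<Sum>w\<in>C - {a}. (gr w \<bullet> b) *\<^sub>R (w - a)) = (\<Sum>w\<in>C - {a}. (if w = v then w - a else 0))"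
    using f(2)[OF v(1)] v g0 by (intro sum.cong) (auto simp: gr_def)
   then show ?thesis using v fin by simp
  qed
  have "y \<in> span B" by (simp add: spanB)
  from linear_eq_on_span[OF lin linear_id onB this] show ?thesis by simp
 qed
 have "barycentric C bc gr"
 proof
  show "finite C" by (rule fin)
  show "2 \<le> card C" using card DIM_positive[where 'a='a] by linarith
  show "bc v (x + y) = bc v x + gr v \<bullet> y" for v x y
   by (simp add: bc_def inner_diff_right inner_add_right)
  show "bc v w = (if v = w then 1 else 0)" if "v \<in> C" "w \<in> C" for v w
  proof (cases "w = a")
   case True then show ?thesis by (auto simp: bc_def)
  next
   case False
   then have w: "w \<in> C - {a}" using that by simp
   have eq: "gr u \<bullet> (w - a) = (if u = w then 1 else 0)" if "u \<noteq> a" for u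
    using f(2)[OF w, of u] that by (simp add: g0 gr_def)
   show ?thesis
   proof (cases "v = a")
    case True
    have "(\<Sum>u\<in>C - {a}. gr u \<bullet> (w - a)) = (\<Sum>u\<in>C - {a}. if u = w then 1 else 0)"
     by (intro sum.cong) (auto simp: eq)
    also have "\<dots> = 1" using w fin by (simp add: sum.delta)
    finally show ?thesis using True False by (simp add: bc_def gra)
   next
    case False
    then show ?thesis using eq[OF False] by (simp add: bc_def)
   qed
  qed
  have bcne: "(\<Sum>v\<in>C - {a}. bc v x) = (\<Sum>v\<in>C - {a}. gr v \<bullet> (x - a))" for x
   by (intro sum.cong) (auto simp: bc_def)
  show s: "(\<Sum>v\<in>C. bc v x) = 1" for x
   using sum.remove[OF fin a, of "%v. bc v x"] bcne[of x] by (simp add: gra bc_def[of a])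
  show "(\<Sum>v\<in>C. bc v x *\<^sub>R v) = x" for x
  proof -
   have "(\<Sum>v\<in>C. bc v x *\<^sub>R v) - a = (\<Sum>v\<in>C. bc v x *\<^sub>R v) - (\<Sum>v\<in>C. bc v x) *\<^sub>R a" by (simp add: s)
   also have "\<dots> = (\<Sum>v\<in>C. bc v x *\<^sub>R (v - a))"
    by (simp add: scaleR_sum_left sum_subtractf scaleR_diff_right)
   also have "\<dots> = (\<Sum>v\<in>C - {a}. bc v x *\<^sub>R (v - a))" using sum.remove[OF fin a, of "%v. bc v x *\<^sub>R (v - a)"] by simp
   also have "\<dots> = (\<Sum>v\<in>C - {a}. (gr v \<bullet> (x - a)) *\<^sub>R (v - a))"
    by (intro sum.cong) (auto simp: bc_def)
   finally show ?thesis by (simp add: rep)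
  qed
 qed
 then show ?thesis using that C by blast
qed

section \<open>Projection onto a hyperplane, the facet measure, and thin layers\<close>

definition hproj :: "'a::euclidean_space \<Rightarrow> real \<Rightarrow> 'a \<Rightarrow> 'a" where
 "hproj n c x = x - (n \<bullet> x - c) *\<^sub>R n"

text \<open>Half-open in the normal direction, so that a layer of thickness \<open>a + b\<close> is
  the disjoint union of one of thickness \<open>a\<close> and a translate of one of thickness
  \<open>b\<close>.\<close>

definition hslab :: "'a::euclidean_space \<Rightarrow> real \<Rightarrow> real \<Rightarrow> 'a set" where
 "hslab n c h = {x. 0 \<le> n \<bullet> x - c \<and> n \<bullet> x - c < h}"

lemma continuous_hproj [continuous_intros]: "continuous_on S (hproj n c)"
 unfolding hproj_def by (intro continuous_intros)

lemma measurable_hproj [measurable]: "hproj n c \<in> borel \<rightarrow>\<^sub>M borel"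
 by (rule borel_measurable_continuous_onI) (rule continuous_hproj)

lemma hslab_borel [measurable]: "hslab n c h \<in> sets borel"
 unfolding hslab_def by measurable

lemma inner_self_unit: "norm n = 1 ==> n \<bullet> n = (1::real)"
 by (simp add: norm_eq_1)

lemma inner_hproj: "norm n = 1 ==> n \<bullet> hproj n c x = c"
 by (simp add: hproj_def inner_diff_right inner_self_unit)

lemma hproj_shift: "norm n = 1 ==> hproj n c (x + s *\<^sub>R n) = hproj n c x"
 by (simp add: hproj_def inner_add_right inner_self_unit algebra_simps)

lemma hproj_decomp: "x = hproj n c x + (n \<bullet> x - c) *\<^sub>R n"
 by (simp add: hproj_def)

lemma hproj_id: "n \<bullet> x = c ==> hproj n c x = x"
 by (simp add: hproj_def)

lemma hproj_uminus: "hproj (- n) (- c) x = hproj n c x"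
 by (simp add: hproj_def inner_minus_left algebra_simps)

text \<open>Turns the \<open>closest_point\<close> in \<open>facet_measure\<close> into an explicit
  affine map.\<close>

lemma closest_point_hyperplane:
 assumes "norm n = (1::real)"
 shows "closest_point {x. n \<bullet> x = c} x = hproj n c x"
proof (rule closest_point_unique[symmetric])
 show "convex {x. n \<bullet> x = c}" by (rule convex_hyperplane)
 show "closed {x. n \<bullet> x = c}" by (rule closed_hyperplane)
 show "hproj n c x \<in> {x. n \<bullet> x = c}" using assms by (simp add: inner_hproj)
 show "\<forall>z\<in>{x. n \<bullet> x = c}. dist x (hproj n c x) \<le> dist x z"
 proof safe
  fix z assume "c = n \<bullet> z"
  have "dist x (hproj n c x) = \<bar>n \<bullet> (x - z)\<bar>"
   using assms \<open>c = n \<bullet> z\<close> by (simp add: dist_norm hproj_def inner_diff_right)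
  also have "\<dots> \<le> norm n * norm (x - z)" by (rule Cauchy_Schwarz_ineq2)
  finally show "dist x (hproj n (n \<bullet> z) x) \<le> dist x z" using assms \<open>c = n \<bullet> z\<close> by (simp add: dist_norm)
 qed
qed

lemma nn_integral_lborel_translate:
 fixes f :: "'a::euclidean_space \<Rightarrow> ennreal"
 assumes "f \<in> borel_measurable borel"
 shows "(\<integral>\<^sup>+x. f (x + a) \<partial>lborel) = (\<integral>\<^sup>+x. f x \<partial>lborel)"
proof -
 have "(\<integral>\<^sup>+x. f x \<partial>lborel) = (\<integral>\<^sup>+x. f x \<partial>distr lborel borel ((+) a))" by (simp add: lborel_distr_plus)
 also have "\<dots> = (\<integral>\<^sup>+x. f (a + x) \<partial>lborel)" using assms by (subst nn_integral_distr) auto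
 finally show ?thesis by (simp add: add.commute)
qed

lemma integral_lborel_translate:
 fixes f :: "'a::euclidean_space \<Rightarrow> real"
 assumes "f \<in> borel_measurable borel"
 shows "(LINT x|lborel. f (x + a)) = (LINT x|lborel. f x)"
proof -
 have "(LINT x|lborel. f x) = (LINT x|distr lborel borel ((+) a). f x)" by (simp add: lborel_distr_plus)
 also have "\<dots> = (LINT x|lborel. f (a + x))" using assms by (subst integral_distr) auto
 finally show ?thesis by (simp add: add.commute)
qed

lemma integrable_lborel_translate:
 fixes f :: "'a::euclidean_space \<Rightarrow> real"
 assumes f: "f \<in> borel_measurable borel" "integrable lborel f"
 shows "integrable lborel (%x. f (x + a))"
proof -
 have "integrable (distr lborel borel ((+) a)) f" using f by (simp add: lborel_distr_plus)
 then have "integrable lborel (%x. f (a + x))" using f by (subst (asm) integrable_distr_eq) auto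
 then show ?thesis by (simp add: add.commute)
qed

lemma null_hyperplane_lborel:
 assumes "n \<noteq> 0" shows "{x. n \<bullet> x = c} \<in> null_sets lborel"
proof -
 have "{x. n \<bullet> x = c} \<in> null_sets lebesgue"
  using negligible_hyperplane[of n c] assms negligible_iff_null_sets by blast
 moreover have "{x. n \<bullet> x = c} \<in> sets borel" by measurable
 ultimately show ?thesis by (simp add: null_sets_def)
qed

text \<open>Replaces the cylinder over the chosen normal by one over a prescribed normal
  \<open>n\<close>. If the two normals differ in sign, the cylinders are translates of each other
  along \<open>n\<close>; passing from the closed to the half-open cylinder drops a null
  hyperplane.\<close>

lemma facet_measure_eq:
 fixes n :: "'a::euclidean_space"
 assumes n: "norm n = 1" and Fc: "compact Fc" and aff: "affine hull Fc = {x. n \<bullet> x = c}"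
  and uniq: "\<And>n'. norm n' = 1 ==> (\<forall>x\<in>Fc. \<forall>y\<in>Fc. n' \<bullet> (y - x) = 0) ==> n' = n \<or> n' = - n"
 shows "fmeas Fc = distr (density lborel (indicator (hslab n c 1 \<inter> hproj n c -` Fc))) borel (hproj n c)"
proof -
 have Fcb [measurable]: "Fc \<in> sets borel" using Fc by (simp add: borel_compact)
 have Fcn: "n \<bullet> x = c" if "x \<in> Fc" for x using aff hull_inc[OF that, of affine] by auto
 define n' where "n' = (SOME n. norm n = 1 \<and> (\<forall>x\<in>Fc. \<forall>y\<in>Fc. n \<bullet> (y - x) = 0))"
 have "norm n' = 1 \<and> (\<forall>x\<in>Fc. \<forall>y\<in>Fc. n' \<bullet> (y - x) = 0)"
  unfolding n'_def by (rule someI[of _ n]) (auto simp: n Fcn inner_diff_right)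
 then have n': "n' = n \<or> n' = - n" using uniq by blast
 define Z where "Z = {x + s *\<^sub>R n' |x s. x \<in> Fc \<and> 0 \<le> s \<and> s \<le> 1}"
 have fm: "fmeas Fc = distr (leb Z) borel (hproj n c)"
  unfolding facet_measure_def Let_def n'_def[symmetric] Z_def[symmetric] aff
  using closest_point_hyperplane[OF n, of c] by (simp add: fun_eq_iff cong: distr_cong)
 \<comment> \<open>Position of the chosen cylinder along \<open>n\<close>: it covers the heights
   from 0 to 1, or from -1 to 0 when the chosen normal is \<open>- n\<close>.\<close>
 define t where "t = (if n' = n then 0 else -1 :: real)"
 have Z: "Z = {x. t \<le> n \<bullet> x - c \<and> n \<bullet> x - c \<le> t + 1 \<and> hproj n c x \<in> Fc}"
 proof (intro set_eqI iffI)
  fix x assume "x \<in> Z"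
  then obtain y s where "x = y + s *\<^sub>R n'" "y \<in> Fc" "0 \<le> s" "s \<le> 1" by (auto simp: Z_def)
  then show "x \<in> {x. t \<le> n \<bullet> x - c \<and> n \<bullet> x - c \<le> t + 1 \<and> hproj n c x \<in> Fc}"
   using n' Fcn[of y] n hproj_shift[OF n, of c y s] hproj_shift[OF n, of c y "-s"] hproj_id[of n y c]
   by (auto simp: t_def inner_add_right inner_self_unit)
 next
  fix x assume "x \<in> {x. t \<le> n \<bullet> x - c \<and> n \<bullet> x - c \<le> t + 1 \<and> hproj n c x \<in> Fc}"
  then have x: "t \<le> n \<bullet> x - c" "n \<bullet> x - c \<le> t + 1" "hproj n c x \<in> Fc" by auto
  define s where "s = (if n' = n then n \<bullet> x - c else c - n \<bullet> x)"
  have "x = hproj n c x + s *\<^sub>R n'"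
   using n' by (auto simp: s_def hproj_def algebra_simps)
  moreover have "0 \<le> s" "s \<le> 1" using x by (auto simp: s_def t_def split: if_splits)
  ultimately show "x \<in> Z" unfolding Z_def using x(3) by blast
 qed
 have Zb [measurable]: "Z \<in> sets borel" unfolding Z by measurable
 show ?thesis
 proof (rule measure_eqI)
  show "sets (fmeas Fc) = sets (distr (density lborel (indicator (hslab n c 1 \<inter> hproj n c -` Fc))) borel (hproj n c))"
   by (simp add: fm)
  fix A assume "A \<in> sets (fmeas Fc)"
  then have A [measurable]: "A \<in> sets borel" by (simp add: fm)
  define Q where "Q = {x. hproj n c x \<in> Fc \<inter> A}"
  have Qb [measurable]: "Q \<in> sets borel" unfolding Q_def by measurable
  have Qs: "x + s *\<^sub>R n \<in> Q \<longleftrightarrow> x \<in> Q" for x s by (simp add: Q_def hproj_shift n)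
  have mp: "hproj n c \<in> leb Z \<rightarrow>\<^sub>M borel"
   by (intro measurable_restrict_space1 measurable_completion) simp
  have "emeasure (fmeas Fc) A = emeasure (leb Z) (hproj n c -` A \<inter> Z)"
   unfolding fm by (subst emeasure_distr[OF mp A]) simp
  also have "\<dots> = emeasure lebesgue (hproj n c -` A \<inter> Z)"
   by (rule emeasure_restrict_space) auto
  also have "hproj n c -` A \<inter> Z = {x. t \<le> n \<bullet> x - c \<and> n \<bullet> x - c \<le> t + 1} \<inter> Q"
   unfolding Z Q_def by auto
  also have "emeasure lebesgue \<dots> = emeasure lborel \<dots>"
   by simp
  also have "\<dots> = emeasure lborel ({x. t \<le> n \<bullet> x - c \<and> n \<bullet> x - c < t + 1} \<inter> Q)"
  proof (rule emeasure_eq_AE)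
   have "AE x in lborel. x \<notin> {x. n \<bullet> x = c + t + 1}"
    by (rule AE_not_in, rule null_hyperplane_lborel) (use n in auto)
   then show "AE x in lborel. (x \<in> {x. t \<le> n \<bullet> x - c \<and> n \<bullet> x - c \<le> t + 1} \<inter> Q) = (x \<in> {x. t \<le> n \<bullet> x - c \<and> n \<bullet> x - c < t + 1} \<inter> Q)"
    by eventually_elim auto
  qed auto
  also have "\<dots> = (\<integral>\<^sup>+x. indicator ({x. t \<le> n \<bullet> x - c \<and> n \<bullet> x - c < t + 1} \<inter> Q) x \<partial>lborel)"
   by (rule nn_integral_indicator[symmetric]) auto
  also have "\<dots> = (\<integral>\<^sup>+x. indicator ({x. t \<le> n \<bullet> x - c \<and> n \<bullet> x - c < t + 1} \<inter> Q) (x + t *\<^sub>R n) \<partial>lborel)"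
   by (rule nn_integral_lborel_translate[symmetric]) auto
  also have "\<dots> = (\<integral>\<^sup>+x. indicator (hslab n c 1 \<inter> Q) x \<partial>lborel)"
   by (intro nn_integral_cong) (auto simp: indicator_def Qs hslab_def inner_add_right inner_self_unit n algebra_simps)
  also have "\<dots> = (\<integral>\<^sup>+x. indicator (hslab n c 1 \<inter> hproj n c -` Fc) x * indicator (hproj n c -` A) x \<partial>lborel)"
   by (intro nn_integral_cong) (auto simp: indicator_def Q_def)
  also have "\<dots> = emeasure (density lborel (indicator (hslab n c 1 \<inter> hproj n c -` Fc))) (hproj n c -` A)"
   using measurable_sets_borel[OF measurable_hproj A] by (subst emeasure_density) auto
  also have "\<dots> = emeasure (distr (density lborel (indicator (hslab n c 1 \<inter> hproj n c -` Fc))) borel (hproj n c)) A"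
   by (subst emeasure_distr) auto
  finally show "emeasure (fmeas Fc) A = emeasure (distr (density lborel (indicator (hslab n c 1 \<inter> hproj n c -` Fc))) borel (hproj n c)) A" .
 qed
qed

text \<open>Cauchy's functional equation for a locally bounded function. Splitting
  \<open>n * x\<close> into integer part and remainder bounds
  \<open>n * \<bar>m x - x * m 1\<bar>\<close> independently of \<open>n\<close>.\<close>

lemma additive_linear:
 fixes m :: "real \<Rightarrow> real"
 assumes add: "\<And>a b. 0 \<le> a ==> 0 \<le> b ==> m (a + b) = m a + m b"
  and bnd: "\<And>a. 0 \<le> a ==> a \<le> 1 ==> \<bar>m a\<bar> \<le> B" and x: "0 \<le> x"
 shows "m x = x * m 1"
proof -
 have m0: "m 0 = 0" using add[of 0 0] by simp
 have mul: "m (real k * a) = real k * m a" if "0 \<le> a" for k a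
 proof (induction k)
  case (Suc k)
  have "m (real (Suc k) * a) = m (real k * a + a)" by (simp add: algebra_simps)
  then show ?case using add[of "real k * a" a] that Suc by (simp add: algebra_simps)
 qed (simp add: m0)
 have bound: "real n * \<bar>m x - x * m 1\<bar> \<le> B + \<bar>m 1\<bar>" for n
 proof -
  define k where "k = nat \<lfloor>real n * x\<rfloor>"
  define r where "r = real n * x - real k"
  have k: "real k = of_int \<lfloor>real n * x\<rfloor>" using x by (simp add: k_def)
  have r: "0 \<le> r" "r \<le> 1" unfolding r_def k by linarith+
  have "real n * m x = m (real k * 1 + r)" using mul[OF x, of n] by (simp add: r_def)
  also have "\<dots> = real k * m 1 + m r" using add[of "real k * 1" r] mul[of 1 k] r by simp
  finally have "real n * (m x - x * m 1) = m r - r * m 1" by (simp add: r_def algebra_simps)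
  then have "real n * \<bar>m x - x * m 1\<bar> = \<bar>m r - r * m 1\<bar>" by (metis abs_mult abs_of_nat)
  also have "\<dots> \<le> \<bar>m r\<bar> + r * \<bar>m 1\<bar>" using r abs_triangle_ineq4[of "m r" "r * m 1"] by (simp add: abs_mult)
  also have "\<dots> \<le> B + \<bar>m 1\<bar>" using bnd[of r] r by (intro add_mono) (auto intro: mult_left_le_one_le)
  finally show ?thesis .
 qed
 have "\<bar>m x - x * m 1\<bar> = 0"
 proof (rule ccontr)
  assume "\<bar>m x - x * m 1\<bar> \<noteq> 0"
  then have "0 < \<bar>m x - x * m 1\<bar>" by simp
  then obtain n :: nat where "B + \<bar>m 1\<bar> < real n * \<bar>m x - x * m 1\<bar>"
   using reals_Archimedean3 by blast
  then show False using bound[of n] by simp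
 qed
 then show ?thesis by simp
qed

text \<open>Integrals over a layer along a hyperplane are proportional to its thickness because they are
 additive in it, by translation invariance.\<close>

lemma layer_integral_linear:
 fixes n :: "'a::euclidean_space" and g :: "'a \<Rightarrow> real"
 assumes n: "norm n = 1" and g [measurable]: "g \<in> borel_measurable borel"
  and int: "\<And>h. integrable lborel (%x. indicator (hslab n c h) x * g (hproj n c x))" and h: "0 \<le> h"
 shows "(LINT x|lborel. indicator (hslab n c h) x * g (hproj n c x)) = h * (LINT x|lborel. indicator (hslab n c 1) x * g (hproj n c x))"
proof -
 define m where "m h = (LINT x|lborel. indicator (hslab n c h) x * g (hproj n c x))" for h
 define G where "G x = g (hproj n c x)" for x
 have Gs: "G (x + s *\<^sub>R n) = G x" for x s by (simp add: G_def hproj_shift n)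
 have Gm [measurable]: "G \<in> borel_measurable borel" unfolding G_def by measurable
 have "m h = h * m 1"
 proof (rule additive_linear[where B = "LINT x|lborel. \<bar>indicator (hslab n c 1) x * G x\<bar>"])
  fix a b :: real assume ab: "0 \<le> a" "0 \<le> b"
  have "m a + m b = (LINT x|lborel. indicator (hslab n c a) x * G x) + (LINT x|lborel. indicator (hslab n c b) (x + (-a) *\<^sub>R n) * G (x + (-a) *\<^sub>R n))"
   using integral_lborel_translate[of "%x. indicator (hslab n c b) x * G x" "(-a) *\<^sub>R n"]
   by (simp add: m_def G_def)
  also have "\<dots> = (LINT x|lborel. indicator (hslab n c a) x * G x + indicator (hslab n c b) (x + (-a) *\<^sub>R n) * G (x + (-a) *\<^sub>R n))"
   using int[of a] integrable_lborel_translate[OF _ int[of b, folded G_def], of "(-a) *\<^sub>R n"]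
   by (intro integral_add[symmetric]) (auto simp: G_def)
  also have "\<dots> = m (a + b)"
   unfolding m_def G_def[symmetric] Gs
   by (intro integral_cong refl)
    (use ab in \<open>auto simp: indicator_def hslab_def inner_diff_right inner_self_unit n algebra_simps\<close>)
  finally show "m (a + b) = m a + m b" by simp
 next
  fix a :: real assume a: "0 \<le> a" "a \<le> 1"
  have "\<bar>m a\<bar> \<le> (LINT x|lborel. \<bar>indicator (hslab n c a) x * G x\<bar>)"
   unfolding m_def G_def by (rule integral_abs_bound)
  also have "\<dots> \<le> (LINT x|lborel. \<bar>indicator (hslab n c 1) x * G x\<bar>)"
   using a int[of a] int[of 1] by (intro integral_mono) (auto simp: G_def indicator_def hslab_def)
  finally show "\<bar>m a\<bar> \<le> (LINT x|lborel. \<bar>indicator (hslab n c 1) x * G x\<bar>)" .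
 qed (rule h)
 then show ?thesis by (simp add: m_def)
qed

lemma integrable_indicator_continuous:
 fixes f :: "'a::euclidean_space \<Rightarrow> real"
 assumes S: "S \<in> sets borel" "bounded S" and f: "continuous_on UNIV f"
 shows "integrable lborel (%x. indicator S x * f x)"
proof -
 obtain r where r: "\<forall>x\<in>S. norm x \<le> r" using S(2) unfolding bounded_iff by blast
 have fm [measurable]: "f \<in> borel_measurable borel" by (rule borel_measurable_continuous_onI) (rule f)
 have Sm [measurable]: "S \<in> sets borel" by (rule S(1))
 have "integrable lborel (%x. indicator (cball 0 r) x *\<^sub>R f x)"
  by (rule borel_integrable_compact) (auto intro: continuous_on_subset[OF f])
 then show ?thesis
  by (rule integrable_bound) (use r in \<open>auto simp: indicator_def intro!: AE_I2\<close>)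
qed

lemma norm_le_hproj:
 assumes "norm n = 1" "x \<in> hslab n c h" "norm (hproj n c x) \<le> r" shows "norm x \<le> r + h"
proof -
 have "norm x \<le> norm (hproj n c x) + norm ((n \<bullet> x - c) *\<^sub>R n)"
  by (subst hproj_decomp[of x n c]) (rule norm_triangle_ineq)
 then show ?thesis using assms by (auto simp: hslab_def)
qed

lemma integrable_layer:
 fixes g :: "'a::euclidean_space \<Rightarrow> real"
 assumes n: "norm n = 1" and g [measurable]: "g \<in> borel_measurable borel"
  and b: "\<And>x. \<bar>g x\<bar> \<le> M" and s: "\<And>x. g x \<noteq> 0 ==> norm x \<le> r"
 shows "integrable lborel (%x. indicator (hslab n c h) x * g (hproj n c x))"
proof -
 have "integrable lborel (%x. indicator (cball 0 (r + h)) x * M)"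
  by (rule integrable_indicator_continuous) auto
 then show ?thesis
 proof (rule integrable_bound)
  show "AE x in lborel. norm (indicator (hslab n c h) x * g (hproj n c x)) \<le> norm (indicator (cball 0 (r + h)) x * M)"
  proof (rule AE_I2)
   fix x
   have "0 \<le> M" using b[of x] by linarith
   show "norm (indicator (hslab n c h) x * g (hproj n c x)) \<le> norm (indicator (cball 0 (r + h)) x * M)"
   proof (cases "x \<in> hslab n c h \<and> g (hproj n c x) \<noteq> 0")
    case True
    then have "norm x \<le> r + h" using norm_le_hproj[OF n] s by blast
    then show ?thesis using b[of "hproj n c x"] True by (auto simp: indicator_def)
   qed (auto simp: indicator_def)
  qed
 qed simp
qed

context barycentric
begin

definition off where "off v = - bc v 0 / norm (gr v)"
abbreviation cell where "cell \<equiv> convex hull C"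
abbreviation facet where "facet v \<equiv> convex hull (C - {v})"

lemma compact_cell: "compact cell" using finC by (rule finite_imp_compact_convex_hull)
lemma compact_facet: "compact (facet v)" using finC by (intro finite_imp_compact_convex_hull) auto
lemma cell_borel [measurable]: "cell \<in> sets borel" using compact_cell by (rule borel_compact)
lemma facet_borel [measurable]: "facet v \<in> sets borel" using compact_facet by (rule borel_compact)
lemma facet_subset_cell: "facet v \<subseteq> cell" by (rule hull_mono) auto

lemma bc_dist: "v \<in> C ==> bc v x = norm (gr v) * (nrm v \<bullet> x - off v)"
 unfolding off_def by (rule bc_gr)

lemma bc_hproj: "v \<in> C ==> bc v (hproj (nrm v) (off v) x) = 0"
 by (simp add: bc_dist inner_hproj norm_nrm)

lemma facet_measure_facet:
 assumes v: "v \<in> C"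
 shows "fmeas (facet v) = distr (density lborel (indicator (hslab (nrm v) (off v) 1 \<inter> hproj (nrm v) (off v) -` facet v)))
  borel (hproj (nrm v) (off v))"
proof (rule facet_measure_eq[OF norm_nrm[OF v] compact_facet])
 have "bc v x = 0 \<longleftrightarrow> nrm v \<bullet> x = off v" for x
  using gr_nonzero[OF v] bc_dist[OF v, of x] by simp
 then show "affine hull (facet v) = {x. nrm v \<bullet> x = off v}" using affine_hull_facet[OF v] by simp
qed (use unit_normal_facet[OF v] in blast)

text \<open>Facet integrals become volume integrals over a prism of height 1, where translation
  invariance of Lebesgue measure can be used.\<close>

lemma facet_integral:
 fixes f :: "'a \<Rightarrow> real"
 assumes v: "v \<in> C" and f [measurable]: "f \<in> borel_measurable borel"
 shows "(LINT x|fmeas (facet v). f x) = (LINT x|lborel. indicator (hslab (nrm v) (off v) 1) x *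
   (indicator (facet v) (hproj (nrm v) (off v) x) * f (hproj (nrm v) (off v) x)))"
  and "integrable (fmeas (facet v)) f \<longleftrightarrow> integrable lborel (%x. indicator (hslab (nrm v) (off v) 1) x *
   (indicator (facet v) (hproj (nrm v) (off v) x) * f (hproj (nrm v) (off v) x)))"
proof -
 let ?A = "hslab (nrm v) (off v) 1 \<inter> hproj (nrm v) (off v) -` facet v"
 have A [measurable]: "?A \<in> sets borel" using measurable_sets_borel[OF measurable_hproj facet_borel] by simp
 have d: "density lborel (indicator ?A) = density lborel (%x. ennreal (indicator ?A x))"
  by (simp add: ennreal_indicator)
 have i: "(%x. indicator ?A x *\<^sub>R f (hproj (nrm v) (off v) x)) = (%x. indicator (hslab (nrm v) (off v) 1) x *
   (indicator (facet v) (hproj (nrm v) (off v) x) * f (hproj (nrm v) (off v) x)))"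
  by (auto simp: indicator_def)
 show "(LINT x|fmeas (facet v). f x) = (LINT x|lborel. indicator (hslab (nrm v) (off v) 1) x *
   (indicator (facet v) (hproj (nrm v) (off v) x) * f (hproj (nrm v) (off v) x)))"
  unfolding facet_measure_facet[OF v] d i[symmetric]
  by (subst integral_distr, simp, simp) (subst integral_density, auto)
 show "integrable (fmeas (facet v)) f \<longleftrightarrow> integrable lborel (%x. indicator (hslab (nrm v) (off v) 1) x *
   (indicator (facet v) (hproj (nrm v) (off v) x) * f (hproj (nrm v) (off v) x)))"
  unfolding facet_measure_facet[OF v] d i[symmetric]
  by (subst integrable_distr_eq, simp, simp) (subst integrable_density, auto)
qed

lemma AE_facet_measure:
 assumes v: "v \<in> C" shows "AE x in fmeas (facet v). x \<in> facet v"
proof -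
 let ?A = "hslab (nrm v) (off v) 1 \<inter> hproj (nrm v) (off v) -` facet v"
 have A [measurable]: "?A \<in> sets borel" using measurable_sets_borel[OF measurable_hproj facet_borel] by simp
 show ?thesis
  unfolding facet_measure_facet[OF v]
  by (subst AE_distr_iff, simp, simp) (subst AE_density, auto simp: indicator_def)
qed

text \<open>Points that project to the boundary of the facet are negligible. After projection
  \<open>bc w\<close> is still affine: its zero set is a hyperplane, or else it is constant with the
  value 1 that it takes at the vertex \<open>w\<close>, which the projection fixes.\<close>

lemma null_bc_hproj:
 assumes v: "v \<in> C" and w: "w \<in> C - {v}"
 shows "AE x in lborel. bc w (hproj (nrm v) (off v) x) \<noteq> 0"
proof -
 define m where "m = gr w - (gr w \<bullet> nrm v) *\<^sub>R nrm v"
 define k where "k = bc w 0 + off v * (gr w \<bullet> nrm v)"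
 have eq: "bc w (hproj (nrm v) (off v) x) = k + m \<bullet> x" for x
  using w by (subst bc_eq) (auto simp: hproj_def m_def k_def inner_diff_right inner_diff_left algebra_simps)
 show ?thesis
 proof (cases "m = 0")
  case True
  have "hproj (nrm v) (off v) w = w"
   using w v bc_dist[OF v, of w] bc_vertex[of v w] gr_nonzero[OF v] by (intro hproj_id) auto
  then have "k = 1" using eq[of w] True bc_vertex[of w w] w by simp
  then show ?thesis by (simp add: eq True)
 next
  case False
  have "AE x in lborel. x \<notin> {x. m \<bullet> x = - k}" by (rule AE_not_in, rule null_hyperplane_lborel) (rule False)
  then show ?thesis by eventually_elim (auto simp: eq)
 qed
qed

text \<open>The layer of the cell below \<open>bc v = h\<close> has width
  \<open>d = h / norm (gr v)\<close>, which explains the factor in the limit. It is compared with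
  the straight prism over the facet: replacing \<open>x\<close> by its projection changes
  \<open>f\<close> by at most \<open>L * d\<close>, and cell and prism disagree only over points
  close to the other facets, whose share of the prism tends to 0.\<close>

lemma layer_limit:
 fixes f :: "'a \<Rightarrow> real" and h :: "nat \<Rightarrow> real"
 assumes v: "v \<in> C" and f: "continuous_on UNIV f"
  and lip: "\<And>r. \<exists>L. \<forall>x\<in>cball 0 r. \<forall>y\<in>cball 0 r. \<bar>f x - f y\<bar> \<le> L * dist x y"
  and h: "\<And>k. 0 < h k" "h ----> 0"
 shows "(%k. (LINT x|lborel. indicator {x \<in> cell. bc v x < h k} x * f x) / h k) ---->
  (LINT x|fmeas (facet v). f x) / norm (gr v)"
proof -
 define n where "n = nrm v"
 define c where "c = off v"
 define P where "P = hproj n c"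
 have n: "norm n = 1" using norm_nrm[OF v] by (simp add: n_def)
 have g0: "0 < norm (gr v)" using gr_nonzero[OF v] by simp
 have fm [measurable]: "f \<in> borel_measurable borel" by (rule borel_measurable_continuous_onI) (rule f)
 have Pm [measurable]: "P \<in> borel \<rightarrow>\<^sub>M borel" unfolding P_def by measurable
 obtain R0 where R0: "\<forall>x\<in>cell. norm x \<le> R0" using compact_imp_bounded[OF compact_cell] unfolding bounded_iff by blast
 \<comment> \<open>The extra 1 leaves room for points and their projections in layers of width at
   most 1, so that a single ball serves for all estimates.\<close>
 define R where "R = \<bar>R0\<bar> + 1"
 have R: "norm x \<le> R - 1" if "x \<in> cell" for x
 proof -
  have "norm x \<le> R0" using R0 that by blast
  then show ?thesis unfolding R_def by linarith
 qed
 obtain L0 where L0: "\<forall>x\<in>cball 0 R. \<forall>y\<in>cball 0 R. \<bar>f x - f y\<bar> \<le> L0 * dist x y" using lip by blast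
 define L where "L = \<bar>L0\<bar>"
 have L: "\<bar>f x - f y\<bar> \<le> L * dist x y" if "norm x \<le> R" "norm y \<le> R" for x y
 proof -
  have "\<bar>f x - f y\<bar> \<le> L0 * dist x y" using L0 that by simp
  also have "\<dots> \<le> L * dist x y" by (simp add: L_def mult_right_mono)
  finally show ?thesis .
 qed
 have "bounded (f ` cball 0 R)"
  by (intro compact_imp_bounded compact_continuous_image continuous_on_subset[OF f]) auto
 then obtain M where "\<forall>y\<in>f ` cball 0 R. norm y \<le> M" unfolding bounded_iff by blast
 then have M: "\<bar>f x\<bar> \<le> M" if "norm x \<le> R" for x using that by simp
 have M0: "0 \<le> M" using M[of 0] unfolding R_def by simp
 define G where "G = (\<Sum>w\<in>C. norm (gr w))"
 have G: "norm (gr w) \<le> G" if "w \<in> C" for w unfolding G_def using that finC by (intro member_le_sum) auto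
 have G0: "0 \<le> G" unfolding G_def by (intro sum_nonneg) auto
 \<comment> \<open>Points where some other coordinate is so small that it could change sign within
   the distance \<open>d\<close>; \<open>G\<close> bounds the gradients of all coordinates.\<close>
 define E where "E d = {y. norm y \<le> R \<and> (\<exists>w\<in>C - {v}. \<bar>bc w y\<bar> \<le> G * d)}" for d
 have bcm [measurable]: "(%x. bc w x) \<in> borel_measurable borel" if "w \<in> C" for w
 proof -
  have "(%x. bc w 0 + gr w \<bullet> x) \<in> borel_measurable borel" by measurable
  then show ?thesis by (simp only: bc_eq[OF that, symmetric])
 qed
 have Em [measurable]: "E d \<in> sets borel" for d
 proof -
  have "E d = cball 0 R \<inter> (\<Union>w\<in>C - {v}. {y. \<bar>bc w y\<bar> \<le> G * d})" by (auto simp: E_def)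
  moreover have "{y. \<bar>bc w y\<bar> \<le> G * d} \<in> sets borel" if "w \<in> C" for w
   using bcm[OF that] by measurable
  then have "(\<Union>w\<in>C - {v}. {y. \<bar>bc w y\<bar> \<le> G * d}) \<in> sets borel"
   using finC by (intro sets.finite_UN) auto
  ultimately show ?thesis by auto
 qed
 \<comment> \<open>\<open>\<sigma>\<close> is the area of the facet, \<open>\<mu> d\<close> the area
   of the part of its hyperplane in \<open>E d\<close>, and \<open>I\<close> the facet integral of
   \<open>f\<close>, all written over a layer of thickness 1.\<close>
 define \<sigma> where "\<sigma> = ((LINT x|lborel. indicator (hslab n c 1) x * indicator (facet v) (P x)) :: real)"
 define \<mu> where "\<mu> d = ((LINT x|lborel. indicator (hslab n c 1) x * indicator (E d) (P x)) :: real)" for d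
 define I where "I = (LINT x|lborel. indicator (hslab n c 1) x * (indicator (facet v) (P x) * f (P x)))"
 have facR: "norm y \<le> R - 1" if "y \<in> facet v" for y using that R facet_subset_cell by blast
 have int\<sigma>: "integrable lborel (%x. indicator (hslab n c h) x * indicator (facet v) (P x) :: real)" for h
  unfolding P_def by (rule integrable_layer[OF n borel_measurable_indicator[OF facet_borel], where M = 1 and r = R]) (use facR in \<open>force simp: indicator_def split: if_splits\<close>)+
 have int\<mu>: "integrable lborel (%x. indicator (hslab n c h) x * indicator (E d) (P x) :: real)" for h d
  unfolding P_def by (rule integrable_layer[OF n borel_measurable_indicator[OF Em], where M = 1 and r = R]) (auto simp: indicator_def E_def split: if_splits)
 have intI: "integrable lborel (%x. indicator (hslab n c h) x * (indicator (facet v) (P x) * f (P x)))" for h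
  unfolding P_def
 proof (rule integrable_layer[OF n, where M = M and r = R and g = "%y. indicator (facet v) y * f y"])
  show "\<bar>indicator (facet v) x * f x\<bar> \<le> M" for x using M[of x] M0 facR[of x] by (auto simp: indicator_def)
  show "norm x \<le> R" if "indicator (facet v) x * f x \<noteq> 0" for x
   using that facR[of x] by (auto simp: indicator_def split: if_splits)
 qed measurable
 have bound: "\<bar>(LINT x|lborel. indicator {x \<in> cell. bc v x < h} x * f x) - (h / norm (gr v)) * I\<bar>
   \<le> (h / norm (gr v)) * (L * (h / norm (gr v)) * \<sigma> + 2 * M * \<mu> (h / norm (gr v)))"
  if h: "0 < h" "h / norm (gr v) \<le> 1" for h
 proof -
  define d where "d = h / norm (gr v)"
  have d: "0 < d" "d \<le> 1" using h g0 by (auto simp: d_def)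
  have layer: "{x \<in> cell. bc v x < h} = cell \<inter> hslab n c d"
  proof -
   have "bc v x < h \<longleftrightarrow> n \<bullet> x - c < d" for x
    using g0 by (simp add: bc_dist[OF v, of x] d_def n_def c_def field_simps)
   moreover have "0 \<le> n \<bullet> x - c" if "x \<in> cell" for x
   proof -
    have "0 \<le> norm (gr v) * (n \<bullet> x - c)"
     using that v convex_hull_eq bc_dist[OF v, of x] by (auto simp: n_def c_def)
    then show ?thesis using g0 by (simp add: zero_le_mult_iff)
   qed
   ultimately show ?thesis by (auto simp: hslab_def)
  qed
  \<comment> \<open>The first term on the right pays for replacing \<open>x\<close> by
    \<open>P x\<close>, the second for points near the other facets, where the two indicators may
    disagree.\<close>
  have pt: "\<bar>indicator (cell \<inter> hslab n c d) x * f x - indicator (hslab n c d) x * (indicator (facet v) (P x) * f (P x))\<bar>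
    \<le> L * d * (indicator (hslab n c d) x * indicator (facet v) (P x)) + 2 * M * (indicator (hslab n c d) x * indicator (E d) (P x))" for x
  proof (cases "x \<in> hslab n c d")
   case False then show ?thesis by simp
  next
   case True
   define t where "t = n \<bullet> x - c"
   have t: "0 \<le> t" "t < d" using True by (auto simp: t_def hslab_def)
   have xP: "x = P x + t *\<^sub>R n" unfolding P_def t_def by (rule hproj_decomp)
   have dxP: "dist x (P x) = t" using t n by (subst (1) xP) (simp add: dist_norm)
   have n1: "norm (P x) \<le> R \<and> norm x \<le> R" if "x \<in> cell \<or> P x \<in> facet v"
    using that
   proof
    assume "x \<in> cell"
    then have "norm x \<le> R - 1" by (rule R)
    moreover have "norm (P x) \<le> norm x + dist x (P x)" by (metis dist_commute dist_norm norm_triangle_sub add.commute)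
    ultimately show ?thesis using dxP t d by linarith
   next
    assume "P x \<in> facet v"
    then have "norm (P x) \<le> R - 1" by (rule facR)
    moreover have "norm x \<le> norm (P x) + dist x (P x)" by (metis dist_norm norm_triangle_sub)
    ultimately show ?thesis using dxP t d by linarith
   qed
   have bcP: "bc v (P x) = 0" unfolding P_def n_def c_def by (rule bc_hproj[OF v])
   show ?thesis
   proof (cases "\<exists>w\<in>C - {v}. \<bar>bc w (P x)\<bar> \<le> G * d")
    case near: True
    show ?thesis
    proof (cases "x \<in> cell \<or> P x \<in> facet v")
     case True
     with n1 near have "P x \<in> E d" "\<bar>f x\<bar> \<le> M" "\<bar>f (P x)\<bar> \<le> M" using M by (auto simp: E_def)
     moreover have "0 \<le> L * d" using d by (simp add: L_def)
     ultimately show ?thesis using \<open>x \<in> hslab n c d\<close> by (auto simp: indicator_def)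
    next
     case False then show ?thesis using M0 by (auto simp: indicator_def)
    qed
   next
    case far: False
    \<comment> \<open>Away from the other facets no coordinate changes sign between \<open>x\<close>
      and its projection, so cell and prism coincide there.\<close>
    have "0 \<le> bc w x \<longleftrightarrow> 0 \<le> bc w (P x)" if w: "w \<in> C - {v}" for w
    proof -
     have "\<bar>bc w x - bc w (P x)\<bar> = \<bar>gr w \<bullet> (x - P x)\<bar>" using w bc_diff by simp
     also have "\<dots> \<le> norm (gr w) * norm (x - P x)" by (rule Cauchy_Schwarz_ineq2)
     also have "\<dots> \<le> G * d" using G[of w] w t dxP G0 by (intro mult_mono) (auto simp: dist_norm)
     finally have "\<bar>bc w x - bc w (P x)\<bar> \<le> G * d" .
     moreover have "G * d < \<bar>bc w (P x)\<bar>" using far w by force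
     ultimately show ?thesis by linarith
    qed
    moreover have "0 \<le> bc v x"
     using t g0 by (simp add: bc_dist[OF v] t_def n_def c_def)
    ultimately have iff: "x \<in> cell \<longleftrightarrow> P x \<in> facet v"
     using bcP facet_eq[OF v] v unfolding convex_hull_eq by (auto, (metis DiffI singletonD order_refl)+)
    show ?thesis
    proof (cases "P x \<in> facet v")
     case True
     have "\<bar>f x - f (P x)\<bar> \<le> L * dist x (P x)" using n1 True by (intro L) auto
     also have "\<dots> \<le> L * d" using dxP t by (intro mult_left_mono) (auto simp: L_def)
     finally show ?thesis using True iff \<open>x \<in> hslab n c d\<close> M0 by (auto simp: indicator_def)
    next
     case False then show ?thesis using iff M0 by (auto simp: indicator_def)
    qed
   qed
  qed
  have i1: "integrable lborel (%x. indicator (cell \<inter> hslab n c d) x * f x)"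
   by (rule integrable_indicator_continuous[OF _ _ f]) (auto intro: bounded_subset[OF compact_imp_bounded[OF compact_cell]])
  have "d * I = (LINT x|lborel. indicator (hslab n c d) x * (indicator (facet v) (P x) * f (P x)))"
   unfolding I_def P_def using layer_integral_linear[OF n _ intI[unfolded P_def], of d] d by simp
  then have "\<bar>(LINT x|lborel. indicator {x \<in> cell. bc v x < h} x * f x) - d * I\<bar>
   = \<bar>LINT x|lborel. indicator (cell \<inter> hslab n c d) x * f x - indicator (hslab n c d) x * (indicator (facet v) (P x) * f (P x))\<bar>"
   unfolding layer using i1 intI[of d] by simp
  also have "\<dots> \<le> (LINT x|lborel. \<bar>indicator (cell \<inter> hslab n c d) x * f x - indicator (hslab n c d) x * (indicator (facet v) (P x) * f (P x))\<bar>)"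
   by (rule integral_abs_bound)
  also have "\<dots> \<le> (LINT x|lborel. L * d * (indicator (hslab n c d) x * indicator (facet v) (P x)) + 2 * M * (indicator (hslab n c d) x * indicator (E d) (P x)))"
   by (intro integral_mono pt integrable_add integrable_mult_right int\<sigma> int\<mu> integrable_abs integrable_diff i1 intI)
  also have "\<dots> = L * d * (LINT x|lborel. indicator (hslab n c d) x * indicator (facet v) (P x)) + 2 * M * (LINT x|lborel. indicator (hslab n c d) x * indicator (E d) (P x))"
   using int\<sigma>[of d] int\<mu>[of d d] by simp
  also have "((LINT x|lborel. indicator (hslab n c d) x * indicator (facet v) (P x)) :: real) = d * \<sigma>"
   unfolding \<sigma>_def P_def using layer_integral_linear[OF n _ int\<sigma>[unfolded P_def], of d] d by simp
  also have "((LINT x|lborel. indicator (hslab n c d) x * indicator (E d) (P x)) :: real) = d * \<mu> d"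
   unfolding \<mu>_def P_def using layer_integral_linear[OF n _ int\<mu>[unfolded P_def], of d d] d by simp
  finally show ?thesis unfolding d_def[symmetric] by (simp add: algebra_simps)
 qed
 define d where "d k = h k / norm (gr v)" for k
 have d: "\<And>k. 0 < d k" "d ----> 0" using h g0 by (auto simp: d_def[abs_def] intro!: tendsto_eq_intros)
 \<comment> \<open>Almost every point projects to a place where none of the finitely many other
   coordinates vanishes, and hence leaves \<open>E (d k)\<close> eventually.\<close>
 have \<mu>0: "(%k. \<mu> (d k)) ----> 0"
 proof -
  have "(%k. \<mu> (d k)) ----> (LINT x|(lborel :: 'a measure). 0)"
   unfolding \<mu>_def
  proof (rule integral_dominated_convergence[where w = "%x. indicator (hslab n c 1) x * indicator (cball 0 R) (P x)"])
   show "integrable lborel (%x. indicator (hslab n c 1) x * indicator (cball 0 R) (P x) :: real)"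
    unfolding P_def by (rule integrable_layer[OF n borel_measurable_indicator, where M = 1 and r = R]) (auto simp: indicator_def split: if_splits)
   have "AE x in lborel. \<forall>w\<in>C - {v}. bc w (P x) \<noteq> 0"
    using null_bc_hproj[OF v] finC unfolding P_def n_def c_def by (intro AE_finite_allI) auto
   then show "AE x in lborel. (%k. indicator (hslab n c 1) x * indicator (E (d k)) (P x)) ----> (0::real)"
   proof eventually_elim
    fix x assume x: "\<forall>w\<in>C - {v}. bc w (P x) \<noteq> 0"
    have "\<forall>\<^sub>F k in sequentially. \<forall>w\<in>C - {v}. G * d k < \<bar>bc w (P x)\<bar>"
    proof (rule eventually_ball_finite)
     show "\<forall>w\<in>C - {v}. \<forall>\<^sub>F k in sequentially. G * d k < \<bar>bc w (P x)\<bar>"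
     proof
      fix w assume "w \<in> C - {v}"
      have "(%k. G * d k) ----> G * 0" by (intro tendsto_intros d)
      then show "\<forall>\<^sub>F k in sequentially. G * d k < \<bar>bc w (P x)\<bar>"
       using x \<open>w \<in> C - {v}\<close> by (intro order_tendstoD(2)) auto
     qed
    qed (use finC in auto)
    then have "\<forall>\<^sub>F k in sequentially. indicator (hslab n c 1) x * indicator (E (d k)) (P x) = (0::real)"
     by eventually_elim (force simp: E_def indicator_def)
    then show "(%k. indicator (hslab n c 1) x * indicator (E (d k)) (P x)) ----> (0::real)"
     by (rule tendsto_eventually)
   qed
   show "AE x in lborel. norm (indicator (hslab n c 1) x * indicator (E (d k)) (P x) :: real) \<le> indicator (hslab n c 1) x * indicator (cball 0 R) (P x)" for k
    by (intro AE_I2) (auto simp: indicator_def E_def)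
  qed measurable
  then show ?thesis by simp
 qed
 have "(%k. L * d k * \<sigma> + 2 * M * \<mu> (d k)) ----> L * 0 * \<sigma> + 2 * M * 0"
  by (intro tendsto_intros d \<mu>0)
 then have z: "(%k. L * d k * \<sigma> + 2 * M * \<mu> (d k)) ----> 0" by simp
 have "\<forall>\<^sub>F k in sequentially. d k < 1" by (rule order_tendstoD(2)[OF d(2)]) simp
 then have "\<forall>\<^sub>F k in sequentially. norm ((LINT x|lborel. indicator {x \<in> cell. bc v x < h k} x * f x) / d k - I) \<le> L * d k * \<sigma> + 2 * M * \<mu> (d k)"
 proof eventually_elim
  case (elim k)
  have "\<bar>(LINT x|lborel. indicator {x \<in> cell. bc v x < h k} x * f x) - d k * I\<bar> \<le> d k * (L * d k * \<sigma> + 2 * M * \<mu> (d k))"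
   using bound[of "h k"] h(1)[of k] elim by (simp add: d_def)
  then have "\<bar>(LINT x|lborel. indicator {x \<in> cell. bc v x < h k} x * f x) - d k * I\<bar> / d k \<le> L * d k * \<sigma> + 2 * M * \<mu> (d k)"
   using d(1)[of k] by (simp add: divide_le_eq mult.commute)
  then show ?case using d(1)[of k] by (simp add: diff_divide_distrib[symmetric] abs_divide field_simps)
 qed
 then have "(%k. (LINT x|lborel. indicator {x \<in> cell. bc v x < h k} x * f x) / d k - I) ----> 0"
  by (rule Lim_null_comparison) (rule z)
 then have "(%k. (LINT x|lborel. indicator {x \<in> cell. bc v x < h k} x * f x) / d k) ----> I"
  by (simp add: LIM_zero_iff)
 then have "(%k. (LINT x|lborel. indicator {x \<in> cell. bc v x < h k} x * f x) / d k / norm (gr v)) ----> I / norm (gr v)"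
  by (intro tendsto_intros) (use g0 in auto)
 moreover have "I = (LINT x|fmeas (facet v). f x)"
  unfolding facet_integral(1)[OF v fm] I_def P_def n_def c_def ..
 ultimately show ?thesis using g0 by (simp add: d_def)
qed

end

section \<open>The divergence theorem along an edge and in an arbitrary direction\<close>

lemma C1_lipschitz_on_balls:
 fixes f :: "'a::euclidean_space \<Rightarrow> real"
 assumes f': "\<And>x. (f has_derivative (%y. G x \<bullet> y)) (at x)" and G: "continuous_on UNIV G"
 shows "\<exists>L. \<forall>x\<in>cball 0 r. \<forall>y\<in>cball 0 r. \<bar>f x - f y\<bar> \<le> L * dist x y"
proof -
 have "bounded (G ` cball 0 r)"
  by (intro compact_imp_bounded compact_continuous_image continuous_on_subset[OF G]) auto
 then obtain L where L: "\<forall>y\<in>G ` cball 0 r. norm y \<le> L" unfolding bounded_iff by blast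
 have "\<bar>f x - f y\<bar> \<le> L * dist x y" if "x \<in> cball 0 r" "y \<in> cball 0 r" for x y
 proof -
  have "norm (f x - f y) \<le> L * norm (x - y)"
  proof (rule differentiable_bound[of "cball 0 r"])
   show "(f has_derivative (%y. G x \<bullet> y)) (at x within cball 0 r)" for x
    using f' by (rule has_derivative_at_withinI)
   show "onorm (%y. G x \<bullet> y) \<le> L" if "x \<in> cball 0 r" for x
   proof (rule onorm_le)
    fix y
    have "norm (G x \<bullet> y) \<le> norm (G x) * norm y" using Cauchy_Schwarz_ineq2 by simp
    also have "\<dots> \<le> L * norm y" using L that by (intro mult_right_mono) auto
    finally show "norm (G x \<bullet> y) \<le> L * norm y" .
   qed
  qed (use that in auto)
  then show ?thesis by (simp add: dist_norm)
 qed
 then show ?thesis by blast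
qed

context barycentric
begin

lemma bc_edge:
 assumes "v \<in> C" "w \<in> C" "v \<noteq> w" "u \<in> C"
 shows "bc u (x + s *\<^sub>R (w - v)) = bc u x + (if u = w then s else if u = v then - s else 0)"
proof -
 have "gr u \<bullet> (w - v) = (if u = w then 1 else if u = v then - 1 else 0)"
  using bc_diff[of u w v] bc_vertex[of u] assms by auto
 then show ?thesis using bc_add[OF assms(4), of x "s *\<^sub>R (w - v)"] by auto
qed

text \<open>The difference quotient of \<open>f\<close> along the edge is integrated over the cell
  in two ways. It converges to the integral of the derivative; and since translation along the edge
  matches the part with \<open>h k \<le> bc v\<close> with the part with
  \<open>h k \<le> bc w\<close>, only the layers at the facets opposite \<open>v\<close> and
  \<open>w\<close> survive.\<close>

lemma gauss_edge:
 fixes f :: "'a \<Rightarrow> real"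
 assumes v: "v \<in> C" and w: "w \<in> C" and vw: "v \<noteq> w"
  and f': "\<And>x. (f has_derivative (%y. G x \<bullet> y)) (at x)" and G: "continuous_on UNIV G"
 shows "(LINT x|lborel. indicator cell x * (G x \<bullet> (w - v))) =
  (LINT x|fmeas (facet v). f x) / norm (gr v) - (LINT x|fmeas (facet w). f x) / norm (gr w)"
proof -
 define e where "e = w - v"
 define h where "h k = inverse (real (Suc k))" for k
 have h: "0 < h k" "h k \<le> 1" for k by (auto simp: h_def inverse_le_1_iff)
 have h0: "h ----> 0" unfolding h_def by (rule LIMSEQ_inverse_real_of_nat)
 have f: "continuous_on UNIV f"
  using f' by (intro continuous_at_imp_continuous_on ballI) (blast intro: has_derivative_continuous)
 have fm [measurable]: "f \<in> borel_measurable borel" by (rule borel_measurable_continuous_onI) (rule f)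
 have fs: "continuous_on UNIV (%x. f (x + s *\<^sub>R e))" for s
  by (rule continuous_on_compose2[OF f]) (auto intro!: continuous_intros)
 note lip = C1_lipschitz_on_balls[OF f' G]
 obtain R0 where R0: "\<forall>x\<in>cell. norm x \<le> R0" using compact_imp_bounded[OF compact_cell] unfolding bounded_iff by blast
 define R where "R = R0 + norm e"
 obtain L0 where L0: "\<forall>x\<in>cball 0 R. \<forall>y\<in>cball 0 R. \<bar>f x - f y\<bar> \<le> L0 * dist x y" using lip by blast
 define L where "L = \<bar>L0\<bar> * norm e"
 have L: "\<bar>f (x + h k *\<^sub>R e) - f x\<bar> \<le> L * h k" if "x \<in> cell" for x k
 proof -
  have xR: "norm x \<le> R0" using R0 that by blast
  have "norm (x + h k *\<^sub>R e) \<le> norm x + h k * norm e" using h[of k] norm_triangle_ineq[of x "h k *\<^sub>R e"] by simp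
  also have "\<dots> \<le> R" unfolding R_def using xR h[of k] by (intro add_mono mult_left_le_one_le) auto
  finally have "x + h k *\<^sub>R e \<in> cball 0 R" by simp
  moreover have "x \<in> cball 0 R" using xR by (simp add: R_def add_increasing2)
  ultimately have "\<bar>f (x + h k *\<^sub>R e) - f x\<bar> \<le> L0 * dist (x + h k *\<^sub>R e) x" using L0 by blast
  also have "\<dots> \<le> \<bar>L0\<bar> * (h k * norm e)" using h[of k] by (auto simp: dist_norm intro!: mult_right_mono)
  finally show ?thesis by (simp add: L_def algebra_simps)
 qed
 have L0: "0 \<le> L" by (simp add: L_def)
 define A where "A k = (LINT x|lborel. indicator cell x * ((f (x + h k *\<^sub>R e) - f x) / h k))" for k
 have bcm [measurable]: "(%x. bc u x) \<in> borel_measurable borel" if "u \<in> C" for u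
 proof -
  have "(%x. bc u 0 + gr u \<bullet> x) \<in> borel_measurable borel" by measurable
  then show ?thesis by (simp only: bc_eq[OF that, symmetric])
 qed
 have Lb: "{x \<in> cell. bc u x < s} \<in> sets borel" "{x \<in> cell. s \<le> bc u x} \<in> sets borel"
   "bounded {x \<in> cell. bc u x < s}" "bounded {x \<in> cell. s \<le> bc u x}" if "u \<in> C" for u s
 proof -
  note [measurable] = bcm[OF that]
  have "cell \<inter> {x. bc u x < s} \<in> sets borel" "cell \<inter> {x. s \<le> bc u x} \<in> sets borel" by measurable
  then show "{x \<in> cell. bc u x < s} \<in> sets borel" "{x \<in> cell. s \<le> bc u x} \<in> sets borel"
   by (simp_all add: Collect_conj_eq)
  show "bounded {x \<in> cell. bc u x < s}" "bounded {x \<in> cell. s \<le> bc u x}"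
   by (rule bounded_subset[OF compact_imp_bounded[OF compact_cell]], blast)+
 qed
 have ii: "integrable lborel (%x. indicator {x \<in> cell. bc u x < s} x * g x)"
   "integrable lborel (%x. indicator {x \<in> cell. s \<le> bc u x} x * g x)"
  if "u \<in> C" "continuous_on UNIV g" for u s and g :: "'a \<Rightarrow> real"
  using Lb[OF that(1)] that(2) by (auto intro!: integrable_indicator_continuous)
 note ic = integrable_indicator_continuous[OF cell_borel compact_imp_bounded[OF compact_cell]]
 have A1: "A ----> (LINT x|lborel. indicator cell x * (G x \<bullet> e))"
  unfolding A_def
 proof (rule integral_dominated_convergence[where w = "%x. indicator cell x * L"])
  show "integrable lborel (%x. indicator cell x * L)" by (rule ic) auto
  have [measurable]: "G \<in> borel_measurable borel" by (rule borel_measurable_continuous_onI) (rule G)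
  show "(%x. indicator cell x * (G x \<bullet> e)) \<in> borel_measurable lborel" by measurable
  show "AE x in lborel. (%k. indicator cell x * ((f (x + h k *\<^sub>R e) - f x) / h k)) ----> indicator cell x * (G x \<bullet> e)"
  proof (intro AE_I2 tendsto_mult tendsto_const)
   fix x
   have "((%s. f (x + s *\<^sub>R e)) has_derivative (%s. G (x + 0 *\<^sub>R e) \<bullet> (s *\<^sub>R e))) (at 0)"
    by (rule has_derivative_compose[OF _ f', where f="%s. x + s *\<^sub>R e"]) (auto intro!: derivative_eq_intros)
   then have "((%s. f (x + s *\<^sub>R e)) has_real_derivative (G x \<bullet> e)) (at 0)"
    by (rule has_derivative_imp_has_field_derivative) simp
   then have "((%s. (f (x + s *\<^sub>R e) - f x) / s) \<longlongrightarrow> G x \<bullet> e) (at 0)"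
    by (simp add: DERIV_def)
   moreover have "filterlim h (at 0) sequentially"
    unfolding filterlim_at using h(1) h0 by (auto intro!: always_eventually simp: less_imp_neq[symmetric])
   ultimately show "(%k. (f (x + h k *\<^sub>R e) - f x) / h k) ----> G x \<bullet> e"
    by (rule filterlim_compose)
  qed
  show "AE x in lborel. norm (indicator cell x * ((f (x + h k *\<^sub>R e) - f x) / h k)) \<le> indicator cell x * L" for k
   using L[of _ k] h(1)[of k] by (intro AE_I2) (auto simp: indicator_def abs_divide divide_le_eq)
 qed measurable
 \<comment> \<open>Error of replacing the shifted function by \<open>f\<close> on the layer at
   \<open>v\<close>: a difference of order \<open>h k\<close> on a set of volume of order
   \<open>h k\<close>, divided by \<open>h k\<close>.\<close>
 define E where "E k = (LINT x|lborel. indicator {x \<in> cell. bc v x < h k} x * (f (x + h k *\<^sub>R e) - f x)) / h k" for k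
 define V where "V k = (LINT x|lborel. indicator {x \<in> cell. bc v x < h k} x * 1) / h k" for k
 have "V ----> (LINT x|fmeas (facet v). 1) / norm (gr v)"
  unfolding V_def by (rule layer_limit[OF v _ _ h(1) h0]) (auto intro!: exI[of _ 0])
 then have "(%k. L * h k * V k) ----> L * 0 * ((LINT x|fmeas (facet v). 1) / norm (gr v))"
  by (intro tendsto_intros h0)
 then have LV: "(%k. L * h k * V k) ----> 0" by simp
 have "norm (E k) \<le> L * h k * V k" for k
 proof -
  have "\<bar>E k\<bar> * h k = \<bar>LINT x|lborel. indicator {x \<in> cell. bc v x < h k} x * (f (x + h k *\<^sub>R e) - f x)\<bar>"
   using h(1)[of k] by (simp add: E_def abs_divide)
  also have "\<dots> \<le> (LINT x|lborel. \<bar>indicator {x \<in> cell. bc v x < h k} x * (f (x + h k *\<^sub>R e) - f x)\<bar>)"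
   by (rule integral_abs_bound)
  also have "\<dots> \<le> (LINT x|lborel. L * h k * (indicator {x \<in> cell. bc v x < h k} x * 1))"
  proof (rule integral_mono)
   show "integrable lborel (%x. \<bar>indicator {x \<in> cell. bc v x < h k} x * (f (x + h k *\<^sub>R e) - f x)\<bar>)"
    by (intro integrable_abs ii(1) v continuous_intros fs f)
   show "integrable lborel (%x. L * h k * (indicator {x \<in> cell. bc v x < h k} x * 1))"
    by (intro integrable_mult_right ii(1) v continuous_intros)
   show "\<bar>indicator {x \<in> cell. bc v x < h k} x * (f (x + h k *\<^sub>R e) - f x)\<bar> \<le> L * h k * (indicator {x \<in> cell. bc v x < h k} x * 1)" for x
    using L[of x k] by (auto simp: indicator_def)
  qed
  also have "\<dots> = L * h k * (V k * h k)" using h(1)[of k] by (simp add: V_def)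
  finally have "\<bar>E k\<bar> * h k \<le> (L * h k * V k) * h k" by (simp add: algebra_simps)
  then show ?thesis using h(1)[of k] by (simp add: mult_le_cancel_right)
 qed
 then have E0: "E ----> 0" by (intro Lim_null_comparison[OF _ LV]) auto
 define F where "F u k = (LINT x|lborel. indicator {x \<in> cell. bc u x < h k} x * f x) / h k" for u k
 have F: "F u ----> (LINT x|fmeas (facet u). f x) / norm (gr u)" if "u \<in> C" for u
  unfolding F_def by (rule layer_limit[OF that f lip h(1) h0])
 have split: "(LINT x|lborel. indicator cell x * g x) = (LINT x|lborel. indicator {x \<in> cell. bc u x < s} x * g x)
   + (LINT x|lborel. indicator {x \<in> cell. s \<le> bc u x} x * g x)" if "u \<in> C" "continuous_on UNIV g" for u s and g :: "'a \<Rightarrow> real"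
  by (subst integral_add[symmetric], rule ii(1)[OF that], rule ii(2)[OF that])
   (auto intro!: integral_cong simp: indicator_def)
 have A2: "A k = E k + F v k - F w k" for k
 proof -
  let ?I = "%S g. LINT x|lborel. indicator S x * g x"
  have fsf: "continuous_on UNIV (%x. f (x + h k *\<^sub>R e) - f x)" by (intro continuous_intros fs f)
  have "A k * h k = ?I cell (%x. f (x + h k *\<^sub>R e) - f x)"
   unfolding A_def integral_mult_left_zero[symmetric] using h(1)[of k] by simp
  also have "\<dots> = ?I cell (%x. f (x + h k *\<^sub>R e)) - ?I cell f"
   by (subst integral_diff[symmetric], rule ic[OF fs], rule ic[OF f]) (simp add: right_diff_distrib)
  also have "?I cell (%x. f (x + h k *\<^sub>R e)) = ?I {x \<in> cell. bc v x < h k} (%x. f (x + h k *\<^sub>R e)) + ?I {x \<in> cell. h k \<le> bc v x} (%x. f (x + h k *\<^sub>R e))"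
   by (rule split[OF v fs])
  also have "?I {x \<in> cell. bc v x < h k} (%x. f (x + h k *\<^sub>R e)) = ?I {x \<in> cell. bc v x < h k} (%x. f (x + h k *\<^sub>R e) - f x) + ?I {x \<in> cell. bc v x < h k} f"
   by (subst integral_add[symmetric], rule ii(1)[OF v fsf], rule ii(1)[OF v f]) (simp add: algebra_simps)
  \<comment> \<open>Translation by \<open>h k\<close> along the edge moves the weight
    \<open>h k\<close> from \<open>bc v\<close> to \<open>bc w\<close> and keeps all other
    coordinates, so it maps the first set onto the second.\<close>
  also have "?I {x \<in> cell. h k \<le> bc v x} (%x. f (x + h k *\<^sub>R e)) = ?I {x \<in> cell. h k \<le> bc w x} f"
  proof -
   have "x + h k *\<^sub>R e \<in> {x \<in> cell. h k \<le> bc w x} \<longleftrightarrow> x \<in> {x \<in> cell. h k \<le> bc v x}" for x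
   proof -
    have *: "bc u (x + h k *\<^sub>R e) = bc u x + (if u = w then h k else if u = v then - h k else 0)" if "u \<in> C" for u
     unfolding e_def by (rule bc_edge[OF v w vw that])
    have "x + h k *\<^sub>R e \<in> {x \<in> cell. h k \<le> bc w x} \<longleftrightarrow> (\<forall>u\<in>C. 0 \<le> bc u x + (if u = w then h k else if u = v then - h k else 0)) \<and> 0 \<le> bc w x"
     using * w by (simp add: convex_hull_eq)
    also have "\<dots> \<longleftrightarrow> (\<forall>u\<in>C. 0 \<le> bc u x) \<and> h k \<le> bc v x"
    proof (intro iffI conjI ballI)
     fix u assume a: "(\<forall>u\<in>C. 0 \<le> bc u x + (if u = w then h k else if u = v then - h k else 0)) \<and> 0 \<le> bc w x" and u: "u \<in> C"
     from a u have "0 \<le> bc u x + (if u = w then h k else if u = v then - h k else 0)" by blast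
     then show "0 \<le> bc u x" using a h(1)[of k] by (auto split: if_splits)
    next
     assume a: "(\<forall>u\<in>C. 0 \<le> bc u x + (if u = w then h k else if u = v then - h k else 0)) \<and> 0 \<le> bc w x"
     then show "h k \<le> bc v x" using v vw by force
    next
     fix u assume a: "(\<forall>u\<in>C. 0 \<le> bc u x) \<and> h k \<le> bc v x" and u: "u \<in> C"
     then have "0 \<le> bc u x" by blast
     then show "0 \<le> bc u x + (if u = w then h k else if u = v then - h k else 0)" using a h(1)[of k] by auto
    next
     assume "(\<forall>u\<in>C. 0 \<le> bc u x) \<and> h k \<le> bc v x"
     then show "0 \<le> bc w x" using w by blast
    qed
    finally show ?thesis by (simp add: convex_hull_eq)
   qed
   then have "(%x. indicator {x \<in> cell. h k \<le> bc v x} x * f (x + h k *\<^sub>R e))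
    = (%x. indicator {x \<in> cell. h k \<le> bc w x} (x + h k *\<^sub>R e) * f (x + h k *\<^sub>R e))"
    by (auto simp: indicator_def fun_eq_iff)
   then show ?thesis
    using integral_lborel_translate[of "%x. indicator {x \<in> cell. h k \<le> bc w x} x * f x" "h k *\<^sub>R e"] Lb(2)[OF w, of "h k"] by simp
  qed
  also have "?I cell f = ?I {x \<in> cell. bc w x < h k} f + ?I {x \<in> cell. h k \<le> bc w x} f" by (rule split[OF w f])
  finally have "A k * h k = ?I {x \<in> cell. bc v x < h k} (%x. f (x + h k *\<^sub>R e) - f x) + ?I {x \<in> cell. bc v x < h k} f - ?I {x \<in> cell. bc w x < h k} f"
   by simp
  then have "A k = (?I {x \<in> cell. bc v x < h k} (%x. f (x + h k *\<^sub>R e) - f x) + ?I {x \<in> cell. bc v x < h k} f - ?I {x \<in> cell. bc w x < h k} f) / h k"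
   using h(1)[of k] by (simp add: eq_divide_eq)
  then show ?thesis by (simp add: E_def F_def add_divide_distrib diff_divide_distrib)
 qed
 have "A ----> 0 + (LINT x|fmeas (facet v). f x) / norm (gr v) - (LINT x|fmeas (facet w). f x) / norm (gr w)"
  unfolding A2 by (intro tendsto_intros E0 F v w)
 with A1 show ?thesis unfolding e_def using LIMSEQ_unique by fastforce
qed

text \<open>\<open>e\<close> is expanded in edges from a base vertex \<open>w0\<close>. The copies
  of \<open>I w0\<close> contributed by the edge identities cancel because the coefficients
  \<open>gr u \<bullet> e\<close> sum to 0, and these coefficients contain the normals.\<close>

lemma gauss_direction:
 fixes f :: "'a \<Rightarrow> real"
 assumes f': "\<And>x. (f has_derivative (%y. G x \<bullet> y)) (at x)" and G: "continuous_on UNIV G"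
 shows "(LINT x|lborel. indicator cell x * (G x \<bullet> e)) = - (\<Sum>v\<in>C. (nrm v \<bullet> e) * (LINT x|fmeas (facet v). f x))"
proof -
 obtain w0 where w0: "w0 \<in> C" using card2 by (metis card.empty ex_in_conv not_numeral_le_zero)
 define I where "I u = (LINT x|fmeas (facet u). f x) / norm (gr u)" for u
 have Ge: "continuous_on UNIV (%x. G x \<bullet> d)" for d by (intro continuous_intros G)
 have edge: "(LINT x|lborel. indicator cell x * (G x \<bullet> (u - w0))) = I w0 - I u" if "u \<in> C" for u
  using gauss_edge[OF w0 that _ f' G] by (cases "u = w0") (auto simp: I_def)
 have "G x \<bullet> e = (\<Sum>u\<in>C. (gr u \<bullet> e) * (G x \<bullet> (u - w0)))" for x
  by (subst (1) gr_rep[of e w0, symmetric]) (simp only: inner_sum_right inner_scaleR_right)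
 then have "(LINT x|lborel. indicator cell x * (G x \<bullet> e)) = (LINT x|lborel. (\<Sum>u\<in>C. (gr u \<bullet> e) * (indicator cell x * (G x \<bullet> (u - w0)))))"
  by (simp add: sum_distrib_left mult.left_commute)
 also have "\<dots> = (\<Sum>u\<in>C. (gr u \<bullet> e) * (I w0 - I u))"
  by (subst integral_sum)
   (auto intro!: integrable_mult_right integrable_indicator_continuous[OF cell_borel compact_imp_bounded[OF compact_cell]] Ge simp: edge simp del: inner_diff_right)
 also have "\<dots> = (\<Sum>u\<in>C. gr u \<bullet> e) * I w0 - (\<Sum>u\<in>C. (gr u \<bullet> e) * I u)"
  by (simp add: right_diff_distrib sum_subtractf sum_distrib_right)
 also have "\<dots> = - (\<Sum>u\<in>C. (gr u \<bullet> e) * I u)" by (simp add: gr_sum)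
 also have "\<dots> = - (\<Sum>v\<in>C. (nrm v \<bullet> e) * (LINT x|fmeas (facet v). f x))"
  by (simp add: I_def nrm_def divide_inverse algebra_simps)
 finally show ?thesis .
qed

end

section \<open>Sobolev spaces on a bounded domain\<close>

text \<open>By translation invariance every difference quotient has integral 0; compact support
  supplies the majorant for the passage to the limit.\<close>

lemma integral_grad_compact_support:
 fixes f :: "'a::euclidean_space \<Rightarrow> real"
 assumes f': "\<And>x. (f has_derivative (%y. G x \<bullet> y)) (at x)" and G: "continuous_on UNIV G"
  and T: "compact T" "\<And>x. x \<notin> T ==> f x = 0" "\<And>x. x \<notin> T ==> G x = 0"
 shows "(LINT x|lborel. G x \<bullet> e) = 0"
proof -
 define h where "h k = inverse (real (Suc k))" for k
 have h: "0 < h k" "h k \<le> 1" for k by (auto simp: h_def inverse_le_1_iff)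
 have h0: "h ----> 0" unfolding h_def by (rule LIMSEQ_inverse_real_of_nat)
 have f: "continuous_on UNIV f"
  using f' by (intro continuous_at_imp_continuous_on ballI) (blast intro: has_derivative_continuous)
 have fm [measurable]: "f \<in> borel_measurable borel" by (rule borel_measurable_continuous_onI) (rule f)
 have Gm [measurable]: "G \<in> borel_measurable borel" by (rule borel_measurable_continuous_onI) (rule G)
 obtain R0 where R0: "\<forall>x\<in>T. norm x \<le> R0" using compact_imp_bounded[OF T(1)] unfolding bounded_iff by blast
 \<comment> \<open>Shifts have length at most \<open>norm e\<close>: the quotients vanish outside
   radius \<open>R0 + norm e\<close>, and the shifted points of that ball have norm at most
   \<open>R\<close>.\<close>
 define R where "R = R0 + 2 * norm e"
 obtain L0 where L0: "\<forall>x\<in>cball 0 R. \<forall>y\<in>cball 0 R. \<bar>f x - f y\<bar> \<le> L0 * dist x y"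
  using C1_lipschitz_on_balls[OF f' G] by blast
 have z: "f (x + h k *\<^sub>R e) - f x = 0" if "\<not> norm x \<le> R0 + norm e" for x k
 proof -
  have "norm x \<le> norm (x + h k *\<^sub>R e) + norm (h k *\<^sub>R e)"
   using norm_triangle_ineq4[of "x + h k *\<^sub>R e" "h k *\<^sub>R e"] by simp
  also have "norm (h k *\<^sub>R e) \<le> norm e" using h[of k] by (auto intro: mult_left_le_one_le)
  finally have "\<not> norm (x + h k *\<^sub>R e) \<le> R0" using that by linarith
  moreover have "\<not> norm x \<le> R0" using that norm_ge_zero[of e] by linarith
  ultimately have "x + h k *\<^sub>R e \<notin> T" "x \<notin> T" using R0 by blast+
  then show ?thesis using T(2) by simp
 qed
 have b: "\<bar>(f (x + h k *\<^sub>R e) - f x) / h k\<bar> \<le> indicator (cball 0 (R0 + norm e)) x * (\<bar>L0\<bar> * norm e)" for x k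
 proof (cases "norm x \<le> R0 + norm e")
  case True
  have "norm (x + h k *\<^sub>R e) \<le> norm x + h k * norm e" using h[of k] norm_triangle_ineq[of x "h k *\<^sub>R e"] by simp
  also have "h k * norm e \<le> norm e" using h[of k] by (intro mult_left_le_one_le) auto
  finally have "norm (x + h k *\<^sub>R e) \<le> R" using True unfolding R_def by linarith
  moreover have "norm x \<le> R" using True norm_ge_zero[of e] unfolding R_def by linarith
  ultimately have "x + h k *\<^sub>R e \<in> cball 0 R" "x \<in> cball 0 R" by auto
  then have "\<bar>f (x + h k *\<^sub>R e) - f x\<bar> \<le> L0 * dist (x + h k *\<^sub>R e) x" using L0 by blast
  also have "\<dots> \<le> \<bar>L0\<bar> * (h k * norm e)" using h[of k] by (auto simp: dist_norm intro!: mult_right_mono)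
  finally show ?thesis using h(1)[of k] True by (simp add: abs_divide divide_le_eq mult.commute mult.left_commute)
 next
  case False
  then show ?thesis using z[OF False, of k] by simp
 qed
 have intf: "integrable lborel f"
 proof -
  have "integrable lborel (%x. indicator T x * f x)"
   using T(1) by (intro integrable_indicator_continuous f compact_imp_bounded borel_compact)
  also have "(%x. indicator T x * f x) = f" using T(2) by (auto simp: indicator_def fun_eq_iff)
  finally show ?thesis .
 qed
 have "(%k. LINT x|lborel. (f (x + h k *\<^sub>R e) - f x) / h k) ----> (LINT x|lborel. G x \<bullet> e)"
 proof (rule integral_dominated_convergence[where w = "%x. indicator (cball 0 (R0 + norm e)) x * (\<bar>L0\<bar> * norm e)"])
  show "integrable lborel (%x. indicator (cball 0 (R0 + norm e)) x * (\<bar>L0\<bar> * norm e))"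
   by (rule integrable_indicator_continuous) auto
  show "(%x. G x \<bullet> e) \<in> borel_measurable lborel" by measurable
  show "AE x in lborel. (%k. (f (x + h k *\<^sub>R e) - f x) / h k) ----> G x \<bullet> e"
  proof (intro AE_I2)
   fix x
   have "((%s. f (x + s *\<^sub>R e)) has_derivative (%s. G (x + 0 *\<^sub>R e) \<bullet> (s *\<^sub>R e))) (at 0)"
    by (rule has_derivative_compose[OF _ f', where f="%s. x + s *\<^sub>R e"]) (auto intro!: derivative_eq_intros)
   then have "((%s. f (x + s *\<^sub>R e)) has_real_derivative (G x \<bullet> e)) (at 0)"
    by (rule has_derivative_imp_has_field_derivative) simp
   then have "((%s. (f (x + s *\<^sub>R e) - f x) / s) \<longlongrightarrow> G x \<bullet> e) (at 0)"
    by (simp add: DERIV_def)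
   moreover have "filterlim h (at 0) sequentially"
    unfolding filterlim_at using h(1) h0 by (auto intro!: always_eventually simp: less_imp_neq[symmetric])
   ultimately show "(%k. (f (x + h k *\<^sub>R e) - f x) / h k) ----> G x \<bullet> e"
    by (rule filterlim_compose)
  qed
  show "AE x in lborel. norm ((f (x + h k *\<^sub>R e) - f x) / h k) \<le> indicator (cball 0 (R0 + norm e)) x * (\<bar>L0\<bar> * norm e)" for k
   using b by (intro AE_I2) simp
 qed measurable
 moreover have "(%k. LINT x|lborel. (f (x + h k *\<^sub>R e) - f x) / h k) = (%k. 0)"
 proof (rule ext)
  fix k
  show "(LINT x|lborel. (f (x + h k *\<^sub>R e) - f x) / h k) = 0"
   using integral_lborel_translate[OF fm, of "h k *\<^sub>R e"] integrable_lborel_translate[OF fm intf, of "h k *\<^sub>R e"] intf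
   by simp
 qed
 ultimately show ?thesis by (simp only: LIMSEQ_const_iff)
qed

lemma integral_lebesgue_on_eq_lborel:
 fixes f :: "'a::euclidean_space \<Rightarrow> real"
 assumes [measurable]: "f \<in> borel_measurable borel" and S [measurable]: "S \<in> sets borel"
 shows "(LINT x|leb S. f x) = (LINT x|lborel. indicator S x * f x)"
proof -
 have "(LINT x|leb S. f x) = (LINT x|lebesgue. indicator S x * f x)"
  using S by (subst integral_restrict_space) auto
 also have "\<dots> = (LINT x|lborel. indicator S x * f x)"
  by (intro integral_completion) measurable
 finally show ?thesis .
qed

text \<open>The gradient is an explicit argument, so products and components carry theirs along.
  Functions given on a cell only will enter through polynomial extensions to the whole
  space.\<close>

definition C1_grad :: "('a::euclidean_space \<Rightarrow> real) \<Rightarrow> ('a \<Rightarrow> 'a) \<Rightarrow> bool" where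
 "C1_grad f G \<longleftrightarrow> (\<forall>x. (f has_derivative (%y. G x \<bullet> y)) (at x)) \<and> continuous_on UNIV G"

lemma C1_grad_deriv: "C1_grad f G ==> (f has_derivative (%y. G x \<bullet> y)) (at x)"
 and C1_grad_cont: "C1_grad f G ==> continuous_on UNIV G"
 by (auto simp: C1_grad_def)

lemma C1_grad_cont_fun: "C1_grad f G ==> continuous_on UNIV f"
 by (intro continuous_at_imp_continuous_on ballI) (blast intro: has_derivative_continuous C1_grad_deriv)

lemma C1_grad_mult:
 assumes "C1_grad f F" "C1_grad g G" shows "C1_grad (%x. f x * g x) (%x. f x *\<^sub>R G x + g x *\<^sub>R F x)"
 unfolding C1_grad_def
proof (intro conjI allI)
 show "((%x. f x * g x) has_derivative (%y. (f x *\<^sub>R G x + g x *\<^sub>R F x) \<bullet> y)) (at x)" for x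
  using has_derivative_mult[OF C1_grad_deriv[OF assms(1), of x] C1_grad_deriv[OF assms(2), of x]]
  by (simp add: inner_add_left algebra_simps)
 show "continuous_on UNIV (%x. f x *\<^sub>R G x + g x *\<^sub>R F x)"
  using assms by (intro continuous_intros C1_grad_cont C1_grad_cont_fun)
qed

lemma test_fun_C1_grad: "\<phi> \<in> test_fun S ==> C1_grad \<phi> (grad \<phi>)"
 by (simp add: C1_grad_def test_fun_has_derivative test_fun_grad_continuous)

lemma C1_grad_L2:
 assumes "C1_grad f G" and S: "S \<in> sets lebesgue" "bounded S"
 shows "f \<in> L2 S" "G \<in> L2 S"
proof -
 obtain R where R: "\<forall>x\<in>S. norm x \<le> R" using S(2) unfolding bounded_iff by blast
 have *: "g \<in> L2 S" if g: "continuous_on UNIV g" for g :: "'a \<Rightarrow> 'b::euclidean_space"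
 proof -
  have "bounded (g ` cball 0 R)"
   by (intro compact_imp_bounded compact_continuous_image continuous_on_subset[OF g]) auto
  then obtain M where M: "\<forall>y\<in>g ` cball 0 R. norm y \<le> M" unfolding bounded_iff by blast
  show ?thesis
  proof (rule L2_bounded[of _ _ M])
   show "S \<in> lmeasurable" using S by (simp add: bounded_set_imp_lmeasurable)
   show "g \<in> borel_measurable (leb S)"
    by (intro continuous_imp_measurable_on_sets_lebesgue continuous_on_subset[OF g] S) auto
   show "norm (g x) \<le> M" if "x \<in> S" for x using M R that by auto
  qed
 qed
 show "f \<in> L2 S" "G \<in> L2 S" using *[OF C1_grad_cont_fun[OF assms(1)]] *[OF C1_grad_cont[OF assms(1)]] by auto
qed

lemma integral_euclidean_eqI:
 fixes f :: "'b \<Rightarrow> 'a::euclidean_space"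
 assumes "integrable M f" "\<And>e. e \<in> Basis ==> (LINT x|M. f x \<bullet> e) = 0"
 shows "(LINT x|M. f x) = 0"
 by (rule euclidean_eqI) (use assms in \<open>simp flip: integral_inner_left\<close>)

text \<open>The product of \<open>v\<close> with a test function has compact support in
  \<open>S\<close>, so its gradient integrates to 0.\<close>

lemma C1_has_wgrad:
 assumes v: "C1_grad v G" and S: "open S" "bounded S" shows "has_wgrad S v G"
 unfolding has_wgrad_def
proof (intro conjI ballI)
 have Sl: "S \<in> sets lebesgue" using S by simp
 show "G \<in> L2 S" by (rule C1_grad_L2(2)[OF v Sl S(2)])
 fix \<phi> assume \<phi>: "\<phi> \<in> test_fun S"
 obtain T where T: "compact T" "T \<subseteq> S" "\<And>x. x \<notin> T ==> \<phi> x = 0" "\<And>x. x \<notin> T ==> grad \<phi> x = 0"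
  using test_funE[OF \<phi>] by blast
 define H where "H x = v x *\<^sub>R grad \<phi> x + \<phi> x *\<^sub>R G x" for x
 have H: "C1_grad (%x. v x * \<phi> x) H"
  unfolding H_def by (rule C1_grad_mult[OF v test_fun_C1_grad[OF \<phi>]])
 have cont: "continuous_on UNIV (%x. v x *\<^sub>R grad \<phi> x)" "continuous_on UNIV (%x. \<phi> x *\<^sub>R G x)"
  by (intro continuous_intros C1_grad_cont_fun[OF v] test_fun_grad_continuous[OF \<phi>] test_fun_continuous[OF \<phi>] C1_grad_cont[OF v])+
 have int: "integrable (leb S) (%x. v x *\<^sub>R grad \<phi> x)" "integrable (leb S) (%x. \<phi> x *\<^sub>R G x)"
 proof -
  have *: "integrable (leb S) g" if g: "continuous_on UNIV g" for g :: "'a \<Rightarrow> 'a"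
  proof -
   have gm [measurable]: "g \<in> borel_measurable borel" by (rule borel_measurable_continuous_onI) (rule g)
   have "integrable lborel (%x. indicator (closure S) x *\<^sub>R g x)"
    using S(2) by (intro borel_integrable_compact continuous_on_subset[OF g]) auto
   then have "integrable lebesgue (%x. indicator (closure S) x *\<^sub>R g x)"
    by (subst integrable_completion) auto
   then have "integrable (leb (closure S)) g"
    by (subst integrable_restrict_space) auto
   then show ?thesis by (rule lebesgue_on_integrable_subset[OF _ closure_subset Sl]) auto
  qed
  show "integrable (leb S) (%x. v x *\<^sub>R grad \<phi> x)" "integrable (leb S) (%x. \<phi> x *\<^sub>R G x)"
   using *[OF cont(1)] *[OF cont(2)] .
 qed
 have "(LINT x|leb S. H x) = 0"
 proof (rule integral_euclidean_eqI)
  show "integrable (leb S) H" unfolding H_def using int by (rule integrable_add)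
  fix e :: 'a
  have Hm: "H \<in> borel_measurable borel" by (rule borel_measurable_continuous_onI) (rule C1_grad_cont[OF H])
  have "(LINT x|leb S. H x \<bullet> e) = (LINT x|lborel. indicator S x * (H x \<bullet> e))"
   using Hm S by (intro integral_lebesgue_on_eq_lborel) auto
  also have "\<dots> = (LINT x|lborel. H x \<bullet> e)"
  proof (intro integral_cong refl)
   fix x
   have "H x = 0" if "x \<notin> S"
   proof -
    have "x \<notin> T" using that T(2) by blast
    then show ?thesis using T(3,4) by (simp add: H_def)
   qed
   then show "indicator S x * (H x \<bullet> e) = H x \<bullet> e" by (auto simp: indicator_def)
  qed
  also have "\<dots> = 0"
   by (rule integral_grad_compact_support[OF C1_grad_deriv[OF H] C1_grad_cont[OF H] T(1)]) (auto simp: H_def T)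
  finally show "(LINT x|leb S. H x \<bullet> e) = 0" .
 qed
 then show "(LINT x|leb S. v x *\<^sub>R grad \<phi> x) = - (LINT x|leb S. \<phi> x *\<^sub>R G x)"
  unfolding H_def using int by (simp add: eq_neg_iff_add_eq_0)
qed

lemma L2_scaleR_integrable:
 assumes "v \<in> L2 S" "w \<in> L2 S" shows "integrable (leb S) (%x. v x *\<^sub>R w x :: 'b::euclidean_space)"
proof (rule integrable_bound)
 show "integrable (leb S) (%x. (norm (v x))\<^sup>2 + (norm (w x))\<^sup>2)"
  using assms by (intro integrable_add L2_square_integrable)
 show "(%x. v x *\<^sub>R w x) \<in> borel_measurable (leb S)"
  by (intro borel_measurable_scaleR L2_measurable assms)
 show "AE x in leb S. norm (v x *\<^sub>R w x) \<le> norm ((norm (v x))\<^sup>2 + (norm (w x))\<^sup>2)"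
 proof (rule AE_I2)
  fix x
  have "\<bar>v x\<bar> * norm (w x) \<le> (\<bar>v x\<bar>)\<^sup>2 + (norm (w x))\<^sup>2"
   using sum_squares_bound[of "\<bar>v x\<bar>" "norm (w x)"] mult_nonneg_nonneg[OF abs_ge_zero norm_ge_zero, of "v x" "w x"]
   by linarith
  then show "norm (v x *\<^sub>R w x) \<le> norm ((norm (v x))\<^sup>2 + (norm (w x))\<^sup>2)" by simp
 qed
qed

section \<open>Weak gradients, H1 and H10 on a bounded open set\<close>

locale bounded_domain =
 fixes U :: "'a::euclidean_space set"
 assumes open_dom: "open U" and bounded_dom: "bounded U"
begin

lemma dom_lebesgue: "U \<in> sets lebesgue" using open_dom by simp
lemma dom_lmeasurable: "U \<in> lmeasurable" using open_dom bounded_dom by (simp add: lmeasurable_open)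

lemma test_fun_L2: "\<phi> \<in> test_fun S ==> \<phi> \<in> L2 U" "\<phi> \<in> test_fun S ==> grad \<phi> \<in> L2 U"
 using C1_grad_L2[OF test_fun_C1_grad dom_lebesgue bounded_dom] by auto

lemma L2_integrable: "v \<in> L2 U ==> integrable (leb U) v"
proof -
 assume v: "v \<in> L2 U"
 have "(%x. 1 :: real) \<in> L2 U" by (rule L2_bounded[OF dom_lmeasurable, of _ 1]) auto
 then show ?thesis using L2_scaleR_integrable[OF _ v, of "%x. 1"] by simp
qed

text \<open>\<open>wgrad\<close> is a choice, and this uniqueness is what allows it to be computed.
  Boundedness of the domain makes \<open>L2\<close> functions integrable, as the fundamental lemma
  demands.\<close>

lemma has_wgrad_unique:
 assumes g: "has_wgrad U v g" and g': "has_wgrad U v g'"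
 shows "AE x in leb U. g x = g' x"
proof -
 have L: "g \<in> L2 U" "g' \<in> L2 U" using g g' by (auto simp: has_wgrad_def)
 have "AE x in leb U. g x - g' x = 0"
 proof (rule fundamental_lemma[OF open_dom])
  show "integrable (leb U) (%x. g x - g' x)" by (intro L2_integrable L2_diff L)
  fix \<phi> assume \<phi>: "\<phi> \<in> test_fun U"
  have "(LINT x|leb U. \<phi> x *\<^sub>R g x) = (LINT x|leb U. \<phi> x *\<^sub>R g' x)"
   using g g' \<phi> unfolding has_wgrad_def by (metis neg_equal_iff_equal)
  then show "(LINT x|leb U. \<phi> x *\<^sub>R (g x - g' x)) = 0"
   using L2_scaleR_integrable[OF test_fun_L2(1)[OF \<phi>] L(1)] L2_scaleR_integrable[OF test_fun_L2(1)[OF \<phi>] L(2)]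
   by (simp add: scaleR_diff_right)
 qed
 then show ?thesis by simp
qed

lemma has_wgrad_wgrad: "has_wgrad U v g ==> has_wgrad U v (wgrad U v)"
 unfolding wgrad_def by (rule someI[of "has_wgrad U v" g])

lemma H1_has_wgrad: "v \<in> H1 U ==> has_wgrad U v (wgrad U v)"
 using has_wgrad_wgrad by (auto simp: H1_def)

lemma wgrad_AE: "has_wgrad U v g ==> AE x in leb U. wgrad U v x = g x"
 using has_wgrad_wgrad has_wgrad_unique by blast

lemma wgrad_L2: "v \<in> H1 U ==> wgrad U v \<in> L2 U"
 using H1_has_wgrad by (auto simp: has_wgrad_def)

lemma H1_L2: "v \<in> H1 U ==> v \<in> L2 U" by (simp add: H1_def)
lemma H10_H1: "v \<in> H10 U ==> v \<in> H1 U" by (simp add: H10_def)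
lemma H10_L2: "v \<in> H10 U ==> v \<in> L2 U" by (simp add: H10_H1 H1_L2)

lemma has_wgrad_axpy:
 assumes v: "v \<in> L2 U" "has_wgrad U v g" and w: "w \<in> L2 U" "has_wgrad U w g'"
 shows "has_wgrad U (%x. v x + c * w x) (%x. g x + c *\<^sub>R g' x)"
 unfolding has_wgrad_def
proof (intro conjI ballI)
 have L: "g \<in> L2 U" "g' \<in> L2 U" using v w by (auto simp: has_wgrad_def)
 then show "(%x. g x + c *\<^sub>R g' x) \<in> L2 U" by (rule L2_lincomb)
 fix \<phi> assume \<phi>: "\<phi> \<in> test_fun U"
 note i = L2_scaleR_integrable[OF v(1) test_fun_L2(2)[OF \<phi>]] L2_scaleR_integrable[OF w(1) test_fun_L2(2)[OF \<phi>]]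
 note i' = L2_scaleR_integrable[OF test_fun_L2(1)[OF \<phi>] L(1)] L2_scaleR_integrable[OF test_fun_L2(1)[OF \<phi>] L(2)]
 have "(LINT x|leb U. (v x + c * w x) *\<^sub>R grad \<phi> x) = (LINT x|leb U. v x *\<^sub>R grad \<phi> x + c *\<^sub>R (w x *\<^sub>R grad \<phi> x))"
  by (simp add: scaleR_add_left)
 also have "\<dots> = (LINT x|leb U. v x *\<^sub>R grad \<phi> x) + c *\<^sub>R (LINT x|leb U. w x *\<^sub>R grad \<phi> x)"
  using i by (simp del: scaleR_scaleR)
 also have "\<dots> = - ((LINT x|leb U. \<phi> x *\<^sub>R g x) + c *\<^sub>R (LINT x|leb U. \<phi> x *\<^sub>R g' x))"
  using v w \<phi> by (simp add: has_wgrad_def)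
 also have "\<dots> = - (LINT x|leb U. \<phi> x *\<^sub>R g x + c *\<^sub>R (\<phi> x *\<^sub>R g' x))"
  using i' by (simp del: scaleR_scaleR)
 finally show "(LINT x|leb U. (v x + c * w x) *\<^sub>R grad \<phi> x) = - (LINT x|leb U. \<phi> x *\<^sub>R (g x + c *\<^sub>R g' x))"
  by (simp add: scaleR_add_right mult.commute)
qed

lemma H1_axpy: "v \<in> H1 U ==> w \<in> H1 U ==> (%x. v x + c * w x) \<in> H1 U"
 using has_wgrad_axpy[of v _ w _ c] by (auto simp: H1_def L2_axpy)

lemma wgrad_axpy: "v \<in> H1 U ==> w \<in> H1 U ==>
  AE x in leb U. wgrad U (%x. v x + c * w x) x = wgrad U v x + c *\<^sub>R wgrad U w x"
 by (intro wgrad_AE has_wgrad_axpy H1_L2 H1_has_wgrad)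

lemma zero_has_wgrad: "has_wgrad U (%x. 0) (%x. 0)" by (simp add: has_wgrad_def L2_zero)

lemma zero_H1: "(%x. 0) \<in> H1 U" using zero_has_wgrad L2_zero by (auto simp: H1_def)

lemma has_wgrad_mult: "v \<in> L2 U ==> has_wgrad U v g ==> has_wgrad U (%x. c * v x) (%x. c *\<^sub>R g x)"
 using has_wgrad_axpy[OF L2_zero zero_has_wgrad, of v g c] by simp

lemma wgrad_mult: "v \<in> H1 U ==> AE x in leb U. wgrad U (%x. c * v x) x = c *\<^sub>R wgrad U v x"
 by (intro wgrad_AE has_wgrad_mult H1_L2 H1_has_wgrad)

lemma H1_mult: "v \<in> H1 U ==> (%x. c * v x) \<in> H1 U"
 using H1_axpy[OF zero_H1, of v c] by simp

lemma H1n_nonneg: "0 \<le> H1n U v" by (simp add: H1n_def)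

lemma L2n_le_H1n: "L2n U v \<le> H1n U v" "L2n U (wgrad U v) \<le> H1n U v"
 by (auto simp: H1n_def L2n_nonneg intro!: real_le_rsqrt)

lemma H1n_mult: "v \<in> H1 U ==> H1n U (%x. c * v x) = \<bar>c\<bar> * H1n U v"
proof -
 assume v: "v \<in> H1 U"
 have "L2n U (wgrad U (%x. c * v x)) = \<bar>c\<bar> * L2n U (wgrad U v)"
  using L2n_cong_AE[OF dom_lebesgue wgrad_mult[OF v, of c]] by (simp add: L2n_scaleR)
 then have "H1n U (%x. c * v x) = sqrt (c\<^sup>2 * ((L2n U v)\<^sup>2 + (L2n U (wgrad U v))\<^sup>2))"
  by (simp add: H1n_def L2n_mult power_mult_distrib distrib_left)
 then show ?thesis by (simp add: H1n_def real_sqrt_mult)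
qed

lemma H1n_triangle:
 assumes v: "v \<in> H1 U" and w: "w \<in> H1 U" shows "H1n U (%x. v x + w x) \<le> H1n U v + H1n U w"
proof -
 have "AE x in leb U. wgrad U (%x. v x + w x) x = wgrad U v x + wgrad U w x"
  using wgrad_axpy[OF v w, of 1] by simp
 then have "L2n U (wgrad U (%x. v x + w x)) = L2n U (%x. wgrad U v x + wgrad U w x)"
  by (rule L2n_cong_AE[OF dom_lebesgue])
 also have "\<dots> \<le> L2n U (wgrad U v) + L2n U (wgrad U w)"
  by (intro L2n_triangle wgrad_L2 v w)
 finally have "H1n U (%x. v x + w x) \<le> sqrt ((L2n U v + L2n U w)\<^sup>2 + (L2n U (wgrad U v) + L2n U (wgrad U w))\<^sup>2)"
  unfolding H1n_def using L2n_triangle[OF H1_L2[OF v] H1_L2[OF w]]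
  by (intro real_sqrt_le_mono add_mono power_mono) (auto simp: L2n_nonneg)
 also have "\<dots> \<le> H1n U v + H1n U w" unfolding H1n_def by (rule real_sqrt_sum_squares_triangle_ineq)
 finally show ?thesis .
qed

lemma test_fun_has_wgrad: "\<phi> \<in> test_fun S ==> has_wgrad U \<phi> (grad \<phi>)"
 by (intro C1_has_wgrad test_fun_C1_grad open_dom bounded_dom)

lemma test_fun_H1: "\<phi> \<in> test_fun S ==> \<phi> \<in> H1 U"
 using test_fun_has_wgrad test_fun_L2(1) by (auto simp: H1_def)

lemma H10_axpy:
 assumes v: "v \<in> H10 U" and w: "w \<in> H10 U" shows "(%x. v x + c * w x) \<in> H10 U"
proof -
 obtain \<phi> where \<phi>: "\<And>n. \<phi> n \<in> test_fun U" "(%n. H1n U (%x. \<phi> n x - v x)) ----> 0"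
  using v by (auto simp: H10_def)
 obtain \<psi> where \<psi>: "\<And>n. \<psi> n \<in> test_fun U" "(%n. H1n U (%x. \<psi> n x - w x)) ----> 0"
  using w by (auto simp: H10_def)
 have dv: "(%x. \<phi> n x - v x) \<in> H1 U" for n using H1_axpy[OF test_fun_H1[OF \<phi>(1)] H10_H1[OF v], of n "-1"] by simp
 have dw: "(%x. \<psi> n x - w x) \<in> H1 U" for n using H1_axpy[OF test_fun_H1[OF \<psi>(1)] H10_H1[OF w], of n "-1"] by simp
 have b: "H1n U (%x. (\<phi> n x + c * \<psi> n x) - (v x + c * w x)) \<le> H1n U (%x. \<phi> n x - v x) + \<bar>c\<bar> * H1n U (%x. \<psi> n x - w x)" for n
 proof -
  have "H1n U (%x. (\<phi> n x - v x) + c * (\<psi> n x - w x)) \<le> H1n U (%x. \<phi> n x - v x) + H1n U (%x. c * (\<psi> n x - w x))"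
   by (intro H1n_triangle H1_mult dv dw)
  also have "H1n U (%x. c * (\<psi> n x - w x)) = \<bar>c\<bar> * H1n U (%x. \<psi> n x - w x)"
   by (intro H1n_mult dw)
  finally show ?thesis by (simp add: algebra_simps)
 qed
 have "(%n. H1n U (%x. \<phi> n x - v x) + \<bar>c\<bar> * H1n U (%x. \<psi> n x - w x)) ----> 0 + \<bar>c\<bar> * 0"
  by (intro tendsto_intros \<phi>(2) \<psi>(2))
 then have lim: "(%n. H1n U (%x. \<phi> n x - v x) + \<bar>c\<bar> * H1n U (%x. \<psi> n x - w x)) ----> 0" by simp
 have "(%n. H1n U (%x. (\<phi> n x + c * \<psi> n x) - (v x + c * w x))) ----> 0"
  by (rule Lim_null_comparison[OF _ lim]) (use b in \<open>auto simp: H1n_nonneg intro!: always_eventually\<close>)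
 moreover have "(%x. \<phi> n x + c * \<psi> n x) \<in> test_fun U" for n by (intro test_fun_axpy \<phi>(1) \<psi>(1))
 ultimately show ?thesis
  using H1_axpy[OF H10_H1[OF v] H10_H1[OF w], of c]
  unfolding H10_def by (auto intro!: exI[of _ "%n x. \<phi> n x + c * \<psi> n x"])
qed

lemma zero_H10: "(%x. 0) \<in> H10 U"
proof -
 have "L2n U (wgrad U (%x. 0)) = 0"
  using L2n_cong_AE[OF dom_lebesgue wgrad_AE[OF zero_has_wgrad]] by (simp add: L2n_def)
 then have "H1n U (%x. 0 - 0) = 0" by (simp add: H1n_def) (simp add: L2n_def)
 then show ?thesis using zero_H1 unfolding H10_def
  by (auto intro!: exI[of _ "%n x. 0"] simp: test_fun_zero)
qed

lemma H10_mult: "v \<in> H10 U ==> (%x. c * v x) \<in> H10 U"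
 using H10_axpy[OF zero_H10, of v c] by simp

lemma H10_diff: "v \<in> H10 U ==> w \<in> H10 U ==> (%x. v x - w x) \<in> H10 U"
 using H10_axpy[of v w "-1"] by simp

lemma H10_sum: "(\<And>i. i \<in> A ==> v i \<in> H10 U) ==> (%x. \<Sum>i\<in>A. c i * v i x) \<in> H10 U"
proof (induction A rule: infinite_finite_induct)
 case (insert a A)
 have "(%x. (\<Sum>i\<in>A. c i * v i x) + c a * v a x) \<in> H10 U" by (rule H10_axpy) (use insert in auto)
 then show ?case using insert by (simp add: add.commute)
qed (auto simp: zero_H10)

lemma H1_sum: "(\<And>i. i \<in> A ==> v i \<in> H1 U) ==> (%x. \<Sum>i\<in>A. c i * v i x) \<in> H1 U"
proof (induction A rule: infinite_finite_induct)
 case (insert a A)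
 have "(%x. (\<Sum>i\<in>A. c i * v i x) + c a * v a x) \<in> H1 U" by (rule H1_axpy) (use insert in auto)
 then show ?case using insert by (simp add: add.commute)
qed (auto simp: zero_H1)

lemma wgrad_sum:
 "(\<And>i. i \<in> A ==> v i \<in> H1 U) ==>
  AE x in leb U. wgrad U (%x. \<Sum>i\<in>A. c i * v i x) x = (\<Sum>i\<in>A. c i *\<^sub>R wgrad U (v i) x)"
proof (induction A rule: infinite_finite_induct)
 case (insert a A)
 have "AE x in leb U. wgrad U (%x. (\<Sum>i\<in>A. c i * v i x) + c a * v a x) x
   = wgrad U (%x. \<Sum>i\<in>A. c i * v i x) x + c a *\<^sub>R wgrad U (v a) x"
  by (rule wgrad_axpy[OF H1_sum]) (use insert in auto)
 moreover have "AE x in leb U. wgrad U (%x. \<Sum>i\<in>A. c i * v i x) x = (\<Sum>i\<in>A. c i *\<^sub>R wgrad U (v i) x)"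
  using insert by simp
 ultimately show ?case
 proof eventually_elim
  case (elim x)
  have "(%x. \<Sum>i\<in>insert a A. c i * v i x) = (%x. (\<Sum>i\<in>A. c i * v i x) + c a * v a x)"
   using insert by (simp add: add.commute)
  then show ?case using elim insert by (simp add: add.commute)
 qed
qed (use wgrad_AE[OF zero_has_wgrad] in auto)

text \<open>An equality at all points although weak gradients are unique only almost everywhere: the
  predicates \<open>has_wgrad U v\<close> and \<open>has_wgrad U w\<close> coincide, so the choice
  operator returns the same function for both.\<close>

lemma wgrad_cong: "(\<And>x. x \<in> U ==> v x = w x) ==> wgrad U v = wgrad U w"
proof -
 assume eq: "\<And>x. x \<in> U ==> v x = w x"
 have "has_wgrad U v = has_wgrad U w"
 proof (rule ext)
  fix g
  have "(LINT x|leb U. v x *\<^sub>R grad \<phi> x) = (LINT x|leb U. w x *\<^sub>R grad \<phi> x)" for \<phi>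
   using eq by (intro integral_cong) auto
  then show "has_wgrad U v g = has_wgrad U w g" by (simp add: has_wgrad_def)
 qed
 then show ?thesis by (simp add: wgrad_def)
qed

text \<open>A test function of the smaller set is also one of the larger set, and it vanishes
  together with its gradient outside the smaller set.\<close>

lemma has_wgrad_subset:
 assumes v: "has_wgrad U v g" and T: "open T" "T \<subseteq> U" shows "has_wgrad T v g"
 unfolding has_wgrad_def
proof (intro conjI ballI)
 have Tl: "T \<in> sets lebesgue" using T by simp
 show "g \<in> L2 T" using v T Tl by (auto simp: has_wgrad_def intro: L2_subset dom_lebesgue)
 fix \<phi> assume \<phi>: "\<phi> \<in> test_fun T"
 obtain Q where Q: "Q \<subseteq> T" "\<And>x. x \<notin> Q ==> \<phi> x = 0" "\<And>x. x \<notin> Q ==> grad \<phi> x = 0"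
  using test_funE[OF \<phi>] by metis
 have r: "(LINT x|leb U. h x) = (LINT x|leb T. h x)" if "\<And>x. x \<notin> T ==> h x = 0" for h :: "'a \<Rightarrow> 'a"
 proof -
  have "(%x. h x) = (%x. if x \<in> T then h x else 0)" using that by auto
  then show ?thesis using integral_restrict[OF T(2) Tl dom_lebesgue, of h] by metis
 qed
 have "\<phi> \<in> test_fun U" using \<phi> test_fun_mono[OF T(2)] by blast
 then have "(LINT x|leb U. v x *\<^sub>R grad \<phi> x) = - (LINT x|leb U. \<phi> x *\<^sub>R g x)"
  using v by (simp add: has_wgrad_def)
 moreover have "(LINT x|leb U. v x *\<^sub>R grad \<phi> x) = (LINT x|leb T. v x *\<^sub>R grad \<phi> x)"
  by (rule r) (use Q in auto)
 moreover have "(LINT x|leb U. \<phi> x *\<^sub>R g x) = (LINT x|leb T. \<phi> x *\<^sub>R g x)"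
  by (rule r) (use Q in auto)
 ultimately show "(LINT x|leb T. v x *\<^sub>R grad \<phi> x) = - (LINT x|leb T. \<phi> x *\<^sub>R g x)" by simp
qed

end

section \<open>Traces on facets\<close>

lemma integral_Cauchy_Schwarz:
 fixes u v :: "'b \<Rightarrow> real"
 assumes "integrable M (%x. (u x)\<^sup>2)" "integrable M (%x. (v x)\<^sup>2)" "integrable M (%x. u x * v x)"
 shows "(LINT x|M. u x * v x)\<^sup>2 \<le> (LINT x|M. (u x)\<^sup>2) * (LINT x|M. (v x)\<^sup>2)"
proof (rule discriminant_nonneg)
 fix t
 have "0 \<le> (LINT x|M. (u x + t * v x)\<^sup>2)" by (rule integral_nonneg) simp
 also have "\<dots> = (LINT x|M. (u x)\<^sup>2 + 2 * t * (u x * v x) + t\<^sup>2 * (v x)\<^sup>2)"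
  by (intro integral_cong refl) (simp add: power2_eq_square algebra_simps)
 also have "\<dots> = (LINT x|M. (u x)\<^sup>2) + 2 * t * (LINT x|M. u x * v x) + t\<^sup>2 * (LINT x|M. (v x)\<^sup>2)"
  using assms by simp
 finally show "0 \<le> (LINT x|M. (u x)\<^sup>2) + 2 * t * (LINT x|M. u x * v x) + t\<^sup>2 * (LINT x|M. (v x)\<^sup>2)" .
qed simp

lemma square_integrable_mult:
 fixes u v :: "'b \<Rightarrow> real"
 assumes "u \<in> borel_measurable M" "v \<in> borel_measurable M" "integrable M (%x. (u x)\<^sup>2)" "integrable M (%x. (v x)\<^sup>2)"
 shows "integrable M (%x. u x * v x)"
proof (rule integrable_bound)
 show "integrable M (%x. (u x)\<^sup>2 + (v x)\<^sup>2)" using assms by simp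
 show "(%x. u x * v x) \<in> borel_measurable M" using assms by measurable
 show "AE x in M. norm (u x * v x) \<le> norm ((u x)\<^sup>2 + (v x)\<^sup>2)"
 proof (rule AE_I2)
  fix x
  have "2 * \<bar>u x * v x\<bar> \<le> (u x)\<^sup>2 + (v x)\<^sup>2" using sum_squares_bound[of "\<bar>u x\<bar>" "\<bar>v x\<bar>"] by (simp add: abs_mult)
  then show "norm (u x * v x) \<le> norm ((u x)\<^sup>2 + (v x)\<^sup>2)" by simp
 qed
qed

lemma square_integrable_diff:
 fixes u v :: "'b \<Rightarrow> real"
 assumes "u \<in> borel_measurable M" "v \<in> borel_measurable M" "integrable M (%x. (u x)\<^sup>2)" "integrable M (%x. (v x)\<^sup>2)"
 shows "integrable M (%x. (u x - v x)\<^sup>2)"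
 using square_integrable_mult[OF assms] assms by (simp add: power2_diff mult.assoc)

text \<open>The Riesz-Fischer argument: a subsequence with rapidly decreasing distances has
  increments that are summable in mean, so it converges almost everywhere. Fatou's lemma then gives
  convergence in mean square for the whole sequence.\<close>

lemma L2_complete:
 fixes f :: "nat \<Rightarrow> 'b \<Rightarrow> real"
 assumes fin: "finite_measure M" and f [measurable]: "\<And>n. f n \<in> borel_measurable M"
  and i: "\<And>n. integrable M (%x. (f n x)\<^sup>2)"
  and C: "\<And>e. 0 < e ==> \<exists>N. \<forall>m\<ge>N. \<forall>n\<ge>N. (LINT x|M. (f m x - f n x)\<^sup>2) < e"
 shows "\<exists>g\<in>borel_measurable M. integrable M (%x. (g x)\<^sup>2) \<and> (%n. LINT x|M. (f n x - g x)\<^sup>2) ----> 0"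
proof -
 interpret finite_measure M by (rule fin)
 have id: "integrable M (%x. (f m x - f n x)\<^sup>2)" for m n
  by (intro square_integrable_diff f i)
 obtain N where N: "\<And>k m n. N k \<le> m ==> N k \<le> n ==> (LINT x|M. (f m x - f n x)\<^sup>2) < (1/4) ^ k" for k :: nat
 proof -
  have "\<forall>k. \<exists>N. \<forall>m\<ge>N. \<forall>n\<ge>N. (LINT x|M. (f m x - f n x)\<^sup>2) < (1/4) ^ k" using C by simp
  then show ?thesis using that by metis
 qed
 \<comment> \<open>Sums of thresholds, so that \<open>r\<close> is monotone and \<open>r k\<close>
   is at least every \<open>N j\<close> with \<open>j \<le> k\<close>.\<close>
 define r where "r k = (\<Sum>j\<le>k. N j)" for k
 have rN: "N k \<le> r k" for k unfolding r_def by (rule member_le_sum) auto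
 have rm: "r k \<le> r (Suc k)" for k by (simp add: r_def)
 have rge: "N k \<le> r l" if "k \<le> l" for k l
  unfolding r_def using that by (intro member_le_sum) auto
 define d where "d k x = f (r (Suc k)) x - f (r k) x" for k x
 have dm [measurable]: "d k \<in> borel_measurable M" for k unfolding d_def by measurable
 have d2: "integrable M (%x. (d k x)\<^sup>2)" "(LINT x|M. (d k x)\<^sup>2) \<le> (1/4) ^ k" for k
  using id[of "r (Suc k)" "r k"] N[of k "r (Suc k)" "r k"] rge[of k "Suc k"] rN[of k] by (auto simp: d_def less_imp_le)
 define c where "c = measure M (space M) + 1"
 have bound: "(\<integral>\<^sup>+x. ennreal \<bar>d k x\<bar> \<partial>M) \<le> ennreal (c * (1/2) ^ k)" for k
 proof -
  \<comment> \<open>Where \<open>\<bar>d k x\<bar>\<close> exceeds \<open>(1/2) ^ k\<close> it is at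
    most \<open>2 ^ k\<close> times its square. On a finite measure space both terms integrate to
    order \<open>(1/2) ^ k\<close>, which is summable.\<close>
  have p: "\<bar>d k x\<bar> \<le> (1/2) ^ k + 2 ^ k * (d k x)\<^sup>2" for x
  proof (cases "\<bar>d k x\<bar> \<le> (1/2) ^ k")
   case False
   then have "(1/2) ^ k * \<bar>d k x\<bar> \<le> \<bar>d k x\<bar> * \<bar>d k x\<bar>" by (intro mult_right_mono) auto
   then have "2 ^ k * ((1/2) ^ k * \<bar>d k x\<bar>) \<le> 2 ^ k * (\<bar>d k x\<bar> * \<bar>d k x\<bar>)" by simp
   then have "\<bar>d k x\<bar> \<le> 2 ^ k * (d k x)\<^sup>2" by (simp add: power_one_over power2_eq_square)
   then show ?thesis by (simp add: add_increasing)
  qed (simp add: add_increasing2)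
  have ii: "integrable M (%x. (1/2) ^ k + 2 ^ k * (d k x)\<^sup>2)" using d2(1)[of k] by simp
  have "(\<integral>\<^sup>+x. ennreal \<bar>d k x\<bar> \<partial>M) \<le> (\<integral>\<^sup>+x. ennreal ((1/2) ^ k + 2 ^ k * (d k x)\<^sup>2) \<partial>M)"
   using p by (intro nn_integral_mono ennreal_leI)
  also have "\<dots> = ennreal (LINT x|M. (1/2) ^ k + 2 ^ k * (d k x)\<^sup>2)"
   by (rule nn_integral_eq_integral[OF ii]) auto
  also have "\<dots> \<le> ennreal (c * (1/2) ^ k)"
  proof (rule ennreal_leI)
   have "(LINT x|M. (1/2) ^ k + 2 ^ k * (d k x)\<^sup>2) = measure M (space M) * (1/2) ^ k + 2 ^ k * (LINT x|M. (d k x)\<^sup>2)"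
    using d2(1)[of k] by simp
   also have "\<dots> \<le> measure M (space M) * (1/2) ^ k + 2 ^ k * (1/4) ^ k"
    using d2(2)[of k] by simp
   also have "(2::real) ^ k * (1/4) ^ k = (1/2) ^ k" by (simp flip: power_mult_distrib)
   finally show "(LINT x|M. (1/2) ^ k + 2 ^ k * (d k x)\<^sup>2) \<le> c * (1/2) ^ k"
    by (simp add: c_def algebra_simps)
  qed
  finally show ?thesis .
 qed
 have "(\<integral>\<^sup>+x. (\<Sum>k. ennreal \<bar>d k x\<bar>) \<partial>M) = (\<Sum>k. \<integral>\<^sup>+x. ennreal \<bar>d k x\<bar> \<partial>M)"
  by (rule nn_integral_suminf) simp
 also have "\<dots> \<le> (\<Sum>k. ennreal (c * (1/2) ^ k))"
  by (intro suminf_le bound) auto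
 also have "\<dots> < \<infinity>"
 proof -
  have "summable (%k. c * (1/2 :: real) ^ k)" by (intro summable_mult summable_geometric) simp
  then have "(\<Sum>k. ennreal (c * (1/2) ^ k)) = ennreal (\<Sum>k. c * (1/2) ^ k)"
   by (intro suminf_ennreal2) (simp_all add: c_def add_nonneg_nonneg)
  then show ?thesis by simp
 qed
 finally have "(\<integral>\<^sup>+x. (\<Sum>k. ennreal \<bar>d k x\<bar>) \<partial>M) \<noteq> \<infinity>" by simp
 then have "AE x in M. (\<Sum>k. ennreal \<bar>d k x\<bar>) \<noteq> \<infinity>"
  by (intro nn_integral_PInf_AE) auto
 then have conv: "AE x in M. (%k. f (r k) x) ----> lim (%k. f (r k) x)"
 proof eventually_elim
  fix x assume "(\<Sum>k. ennreal \<bar>d k x\<bar>) \<noteq> \<infinity>"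
  then have "summable (%k. \<bar>d k x\<bar>)" by (intro summable_suminf_not_top) auto
  then have "summable (%k. d k x)" by (rule summable_rabs_cancel)
  then have "convergent (%n. \<Sum>k<n. d k x)" by (simp add: summable_iff_convergent)
  moreover have "(\<Sum>k<n. d k x) = f (r n) x - f (r 0) x" for n
   unfolding d_def by (induction n) auto
  ultimately have "convergent (%n. f (r n) x - f (r 0) x)" by simp
  then have "convergent (%n. (f (r n) x - f (r 0) x) + f (r 0) x)" by (intro convergent_add convergent_const)
  then have "convergent (%n. f (r n) x)" by simp
  then show "(%k. f (r k) x) ----> lim (%k. f (r k) x)" by (simp add: convergent_LIMSEQ_iff)
 qed
 define g where "g x = lim (%k. f (r k) x)" for x
 have gm [measurable]: "g \<in> borel_measurable M" unfolding g_def by measurable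
 \<comment> \<open>Fatou along the subsequence: the distance of the \<open>n\<close>-th function to
   the limit is bounded by its distances to late members of the subsequence.\<close>
 have fatou: "(\<integral>\<^sup>+x. ennreal ((f n x - g x)\<^sup>2) \<partial>M) \<le> ennreal ((1/4) ^ k)" if "N k \<le> n" for n k
 proof -
  have "(\<integral>\<^sup>+x. ennreal ((f n x - g x)\<^sup>2) \<partial>M) = (\<integral>\<^sup>+x. liminf (%l. ennreal ((f n x - f (r l) x)\<^sup>2)) \<partial>M)"
  proof (rule nn_integral_cong_AE)
   show "AE x in M. ennreal ((f n x - g x)\<^sup>2) = liminf (%l. ennreal ((f n x - f (r l) x)\<^sup>2))"
    using conv
   proof eventually_elim
    fix x assume "(%k. f (r k) x) ----> lim (%k. f (r k) x)"
    then have "(%l. ennreal ((f n x - f (r l) x)\<^sup>2)) ----> ennreal ((f n x - g x)\<^sup>2)"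
     unfolding g_def by (intro tendsto_ennrealI tendsto_intros)
    then show "ennreal ((f n x - g x)\<^sup>2) = liminf (%l. ennreal ((f n x - f (r l) x)\<^sup>2))"
     using lim_imp_Liminf[OF sequentially_bot] by metis
   qed
  qed
  also have "\<dots> \<le> liminf (%l. \<integral>\<^sup>+x. ennreal ((f n x - f (r l) x)\<^sup>2) \<partial>M)"
   by (rule nn_integral_liminf) measurable
  also have "\<dots> \<le> ennreal ((1/4) ^ k)"
  proof (rule Liminf_le)
   have "(\<integral>\<^sup>+x. ennreal ((f n x - f (r l) x)\<^sup>2) \<partial>M) \<le> ennreal ((1/4) ^ k)" if "k \<le> l" for l
    using N[of k n "r l"] \<open>N k \<le> n\<close> rge[OF that] id[of n "r l"]
    by (subst nn_integral_eq_integral) (auto intro: ennreal_leI)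
   then show "\<forall>\<^sub>F l in sequentially. (\<integral>\<^sup>+x. ennreal ((f n x - f (r l) x)\<^sup>2) \<partial>M) \<le> ennreal ((1/4) ^ k)"
    using eventually_ge_at_top[of k] by (rule eventually_mono[rotated])
  qed simp
  finally show ?thesis .
 qed
 have ig: "integrable M (%x. (f n x - g x)\<^sup>2)" if "N k \<le> n" for n k
  using fatou[OF that] by (intro integrableI_bounded) (auto simp: less_top[symmetric] top_unique neq_top_trans)
 have lim: "(%n. LINT x|M. (f n x - g x)\<^sup>2) ----> 0"
 proof (rule LIMSEQ_I)
  fix e :: real assume "0 < e"
  then obtain k where k: "(1/4 :: real) ^ k < e" using real_arch_pow_inv[of e "1/4"] by auto
  have "norm ((LINT x|M. (f n x - g x)\<^sup>2) - 0) < e" if "N k \<le> n" for n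
  proof -
   have "ennreal (LINT x|M. (f n x - g x)\<^sup>2) \<le> ennreal ((1/4) ^ k)"
    using fatou[OF that] by (subst nn_integral_eq_integral[OF ig[OF that], symmetric]) auto
   then have "(LINT x|M. (f n x - g x)\<^sup>2) \<le> (1/4) ^ k" by (simp add: ennreal_le_iff)
   moreover have "0 \<le> (LINT x|M. (f n x - g x)\<^sup>2)" by (rule integral_nonneg) simp
   ultimately show ?thesis using k by simp
  qed
  then show "\<exists>no. \<forall>n\<ge>no. norm ((LINT x|M. (f n x - g x)\<^sup>2) - 0) < e" by blast
 qed
 have "integrable M (%x. (f (N 0) x - (f (N 0) x - g x))\<^sup>2)"
  by (rule square_integrable_diff[OF f _ i ig[OF order_refl]]) measurable
 then have "integrable M (%x. (g x)\<^sup>2)" by simp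
 with lim gm show ?thesis by blast
qed

text \<open>Only the interior of the cell is placed in the open set \<open>U\<close>, since a cell
  may touch the boundary. This suffices for integrals, as the frontier of a convex set is
  negligible.\<close>

locale mesh_cell = bounded_domain U + barycentric C bc gr
 for U C :: "'a::euclidean_space set" and bc gr +
 assumes cell_in_dom: "interior cell \<subseteq> U"
begin

lemma negligible_frontier_cell: "negligible (frontier cell)"
 by (rule negligible_convex_frontier) simp

lemma integral_cell_interior:
 fixes f :: "'a \<Rightarrow> 'b::euclidean_space"
 shows "(LINT x|leb cell. f x) = (LINT x|leb (interior cell). f x)"
proof -
 have cl: "cell \<in> sets lebesgue" using cell_borel by simp
 have "AE x in lebesgue. x \<notin> frontier cell"
  using negligible_frontier_cell by (intro AE_not_in) (simp add: negligible_iff_null_sets)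
 then have "AE x in lebesgue. x \<in> cell \<longrightarrow> f x = (if x \<in> interior cell then f x else 0)"
  by eventually_elim (auto simp: frontier_def closure_subset[THEN subsetD])
 then have "(LINT x|leb cell. f x) = (LINT x|leb cell. (if x \<in> interior cell then f x else 0))"
  by (intro lebesgue_on_integral_cong_AE[OF cl]) (simp add: AE_restrict_space_iff cl)
 also have "\<dots> = (LINT x|leb (interior cell). f x)"
  by (rule integral_restrict[OF interior_subset]) (use cl in auto)
 finally show ?thesis .
qed

lemma ip_cell_interior: "ip cell v w = ip (interior cell) v w"
 unfolding ip_def by (rule integral_cell_interior)

lemma ip_cell_le: "v \<in> L2 U ==> ip cell v v \<le> (L2n U v)\<^sup>2"
proof -
 assume v: "v \<in> L2 U"
 have "ip cell v v = (L2n (interior cell) v)\<^sup>2" unfolding ip_cell_interior L2n_power2 ..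
 also have "\<dots> \<le> (L2n U v)\<^sup>2"
  by (intro power_mono L2n_nonneg L2n_mono_set[OF v cell_in_dom _ dom_lebesgue]) simp
 finally show ?thesis .
qed

lemma gauss_cell:
 assumes "C1_grad f G"
 shows "(LINT x|leb cell. G x \<bullet> e) = - (\<Sum>v\<in>C. (nrm v \<bullet> e) * (LINT x|fmeas (facet v). f x))"
proof -
 have "G \<in> borel_measurable borel" by (rule borel_measurable_continuous_onI) (rule C1_grad_cont[OF assms])
 then have "(LINT x|leb cell. G x \<bullet> e) = (LINT x|lborel. indicator cell x * (G x \<bullet> e))"
  by (intro integral_lebesgue_on_eq_lborel) auto
 then show ?thesis using gauss_direction[OF C1_grad_deriv[OF assms] C1_grad_cont[OF assms], of e] by simp
qed

lemma integrable_cell_continuous: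
 fixes f :: "'a \<Rightarrow> real"
 assumes f: "continuous_on UNIV f" shows "integrable (leb cell) f"
proof -
 have [measurable]: "f \<in> borel_measurable borel" by (rule borel_measurable_continuous_onI) (rule f)
 have "integrable lebesgue (%x. indicator cell x * f x)"
  using integrable_indicator_continuous[OF cell_borel compact_imp_bounded[OF compact_cell] f]
  by (subst integrable_completion) auto
 then show ?thesis by (subst integrable_restrict_space) auto
qed

lemma integrable_facet_bounded:
 fixes f :: "'a \<Rightarrow> real"
 assumes v: "v \<in> C" and f [measurable]: "f \<in> borel_measurable borel" and b: "\<And>x. x \<in> facet v ==> \<bar>f x\<bar> \<le> M"
 shows "integrable (fmeas (facet v)) f"
proof -
 obtain R where R: "\<forall>x\<in>facet v. norm x \<le> R" using compact_imp_bounded[OF compact_facet] unfolding bounded_iff by blast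
 have "integrable lborel (%x. indicator (hslab (nrm v) (off v) 1) x * (indicator (facet v) (hproj (nrm v) (off v) x) * f (hproj (nrm v) (off v) x)))"
 proof (rule integrable_layer[OF norm_nrm[OF v], where g = "%y. indicator (facet v) y * f y" and M = "\<bar>M\<bar>" and r = R])
  show "\<bar>indicator (facet v) x * f x\<bar> \<le> \<bar>M\<bar>" for x using b[of x] by (auto simp: indicator_def)
  show "norm x \<le> R" if "indicator (facet v) x * f x \<noteq> 0" for x using R that by (auto simp: indicator_def split: if_splits)
 qed measurable
 then show ?thesis using facet_integral(2)[OF v f] by blast
qed

lemma sets_facet_measure [measurable_cong]: "sets (fmeas (facet v)) = sets borel"
 by (simp add: facet_measure_def Let_def)

lemma facet_measurable_iff: "f \<in> borel_measurable (fmeas (facet v)) \<longleftrightarrow> f \<in> borel_measurable borel"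
 by (simp add: measurable_cong_sets[OF sets_facet_measure])

lemma integrable_facet_continuous:
 fixes f :: "'a \<Rightarrow> real"
 assumes v: "v \<in> C" and f: "continuous_on UNIV f" shows "integrable (fmeas (facet v)) f"
proof -
 have fm: "f \<in> borel_measurable borel" by (rule borel_measurable_continuous_onI) (rule f)
 have "bounded (f ` facet v)"
  by (intro compact_imp_bounded compact_continuous_image continuous_on_subset[OF f] compact_facet) auto
 then obtain M where M: "\<forall>y\<in>f ` facet v. norm y \<le> M" unfolding bounded_iff by blast
 show ?thesis by (rule integrable_facet_bounded[OF v fm]) (use M in auto)
qed

lemma finite_facet_measure: "v \<in> C ==> finite_measure (fmeas (facet v))"
proof -
 assume v: "v \<in> C"
 have "integrable (fmeas (facet v)) (%x. 1 :: real)"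
  by (rule integrable_facet_continuous[OF v]) (rule continuous_on_const)
 then show ?thesis
  by (intro finite_measureI) (auto simp: integrable_iff_bounded less_top)
qed

text \<open>The directional identity applied to \<open>f\<close> times each component of
  \<open>W\<close>, summed over the coordinate directions.\<close>

lemma gauss_cell_field:
 assumes f: "C1_grad f G" and W: "\<And>b. b \<in> Basis ==> C1_grad (%x. W x \<bullet> b) (D b)"
 shows "(LINT x|leb cell. G x \<bullet> W x + f x * (\<Sum>b\<in>Basis. D b x \<bullet> b)) = - (\<Sum>v\<in>C. LINT x|fmeas (facet v). f x * (nrm v \<bullet> W x))"
proof -
 have fW: "C1_grad (%x. f x * (W x \<bullet> b)) (%x. f x *\<^sub>R D b x + (W x \<bullet> b) *\<^sub>R G x)" if "b \<in> Basis" for b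
  by (rule C1_grad_mult[OF f W[OF that]])
 have ex: "(\<Sum>b\<in>Basis. (W x \<bullet> b) * (y \<bullet> b)) = y \<bullet> W x" for x y
  by (subst euclidean_inner) (simp add: mult.commute)
 have "(LINT x|leb cell. G x \<bullet> W x + f x * (\<Sum>b\<in>Basis. D b x \<bullet> b))
   = (LINT x|leb cell. (\<Sum>b\<in>Basis. (f x *\<^sub>R D b x + (W x \<bullet> b) *\<^sub>R G x) \<bullet> b))"
  by (intro integral_cong refl)
   (simp add: inner_add_left sum.distrib ex sum_distrib_left)
 also have "\<dots> = (\<Sum>b\<in>Basis. LINT x|leb cell. (f x *\<^sub>R D b x + (W x \<bullet> b) *\<^sub>R G x) \<bullet> b)"
  by (intro integral_sum integrable_cell_continuous continuous_intros C1_grad_cont_fun[OF f] C1_grad_cont[OF f] C1_grad_cont[OF W] C1_grad_cont_fun[OF W]) auto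
 also have "\<dots> = (\<Sum>b\<in>Basis. - (\<Sum>v\<in>C. (nrm v \<bullet> b) * (LINT x|fmeas (facet v). f x * (W x \<bullet> b))))"
  by (intro sum.cong refl gauss_cell fW)
 also have "\<dots> = - (\<Sum>v\<in>C. \<Sum>b\<in>Basis. (LINT x|fmeas (facet v). (nrm v \<bullet> b) * (f x * (W x \<bullet> b))))"
  by (simp add: sum_negf sum.swap[of _ C])
 also have "\<dots> = - (\<Sum>v\<in>C. LINT x|fmeas (facet v). (\<Sum>b\<in>Basis. (nrm v \<bullet> b) * (f x * (W x \<bullet> b))))"
  by (intro arg_cong[where f = uminus] sum.cong refl integral_sum[symmetric] integrable_facet_continuous continuous_intros C1_grad_cont_fun[OF f] C1_grad_cont_fun[OF W])
 also have "\<dots> = - (\<Sum>v\<in>C. LINT x|fmeas (facet v). f x * (nrm v \<bullet> W x))"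
  by (intro arg_cong[where f = uminus] sum.cong refl integral_cong)
   (simp add: mult.left_commute[of _ "f _"] sum_distrib_left[symmetric], subst (2) euclidean_inner, simp)
 finally show ?thesis .
qed

text \<open>The divergence theorem for the field \<open>x - v\<close> weighted with the square of
  \<open>\<phi>\<close>. This field is tangential to every facet through \<open>v\<close>; on the
  facet opposite \<open>v\<close> it satisfies \<open>gr v \<bullet> (x - v) = -1\<close>, so its
  normal component is constant there and isolates this one facet.\<close>

lemma trace_inequality:
 assumes v: "v \<in> C"
 shows "\<exists>c\<ge>0. \<forall>\<phi>\<in>test_fun U. (LINT x|fmeas (facet v). (\<phi> x)\<^sup>2) \<le> c * (H1n U \<phi>)\<^sup>2"
proof -
 obtain d where d: "\<forall>x\<in>cell. norm x \<le> d" using compact_imp_bounded[OF compact_cell] unfolding bounded_iff by blast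
 \<comment> \<open>\<open>2 * \<bar>d\<bar>\<close> bounds \<open>norm (x - v)\<close> on the cell,
   and the dimension is the divergence of the field \<open>x - v\<close>.\<close>
 define k where "k = 2 * \<bar>d\<bar> + real DIM('a)"
 have "(LINT x|fmeas (facet v). (\<phi> x)\<^sup>2) \<le> norm (gr v) * k * (H1n U \<phi>)\<^sup>2" if \<phi>: "\<phi> \<in> test_fun U" for \<phi>
 proof -
  note c\<phi> = test_fun_C1_grad[OF \<phi>]
  define W where "W x = \<phi> x *\<^sub>R (x - v)" for x
  define D where "D b x = \<phi> x *\<^sub>R b + ((x - v) \<bullet> b) *\<^sub>R grad \<phi> x" for b x
  have lin: "C1_grad (%x. (x - v) \<bullet> b) (%x. b)" for b
   unfolding C1_grad_def by (auto intro!: derivative_eq_intros simp: inner_commute)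
  have W: "C1_grad (%x. W x \<bullet> b) (D b)" for b
   using C1_grad_mult[OF c\<phi> lin[of b]] unfolding W_def D_def by simp
  have "(LINT x|leb cell. grad \<phi> x \<bullet> W x + \<phi> x * (\<Sum>b\<in>Basis. D b x \<bullet> b))
   = - (\<Sum>u\<in>C. LINT x|fmeas (facet u). \<phi> x * (nrm u \<bullet> W x))"
   by (rule gauss_cell_field[OF c\<phi> W])
  also have "(\<Sum>u\<in>C. LINT x|fmeas (facet u). \<phi> x * (nrm u \<bullet> W x))
   = (\<Sum>u\<in>C. if u = v then - (LINT x|fmeas (facet v). (\<phi> x)\<^sup>2) / norm (gr v) else 0)"
  proof (rule sum.cong[OF refl])
   fix u assume u: "u \<in> C"
   have m: "(%x. \<phi> x * (nrm u \<bullet> W x)) \<in> borel_measurable (fmeas (facet u))"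
    unfolding facet_measurable_iff W_def
    by (intro borel_measurable_continuous_onI continuous_intros test_fun_continuous[OF \<phi>])
   have ae: "AE x in fmeas (facet u). \<phi> x * (nrm u \<bullet> W x) = (if u = v then - (1 / norm (gr v)) else 0) * (\<phi> x)\<^sup>2"
    using AE_facet_measure[OF u]
   proof eventually_elim
    fix x assume x: "x \<in> facet u"
    then have "bc u x = 0" using facet_eq[OF u] by auto
    then have "gr u \<bullet> (x - v) = (if u = v then - 1 else 0)"
     using bc_diff[OF u, of x v] bc_vertex[OF u v] by auto
    then show "\<phi> x * (nrm u \<bullet> W x) = (if u = v then - (1 / norm (gr v)) else 0) * (\<phi> x)\<^sup>2"
     by (auto simp: W_def nrm_def power2_eq_square divide_inverse)
   qed
   have "(LINT x|fmeas (facet u). \<phi> x * (nrm u \<bullet> W x)) = (LINT x|fmeas (facet u). (if u = v then - (1 / norm (gr v)) else 0) * (\<phi> x)\<^sup>2)"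
   proof (rule integral_cong_AE[OF m _ ae])
    have [measurable]: "\<phi> \<in> borel_measurable borel"
     by (rule borel_measurable_continuous_onI) (rule test_fun_continuous[OF \<phi>])
    show "(%x. (if u = v then - (1 / norm (gr v)) else 0) * (\<phi> x)\<^sup>2) \<in> borel_measurable (fmeas (facet u))"
     unfolding facet_measurable_iff by measurable
   qed
   then show "(LINT x|fmeas (facet u). \<phi> x * (nrm u \<bullet> W x)) = (if u = v then - (LINT x|fmeas (facet v). (\<phi> x)\<^sup>2) / norm (gr v) else 0)"
    by auto
  qed
  also have "- \<dots> = (LINT x|fmeas (facet v). (\<phi> x)\<^sup>2) / norm (gr v)" using v finC by (simp add: sum.delta)
  finally have eq: "(LINT x|fmeas (facet v). (\<phi> x)\<^sup>2) / norm (gr v) = (LINT x|leb cell. grad \<phi> x \<bullet> W x + \<phi> x * (\<Sum>b\<in>Basis. D b x \<bullet> b))" by simp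
  also have "\<dots> \<le> (LINT x|leb cell. k * (\<phi> x * \<phi> x + grad \<phi> x \<bullet> grad \<phi> x))"
  proof (rule integral_mono)
   show "integrable (leb cell) (%x. grad \<phi> x \<bullet> W x + \<phi> x * (\<Sum>b\<in>Basis. D b x \<bullet> b))"
    unfolding W_def D_def by (intro integrable_cell_continuous continuous_intros test_fun_continuous[OF \<phi>] test_fun_grad_continuous[OF \<phi>])
   show "integrable (leb cell) (%x. k * (\<phi> x * \<phi> x + grad \<phi> x \<bullet> grad \<phi> x))"
    by (intro integrable_cell_continuous continuous_intros test_fun_continuous[OF \<phi>] test_fun_grad_continuous[OF \<phi>])
   fix x assume "x \<in> space (leb cell)"
   then have x: "x \<in> cell" by simp
   have ex: "(\<Sum>b\<in>Basis. ((x - v) \<bullet> b) * (y \<bullet> b)) = y \<bullet> (x - v)" for y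
    by (subst euclidean_inner) (simp add: mult.commute)
   have sD: "(\<Sum>b\<in>Basis. D b x \<bullet> b) = real DIM('a) * \<phi> x + grad \<phi> x \<bullet> (x - v)"
    unfolding D_def by (simp add: inner_add_left sum.distrib ex inner_Basis)
   have e: "grad \<phi> x \<bullet> W x + \<phi> x * (\<Sum>b\<in>Basis. D b x \<bullet> b) = 2 * (\<phi> x * (grad \<phi> x \<bullet> (x - v))) + real DIM('a) * (\<phi> x * \<phi> x)"
    unfolding sD W_def inner_scaleR_right by (simp add: distrib_left)
   have nx: "norm (x - v) \<le> 2 * \<bar>d\<bar>"
   proof -
    have "v \<in> cell" using v by (rule hull_inc)
    then have "norm x \<le> \<bar>d\<bar>" "norm v \<le> \<bar>d\<bar>" using d x by force+
    then show ?thesis using norm_triangle_ineq4[of x v] by linarith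
   qed
   have "2 * (\<phi> x * (grad \<phi> x \<bullet> (x - v))) \<le> 2 * (\<bar>\<phi> x\<bar> * (norm (grad \<phi> x) * norm (x - v)))"
   proof -
    have "\<phi> x * (grad \<phi> x \<bullet> (x - v)) \<le> \<bar>\<phi> x * (grad \<phi> x \<bullet> (x - v))\<bar>" by simp
    also have "\<dots> \<le> \<bar>\<phi> x\<bar> * (norm (grad \<phi> x) * norm (x - v))"
     by (simp add: abs_mult mult_left_mono Cauchy_Schwarz_ineq2)
    finally show ?thesis by simp
   qed
   also have "\<dots> = norm (x - v) * (2 * \<bar>\<phi> x\<bar> * norm (grad \<phi> x))" by (simp add: algebra_simps)
   also have "\<dots> \<le> (2 * \<bar>d\<bar>) * (2 * \<bar>\<phi> x\<bar> * norm (grad \<phi> x))" by (intro mult_right_mono nx) auto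
   also have "\<dots> \<le> (2 * \<bar>d\<bar>) * (\<bar>\<phi> x\<bar>\<^sup>2 + (norm (grad \<phi> x))\<^sup>2)" by (intro mult_left_mono sum_squares_bound) auto
   also have "\<dots> = (2 * \<bar>d\<bar>) * (\<phi> x * \<phi> x + grad \<phi> x \<bullet> grad \<phi> x)" by (simp add: power2_eq_square flip: power2_norm_eq_inner)
   finally have a: "2 * (\<phi> x * (grad \<phi> x \<bullet> (x - v))) \<le> (2 * \<bar>d\<bar>) * (\<phi> x * \<phi> x + grad \<phi> x \<bullet> grad \<phi> x)" .
   have b: "real DIM('a) * (\<phi> x * \<phi> x) \<le> real DIM('a) * (\<phi> x * \<phi> x + grad \<phi> x \<bullet> grad \<phi> x)"
    by (intro mult_left_mono) auto
   show "grad \<phi> x \<bullet> W x + \<phi> x * (\<Sum>b\<in>Basis. D b x \<bullet> b) \<le> k * (\<phi> x * \<phi> x + grad \<phi> x \<bullet> grad \<phi> x)"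
    unfolding e k_def distrib_right using a b by linarith
  qed
  also have "\<dots> = k * (ip cell \<phi> \<phi> + ip cell (grad \<phi>) (grad \<phi>))"
   unfolding ip_def
   by (subst integral_add[symmetric])
    (auto intro!: integrable_cell_continuous continuous_intros test_fun_continuous[OF \<phi>] test_fun_grad_continuous[OF \<phi>])
  also have "\<dots> \<le> k * ((L2n U \<phi>)\<^sup>2 + (L2n U (grad \<phi>))\<^sup>2)"
   by (intro mult_left_mono add_mono ip_cell_le test_fun_L2[OF \<phi>]) (auto simp: k_def)
  also have "L2n U (grad \<phi>) = L2n U (wgrad U \<phi>)"
   using L2n_cong_AE[OF dom_lebesgue wgrad_AE[OF test_fun_has_wgrad[OF \<phi>]]] by simp
  also have "(L2n U \<phi>)\<^sup>2 + (L2n U (wgrad U \<phi>))\<^sup>2 = (H1n U \<phi>)\<^sup>2" by (simp add: H1n_def)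
  finally show ?thesis using gr_nonzero[OF v] by (simp add: divide_le_eq algebra_simps)
 qed
 then show ?thesis by (intro exI[of _ "norm (gr v) * k"]) (auto simp: k_def)
qed

end

context mesh_cell
begin

text \<open>By the trace inequality an approximating sequence in \<open>H1n\<close> restricts to a
  Cauchy sequence in the square integrable functions on the facet.\<close>

lemma facet_trace_exists:
 assumes v: "v \<in> C" and w: "w \<in> H10 U"
 shows "\<exists>g. g \<in> borel_measurable borel \<and> integrable (fmeas (facet v)) (%x. (g x)\<^sup>2) \<and>
   (\<exists>\<phi>. (\<forall>n::nat. \<phi> n \<in> test_fun U) \<and> (%n. H1n U (%x. \<phi> n x - w x)) ----> 0 \<and>
     (%n. LINT x|fmeas (facet v). (\<phi> n x - g x)\<^sup>2) ----> 0)"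
proof -
 obtain \<phi> where \<phi>: "\<And>n. \<phi> n \<in> test_fun U" "(%n. H1n U (%x. \<phi> n x - w x)) ----> 0"
  using w by (auto simp: H10_def)
 obtain c where c: "0 \<le> c" "\<And>\<phi>. \<phi> \<in> test_fun U ==> (LINT x|fmeas (facet v). (\<phi> x)\<^sup>2) \<le> c * (H1n U \<phi>)\<^sup>2"
  using trace_inequality[OF v] by blast
 have "\<exists>g\<in>borel_measurable (fmeas (facet v)). integrable (fmeas (facet v)) (%x. (g x)\<^sup>2) \<and>
  (%n. LINT x|fmeas (facet v). (\<phi> n x - g x)\<^sup>2) ----> 0"
 proof (rule L2_complete[OF finite_facet_measure[OF v]])
  show "\<phi> n \<in> borel_measurable (fmeas (facet v))" for n
   unfolding facet_measurable_iff by (rule borel_measurable_continuous_onI) (rule test_fun_continuous[OF \<phi>(1)])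
  show "integrable (fmeas (facet v)) (%x. (\<phi> n x)\<^sup>2)" for n
   by (intro integrable_facet_continuous[OF v] continuous_intros test_fun_continuous[OF \<phi>(1)])
  fix e :: real assume e: "0 < e"
  \<comment> \<open>Chosen to give \<open>c * (2 * s)\<^sup>2 < e\<close>, where
    \<open>2 * s\<close> bounds the distance of two late members of the sequence.\<close>
  define s where "s = sqrt (e / (c + 1)) / 2"
  have s: "0 < s" using e c(1) by (simp add: s_def)
  have s2: "c * (2 * s)\<^sup>2 < e" using e c(1) by (simp add: s_def field_simps)
  obtain N where N: "\<And>n. N \<le> n ==> H1n U (%x. \<phi> n x - w x) < s"
   using LIMSEQ_D[OF \<phi>(2) s] by (auto simp: H1n_nonneg)
  have "(LINT x|fmeas (facet v). (\<phi> m x - \<phi> n x)\<^sup>2) < e" if mn: "N \<le> m" "N \<le> n" for m n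
  proof -
   have d: "(%x. \<phi> k x - w x) \<in> H1 U" for k
    using H1_axpy[OF test_fun_H1[OF \<phi>(1)[of k]] H10_H1[OF w], of "-1"] by simp
   have d': "(%x. - 1 * (\<phi> n x - w x)) \<in> H1 U" by (rule H1_mult[OF d])
   have t: "(%x. \<phi> m x - \<phi> n x) \<in> test_fun U" using test_fun_axpy[OF \<phi>(1)[of m] \<phi>(1)[of n], of "-1"] by simp
   have "H1n U (%x. \<phi> m x - \<phi> n x) \<le> H1n U (%x. \<phi> m x - w x) + H1n U (%x. - 1 * (\<phi> n x - w x))"
    using H1n_triangle[OF d[of m] d'] by simp
   also have "H1n U (%x. - 1 * (\<phi> n x - w x)) = H1n U (%x. \<phi> n x - w x)"
    using H1n_mult[OF d[of n], of "-1"] by simp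
   also have "H1n U (%x. \<phi> m x - w x) + H1n U (%x. \<phi> n x - w x) \<le> 2 * s" using N[OF mn(1)] N[OF mn(2)] by simp
   finally have "(H1n U (%x. \<phi> m x - \<phi> n x))\<^sup>2 \<le> (2 * s)\<^sup>2" by (intro power_mono H1n_nonneg)
   then have "c * (H1n U (%x. \<phi> m x - \<phi> n x))\<^sup>2 \<le> c * (2 * s)\<^sup>2" by (intro mult_left_mono c)
   then show ?thesis using c(2)[OF t] s2 by linarith
  qed
  then show "\<exists>N. \<forall>m\<ge>N. \<forall>n\<ge>N. (LINT x|fmeas (facet v). (\<phi> m x - \<phi> n x)\<^sup>2) < e" by blast
 qed
 then obtain g where g: "g \<in> borel_measurable borel" "integrable (fmeas (facet v)) (%x. (g x)\<^sup>2)"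
  "(%n. LINT x|fmeas (facet v). (\<phi> n x - g x)\<^sup>2) ----> 0" by (auto simp: facet_measurable_iff)
 show ?thesis by (rule exI[of _ g], intro conjI g exI[of _ \<phi>] allI \<phi>)
qed

text \<open>The chosen trace comes with an approximating sequence of its own. The trace inequality
  for the difference of the two sequences shows that every sequence approximating \<open>w\<close>
  leads to the same limit.\<close>

lemma facet_trace_limit:
 assumes v: "v \<in> C" and w: "w \<in> H10 U" and \<psi>: "\<And>n::nat. \<psi> n \<in> test_fun U" "(%n. H1n U (%x. \<psi> n x - w x)) ----> 0"
  and E: "E \<in> borel_measurable borel" "\<And>x. x \<in> facet v ==> \<bar>E x\<bar> \<le> M"
 shows "(%n. LINT x|fmeas (facet v). E x * \<psi> n x) ----> (LINT x|fmeas (facet v). E x * facet_trace U (facet v) w x)"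
proof -
 define g where "g = facet_trace U (facet v) w"
 let ?M = "fmeas (facet v)"
 have gp: "g \<in> borel_measurable borel \<and> integrable ?M (%x. (g x)\<^sup>2) \<and>
   (\<exists>\<phi>. (\<forall>n::nat. \<phi> n \<in> test_fun U) \<and> (%n. H1n U (%x. \<phi> n x - w x)) ----> 0 \<and>
     (%n. LINT x|?M. (\<phi> n x - g x)\<^sup>2) ----> 0)"
  unfolding g_def facet_trace_def by (rule someI_ex[OF facet_trace_exists[OF v w]])
 then obtain \<phi> where \<phi>: "\<And>n::nat. \<phi> n \<in> test_fun U" "(%n. H1n U (%x. \<phi> n x - w x)) ----> 0"
   "(%n. LINT x|?M. (\<phi> n x - g x)\<^sup>2) ----> 0" by blast
 have gm: "g \<in> borel_measurable ?M" and g2: "integrable ?M (%x. (g x)\<^sup>2)" using gp by (auto simp: facet_measurable_iff)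
 obtain c where c: "0 \<le> c" "\<And>\<phi>. \<phi> \<in> test_fun U ==> (LINT x|?M. (\<phi> x)\<^sup>2) \<le> c * (H1n U \<phi>)\<^sup>2"
  using trace_inequality[OF v] by blast
 have Em: "E \<in> borel_measurable ?M" using E(1) by (simp add: facet_measurable_iff)
 have E2: "integrable ?M (%x. (E x)\<^sup>2)"
 proof (rule integrable_facet_bounded[OF v, of _ "M\<^sup>2"])
  show "(%x. (E x)\<^sup>2) \<in> borel_measurable borel" using E(1) by measurable
  show "\<bar>(E x)\<^sup>2\<bar> \<le> M\<^sup>2" if "x \<in> facet v" for x
   using power_mono[OF E(2)[OF that], of 2] by simp
 qed
 have tm: "\<phi> \<in> borel_measurable ?M" "integrable ?M (%x. (\<phi> x)\<^sup>2)" if "\<phi> \<in> test_fun U" for \<phi>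
 proof -
  have c: "continuous_on UNIV \<phi>" by (rule test_fun_continuous[OF that])
  show "\<phi> \<in> borel_measurable ?M" unfolding facet_measurable_iff by (rule borel_measurable_continuous_onI) (rule c)
  show "integrable ?M (%x. (\<phi> x)\<^sup>2)" by (intro integrable_facet_continuous[OF v] continuous_intros c)
 qed
 have b: "norm ((LINT x|?M. E x * \<psi> n x) - (LINT x|?M. E x * g x))
  \<le> sqrt ((LINT x|?M. (E x)\<^sup>2) * (c * (H1n U (%x. \<psi> n x - w x) + H1n U (%x. \<phi> n x - w x))\<^sup>2))
   + sqrt ((LINT x|?M. (E x)\<^sup>2) * (LINT x|?M. (\<phi> n x - g x)\<^sup>2))" for n
 proof -
  have t: "(%x. \<psi> n x - \<phi> n x) \<in> test_fun U" using test_fun_axpy[OF \<psi>(1)[of n] \<phi>(1)[of n], of "-1"] by simp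
  have d: "(%x. \<psi> n x - w x) \<in> H1 U" "(%x. \<phi> n x - w x) \<in> H1 U"
   using H1_axpy[OF test_fun_H1[OF \<phi>(1)[of n]] H10_H1[OF w], of "-1"]
    H1_axpy[OF test_fun_H1[OF \<psi>(1)[of n]] H10_H1[OF w], of "-1"] by auto
  have d': "(%x. - 1 * (\<phi> n x - w x)) \<in> H1 U" by (rule H1_mult[OF d(2)])
  have "H1n U (%x. \<psi> n x - \<phi> n x) \<le> H1n U (%x. \<psi> n x - w x) + H1n U (%x. - 1 * (\<phi> n x - w x))"
   using H1n_triangle[OF d(1) d'] by simp
  also have "H1n U (%x. - 1 * (\<phi> n x - w x)) = H1n U (%x. \<phi> n x - w x)"
   using H1n_mult[OF d(2), of "-1"] by simp
  finally have h: "H1n U (%x. \<psi> n x - \<phi> n x) \<le> H1n U (%x. \<psi> n x - w x) + H1n U (%x. \<phi> n x - w x)" .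
  have dg: "(%x. \<phi> n x - g x) \<in> borel_measurable ?M" "integrable ?M (%x. (\<phi> n x - g x)\<^sup>2)"
   using tm[OF \<phi>(1)[of n]] gm g2 by (auto intro: square_integrable_diff)
  note p1 = square_integrable_mult[OF Em tm(1)[OF t] E2 tm(2)[OF t]]
  note p2 = square_integrable_mult[OF Em dg(1) E2 dg(2)]
  note p3 = square_integrable_mult[OF Em tm(1)[OF \<psi>(1)[of n]] E2 tm(2)[OF \<psi>(1)[of n]]]
  note p4 = square_integrable_mult[OF Em gm E2 g2]
  have "(LINT x|?M. E x * \<psi> n x) - (LINT x|?M. E x * g x) = (LINT x|?M. E x * \<psi> n x - E x * g x)" using p3 p4 by simp
  also have "\<dots> = (LINT x|?M. E x * (\<psi> n x - \<phi> n x) + E x * (\<phi> n x - g x))"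
   by (simp add: algebra_simps)
  also have "\<dots> = (LINT x|?M. E x * (\<psi> n x - \<phi> n x)) + (LINT x|?M. E x * (\<phi> n x - g x))"
   using p1 p2 by (rule integral_add)
  finally have "norm ((LINT x|?M. E x * \<psi> n x) - (LINT x|?M. E x * g x)) \<le> \<bar>LINT x|?M. E x * (\<psi> n x - \<phi> n x)\<bar> + \<bar>LINT x|?M. E x * (\<phi> n x - g x)\<bar>" by simp
  also have "\<bar>LINT x|?M. E x * (\<psi> n x - \<phi> n x)\<bar> \<le> sqrt ((LINT x|?M. (E x)\<^sup>2) * (c * (H1n U (%x. \<psi> n x - w x) + H1n U (%x. \<phi> n x - w x))\<^sup>2))"
  proof (rule real_le_rsqrt)
   have "(LINT x|?M. E x * (\<psi> n x - \<phi> n x))\<^sup>2 \<le> (LINT x|?M. (E x)\<^sup>2) * (LINT x|?M. (\<psi> n x - \<phi> n x)\<^sup>2)"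
    by (rule integral_Cauchy_Schwarz[OF E2 tm(2)[OF t] p1])
   also have "\<dots> \<le> (LINT x|?M. (E x)\<^sup>2) * (c * (H1n U (%x. \<psi> n x - \<phi> n x))\<^sup>2)"
    by (intro mult_left_mono c(2) t) simp
   also have "\<dots> \<le> (LINT x|?M. (E x)\<^sup>2) * (c * (H1n U (%x. \<psi> n x - w x) + H1n U (%x. \<phi> n x - w x))\<^sup>2)"
    by (intro mult_left_mono power_mono h H1n_nonneg c(1)) simp
   finally show "\<bar>LINT x|?M. E x * (\<psi> n x - \<phi> n x)\<bar>\<^sup>2 \<le> (LINT x|?M. (E x)\<^sup>2) * (c * (H1n U (%x. \<psi> n x - w x) + H1n U (%x. \<phi> n x - w x))\<^sup>2)" by simp
  qed
  also have "\<bar>LINT x|?M. E x * (\<phi> n x - g x)\<bar> \<le> sqrt ((LINT x|?M. (E x)\<^sup>2) * (LINT x|?M. (\<phi> n x - g x)\<^sup>2))"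
   using integral_Cauchy_Schwarz[OF E2 dg(2) p2] by (intro real_le_rsqrt) simp
  finally show ?thesis by simp
 qed
 define A where "A = (LINT x|?M. (E x)\<^sup>2)"
 define \<alpha> where "\<alpha> n = H1n U (%x. \<psi> n x - w x)" for n
 define \<beta> where "\<beta> n = H1n U (%x. \<phi> n x - w x)" for n
 define \<gamma> where "\<gamma> n = (LINT x|?M. (\<phi> n x - g x)\<^sup>2)" for n
 have l: "\<alpha> ----> 0" "\<beta> ----> 0" "\<gamma> ----> 0"
  using \<psi>(2) \<phi>(2,3) by (simp_all add: \<alpha>_def[abs_def] \<beta>_def[abs_def] \<gamma>_def[abs_def])
 have "(%n. sqrt (A * (c * (\<alpha> n + \<beta> n)\<^sup>2)) + sqrt (A * \<gamma> n)) ----> sqrt (A * (c * (0 + 0)\<^sup>2)) + sqrt (A * 0)"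
  by (intro tendsto_intros l)
 then have lim: "(%n. sqrt (A * (c * (\<alpha> n + \<beta> n)\<^sup>2)) + sqrt (A * \<gamma> n)) ----> 0" by simp
 have "(%n. (LINT x|?M. E x * \<psi> n x) - (LINT x|?M. E x * g x)) ----> 0"
 proof (rule Lim_null_comparison[OF _ lim], rule always_eventually, rule allI)
  show "norm ((LINT x|?M. E x * \<psi> n x) - (LINT x|?M. E x * g x)) \<le> sqrt (A * (c * (\<alpha> n + \<beta> n)\<^sup>2)) + sqrt (A * \<gamma> n)" for n
   using b[of n] unfolding A_def \<alpha>_def \<beta>_def \<gamma>_def .
 qed
 then show ?thesis unfolding g_def by (simp add: LIM_zero_iff)
qed

end

section \<open>Points near a facet and the interior of a simplex\<close>

context barycentric
begin

lemma inj_facet: "inj_on facet C"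
proof (rule inj_onI)
 fix v w assume vw: "v \<in> C" "w \<in> C" "facet v = facet w"
 show "v = w"
 proof (rule ccontr)
  assume "v \<noteq> w"
  then have "v \<in> facet w" using vw by (intro hull_inc) auto
  then have "v \<in> facet v" using vw by simp
  then have "bc v v = 0" using facet_eq[OF vw(1)] by blast
  then show False using bc_vertex[OF vw(1,1)] by simp
 qed
qed

lemma interior_cell_pos:
 assumes "\<And>u. u \<in> C ==> 0 < bc u x" shows "x \<in> interior cell"
proof (rule interiorI)
 have "open {x. 0 < bc u x}" if "u \<in> C" for u
 proof -
  have "0 < bc u x \<longleftrightarrow> gr u \<bullet> x > - bc u 0" for x using bc_eq[OF that, of x] by linarith
  then have "{x. 0 < bc u x} = {x. gr u \<bullet> x > - bc u 0}" by blast
  then show ?thesis by (simp only: open_halfspace_gt)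
 qed
 then show "open (\<Inter>u\<in>C. {x. 0 < bc u x})" using finC by auto
 show "x \<in> (\<Inter>u\<in>C. {x. 0 < bc u x})" using assms by auto
 show "(\<Inter>u\<in>C. {x. 0 < bc u x}) \<subseteq> cell" unfolding convex_hull_eq by (auto intro: less_imp_le)
qed

lemma interior_cell_nonempty: "interior cell \<noteq> {}"
proof -
 define k where "k = real (card C)"
 have k: "0 < k" using card2 by (simp add: k_def)
 have s: "sum (%w. 1 / k) C = 1" using k by (simp add: k_def)
 have "0 < bc u (\<Sum>w\<in>C. (1 / k) *\<^sub>R w)" if u: "u \<in> C" for u
 proof -
  have "bc u (\<Sum>w\<in>C. (1 / k) *\<^sub>R w) = (\<Sum>w\<in>C. 1 / k * bc u w)" by (rule bc_affine_combination[OF u finC s])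
  also have "\<dots> = (\<Sum>w\<in>C. if w = u then 1 / k else 0)" using u by (intro sum.cong) (auto simp: bc_vertex)
  also have "\<dots> = 1 / k" using u finC by simp
  finally show ?thesis using k by simp
 qed
 then show ?thesis using interior_cell_pos by blast
qed

text \<open>The other coordinates are positive at \<open>y\<close> and remain so for small
  \<open>s\<close>, while \<open>bc v\<close> grows at the rate \<open>norm (gr v)\<close>.\<close>

lemma inward_interior:
 assumes v: "v \<in> C" and y: "bc v y = 0" "\<And>w. w \<in> C - {v} ==> 0 < bc w y"
 shows "\<forall>\<^sub>F s in at_right 0. y + s *\<^sub>R nrm v \<in> interior cell"
proof -
 have "\<forall>\<^sub>F s in at_right 0. \<forall>w\<in>C - {v}. 0 < bc w (y + s *\<^sub>R nrm v)"
 proof (rule eventually_ball_finite)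
  show "\<forall>w\<in>C - {v}. \<forall>\<^sub>F s in at_right 0. 0 < bc w (y + s *\<^sub>R nrm v)"
  proof
   fix w assume w: "w \<in> C - {v}"
   have "((%s. bc w y + s * (gr w \<bullet> nrm v)) \<longlongrightarrow> bc w y + 0 * (gr w \<bullet> nrm v)) (at_right 0)"
    by (intro tendsto_intros)
   then have "\<forall>\<^sub>F s in at_right 0. 0 < bc w y + s * (gr w \<bullet> nrm v)"
    using y(2)[OF w] by (intro order_tendstoD(1)) auto
   then show "\<forall>\<^sub>F s in at_right 0. 0 < bc w (y + s *\<^sub>R nrm v)" using w by (simp add: bc_add)
  qed
 qed (use finC in auto)
 moreover have "\<forall>\<^sub>F s in at_right (0::real). 0 < s" by (rule eventually_at_right_less)
 ultimately show ?thesis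
 proof eventually_elim
  case (elim s)
  show ?case
  proof (rule interior_cell_pos)
   fix u assume "u \<in> C"
   then show "0 < bc u (y + s *\<^sub>R nrm v)"
    using elim y(1) v gr_nonzero[OF v] by (cases "u = v") (auto simp: bc_add nrm_def dot_square_norm power2_eq_square)
  qed
 qed
qed

lemma outward_notin:
 assumes v: "v \<in> C" and y: "bc v y = 0" and s: "0 < s" shows "y - s *\<^sub>R nrm v \<notin> cell"
proof -
 have "bc v (y - s *\<^sub>R nrm v) = bc v y + gr v \<bullet> (- s *\<^sub>R nrm v)" using bc_add[OF v, of y "- s *\<^sub>R nrm v"] by simp
 also have "\<dots> = - (s * norm (gr v))" using gr_nonzero[OF v] y by (simp add: nrm_def dot_square_norm power2_eq_square)
 finally have "bc v (y - s *\<^sub>R nrm v) < 0" using s gr_nonzero[OF v] by simp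
 then show ?thesis using v by (auto simp: convex_hull_eq not_le)
qed

text \<open>For affinely independent vertices the relative interior consists of the convex
  combinations with positive weights, and these weights are the barycentric coordinates.\<close>

lemma rel_interior_facet_pos:
 assumes ind: "\<not> affine_dependent C" and v: "v \<in> C" and y: "y \<in> rel_interior (facet v)"
 shows "bc v y = 0" "\<And>w. w \<in> C - {v} ==> 0 < bc w y"
proof -
 have "\<not> affine_dependent (C - {v})" using ind affine_independent_subset by blast
 then obtain u where u: "\<And>x. x \<in> C - {v} ==> 0 < u x" "sum u (C - {v}) = 1" "(\<Sum>x\<in>C - {v}. u x *\<^sub>R x) = y"
  using y by (auto simp: rel_interior_convex_hull_explicit)
 show "bc v y = 0" using y rel_interior_subset facet_eq[OF v] by blast
 show "0 < bc w y" if w: "w \<in> C - {v}" for w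
 proof -
  have "bc w y = (\<Sum>x\<in>C - {v}. u x * bc w x)"
   unfolding u(3)[symmetric] using w finC u(2) by (intro bc_affine_combination) auto
  also have "\<dots> = (\<Sum>x\<in>C - {v}. if x = w then u x else 0)"
   using w by (intro sum.cong) (auto simp: bc_vertex)
  also have "\<dots> = u w" using w finC by simp
  finally show ?thesis using u(1)[OF w] by simp
 qed
qed

end

section \<open>Element-wise integration by parts on a conforming mesh\<close>

lemma Ck_C1_grad: "Ck (Suc k) f ==> C1_grad f (grad f)"
proof -
 assume f: "Ck (Suc k) f"
 have "continuous_on UNIV (%x. frechet_derivative f (at x) i)" if "i \<in> Basis" for i
  using f that by (auto intro: Ck_continuous[of k])
 then have "continuous_on UNIV (grad f)" unfolding grad_def[abs_def] by (intro continuous_intros) auto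
 then show ?thesis using has_derivative_grad[OF Ck_Suc_has_derivative[OF f]] by (simp add: C1_grad_def)
qed

lemma Ck_grad_component:
 assumes "Ck (Suc k) f" "b \<in> Basis" shows "Ck k (%x. grad f x \<bullet> b)"
proof -
 have "(%x. grad f x \<bullet> b) = (%x. frechet_derivative f (at x) b)"
  using assms(2) by (auto simp: grad_def inner_sum_left inner_Basis if_distrib cong: if_cong)
 then show ?thesis using assms by simp
qed

definition lap :: "('a::euclidean_space \<Rightarrow> real) \<Rightarrow> 'a \<Rightarrow> real" where
 "lap f x = (\<Sum>b\<in>Basis. grad (%y. grad f y \<bullet> b) x \<bullet> b)"

lemma Ck_component_C1_grad: "Ck 2 f ==> b \<in> Basis ==> C1_grad (%x. grad f x \<bullet> b) (grad (%x. grad f x \<bullet> b))"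
 using Ck_C1_grad[of 0] Ck_grad_component[of 1 f b] by (simp add: numeral_2_eq_2)

lemma Ck2_C1_grad: "Ck 2 f ==> C1_grad f (grad f)"
 using Ck_C1_grad[of 1 f] by (simp add: numeral_2_eq_2)

lemma lap_continuous: "Ck 2 f ==> continuous_on S (lap f)"
 unfolding lap_def[abs_def]
 by (intro continuous_intros continuous_on_subset[OF C1_grad_cont[OF Ck_component_C1_grad]]) auto

lemma grad_continuous: "Ck 2 f ==> continuous_on S (grad f)"
 using continuous_on_subset[OF C1_grad_cont[OF Ck2_C1_grad]] by blast

lemma grad_transform_open:
 assumes "open Q" "x \<in> Q" "\<And>y. y \<in> Q ==> v y = q y" "C1_grad q G"
 shows "grad v x = G x"
proof (rule grad_eqI)
 show "(v has_derivative (\<bullet>) (G x)) (at x)"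
  using has_derivative_transform_within_open[OF C1_grad_deriv[OF assms(4)] assms(1,2)] assms(3) by auto
qed

text \<open>\<open>regular_dom\<close> excludes slits: the interior of a cell lies in the interior
  of \<open>closure U\<close>, and it has to lie in \<open>U\<close>.\<close>

locale simplicial_mesh = bounded_domain U for U :: "'a::euclidean_space set" +
 fixes T :: "'a set set"
 assumes regular_dom: "interior (closure U) = U" and mesh: "conforming_mesh U T"
begin

lemma finite_mesh: "finite T" using mesh by (simp add: conforming_mesh_def triangulation_def)
lemma mesh_Union: "\<Union>T = closure U" using mesh by (simp add: conforming_mesh_def)
lemma mesh_simplex: "K \<in> T ==> int DIM('a) simplex K" using mesh by (simp add: conforming_mesh_def)
lemma mesh_face: "K \<in> T ==> K' \<in> T ==> K \<inter> K' face_of K" using mesh by (simp add: conforming_mesh_def triangulation_def)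

lemma interior_mesh_cell: "K \<in> T ==> interior K \<subseteq> U"
 using interior_mono[of K "closure U"] mesh_Union regular_dom by blast

lemma cell_obtain:
 assumes K: "K \<in> T"
 obtains C bc gr where "mesh_cell U C bc gr" "K = convex hull C" "\<not> affine_dependent C"
proof -
 obtain C bc gr where C: "barycentric C bc gr" "K = convex hull C" "\<not> affine_dependent C"
  by (rule simplex_barycentric[OF mesh_simplex[OF K]])
 have "mesh_cell U C bc gr"
  using bounded_domain_axioms C(1) interior_mesh_cell[OF K] C(2)
  by (simp add: mesh_cell_def mesh_cell_axioms_def)
 then show ?thesis using that C by blast
qed

lemma facets_eq:
 assumes "mesh_cell U C bc gr" "\<not> affine_dependent C"
 shows "{Fc. Fc facet_of convex hull C} = (%v. convex hull (C - {v})) ` C"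
proof -
 interpret mesh_cell U C bc gr by (rule assms(1))
 show ?thesis using facet_of_convex_hull_affine_independent[OF assms(2)] facet_nonempty by auto
qed

lemma pair_obtain:
 assumes K: "K \<in> T" and Fc: "Fc facet_of K"
 obtains C bc gr v where "mesh_cell U C bc gr" "K = convex hull C" "\<not> affine_dependent C" "v \<in> C" "Fc = convex hull (C - {v})"
proof -
 obtain C bc gr where C: "mesh_cell U C bc gr" "K = convex hull C" "\<not> affine_dependent C" by (rule cell_obtain[OF K])
 then have "Fc \<in> (%v. convex hull (C - {v})) ` C" using facets_eq[OF C(1,3)] Fc by blast
 then show ?thesis using that C by blast
qed

lemma finite_facets: "K \<in> T ==> finite {Fc. Fc facet_of K}"
proof -
 assume K: "K \<in> T"
 obtain C bc gr where C: "mesh_cell U C bc gr" "K = convex hull C" "\<not> affine_dependent C" by (rule cell_obtain[OF K])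
 interpret mesh_cell U C bc gr by (rule C(1))
 show ?thesis using facets_eq[OF C(1,3)] finC C(2) by simp
qed

lemma mesh_cell_aff_dim: "K \<in> T ==> aff_dim K = int DIM('a)"
 using mesh_simplex aff_dim_simplex by blast

lemma mesh_cell_convex: "K \<in> T ==> convex K"
 using mesh_simplex convex_simplex by blast

lemma mesh_cell_closed: "K \<in> T ==> closed K"
 using mesh_simplex closed_simplex by blast

lemma mesh_cell_compact: "K \<in> T ==> compact K"
 using mesh_simplex compact_simplex by blast

text \<open>By conformity a cell contained in another one is a face of it, and a proper face would
  have smaller dimension.\<close>

lemma mesh_cells_not_nested:
 assumes K: "K \<in> T" "K' \<in> T" "K \<inter> K' = K" shows "K = K'"
proof (rule ccontr)
 assume "K \<noteq> K'"
 have "K' \<inter> K face_of K'" by (rule mesh_face) (use K in auto)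
 moreover have "K' \<inter> K = K" using K(3) by blast
 ultimately have "K face_of K'" by simp
 then have "aff_dim K < aff_dim K'" using face_of_aff_dim_lt[OF mesh_cell_convex[OF K(2)]] \<open>K \<noteq> K'\<close> by blast
 then show False using mesh_cell_aff_dim K by simp
qed

lemma interiors_disjoint:
 assumes K: "K \<in> T" "K' \<in> T" "K \<noteq> K'" shows "interior K \<inter> interior K' = {}"
proof -
 have "K \<inter> K' \<noteq> K" using mesh_cells_not_nested K by blast
 then have "(K \<inter> K') \<inter> interior K = {}" by (rule face_of_disjoint_interior[OF mesh_face[OF K(1,2)]])
 then show ?thesis using interior_subset by blast
qed

lemma facet_side:
 assumes K: "K \<in> T" and Fc: "Fc facet_of K" and y: "y \<in> rel_interior Fc"
 shows "\<forall>\<^sub>F s in at_right 0. y + s *\<^sub>R inner_normal K Fc \<in> interior K"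
  and "0 < s ==> y - s *\<^sub>R inner_normal K Fc \<notin> K"
proof -
 obtain C bc gr v where C: "mesh_cell U C bc gr" "K = convex hull C" "\<not> affine_dependent C" "v \<in> C" "Fc = convex hull (C - {v})"
  by (rule pair_obtain[OF K Fc])
 interpret mesh_cell U C bc gr by (rule C(1))
 have y': "y \<in> rel_interior (facet v)" using y C(5) by simp
 note p = rel_interior_facet_pos[OF C(3,4) y']
 show "\<forall>\<^sub>F s in at_right 0. y + s *\<^sub>R inner_normal K Fc \<in> interior K"
  unfolding C(2,5) inner_normal_facet[OF C(4)] by (rule inward_interior[OF C(4) p])
 show "y - s *\<^sub>R inner_normal K Fc \<notin> K" if "0 < s"
  unfolding C(2,5) inner_normal_facet[OF C(4)] by (rule outward_notin[OF C(4) p(1) that])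
qed

lemma facet_rel_interior_nonempty:
 assumes K: "K \<in> T" and Fc: "Fc facet_of K" shows "rel_interior Fc \<noteq> {}"
 using Fc mesh_cell_convex[OF K] facet_of_imp_face_of face_of_imp_convex rel_interior_eq_empty
 by (metis facet_of_def)

text \<open>Both unit normals are orthogonal to the common facet, so they agree up to sign. If they
  were equal, points slightly off the relative interior of the facet would lie in the interiors of
  both cells.\<close>

lemma opposite_normals:
 assumes K: "K \<in> T" "Fc facet_of K" and K': "K' \<in> T" "Fc facet_of K'" and ne: "K \<noteq> K'"
 shows "inner_normal K' Fc = - inner_normal K Fc"
proof -
 obtain C bc gr v where C: "mesh_cell U C bc gr" "K = convex hull C" "\<not> affine_dependent C" "v \<in> C" "Fc = convex hull (C - {v})"
  by (rule pair_obtain[OF K])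
 obtain C' bc' gr' v' where C': "mesh_cell U C' bc' gr'" "K' = convex hull C'" "\<not> affine_dependent C'" "v' \<in> C'" "Fc = convex hull (C' - {v'})"
  by (rule pair_obtain[OF K'])
 interpret A: mesh_cell U C bc gr by (rule C(1))
 interpret B: mesh_cell U C' bc' gr' by (rule C'(1))
 have n: "inner_normal K Fc = A.nrm v" unfolding C(2,5) by (rule A.inner_normal_facet[OF C(4)])
 have n': "inner_normal K' Fc = B.nrm v'" unfolding C'(2,5) by (rule B.inner_normal_facet[OF C'(4)])
 have perp: "B.nrm v' \<bullet> (w' - w) = 0" if "w \<in> convex hull (C - {v})" "w' \<in> convex hull (C - {v})" for w w'
 proof -
  have "w \<in> convex hull (C' - {v'})" "w' \<in> convex hull (C' - {v'})" using that C(5) C'(5) by auto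
  then show ?thesis using B.nrm_facet[OF C'(4), of w w'] B.facet_eq[OF C'(4)] by auto
 qed
 have "B.nrm v' = A.nrm v \<or> B.nrm v' = - A.nrm v"
  by (rule A.unit_normal_facet[OF C(4) B.norm_nrm[OF C'(4)] perp])
 moreover have "B.nrm v' \<noteq> A.nrm v"
 proof
  assume eq: "B.nrm v' = A.nrm v"
  obtain y where y: "y \<in> rel_interior Fc" using facet_rel_interior_nonempty[OF K] by blast
  have "\<forall>\<^sub>F s in at_right 0. y + s *\<^sub>R A.nrm v \<in> interior K \<and> y + s *\<^sub>R A.nrm v \<in> interior K'"
   using facet_side(1)[OF K y] facet_side(1)[OF K' y] unfolding n n' eq by eventually_elim simp
  then obtain s :: real where "y + s *\<^sub>R A.nrm v \<in> interior K \<inter> interior K'"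
   using eventually_happens[of _ "at_right (0::real)"] by (auto simp: trivial_limit_at_right_real)
  then show False using interiors_disjoint[OF K(1) K'(1) ne] by blast
 qed
 ultimately show ?thesis using n n' by simp
qed

lemma inner_normal_norm:
 assumes "K \<in> T" "Fc facet_of K" shows "norm (inner_normal K Fc) = 1"
proof -
 obtain C bc gr v where C: "mesh_cell U C bc gr" "K = convex hull C" "\<not> affine_dependent C" "v \<in> C" "Fc = convex hull (C - {v})"
  by (rule pair_obtain[OF assms])
 interpret A: mesh_cell U C bc gr by (rule C(1))
 show ?thesis unfolding C(2,5) A.inner_normal_facet[OF C(4)] by (rule A.norm_nrm[OF C(4)])
qed

text \<open>The facet is crossed at a point of its relative interior that lies in \<open>U\<close>.
  Some cell contains points arbitrarily close beyond it; conformity makes the intersection of this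
  cell with \<open>K\<close> a common face, and counting dimensions identifies that face with the
  facet.\<close>

lemma neighbour_exists:
 assumes K: "K \<in> T" and Fc: "Fc facet_of K" and int: "\<not> Fc \<subseteq> frontier U"
 shows "\<exists>K'. K' \<in> T \<and> K' \<noteq> K \<and> Fc facet_of K'"
proof -
 have face: "Fc face_of K" and sub: "Fc \<subseteq> K" using Fc by (auto simp: facet_of_imp_face_of facet_of_imp_subset)
 have conv: "convex Fc" using face face_of_imp_convex mesh_cell_convex[OF K] by blast
 have "Fc \<subseteq> closure U" using sub K mesh_Union by blast
 then have "U \<inter> Fc \<noteq> {}" using int open_dom by (auto simp: frontier_def interior_open)
 \<comment> \<open>The hypothesis provides some point of the facet in the open set \<open>U\<close>;
   density of the relative interior in the facet moves it there.\<close>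
 then have "U \<inter> closure (rel_interior Fc) \<noteq> {}"
  using convex_closure_rel_interior[OF conv] closure_subset by blast
 then obtain y where y: "y \<in> U" "y \<in> rel_interior Fc"
  using open_Int_closure_eq_empty[OF open_dom, of "rel_interior Fc"] by blast
 define n where "n = inner_normal K Fc"
 have lim: "((%s. y - s *\<^sub>R n) \<longlongrightarrow> y - 0 *\<^sub>R n) (at_right 0)" by (intro tendsto_intros)
 then have "\<forall>\<^sub>F s in at_right 0. y - s *\<^sub>R n \<in> U"
  using y(1) open_dom by (intro topological_tendstoD) auto
 then have ev: "\<forall>\<^sub>F s in at_right 0. \<exists>K'\<in>T. y - s *\<^sub>R n \<in> K'"
 proof eventually_elim
  case (elim s)
  then show ?case using mesh_Union closure_subset[of U] by blast
 qed
 \<comment> \<open>Otherwise each of the finitely many cells would be avoided for all small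
   \<open>s\<close>, hence all of them at once, although they cover \<open>U\<close>.\<close>
 have "\<exists>K'\<in>T. \<exists>\<^sub>F s in at_right 0. y - s *\<^sub>R n \<in> K'"
 proof (rule ccontr)
  assume "\<not> ?thesis"
  then have "\<forall>\<^sub>F s in at_right 0. \<forall>K'\<in>T. y - s *\<^sub>R n \<notin> K'"
   by (intro eventually_ball_finite[OF finite_mesh]) (auto simp: frequently_def)
  with ev have "\<forall>\<^sub>F s in at_right (0::real). False" by eventually_elim blast
  then show False by (simp add: trivial_limit_at_right_real eventually_False)
 qed
 then obtain K' where K': "K' \<in> T" "\<exists>\<^sub>F s in at_right 0. y - s *\<^sub>R n \<in> K'" by blast
 have "y \<in> K'"
 proof (rule ccontr)
  assume "y \<notin> K'"
  then have "\<forall>\<^sub>F s in at_right 0. y - s *\<^sub>R n \<in> - K'"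
   using mesh_cell_closed[OF K'(1)] by (intro topological_tendstoD[OF lim]) auto
  then show False using K'(2) by (simp add: frequently_def)
 qed
 have "K' \<noteq> K"
 proof
  assume "K' = K"
  have "\<forall>\<^sub>F s in at_right (0::real). 0 < s" by (rule eventually_at_right_less)
  then have "\<forall>\<^sub>F s in at_right 0. y - s *\<^sub>R n \<notin> K"
   by eventually_elim (use facet_side(2)[OF K Fc y(2)] in \<open>simp add: n_def\<close>)
  then show False using K'(2) \<open>K' = K\<close> by (simp add: frequently_def)
 qed
 define F where "F = K \<inter> K'"
 have FK: "F face_of K" unfolding F_def by (rule mesh_face[OF K K'(1)])
 have FK': "F face_of K'" unfolding F_def using mesh_face[OF K'(1) K] by (simp add: Int_commute)
 have yF: "y \<in> F" using \<open>y \<in> K'\<close> y(2) rel_interior_subset sub by (auto simp: F_def)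
 \<comment> \<open>A face that meets the relative interior of a subset of \<open>K\<close> contains
   this subset.\<close>
 have "Fc \<subseteq> F" using subset_of_face_of[OF FK sub] yF y(2) by blast
 have "F \<noteq> K" using mesh_cells_not_nested[OF K K'(1)] \<open>K' \<noteq> K\<close> by (auto simp: F_def)
 then have "aff_dim F < aff_dim K" by (rule face_of_aff_dim_lt[OF mesh_cell_convex[OF K] FK])
 moreover have ad: "aff_dim Fc = aff_dim K - 1" using Fc by (simp add: facet_of_def)
 moreover have "aff_dim Fc \<le> aff_dim F" by (rule aff_dim_subset[OF \<open>Fc \<subseteq> F\<close>])
 ultimately have adF: "aff_dim Fc = aff_dim F" by linarith
 have "Fc face_of F" by (rule face_of_subset[OF face \<open>Fc \<subseteq> F\<close>]) (auto simp: F_def)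
 moreover have "convex F" using FK face_of_imp_convex mesh_cell_convex[OF K] by blast
 ultimately have "Fc = F" using face_of_aff_dim_lt[of F Fc] adF by fastforce
 then have "Fc facet_of K'"
  using FK' ad mesh_cell_aff_dim[OF K] mesh_cell_aff_dim[OF K'(1)] yF by (auto simp: facet_of_def)
 then show ?thesis using K' \<open>K' \<noteq> K\<close> by blast
qed

text \<open>With three cells at one facet the normals would be pairwise opposite, so a unit vector
  would equal its own negative.\<close>

lemma neighbour_unique:
 assumes K: "K \<in> T" "Fc facet_of K"
  and A: "A \<in> T" "A \<noteq> K" "Fc facet_of A" and B: "B \<in> T" "B \<noteq> K" "Fc facet_of B"
 shows "A = B"
proof (rule ccontr)
 assume "A \<noteq> B"
 then have *: "inner_normal B Fc = - inner_normal A Fc" "inner_normal A Fc = - inner_normal K Fc" "inner_normal B Fc = - inner_normal K Fc"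
  using opposite_normals A B K by metis+
 then have q: "inner_normal K Fc = - inner_normal K Fc" by simp
 have "inner_normal K Fc + inner_normal K Fc = 0" by (subst (2) q) simp
 then have "2 *\<^sub>R inner_normal K Fc = 0" by (simp only: scaleR_2)
 then have "inner_normal K Fc = 0" by simp
 then show False using inner_normal_norm[OF K] by simp
qed

definition nb where "nb K Fc = (THE K'. K' \<in> T \<and> K' \<noteq> K \<and> Fc facet_of K')"

lemma nb_props:
 assumes "K \<in> T" "Fc facet_of K" "\<not> Fc \<subseteq> frontier U"
 shows "nb K Fc \<in> T" "nb K Fc \<noteq> K" "Fc facet_of nb K Fc"
proof -
 have "\<exists>!K'. K' \<in> T \<and> K' \<noteq> K \<and> Fc facet_of K'"
  using neighbour_exists[OF assms] neighbour_unique[OF assms(1,2)] by blast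
 from theI'[OF this] show "nb K Fc \<in> T" "nb K Fc \<noteq> K" "Fc facet_of nb K Fc" by (auto simp: nb_def)
qed

lemma nb_nb:
 assumes "K \<in> T" "Fc facet_of K" "\<not> Fc \<subseteq> frontier U" shows "nb (nb K Fc) Fc = K"
 using neighbour_unique[OF nb_props(1,3)[OF assms] nb_props[OF nb_props(1,3)[OF assms] assms(3)], of K] assms nb_props(2)[OF assms]
 by metis

text \<open>The case outside \<open>K\<close> matters because \<open>edge_res\<close> has to be
  measurable on the whole space. There the filter is trivial, every value is a limit, and
  \<open>Lim\<close> returns the same unspecified constant at all points.\<close>

lemma cell_grad_eq:
 assumes K: "K \<in> T" and q: "C1_grad q G" and v: "\<And>x. x \<in> K ==> v x = q x"
 shows "cell_grad K v x = (if x \<in> K then G x else (THE l. True))"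
proof -
 obtain C bc gr where C: "mesh_cell U C bc gr" "K = convex hull C" "\<not> affine_dependent C" by (rule cell_obtain[OF K])
 interpret mesh_cell U C bc gr by (rule C(1))
 have ine: "interior K \<noteq> {}" using interior_cell_nonempty C(2) by simp
 have cl: "closure (interior K) = K"
  using convex_closure_interior[OF mesh_cell_convex[OF K] ine] mesh_cell_closed[OF K] by simp
 show ?thesis
 proof (cases "x \<in> K")
  case True
  have "x islimpt interior K"
  proof (cases "x \<in> interior K")
   case True
   then show ?thesis by (intro interior_limit_point) simp
  next
   case False
   then show ?thesis using True cl by (metis closure_def Un_iff mem_Collect_eq)
  qed
  then have nt: "at x within interior K \<noteq> bot" by (simp add: trivial_limit_within)
  have "(G \<longlongrightarrow> G x) (at x within interior K)"
   using C1_grad_cont[OF q] by (meson UNIV_I continuous_on_def tendsto_within_subset top_greatest)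
  moreover have "\<forall>\<^sub>F y in at x within interior K. G y = grad v y"
   unfolding eventually_at_filter
   by (rule always_eventually) (use grad_transform_open[OF open_interior _ _ q] v interior_subset in \<open>metis subsetD\<close>)
  ultimately have "(grad v \<longlongrightarrow> G x) (at x within interior K)" by (rule Lim_transform_eventually)
  then show ?thesis using True nt by (simp add: cell_grad_def tendsto_Lim)
 next
  case False
  then have "\<not> x islimpt interior K" using cl by (metis closure_def Un_iff mem_Collect_eq)
  then have "at x within interior K = bot" by (simp add: trivial_limit_within)
  then show ?thesis using False by (simp add: cell_grad_def t2_space_class.Lim_def)
 qed
qed

end

lemma C1_grad_L2_closed:
 "Ck 2 f ==> S \<in> sets lebesgue ==> bounded S ==> grad f \<in> L2 S"
 "Ck 2 f ==> S \<in> sets lebesgue ==> bounded S ==> lap f \<in> L2 S"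
proof -
 assume f: "Ck 2 f" and S: "S \<in> sets lebesgue" "bounded S"
 show "grad f \<in> L2 S" by (rule C1_grad_L2(2)[OF Ck2_C1_grad[OF f] S])
 show "lap f \<in> L2 S" unfolding lap_def[abs_def]
 proof (rule L2_sum)
  fix b :: 'a assume b: "b \<in> Basis"
  have g: "grad (%y. grad f y \<bullet> b) \<in> L2 S" by (rule C1_grad_L2(2)[OF Ck_component_C1_grad[OF f b] S])
  show "(%x. grad (%y. grad f y \<bullet> b) x \<bullet> b) \<in> L2 S"
  proof -
   have "(%x. b \<bullet> grad (%y. grad f y \<bullet> b) x) \<in> L2 S"
    by (rule L2_bounded_mult(1)[OF S(1) _ _ g, of _ "norm b"]) auto
   also have "(%x. b \<bullet> grad (%y. grad f y \<bullet> b) x) = (%x. grad (%y. grad f y \<bullet> b) x \<bullet> b)"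
    by (rule ext) (rule inner_commute)
   finally show ?thesis .
  qed
 qed
qed

section \<open>Summation over all cells and the two sides of a facet\<close>

context simplicial_mesh
begin

lemma gauss_mesh_cell:
 assumes K: "K \<in> T" and q: "Ck 2 q" and \<phi>: "\<phi> \<in> test_fun U"
 shows "ip K (grad \<phi>) (grad q) + ip K \<phi> (lap q)
  = - (\<Sum>Fc | Fc facet_of K. LINT x|fmeas Fc. \<phi> x * (inner_normal K Fc \<bullet> grad q x))"
proof -
 obtain C bc gr where C: "mesh_cell U C bc gr" "K = convex hull C" "\<not> affine_dependent C" by (rule cell_obtain[OF K])
 interpret mesh_cell U C bc gr by (rule C(1))
 have W: "C1_grad (%x. grad q x \<bullet> b) (grad (%x. grad q x \<bullet> b))" if "b \<in> Basis" for b by (rule Ck_component_C1_grad[OF q that])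
 have "ip K (grad \<phi>) (grad q) + ip K \<phi> (lap q) = (LINT x|leb cell. grad \<phi> x \<bullet> grad q x + \<phi> x * lap q x)"
  unfolding ip_def C(2) inner_real_def
  by (intro integral_add[symmetric] integrable_cell_continuous continuous_intros
   lap_continuous[OF q] grad_continuous[OF q] test_fun_continuous[OF \<phi>] test_fun_grad_continuous[OF \<phi>])
 also have "\<dots> = - (\<Sum>v\<in>C. LINT x|fmeas (facet v). \<phi> x * (nrm v \<bullet> grad q x))"
  unfolding lap_def by (rule gauss_cell_field[OF test_fun_C1_grad[OF \<phi>] W])
 also have "(\<Sum>v\<in>C. LINT x|fmeas (facet v). \<phi> x * (nrm v \<bullet> grad q x))
  = (\<Sum>Fc\<in>facet ` C. LINT x|fmeas Fc. \<phi> x * (inner_normal K Fc \<bullet> grad q x))"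
  by (subst sum.reindex[OF inj_facet]) (auto intro!: sum.cong simp: C(2) inner_normal_facet)
 finally show ?thesis unfolding facets_eq[OF C(1,3), folded C(2)] .
qed

text \<open>Collects the facts on a facet in a form that mentions no vertex set, for use with all
  facets of the mesh.\<close>

lemma facet_facts:
 assumes K: "K \<in> T" and Fc: "Fc facet_of K"
 shows "AE x in fmeas Fc. x \<in> Fc"
  and "sets (fmeas Fc) = sets borel"
  and "\<And>f :: 'a \<Rightarrow> real. continuous_on UNIV f ==> integrable (fmeas Fc) f"
  and "\<And>w \<psi> E M. w \<in> H10 U ==> (\<And>n::nat. \<psi> n \<in> test_fun U) ==> (%n. H1n U (%x. \<psi> n x - w x)) ----> 0 ==>
   E \<in> borel_measurable borel ==> (\<And>x. x \<in> Fc ==> \<bar>E x\<bar> \<le> M) ==>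
   (%n. LINT x|fmeas Fc. E x * \<psi> n x) ----> (LINT x|fmeas Fc. E x * facet_trace U Fc w x)"
  and "compact Fc"
proof -
 obtain C bc gr v where C: "mesh_cell U C bc gr" "K = convex hull C" "\<not> affine_dependent C" "v \<in> C" "Fc = convex hull (C - {v})"
  by (rule pair_obtain[OF K Fc])
 interpret A: mesh_cell U C bc gr by (rule C(1))
 show "AE x in fmeas Fc. x \<in> Fc" unfolding C(5) by (rule A.AE_facet_measure[OF C(4)])
 show "sets (fmeas Fc) = sets borel" unfolding C(5) by (rule A.sets_facet_measure)
 show "integrable (fmeas Fc) f" if "continuous_on UNIV f" for f :: "'a \<Rightarrow> real"
  unfolding C(5) by (rule A.integrable_facet_continuous[OF C(4) that])
 show "(%n. LINT x|fmeas Fc. E x * \<psi> n x) ----> (LINT x|fmeas Fc. E x * facet_trace U Fc w x)"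
  if "w \<in> H10 U" "\<And>n::nat. \<psi> n \<in> test_fun U" "(%n. H1n U (%x. \<psi> n x - w x)) ----> 0"
   "E \<in> borel_measurable borel" "\<And>x. x \<in> Fc ==> \<bar>E x\<bar> \<le> M" for w \<psi> E M
  unfolding C(5) by (rule A.facet_trace_limit[OF C(4) that[unfolded C(5)]])
 show "compact Fc" unfolding C(5) by (rule A.compact_facet)
qed

lemma ip_mesh_cell_interior:
 assumes "K \<in> T" shows "ip K f g = ip (interior K) f g"
proof -
 obtain C bc gr where C: "mesh_cell U C bc gr" "K = convex hull C" "\<not> affine_dependent C" by (rule cell_obtain[OF assms])
 interpret mesh_cell U C bc gr by (rule C(1))
 show ?thesis unfolding C(2) by (rule ip_cell_interior)
qed

context
 fixes D :: "'a setting" and v :: "'a \<Rightarrow> real" and q :: "'a set \<Rightarrow> 'a \<Rightarrow> real"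
 assumes D: "Om D = U" and q: "\<And>K. K \<in> T ==> Ck 2 (q K)" and vq: "\<And>K x. K \<in> T ==> x \<in> K ==> v x = q K x"
begin

lemma edge_res_boundary: "Fc \<subseteq> frontier U ==> edge_res D T K Fc v x = 0"
 by (simp add: edge_res_def D)

lemma edge_res_interior:
 assumes K: "K \<in> T" and Fc: "Fc facet_of K" and int: "\<not> Fc \<subseteq> frontier U"
 shows "edge_res D T K Fc v \<in> borel_measurable borel"
  and "x \<in> Fc ==> edge_res D T K Fc v x = 1 / 2 * eps D * (inner_normal K Fc \<bullet> (grad (q (nb K Fc)) x - grad (q K) x))"
proof -
 note nb = nb_props[OF K Fc int]
 have e: "edge_res D T K Fc v x = 1 / 2 * (inner_normal K Fc \<bullet> (eps D *\<^sub>R (if x \<in> nb K Fc then grad (q (nb K Fc)) x else (THE l. True))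
   - eps D *\<^sub>R (if x \<in> K then grad (q K) x else (THE l. True))))" for x
  using cell_grad_eq[OF nb(1) Ck2_C1_grad[OF q[OF nb(1)]] vq[OF nb(1)], of x] cell_grad_eq[OF K Ck2_C1_grad[OF q[OF K]] vq[OF K], of x] int
  unfolding edge_res_def D Let_def nb_def[symmetric] by simp
 have m [measurable]: "grad (q K) \<in> borel_measurable borel" "grad (q (nb K Fc)) \<in> borel_measurable borel"
  using grad_continuous[OF q[OF K]] grad_continuous[OF q[OF nb(1)]] by (auto intro: borel_measurable_continuous_onI)
 have [measurable]: "K \<in> sets borel" "nb K Fc \<in> sets borel"
  using mesh_cell_closed[OF K] mesh_cell_closed[OF nb(1)] by auto
 show "edge_res D T K Fc v \<in> borel_measurable borel"
  unfolding e[abs_def] by measurable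
 assume "x \<in> Fc"
 then have "x \<in> K" "x \<in> nb K Fc" using facet_of_imp_subset[OF Fc] facet_of_imp_subset[OF nb(3)] by auto
 then show "edge_res D T K Fc v x = 1 / 2 * eps D * (inner_normal K Fc \<bullet> (grad (q (nb K Fc)) x - grad (q K) x))"
  unfolding e by (simp add: inner_diff_right algebra_simps)
qed

text \<open>An inner facet belongs to two cells with opposite normals. The factor 1/2 in
  \<open>edge_res\<close> shares the jump between them, so the sum over all pairs of a cell and a
  facet contains each one-sided normal derivative exactly once. On boundary facets the test function
  vanishes.\<close>

lemma edge_sum_test:
 assumes \<phi>: "\<phi> \<in> test_fun U"
 shows "(\<Sum>K\<in>T. \<Sum>Fc | Fc facet_of K. LINT x|fmeas Fc. edge_res D T K Fc v x * \<phi> x)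
  = eps D * (\<Sum>K\<in>T. ip K (grad \<phi>) (grad (q K)) + ip K \<phi> (lap (q K)))"
proof -
 define a where "a K Fc = (LINT x|fmeas Fc. \<phi> x * (inner_normal K Fc \<bullet> grad (q K) x))" for K Fc
 define P where "P = (SIGMA K:T. {Fc. Fc facet_of K})"
 define I where "I Fc \<longleftrightarrow> \<not> Fc \<subseteq> frontier U" for Fc
 define PI where "PI = {(K, Fc) \<in> P. I Fc}"
 have finP: "finite P" unfolding P_def using finite_mesh finite_facets by (intro finite_SigmaI) auto
 have fr: "\<phi> x = 0" if "x \<in> frontier U" for x
 proof -
  obtain Q where Q: "Q \<subseteq> U" "\<And>x. x \<notin> Q ==> \<phi> x = 0" using test_funE[OF \<phi>] by metis
  have "x \<notin> U" using that open_dom by (simp add: frontier_def interior_open)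
  then show ?thesis using Q by blast
 qed
 have cont: "continuous_on UNIV (%x. \<phi> x * (n \<bullet> grad (q K) x))" if "K \<in> T" for K n
  by (intro continuous_intros test_fun_continuous[OF \<phi>] grad_continuous[OF q[OF that]])
 have a0: "a K Fc = 0" if "K \<in> T" "Fc facet_of K" "Fc \<subseteq> frontier U" for K Fc
 proof -
  have "AE x in fmeas Fc. \<phi> x * (inner_normal K Fc \<bullet> grad (q K) x) = 0"
   using facet_facts(1)[OF that(1,2)] by eventually_elim (use fr that(3) in auto)
  then show ?thesis unfolding a_def by (rule integral_eq_zero_AE)
 qed
 \<comment> \<open>Because the inner normals of the two cells are opposite, the jump becomes a sum
   of two one-sided normal derivatives with equal signs.\<close>
 have E: "(LINT x|fmeas Fc. edge_res D T K Fc v x * \<phi> x) = - (1 / 2 * eps D) * (a K Fc + a (nb K Fc) Fc)"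
  if KG: "K \<in> T" "Fc facet_of K" "\<not> Fc \<subseteq> frontier U" for K Fc
 proof -
  note nb = nb_props[OF KG]
  have sb: "borel_measurable (fmeas Fc) = borel_measurable borel"
   by (rule measurable_cong_sets[OF facet_facts(2)[OF KG(1,2)] refl])
  have n: "inner_normal (nb K Fc) Fc = - inner_normal K Fc"
   by (rule opposite_normals[OF KG(1,2) nb(1,3)]) (use nb(2) in auto)
  have "(LINT x|fmeas Fc. edge_res D T K Fc v x * \<phi> x)
   = (LINT x|fmeas Fc. - (1 / 2 * eps D) * (\<phi> x * (inner_normal K Fc \<bullet> grad (q K) x) + \<phi> x * (inner_normal (nb K Fc) Fc \<bullet> grad (q (nb K Fc)) x)))"
  proof (rule integral_cong_AE)
   have [measurable]: "\<phi> \<in> borel_measurable borel" by (rule borel_measurable_continuous_onI) (rule test_fun_continuous[OF \<phi>])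
   have [measurable]: "edge_res D T K Fc v \<in> borel_measurable borel" by (rule edge_res_interior(1)[OF KG])
   have [measurable]: "grad (q K) \<in> borel_measurable borel" "grad (q (nb K Fc)) \<in> borel_measurable borel"
    using grad_continuous[OF q[OF KG(1)]] grad_continuous[OF q[OF nb(1)]] by (auto intro: borel_measurable_continuous_onI)
   show "(%x. edge_res D T K Fc v x * \<phi> x) \<in> borel_measurable (fmeas Fc)" unfolding sb by measurable
   show "(%x. - (1 / 2 * eps D) * (\<phi> x * (inner_normal K Fc \<bullet> grad (q K) x) + \<phi> x * (inner_normal (nb K Fc) Fc \<bullet> grad (q (nb K Fc)) x))) \<in> borel_measurable (fmeas Fc)"
    unfolding sb by measurable
   show "AE x in fmeas Fc. edge_res D T K Fc v x * \<phi> x = - (1 / 2 * eps D) * (\<phi> x * (inner_normal K Fc \<bullet> grad (q K) x) + \<phi> x * (inner_normal (nb K Fc) Fc \<bullet> grad (q (nb K Fc)) x))"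
    using facet_facts(1)[OF KG(1,2)]
    by eventually_elim (simp add: edge_res_interior(2)[OF KG] n inner_diff_right algebra_simps)
  qed
  also have "\<dots> = - (1 / 2 * eps D) * (a K Fc + a (nb K Fc) Fc)"
   unfolding a_def using facet_facts(3)[OF KG(1,2)] cont[OF KG(1)] cont[OF nb(1)] by simp
  finally show ?thesis .
 qed
 have nbI: "nb K Fc \<in> T" "Fc facet_of nb K Fc" "nb (nb K Fc) Fc = K" if "K \<in> T" "Fc facet_of K" "I Fc" for K Fc
  using nb_props[OF that(1,2)] nb_nb[OF that(1,2)] that(3) unfolding I_def by blast+
 have EI: "(LINT x|fmeas Fc. edge_res D T K Fc v x * \<phi> x) = - (1 / 2 * eps D) * (a K Fc + a (nb K Fc) Fc)"
  if "K \<in> T" "Fc facet_of K" "I Fc" for K Fc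
  using E that unfolding I_def by blast
 \<comment> \<open>Passing to the neighbour is an involution on the pairs with an inner
   facet.\<close>
 have bij: "(\<Sum>(K, Fc)\<in>PI. a (nb K Fc) Fc) = (\<Sum>(K, Fc)\<in>PI. a K Fc)"
  by (rule sum.reindex_bij_witness[where i = "%(K, Fc). (nb K Fc, Fc)" and j = "%(K, Fc). (nb K Fc, Fc)"])
   (auto simp: PI_def P_def nbI)
 have "(\<Sum>K\<in>T. \<Sum>Fc | Fc facet_of K. LINT x|fmeas Fc. edge_res D T K Fc v x * \<phi> x)
   = (\<Sum>(K, Fc)\<in>P. LINT x|fmeas Fc. edge_res D T K Fc v x * \<phi> x)"
  unfolding P_def using finite_mesh finite_facets by (intro sum.Sigma) auto
 also have "\<dots> = (\<Sum>(K, Fc)\<in>PI. LINT x|fmeas Fc. edge_res D T K Fc v x * \<phi> x)"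
  using finP by (intro sum.mono_neutral_right) (auto simp: PI_def I_def edge_res_boundary)
 also have "\<dots> = (\<Sum>(K, Fc)\<in>PI. - (1 / 2 * eps D) * (a K Fc + a (nb K Fc) Fc))"
  by (intro sum.cong refl) (auto simp: PI_def P_def EI)
 also have "\<dots> = - (1 / 2 * eps D) * ((\<Sum>(K, Fc)\<in>PI. a K Fc) + (\<Sum>(K, Fc)\<in>PI. a (nb K Fc) Fc))"
  unfolding sum.distrib[symmetric] sum_distrib_left by (intro sum.cong refl) auto
 also have "\<dots> = - eps D * (\<Sum>(K, Fc)\<in>PI. a K Fc)" unfolding bij by simp
 also have "(\<Sum>(K, Fc)\<in>PI. a K Fc) = (\<Sum>(K, Fc)\<in>P. a K Fc)"
  using finP by (intro sum.mono_neutral_left) (auto simp: PI_def P_def I_def a0)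
 also have "\<dots> = (\<Sum>K\<in>T. \<Sum>Fc | Fc facet_of K. a K Fc)"
  unfolding P_def using finite_mesh finite_facets by (intro sum.Sigma[symmetric]) auto
 also have "\<dots> = - (\<Sum>K\<in>T. ip K (grad \<phi>) (grad (q K)) + ip K \<phi> (lap (q K)))"
  unfolding sum_negf[symmetric] by (intro sum.cong refl) (simp add: gauss_mesh_cell q \<phi> a_def)
 finally show ?thesis by simp
qed

lemma tendsto_ip_cell:
 assumes K: "K \<in> T" and f: "\<And>n. f n \<in> L2 U" "f' \<in> L2 U" and lim: "(%n::nat. L2n U (%x. f n x - f' x)) ----> 0"
  and g: "g \<in> L2 (interior K)"
 shows "(%n. ip K (f n) g) ----> ip K f' g"
proof -
 have sub: "interior K \<subseteq> U" "interior K \<in> sets lebesgue" using interior_mesh_cell[OF K] by auto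
 have L: "h \<in> L2 (interior K)" if "h \<in> L2 U" for h :: "'a \<Rightarrow> 'b"
  by (rule L2_subset[OF that sub dom_lebesgue])
 have "(%n. L2n (interior K) (%x. f n x - f' x)) ----> 0"
 proof (rule Lim_null_comparison[OF _ lim], rule always_eventually, rule allI)
  show "norm (L2n (interior K) (%x. f n x - f' x)) \<le> L2n U (%x. f n x - f' x)" for n
   using L2n_mono_set[OF L2_diff[OF f] sub dom_lebesgue, of n] by (simp add: L2n_nonneg)
 qed
 then show ?thesis unfolding ip_mesh_cell_interior[OF K] by (intro tendsto_ip_left L f g)
qed

text \<open>Both sides are continuous along test functions that tend to \<open>w\<close> in
  \<open>H1n\<close>: the cell terms by Cauchy-Schwarz, the facet terms by the limit property of the
  trace.\<close>

lemma mesh_ibp: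
 assumes w: "w \<in> H10 U"
 shows "(\<Sum>K\<in>T. edge_pairing D T K v w) = eps D * (\<Sum>K\<in>T. ip K (wgrad U w) (grad (q K)) + ip K w (lap (q K)))"
proof -
 obtain \<psi> where \<psi>: "\<And>n::nat. \<psi> n \<in> test_fun U" "(%n. H1n U (%x. \<psi> n x - w x)) ----> 0"
  using w by (auto simp: H10_def)
 have wL: "w \<in> L2 U" "wgrad U w \<in> L2 U" using w by (auto intro: H10_L2 wgrad_L2 H10_H1)
 have "(%n. L2n U (%x. \<psi> n x - w x)) ----> 0"
  by (rule Lim_null_comparison[OF _ \<psi>(2)]) (auto simp: L2n_nonneg L2n_le_H1n intro!: always_eventually)
 note l1 = this
 have "(%n. L2n U (%x. grad (\<psi> n) x - wgrad U w x)) ----> 0"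
 proof (rule Lim_null_comparison[OF _ \<psi>(2)], rule always_eventually, rule allI)
  fix n
  have "AE x in leb U. wgrad U (%x. \<psi> n x + (-1) * w x) x = grad (\<psi> n) x + (-1) *\<^sub>R wgrad U w x"
   by (rule wgrad_AE[OF has_wgrad_axpy]) (use \<psi>(1) w in \<open>auto intro: test_fun_L2 test_fun_has_wgrad H10_L2 H10_H1 H1_has_wgrad\<close>)
  then have "L2n U (wgrad U (%x. \<psi> n x - w x)) = L2n U (%x. grad (\<psi> n) x - wgrad U w x)"
   by (intro L2n_cong_AE[OF dom_lebesgue]) simp
  then show "norm (L2n U (%x. grad (\<psi> n) x - wgrad U w x)) \<le> H1n U (%x. \<psi> n x - w x)"
   using L2n_le_H1n(2)[of "%x. \<psi> n x - w x"] by (simp add: L2n_nonneg)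
 qed
 note l2 = this
 have "(%n. eps D * (\<Sum>K\<in>T. ip K (grad (\<psi> n)) (grad (q K)) + ip K (\<psi> n) (lap (q K)))) ---->
   eps D * (\<Sum>K\<in>T. ip K (wgrad U w) (grad (q K)) + ip K w (lap (q K)))"
 proof (intro tendsto_mult tendsto_const tendsto_sum tendsto_add)
  fix K assume K: "K \<in> T"
  have b: "bounded (interior K)" using mesh_cell_compact[OF K] compact_imp_bounded bounded_interior by blast
  show "(%n. ip K (grad (\<psi> n)) (grad (q K))) ----> ip K (wgrad U w) (grad (q K))"
   by (rule tendsto_ip_cell[OF K test_fun_L2(2)[OF \<psi>(1)] wL(2) l2 C1_grad_L2_closed(1)[OF q[OF K] _ b]]) auto
  show "(%n. ip K (\<psi> n) (lap (q K))) ----> ip K w (lap (q K))"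
   by (rule tendsto_ip_cell[OF K test_fun_L2(1)[OF \<psi>(1)] wL(1) l1 C1_grad_L2_closed(2)[OF q[OF K] _ b]]) auto
 qed
 moreover have "(%n. \<Sum>K\<in>T. \<Sum>Fc | Fc facet_of K. LINT x|fmeas Fc. edge_res D T K Fc v x * \<psi> n x) ----> (\<Sum>K\<in>T. edge_pairing D T K v w)"
  unfolding edge_pairing_def D
 proof (intro tendsto_sum)
  fix K Fc assume K: "K \<in> T" and "Fc \<in> {Fc. Fc facet_of K}"
  then have Fc: "Fc facet_of K" by simp
  show "(%n. LINT x|fmeas Fc. edge_res D T K Fc v x * \<psi> n x) ----> (LINT x|fmeas Fc. edge_res D T K Fc v x * facet_trace U Fc w x)"
  proof (cases "Fc \<subseteq> frontier U")
   case True then show ?thesis by (simp add: edge_res_boundary)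
  next
   case False
   note nb = nb_props[OF K Fc False]
   define h where "h x = 1 / 2 * eps D * (inner_normal K Fc \<bullet> (grad (q (nb K Fc)) x - grad (q K) x))" for x
   have "continuous_on Fc h"
    unfolding h_def by (intro continuous_intros grad_continuous[OF q[OF K]] grad_continuous[OF q[OF nb(1)]])
   then have "bounded (h ` Fc)"
    by (intro compact_imp_bounded compact_continuous_image facet_facts(5)[OF K Fc])
   then obtain M where M: "\<forall>y\<in>h ` Fc. norm y \<le> M" unfolding bounded_iff by blast
   have "\<bar>edge_res D T K Fc v x\<bar> \<le> M" if "x \<in> Fc" for x
    using M that edge_res_interior(2)[OF K Fc False that] by (auto simp: h_def)
   then show ?thesis
    by (rule facet_facts(4)[OF K Fc w \<psi> edge_res_interior(1)[OF K Fc False]])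
  qed
 qed
 ultimately show ?thesis unfolding edge_sum_test[OF \<psi>(1)] by (rule LIMSEQ_unique[rotated])
qed

end

end

section \<open>Functions of time with values in a space\<close>

lemma AE_limit_measurable:
 fixes f :: "nat \<Rightarrow> 'a::euclidean_space \<Rightarrow> real"
 assumes S: "S \<in> sets lebesgue" and f: "\<And>n. f n \<in> borel_measurable (leb S)"
  and lim: "AE t in leb S. (%n. f n t) ----> g t"
 shows "g \<in> borel_measurable (leb S)"
proof (rule borel_measurable_lebesgue_on_AE[OF S])
 show "AE t in leb S. lim (%n. f n t) = g t"
  using lim by eventually_elim (rule limI)
 show "(%t. lim (%n. f n t)) \<in> borel_measurable (leb S)"
  using f by (rule borel_measurable_lim_metric)
qed

lemma simple_function_lebesgue_on_subset:
 assumes s: "simple_function (leb S) s" and T: "T \<subseteq> S" "T \<in> sets lebesgue" and S: "S \<in> sets lebesgue"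
 shows "simple_function (leb T) s"
 unfolding simple_function_def
proof (intro conjI ballI)
 show "finite (s ` space (leb T))"
  using s T by (auto simp: simple_function_def intro: finite_subset[of _ "s ` S"])
 fix y assume "y \<in> s ` space (leb T)"
 then have "s -` {y} \<inter> S \<in> sets (leb S)" using s T by (auto simp: simple_function_def)
 then have "s -` {y} \<inter> S \<in> sets lebesgue" using S by (simp add: sets_restrict_space_iff)
 then have "(s -` {y} \<inter> S) \<inter> T \<in> sets lebesgue" using T by blast
 moreover have "(s -` {y} \<inter> S) \<inter> T = s -` {y} \<inter> T" using T by blast
 ultimately show "s -` {y} \<inter> space (leb T) \<in> sets (leb T)" using T by (simp add: sets_restrict_space_iff)
qed

lemma AE_lebesgue_on_subset:
 assumes ae: "AE t in leb S. P t" and T: "T \<subseteq> S" "T \<in> sets lebesgue" and S: "S \<in> sets lebesgue"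
 shows "AE t in leb T. P t"
proof -
 have "AE t in lebesgue. t \<in> S \<longrightarrow> P t" using ae S by (simp add: AE_restrict_space_iff)
 then have "AE t in lebesgue. t \<in> T \<longrightarrow> P t" by eventually_elim (use T in auto)
 then show ?thesis using T by (simp add: AE_restrict_space_iff)
qed

lemma strongly_measurable_subset:
 assumes v: "strongly_measurable S V N v" and T: "T \<subseteq> S" "T \<in> sets lebesgue" and S: "S \<in> sets lebesgue"
 shows "strongly_measurable T V N v"
proof -
 obtain s where s: "\<And>n::nat. simple_function (leb S) (s n)" "\<And>n. s n ` S \<subseteq> V"
  "AE t in leb S. (%n. N (%x. s n t x - v t x)) ----> 0"
  using v by (auto simp: strongly_measurable_def)
 show ?thesis unfolding strongly_measurable_def
  using simple_function_lebesgue_on_subset[OF s(1) T S] s(2) T AE_lebesgue_on_subset[OF s(3) T S]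
  by (intro exI[of _ s]) blast
qed

lemma Lbochner_subset:
 assumes v: "v \<in> Lbochner q S V N" and T: "T \<subseteq> S" "T \<in> sets lebesgue" and S: "S \<in> sets lebesgue"
 shows "v \<in> Lbochner q T V N"
 using v strongly_measurable_subset[OF _ T S] AE_lebesgue_on_subset[OF _ T S] lebesgue_on_integrable_subset[OF _ T S]
 by (auto simp: Lbochner_def)

text \<open>A common frame for \<open>L2\<close>, \<open>H10\<close> and \<open>Hm1\<close>.
  \<open>N\<close> is only a seminorm, because functions that differ on a null set, or functionals
  that differ off \<open>H10\<close>, remain distinct elements.\<close>

locale vspace =
 fixes V :: "('b \<Rightarrow> real) set" and N :: "('b \<Rightarrow> real) \<Rightarrow> real"
 assumes V_zero: "(%x. 0) \<in> V"
  and V_axpy: "v \<in> V ==> w \<in> V ==> (%x. v x + c * w x) \<in> V"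
  and N_nonneg: "v \<in> V ==> 0 \<le> N v"
  and N_triangle: "v \<in> V ==> w \<in> V ==> N (%x. v x + w x) \<le> N v + N w"
  and N_mult: "v \<in> V ==> N (%x. c * v x) = \<bar>c\<bar> * N v"
begin

lemma V_mult: "v \<in> V ==> (%x. c * v x) \<in> V"
 using V_axpy[OF V_zero, of v c] by simp

lemma V_diff: "v \<in> V ==> w \<in> V ==> (%x. v x - w x) \<in> V"
 using V_axpy[of v w "-1"] by simp

lemma N_axpy: "v \<in> V ==> w \<in> V ==> N (%x. v x + c * w x) \<le> N v + \<bar>c\<bar> * N w"
 using N_triangle[of v "%x. c * w x"] N_mult[of w c] V_mult[of w c] by simp

lemma N_diff_commute: "v \<in> V ==> w \<in> V ==> N (%x. v x - w x) = N (%x. w x - v x)"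
 using N_mult[OF V_diff[of w v], of "-1"] by simp

lemma N_diff_abs: "v \<in> V ==> w \<in> V ==> \<bar>N v - N w\<bar> \<le> N (%x. v x - w x)"
proof -
 assume v: "v \<in> V" "w \<in> V"
 have "N v \<le> N (%x. v x - w x) + N w" using N_triangle[OF V_diff[OF v] v(2)] by simp
 moreover have "N w \<le> N (%x. w x - v x) + N v" using N_triangle[OF V_diff[OF v(2,1)] v(1)] by simp
 ultimately show ?thesis using N_diff_commute[OF v] by linarith
qed

lemma strongly_measurable_axpy:
 assumes v: "strongly_measurable S V N v" "AE t in leb S. v t \<in> V"
  and w: "strongly_measurable S V N w" "AE t in leb S. w t \<in> V"
 shows "strongly_measurable S V N (%t x. v t x + c * w t x)"
proof -
 obtain s where s: "\<And>n::nat. simple_function (leb S) (s n)" "\<And>n. s n ` S \<subseteq> V"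
  "AE t in leb S. (%n. N (%x. s n t x - v t x)) ----> 0"
  using v(1) by (auto simp: strongly_measurable_def)
 obtain r where r: "\<And>n::nat. simple_function (leb S) (r n)" "\<And>n. r n ` S \<subseteq> V"
  "AE t in leb S. (%n. N (%x. r n t x - w t x)) ----> 0"
  using w(1) by (auto simp: strongly_measurable_def)
 have "simple_function (leb S) (%t. (%p q. %x. p x + c * q x) (s n t) (r n t))" for n
  by (rule simple_function_compose2[OF s(1) r(1)])
 moreover have "(%t x. s n t x + c * r n t x) ` S \<subseteq> V" for n using s(2) r(2) by (auto simp: image_subset_iff intro!: V_axpy)
 moreover have "AE t in leb S. t \<in> S" by (rule AE_I2) simp
 with s(3) r(3) v(2) w(2) have "AE t in leb S. (%n. N (%x. (s n t x + c * r n t x) - (v t x + c * w t x))) ----> 0"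
 proof eventually_elim
  case (elim t)
  have st: "s n t \<in> V" "r n t \<in> V" for n using s(2) r(2) elim(5) by (auto simp: image_subset_iff)
  have eq: "(%x. (s n t x + c * r n t x) - (v t x + c * w t x)) = (%x. (s n t x - v t x) + c * (r n t x - w t x))" for n
   by (simp add: algebra_simps)
  have "(%n. N (%x. s n t x - v t x) + \<bar>c\<bar> * N (%x. r n t x - w t x)) ----> 0 + \<bar>c\<bar> * 0"
   by (intro tendsto_intros elim)
  then have lim: "(%n. N (%x. s n t x - v t x) + \<bar>c\<bar> * N (%x. r n t x - w t x)) ----> 0" by simp
  show ?case unfolding eq
  proof (rule Lim_null_comparison[OF _ lim], rule always_eventually, rule allI)
   fix n
   have d: "(%x. s n t x - v t x) \<in> V" "(%x. r n t x - w t x) \<in> V" using st elim by (auto intro: V_diff)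
   show "norm (N (%x. (s n t x - v t x) + c * (r n t x - w t x))) \<le> N (%x. s n t x - v t x) + \<bar>c\<bar> * N (%x. r n t x - w t x)"
    using N_axpy[OF d, of c] N_nonneg[OF V_axpy[OF d, of c]] by simp
  qed
 qed
 ultimately show ?thesis unfolding strongly_measurable_def by (intro exI[of _ "%n t x. s n t x + c * r n t x"]) auto
qed

lemma strongly_measurable_norm:
 assumes S: "S \<in> sets lebesgue" and v: "strongly_measurable S V N v" "AE t in leb S. v t \<in> V"
 shows "(%t. N (v t)) \<in> borel_measurable (leb S)"
proof -
 obtain s where s: "\<And>n::nat. simple_function (leb S) (s n)" "\<And>n. s n ` S \<subseteq> V"
  "AE t in leb S. (%n. N (%x. s n t x - v t x)) ----> 0"
  using v(1) by (auto simp: strongly_measurable_def)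
 show ?thesis
 proof (rule AE_limit_measurable[OF S])
  show "(%t. N (s n t)) \<in> borel_measurable (leb S)" for n
   using simple_function_compose1[OF s(1), of N n] by (rule borel_measurable_simple_function)
  have "AE t in leb S. t \<in> S" by (rule AE_I2) simp
  with s(3) v(2) show "AE t in leb S. (%n. N (s n t)) ----> N (v t)"
  proof eventually_elim
   case (elim t)
   have "(%n. N (s n t) - N (v t)) ----> 0"
    by (rule Lim_null_comparison[OF _ elim(1)]) (use elim s(2) in \<open>auto intro!: always_eventually N_diff_abs\<close>)
   then show ?case by (simp add: LIM_zero_iff)
  qed
 qed
qed

lemma Lbochner2_axpy:
 assumes S: "S \<in> sets lebesgue" and v: "v \<in> Lbochner 2 S V N" and w: "w \<in> Lbochner 2 S V N"
 shows "(%t x. v t x + c * w t x) \<in> Lbochner 2 S V N"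
proof -
 have v': "AE t in leb S. v t \<in> V" "strongly_measurable S V N v" "integrable (leb S) (%t. (N (v t))\<^sup>2)"
  and w': "AE t in leb S. w t \<in> V" "strongly_measurable S V N w" "integrable (leb S) (%t. (N (w t))\<^sup>2)"
  using v w by (auto simp: Lbochner_def)
 have ae: "AE t in leb S. (%x. v t x + c * w t x) \<in> V"
  using v'(1) w'(1) by eventually_elim (rule V_axpy)
 have sm: "strongly_measurable S V N (%t x. v t x + c * w t x)"
  by (rule strongly_measurable_axpy[OF v'(2,1) w'(2,1)])
 have "integrable (leb S) (%t. (N (%x. v t x + c * w t x))\<^sup>2)"
 proof (rule integrable_bound)
  show "integrable (leb S) (%t. 2 * (N (v t))\<^sup>2 + 2 * c\<^sup>2 * (N (w t))\<^sup>2)" using v'(3) w'(3) by simp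
  show "(%t. (N (%x. v t x + c * w t x))\<^sup>2) \<in> borel_measurable (leb S)"
   using strongly_measurable_norm[OF S sm ae] by measurable
  show "AE t in leb S. norm ((N (%x. v t x + c * w t x))\<^sup>2) \<le> norm (2 * (N (v t))\<^sup>2 + 2 * c\<^sup>2 * (N (w t))\<^sup>2)"
   using v'(1) w'(1)
  proof eventually_elim
   case (elim t)
   have "(N (%x. v t x + c * w t x))\<^sup>2 \<le> (N (v t) + \<bar>c\<bar> * N (w t))\<^sup>2"
    using N_axpy[OF elim, of c] N_nonneg[OF V_axpy[OF elim, of c]] by (rule power_mono)
   also have "\<dots> \<le> 2 * (N (v t))\<^sup>2 + 2 * (\<bar>c\<bar> * N (w t))\<^sup>2"
    using sum_squares_bound[of "N (v t)" "\<bar>c\<bar> * N (w t)"] by (simp add: power2_sum)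
   finally show ?case by (simp add: power_mult_distrib)
  qed
 qed
 with ae sm show ?thesis by (simp add: Lbochner_def)
qed

lemma strongly_measurable_const: "v0 \<in> V ==> strongly_measurable S V N (%t. v0)"
 unfolding strongly_measurable_def
 using N_mult[OF V_zero, of 0] by (intro exI[of _ "%n t. v0"]) auto

lemma strongly_measurable_scalar:
 assumes h: "h \<in> borel_measurable (leb S)" and v0: "v0 \<in> V"
 shows "strongly_measurable S V N (%t x. h t * v0 x)"
proof -
 obtain F where F: "\<And>i. simple_function (leb S) (F i)" "\<And>x. x \<in> S ==> (%i. F i x) ----> h x"
  using borel_measurable_implies_sequence_metric[OF h, of 0] by auto
 have "simple_function (leb S) (%t x. F i t * v0 x)" for i
  using simple_function_compose1[OF F(1)[of i], of "%a x. a * v0 x"] by simp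
 moreover have "(%t x. F i t * v0 x) ` S \<subseteq> V" for i using v0 by (auto intro: V_mult)
 moreover have "AE t in leb S. (%i. N (%x. F i t * v0 x - h t * v0 x)) ----> 0"
 proof (rule AE_I2)
  fix t assume "t \<in> space (leb S)"
  then have "(%i. \<bar>F i t - h t\<bar> * N v0) ----> \<bar>h t - h t\<bar> * N v0" using F(2) by (intro tendsto_intros) auto
  moreover have "N (%x. F i t * v0 x - h t * v0 x) = \<bar>F i t - h t\<bar> * N v0" for i
   using N_mult[OF v0, of "F i t - h t"] by (simp add: left_diff_distrib)
  ultimately show "(%i. N (%x. F i t * v0 x - h t * v0 x)) ----> 0" by simp
 qed
 ultimately show ?thesis unfolding strongly_measurable_def by (intro exI[of _ "%i t x. F i t * v0 x"]) auto
qed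

lemma Lbochner2_scalar:
 assumes h: "h \<in> borel_measurable (leb S)" "integrable (leb S) (%t. (h t)\<^sup>2)" and v0: "v0 \<in> V"
 shows "(%t x. h t * v0 x) \<in> Lbochner 2 S V N"
proof -
 have "integrable (leb S) (%t. (N (%x. h t * v0 x))\<^sup>2)"
  unfolding N_mult[OF v0] using h(2) by (simp add: power_mult_distrib)
 then show ?thesis using strongly_measurable_scalar[OF h(1) v0] v0 by (auto simp: Lbochner_def V_mult)
qed

lemma Lbochner2_sum:
 assumes S: "S \<in> sets lebesgue" and fin: "finite A" and v: "\<And>i. i \<in> A ==> v i \<in> Lbochner 2 S V N"
 shows "(%t x. \<Sum>i\<in>A. v i t x) \<in> Lbochner 2 S V N"
 using fin v
proof (induction A rule: finite_induct)
 case empty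
 have "(%t x. 0 * 0) \<in> Lbochner 2 S V N" by (rule Lbochner2_scalar[OF _ _ V_zero, of "%t. 0"]) auto
 then show ?case by simp
next
 case (insert i A)
 then have "(%t x. (\<Sum>i\<in>A. v i t x) + 1 * v i t x) \<in> Lbochner 2 S V N" by (intro Lbochner2_axpy[OF S]) auto
 then show ?case using insert by (simp add: add.commute)
qed

end

text \<open>Serves the duality pairing, the inner products, and the transport and diffusion terms
  alike. Boundedness makes \<open>B\<close> continuous, so approximating simple functions give
  measurability of \<open>B (v t) (w t)\<close> in time.\<close>

locale bilinear_pairing = A: vspace V N + B: vspace W N'
 for V :: "('b \<Rightarrow> real) set" and N and W :: "('c \<Rightarrow> real) set" and N' +
 fixes B :: "('b \<Rightarrow> real) \<Rightarrow> ('c \<Rightarrow> real) \<Rightarrow> real" and M :: real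
 assumes B_left: "v \<in> V ==> v' \<in> V ==> w \<in> W ==> B (%x. v x + c * v' x) w = B v w + c * B v' w"
  and B_right: "v \<in> V ==> w \<in> W ==> w' \<in> W ==> B v (%x. w x + c * w' x) = B v w + c * B v w'"
  and B_bound: "v \<in> V ==> w \<in> W ==> \<bar>B v w\<bar> \<le> M * N v * N' w"
begin

lemma B_tendsto:
 assumes s: "\<And>n. s n \<in> V" "v \<in> V" "(%n::nat. N (%x. s n x - v x)) ----> 0"
  and r: "\<And>n. r n \<in> W" "w \<in> W" "(%n. N' (%x. r n x - w x)) ----> 0"
 shows "(%n. B (s n) (r n)) ----> B v w"
proof -
 have "(%n. M * N (%x. s n x - v x) * N' w + M * (N (%x. s n x - v x) + N v) * N' (%x. r n x - w x)) ----> M * 0 * N' w + M * (0 + N v) * 0"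
  by (intro tendsto_intros s r)
 then have lim: "(%n. M * N (%x. s n x - v x) * N' w + M * (N (%x. s n x - v x) + N v) * N' (%x. r n x - w x)) ----> 0" by simp
 have "(%n. B (s n) (r n) - B v w) ----> 0"
 proof (rule Lim_null_comparison[OF _ lim], rule always_eventually, rule allI)
  fix n
  have d: "(%x. s n x - v x) \<in> V" "(%x. r n x - w x) \<in> W" using s r by (auto intro: A.V_diff B.V_diff)
  have 1: "B (%x. s n x - v x) w = B (s n) w - B v w" using B_left[OF s(1)[of n] s(2) r(2), of "-1"] by simp
  have 2: "B (s n) (%x. r n x - w x) = B (s n) (r n) - B (s n) w" using B_right[OF s(1)[of n] r(1)[of n] r(2), of "-1"] by simp
  have dd: "(%x. (s n x - v x) + 1 * v x) \<in> V" by (rule A.V_axpy[OF d(1) s(2)])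
  \<comment> \<open>\<open>s n\<close> is split into its deviation from \<open>v\<close> and
    \<open>v\<close> itself, which yields a bound in terms of quantities with known limits.\<close>
  have eq: "B (s n) (%x. r n x - w x) = B (%x. s n x - v x) (%x. r n x - w x) + B v (%x. r n x - w x)"
   using B_left[OF d(1) s(2) d(2), of 1] by simp
  have "\<bar>B (s n) (%x. r n x - w x)\<bar> \<le> \<bar>B (%x. s n x - v x) (%x. r n x - w x)\<bar> + \<bar>B v (%x. r n x - w x)\<bar>"
   unfolding eq by simp
  also have "\<dots> \<le> M * N (%x. s n x - v x) * N' (%x. r n x - w x) + M * N v * N' (%x. r n x - w x)"
   by (intro add_mono B_bound d s(2))
  finally have b2: "\<bar>B (s n) (%x. r n x - w x)\<bar> \<le> M * (N (%x. s n x - v x) + N v) * N' (%x. r n x - w x)"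
   by (simp add: algebra_simps)
  have "B (s n) (r n) - B v w = B (%x. s n x - v x) w + B (s n) (%x. r n x - w x)" unfolding 1 2 by simp
  then show "norm (B (s n) (r n) - B v w) \<le> M * N (%x. s n x - v x) * N' w + M * (N (%x. s n x - v x) + N v) * N' (%x. r n x - w x)"
   using B_bound[OF d(1) r(2)] b2 by simp
 qed
 then show ?thesis by (simp add: LIM_zero_iff)
qed

lemma pairing_measurable:
 assumes S: "S \<in> sets lebesgue" and v: "strongly_measurable S V N v" "AE t in leb S. v t \<in> V"
  and w: "strongly_measurable S W N' w" "AE t in leb S. w t \<in> W"
 shows "(%t. B (v t) (w t)) \<in> borel_measurable (leb S)"
proof -
 obtain s where s: "\<And>n::nat. simple_function (leb S) (s n)" "\<And>n. s n ` S \<subseteq> V"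
  "AE t in leb S. (%n. N (%x. s n t x - v t x)) ----> 0"
  using v(1) by (auto simp: strongly_measurable_def)
 obtain r where r: "\<And>n::nat. simple_function (leb S) (r n)" "\<And>n. r n ` S \<subseteq> W"
  "AE t in leb S. (%n. N' (%x. r n t x - w t x)) ----> 0"
  using w(1) by (auto simp: strongly_measurable_def)
 show ?thesis
 proof (rule AE_limit_measurable[OF S])
  show "(%t. B (s n t) (r n t)) \<in> borel_measurable (leb S)" for n
   using simple_function_compose2[OF s(1) r(1), of B n n] by (rule borel_measurable_simple_function)
  have "AE t in leb S. t \<in> S" by (rule AE_I2) simp
  with s(3) v(2) r(3) w(2) show "AE t in leb S. (%n. B (s n t) (r n t)) ----> B (v t) (w t)"
  proof eventually_elim
   case (elim t)
   have "s n t \<in> V" "r n t \<in> W" for n using s(2) r(2) elim(5) by (auto simp: image_subset_iff)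
   then show ?case using elim by (intro B_tendsto) auto
  qed
 qed
qed

lemma pairing_integrable:
 assumes S: "S \<in> sets lebesgue" and v: "v \<in> Lbochner 2 S V N" and w: "w \<in> Lbochner 2 S W N'"
 shows "integrable (leb S) (%t. B (v t) (w t))"
proof -
 have v': "AE t in leb S. v t \<in> V" "strongly_measurable S V N v" "integrable (leb S) (%t. (N (v t))\<^sup>2)"
  and w': "AE t in leb S. w t \<in> W" "strongly_measurable S W N' w" "integrable (leb S) (%t. (N' (w t))\<^sup>2)"
  using v w by (auto simp: Lbochner_def)
 show ?thesis
 proof (rule integrable_bound)
  show "integrable (leb S) (%t. \<bar>M\<bar> * ((N (v t))\<^sup>2 + (N' (w t))\<^sup>2))" using v'(3) w'(3) by simp
  show "(%t. B (v t) (w t)) \<in> borel_measurable (leb S)" by (rule pairing_measurable[OF S v'(2,1) w'(2,1)])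
  show "AE t in leb S. norm (B (v t) (w t)) \<le> norm (\<bar>M\<bar> * ((N (v t))\<^sup>2 + (N' (w t))\<^sup>2))"
   using v'(1) w'(1)
  proof eventually_elim
   case (elim t)
   have n: "0 \<le> N (v t)" "0 \<le> N' (w t)" using elim A.N_nonneg B.N_nonneg by auto
   have "\<bar>B (v t) (w t)\<bar> \<le> M * N (v t) * N' (w t)" by (rule B_bound[OF elim])
   also have "\<dots> \<le> \<bar>M\<bar> * (N (v t) * N' (w t))"
    unfolding mult.assoc using n by (intro mult_right_mono) auto
   also have "\<dots> \<le> \<bar>M\<bar> * ((N (v t))\<^sup>2 + (N' (w t))\<^sup>2)"
    using sum_squares_bound[of "N (v t)" "N' (w t)"] mult_nonneg_nonneg[OF n] by (intro mult_left_mono) (auto simp: power2_eq_square)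
   finally show ?case by simp
  qed
 qed
qed

text \<open>For factors that are integrable in time to the first power only, such as
  \<open>rhs D\<close> with values in \<open>L2\<close>; the second factor is then kept constant in
  time.\<close>

lemma pairing_integrable_const:
 assumes S: "S \<in> sets lebesgue" and v: "v \<in> Lbochner 1 S V N" and w: "w \<in> W"
 shows "integrable (leb S) (%t. B (v t) w)"
proof -
 have v': "AE t in leb S. v t \<in> V" "strongly_measurable S V N v" "integrable (leb S) (%t. N (v t))"
  using v by (auto simp: Lbochner_def)
 show ?thesis
 proof (rule integrable_bound)
  show "integrable (leb S) (%t. M * N' w * N (v t))" using v'(3) by simp
  show "(%t. B (v t) w) \<in> borel_measurable (leb S)"
   by (rule pairing_measurable[OF S v'(2,1) B.strongly_measurable_const[OF w]]) (use w in auto)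
  show "AE t in leb S. norm (B (v t) w) \<le> norm (M * N' w * N (v t))"
   using v'(1)
  proof eventually_elim
   case (elim t)
   then show ?case using B_bound[OF elim w] by (simp add: algebra_simps)
  qed
 qed
qed

end

section \<open>The dual space Hm1 and the concrete pairings\<close>

context bounded_domain
begin

lemma vspace_L2: "vspace (L2 U :: ('a \<Rightarrow> real) set) (L2n U)"
 by unfold_locales (auto simp: L2_zero L2_axpy L2n_nonneg L2n_triangle L2n_mult)

lemma vspace_H10: "vspace (H10 U) (H1n U)"
 by unfold_locales (auto simp: zero_H10 H10_axpy H1n_nonneg H1n_triangle H10_H1 H1n_mult)

lemma Hm1_linear: "l \<in> Hm1 U ==> v \<in> H10 U ==> w \<in> H10 U ==> l (%x. v x + c * w x) = l v + c * l w"
 by (simp add: Hm1_def)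

lemma Hm1_mult: "l \<in> Hm1 U ==> v \<in> H10 U ==> l (%x. c * v x) = c * l v"
 using Hm1_linear[of l v v "c - 1"] by (simp add: algebra_simps)

lemma zero_H1n: "H1n U (%x. 0) = 0"
 using H1n_mult[OF zero_H1, of 0] by simp

lemma Hm1n_upper:
 assumes l: "l \<in> Hm1 U" and v: "v \<in> H10 U" "H1n U v \<le> 1" shows "\<bar>l v\<bar> \<le> Hm1n U l"
proof -
 obtain C where C: "\<And>v. v \<in> H10 U ==> \<bar>l v\<bar> \<le> C * H1n U v" using l unfolding Hm1_def by blast
 have "\<bar>l w\<bar> \<le> \<bar>C\<bar>" if "w \<in> H10 U" "H1n U w \<le> 1" for w
 proof -
  have "\<bar>l w\<bar> \<le> C * H1n U w" by (rule C[OF that(1)])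
  also have "\<dots> \<le> \<bar>C\<bar> * H1n U w" by (intro mult_right_mono) (auto simp: H1n_nonneg)
  also have "\<dots> \<le> \<bar>C\<bar>" using that(2) by (intro mult_left_le) (auto simp: H1n_nonneg)
  finally show ?thesis .
 qed
 then have "bdd_above ((%v. \<bar>l v\<bar>) ` {v \<in> H10 U. H1n U v \<le> 1})" by (intro bdd_aboveI[of _ "\<bar>C\<bar>"]) auto
 then show ?thesis unfolding Hm1n_def using v by (intro cSUP_upper) auto
qed

lemma Hm1n_least: "(\<And>v. v \<in> H10 U ==> H1n U v \<le> 1 ==> \<bar>l v\<bar> \<le> B) ==> Hm1n U l \<le> B"
 unfolding Hm1n_def using zero_H10 zero_H1n by (intro cSUP_least) auto

lemma Hm1n_nonneg: "l \<in> Hm1 U ==> 0 \<le> Hm1n U l"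
 using Hm1n_upper[OF _ zero_H10, of l] zero_H1n abs_ge_zero[of "l (%x. 0)"] by linarith

text \<open>Scaling to \<open>H1n U v = 1\<close>. A function of seminorm 0 cannot be scaled, but
  for it the defining bound of \<open>Hm1\<close> gives the value 0. The factor 1 is the constant of
  \<open>bilinear_pairing\<close>.\<close>

lemma Hm1n_bound:
 assumes l: "l \<in> Hm1 U" and v: "v \<in> H10 U" shows "\<bar>l v\<bar> \<le> 1 * Hm1n U l * H1n U v"
proof (cases "H1n U v = 0")
 case True
 obtain C where "\<And>v. v \<in> H10 U ==> \<bar>l v\<bar> \<le> C * H1n U v" using l unfolding Hm1_def by blast
 from this[OF v] show ?thesis using True by simp
next
 case False
 define c where "c = H1n U v"
 have c: "0 < c" using False H1n_nonneg[of v] by (simp add: c_def)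
 have "H1n U (%x. (1 / c) * v x) = 1" using H1n_mult[OF H10_H1[OF v], of "1 / c"] c by (simp add: c_def)
 then have "\<bar>l (%x. (1 / c) * v x)\<bar> \<le> Hm1n U l" by (intro Hm1n_upper[OF l H10_mult[OF v]]) simp
 then show ?thesis using Hm1_mult[OF l v, of "1 / c"] c by (simp add: abs_mult field_simps c_def)
qed

lemma Hm1_axpy:
 assumes l: "l \<in> Hm1 U" and k: "k \<in> Hm1 U" shows "(%v. l v + c * k v) \<in> Hm1 U"
proof -
 have "\<bar>l v + c * k v\<bar> \<le> (Hm1n U l + \<bar>c\<bar> * Hm1n U k) * H1n U v" if v: "v \<in> H10 U" for v
 proof -
  have "\<bar>l v + c * k v\<bar> \<le> \<bar>l v\<bar> + \<bar>c\<bar> * \<bar>k v\<bar>" using abs_triangle_ineq[of "l v" "c * k v"] by (simp add: abs_mult)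
  also have "\<dots> \<le> 1 * Hm1n U l * H1n U v + \<bar>c\<bar> * (1 * Hm1n U k * H1n U v)"
   by (intro add_mono mult_left_mono Hm1n_bound l k v) auto
  finally show ?thesis by (simp add: algebra_simps)
 qed
 moreover have "l (%x. v x + d * w x) + c * k (%x. v x + d * w x) = (l v + c * k v) + d * (l w + c * k w)"
  if "v \<in> H10 U" "w \<in> H10 U" for v w d
  using Hm1_linear[OF l that, of d] Hm1_linear[OF k that, of d] by (simp add: algebra_simps)
 ultimately show ?thesis unfolding Hm1_def by blast
qed

lemma zero_Hm1: "(%v. 0) \<in> Hm1 U"
 by (auto simp: Hm1_def intro!: exI[of _ 0])

lemma Hm1n_mult_le: "l \<in> Hm1 U ==> Hm1n U (%v. c * l v) \<le> \<bar>c\<bar> * Hm1n U l"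
 by (rule Hm1n_least) (auto simp: abs_mult intro: mult_left_mono Hm1n_upper)

lemma vspace_Hm1: "vspace (Hm1 U) (Hm1n U)"
proof
 show "Hm1n U (%x. l x + k x) \<le> Hm1n U l + Hm1n U k" if "l \<in> Hm1 U" "k \<in> Hm1 U" for l k
 proof (rule Hm1n_least)
  fix v assume v: "v \<in> H10 U" "H1n U v \<le> 1"
  show "\<bar>l v + k v\<bar> \<le> Hm1n U l + Hm1n U k"
   using Hm1n_upper[OF that(1) v] Hm1n_upper[OF that(2) v] abs_triangle_ineq[of "l v" "k v"] by linarith
 qed
 show "Hm1n U (%x. c * l x) = \<bar>c\<bar> * Hm1n U l" if l: "l \<in> Hm1 U" for l c
 proof (cases "c = 0")
  case True
  have "Hm1n U (%x. 0 * l x) \<le> \<bar>0\<bar> * Hm1n U l" by (rule Hm1n_mult_le[OF l])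
  moreover have "0 \<le> Hm1n U (%x. 0 * l x)" using Hm1n_nonneg[OF zero_Hm1] by simp
  ultimately show ?thesis using True by simp
 next
  case False
  have cl: "(%x. c * l x) \<in> Hm1 U" using Hm1_axpy[OF zero_Hm1 l, of c] by simp
  have "Hm1n U (%x. (1 / c) * (c * l x)) \<le> \<bar>1 / c\<bar> * Hm1n U (%x. c * l x)" by (rule Hm1n_mult_le[OF cl])
  then have "\<bar>c\<bar> * Hm1n U l \<le> Hm1n U (%x. c * l x)" using False by (simp add: abs_divide field_simps)
  then show ?thesis using Hm1n_mult_le[OF l, of c] by simp
 qed
qed (auto simp: zero_Hm1 Hm1_axpy Hm1n_nonneg)

lemma pairing_Hm1: "bilinear_pairing (Hm1 U) (Hm1n U) (H10 U) (H1n U) (%l v. l v) 1"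
proof (intro bilinear_pairing.intro bilinear_pairing_axioms.intro vspace_Hm1 vspace_H10)
 fix l :: "('a \<Rightarrow> real) \<Rightarrow> real" and v w c assume "l \<in> Hm1 U" "v \<in> H10 U"
 then show "\<bar>l v\<bar> \<le> 1 * Hm1n U l * H1n U v" by (rule Hm1n_bound)
 assume "w \<in> H10 U"
 then show "l (%x. v x + c * w x) = l v + c * l w" using Hm1_linear \<open>l \<in> Hm1 U\<close> \<open>v \<in> H10 U\<close> by blast
qed simp

lemma ip_axpy_left:
 fixes v v' w :: "'a \<Rightarrow> real"
 shows "v \<in> L2 S ==> v' \<in> L2 S ==> w \<in> L2 S ==> ip S (%x. v x + c * v' x) w = ip S v w + c * ip S v' w"
 using ip_lincomb_left[of v S v' w c] by simp

lemma ip_axpy_right: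
 fixes v v' w :: "'a \<Rightarrow> real"
 shows "v \<in> L2 S ==> v' \<in> L2 S ==> w \<in> L2 S ==> ip S w (%x. v x + c * v' x) = ip S w v + c * ip S w v'"
 using ip_lincomb_right[of v S v' w c] by simp

lemma pairing_L2: "bilinear_pairing (L2 U :: ('a \<Rightarrow> real) set) (L2n U) (L2 U) (L2n U) (ip U) 1"
 by (intro bilinear_pairing.intro bilinear_pairing_axioms.intro vspace_L2 ip_axpy_left ip_axpy_right)
  (auto simp: ip_Cauchy_Schwarz)

lemma pairing_ip: "bilinear_pairing (H10 U) (H1n U) (H10 U) (H1n U) (%v w. ip U v w) 1"
proof (intro bilinear_pairing.intro bilinear_pairing_axioms.intro vspace_H10 ip_axpy_left ip_axpy_right H10_L2)
 fix v w assume "v \<in> H10 U" "w \<in> H10 U"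
 then have "\<bar>ip U v w\<bar> \<le> L2n U v * L2n U w" by (intro ip_Cauchy_Schwarz H10_L2)
 also have "\<dots> \<le> H1n U v * H1n U w" by (intro mult_mono L2n_le_H1n H1n_nonneg L2n_nonneg)
 finally show "\<bar>ip U v w\<bar> \<le> 1 * H1n U v * H1n U w" by simp
qed

lemma ip_Hm1:
 assumes w: "w \<in> L2 U" shows "ip U w \<in> Hm1 U"
proof -
 have "\<bar>ip U w v\<bar> \<le> L2n U w * H1n U v" if v: "v \<in> H10 U" for v
  using ip_Cauchy_Schwarz[OF w H10_L2[OF v]] mult_left_mono[OF L2n_le_H1n(1)[of v] L2n_nonneg[of U w]] by linarith
 then show ?thesis unfolding Hm1_def using ip_axpy_right[OF H10_L2 H10_L2 w] by blast
qed

end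

section \<open>Weak derivatives in time and one-sided limits\<close>

lemma Ioc_lebesgue [simp]: "{c<..d::real} \<in> sets lebesgue" by simp
lemma Ioc_lmeasurable [simp]: "{c<..d::real} \<in> lmeasurable" by (intro bounded_set_imp_lmeasurable) auto

lemma AE_Ioc_Ioo:
 assumes "AE t in leb {c<..<d::real}. P t" shows "AE t in leb {c<..d}. P t"
proof -
 have "AE t in lebesgue. t \<in> {c<..<d} \<longrightarrow> P t" using assms by (simp add: AE_restrict_space_iff)
 moreover have "AE t in lebesgue. t \<notin> {d}" by (rule AE_not_in) (simp add: negligible_iff_null_sets[symmetric])
 ultimately have "AE t in lebesgue. t \<in> {c<..d} \<longrightarrow> P t" by eventually_elim auto
 then show ?thesis by (simp add: AE_restrict_space_iff)
qed

lemma bounded_mult_integrable: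
 fixes h f :: "real \<Rightarrow> real"
 assumes h: "h \<in> borel_measurable (leb S)" "\<And>t. t \<in> S ==> \<bar>h t\<bar> \<le> M" and f: "integrable (leb S) f"
 shows "integrable (leb S) (%t. h t * f t)"
proof (rule integrable_bound)
 show "integrable (leb S) (%t. M * f t)" using f by simp
 show "(%t. h t * f t) \<in> borel_measurable (leb S)" using h(1) f by measurable
 show "AE t in leb S. norm (h t * f t) \<le> norm (M * f t)"
 proof (rule AE_I2)
  fix t assume "t \<in> space (leb S)"
  then have "\<bar>h t\<bar> \<le> \<bar>M\<bar>" using h(2)[of t] by simp
  then show "norm (h t * f t) \<le> norm (M * f t)" by (simp add: abs_mult mult_right_mono)
 qed
qed

lemma bounded_integrable_Ioc:
 fixes h :: "real \<Rightarrow> real"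
 assumes "h \<in> borel_measurable (leb {c<..d})" "\<And>t. t \<in> {c<..d} ==> \<bar>h t\<bar> \<le> M"
 shows "integrable (leb {c<..d}) h"
proof -
 interpret finite_measure "leb {c<..d}" by (rule finite_measure_lebesgue_on) simp
 show ?thesis using bounded_mult_integrable[OF assms, of "%t. 1"] by simp
qed

lemma test_fun_real:
 fixes \<zeta> :: "real \<Rightarrow> real"
 assumes "\<zeta> \<in> test_fun S"
 shows "(\<zeta> has_real_derivative deriv \<zeta> t) (at t)" "continuous_on Q (deriv \<zeta>)"
  "\<exists>M. \<forall>t\<in>{c..d}. \<bar>deriv \<zeta> t\<bar> \<le> M" "\<exists>M. \<forall>t\<in>{c..d}. \<bar>\<zeta> t\<bar> \<le> M"
proof -
 have d: "(\<zeta> has_real_derivative grad \<zeta> t) (at t)" for t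
  using test_fun_has_derivative[OF assms, of t] by (simp add: has_field_derivative_def)
 then have eq: "deriv \<zeta> = grad \<zeta>" by (intro ext DERIV_imp_deriv)
 show "(\<zeta> has_real_derivative deriv \<zeta> t) (at t)" using d eq by simp
 show c: "continuous_on Q (deriv \<zeta>)" for Q unfolding eq by (rule test_fun_grad_continuous[OF assms])
 have *: "\<exists>M. \<forall>t\<in>{c..d}. \<bar>f t\<bar> \<le> M" if "continuous_on {c..d} f" for f :: "real \<Rightarrow> real"
 proof -
  have "bounded (f ` {c..d})" by (intro compact_imp_bounded compact_continuous_image that) auto
  then show ?thesis by (auto simp: bounded_iff)
 qed
 show "\<exists>M. \<forall>t\<in>{c..d}. \<bar>deriv \<zeta> t\<bar> \<le> M" "\<exists>M. \<forall>t\<in>{c..d}. \<bar>\<zeta> t\<bar> \<le> M"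
  using *[OF c] *[OF test_fun_continuous[OF assms]] by auto
qed

lemma test_fun_zero_outside: "\<zeta> \<in> test_fun S ==> t \<notin> S ==> \<zeta> t = 0"
 using test_funE[of \<zeta> S] by (metis subsetD)

lemma test_fun_deriv_zero_outside:
 fixes \<zeta> :: "real \<Rightarrow> real"
 assumes "\<zeta> \<in> test_fun S" "t \<notin> S" shows "deriv \<zeta> t = 0"
proof -
 have "grad \<zeta> t = 0" using test_funE[OF assms(1)] assms(2) by (metis subsetD)
 then have "(\<zeta> has_derivative (%y. 0)) (at t)"
  using test_fun_has_derivative[OF assms(1), of t] by simp
 then have "(\<zeta> has_real_derivative 0) (at t)"
  by (rule has_derivative_imp_has_field_derivative) simp
 then show ?thesis by (rule DERIV_imp_deriv)
qed

lemma fundamental_lemma_Ioc: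
 fixes f :: "real \<Rightarrow> real"
 assumes f: "integrable (leb {c<..d}) f"
  and z: "\<And>\<zeta>. \<zeta> \<in> test_fun {c<..<d} ==> (LINT t|leb {c<..d}. \<zeta> t * f t) = 0"
 shows "AE t in leb {c<..d}. f t = 0"
proof (rule AE_Ioc_Ioo, rule fundamental_lemma)
 show "integrable (leb {c<..<d}) f"
  by (rule lebesgue_on_integrable_subset[OF f]) auto
 fix \<zeta> :: "real \<Rightarrow> real" assume \<zeta>: "\<zeta> \<in> test_fun {c<..<d}"
 have "(LINT t|leb {c<..<d}. \<zeta> t *\<^sub>R f t) = (LINT t|leb {c<..d}. (if t \<in> {c<..<d} then \<zeta> t * f t else 0))"
  by (subst integral_restrict) auto
 also have "\<dots> = (LINT t|leb {c<..d}. \<zeta> t * f t)"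
  using test_fun_zero_outside[OF \<zeta>] by (intro integral_cong) auto
 also have "\<dots> = 0" by (rule z[OF \<zeta>])
 finally show "(LINT t|leb {c<..<d}. \<zeta> t *\<^sub>R f t) = 0" .
qed simp

text \<open>The finite exceptional set \<open>F\<close> admits the kinks of ramps. There are no
  boundary terms, as \<open>\<zeta>\<close> vanishes at both end points.\<close>

lemma piecewise_C1_by_parts:
 fixes \<eta> h \<zeta> :: "real \<Rightarrow> real"
 assumes cd: "c \<le> d" and \<eta>: "continuous_on {c..d} \<eta>" and F: "finite F"
  and \<eta>': "\<And>t. t \<in> {c<..<d} - F ==> (\<eta> has_real_derivative h t) (at t)"
  and h: "h \<in> borel_measurable (leb {c<..d})" "\<And>t. t \<in> {c<..d} ==> \<bar>h t\<bar> \<le> M"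
  and \<zeta>: "\<zeta> \<in> test_fun {c<..<d}"
 shows "(LINT t|leb {c<..d}. deriv \<zeta> t * \<eta> t) = - (LINT t|leb {c<..d}. \<zeta> t * h t)"
proof -
 have \<eta>m: "\<eta> \<in> borel_measurable (leb {c<..d})"
  by (intro continuous_imp_measurable_on_sets_lebesgue continuous_on_subset[OF \<eta>]) auto
 have "bounded (\<eta> ` {c..d})" by (intro compact_imp_bounded compact_continuous_image \<eta>) auto
 then obtain M\<eta> where M\<eta>: "\<forall>y\<in>\<eta> ` {c..d}. norm y \<le> M\<eta>" unfolding bounded_iff by blast
 obtain M1 where M1: "\<forall>t\<in>{c..d}. \<bar>deriv \<zeta> t\<bar> \<le> M1" using test_fun_real(3)[OF \<zeta>] by blast
 obtain M2 where M2: "\<forall>t\<in>{c..d}. \<bar>\<zeta> t\<bar> \<le> M2" using test_fun_real(4)[OF \<zeta>] by blast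
 have i1: "integrable (leb {c<..d}) (%t. deriv \<zeta> t * \<eta> t)"
 proof (rule bounded_mult_integrable)
  show "deriv \<zeta> \<in> borel_measurable (leb {c<..d})"
   by (intro continuous_imp_measurable_on_sets_lebesgue test_fun_real(2)[OF \<zeta>]) auto
  show "\<bar>deriv \<zeta> t\<bar> \<le> M1" if "t \<in> {c<..d}" for t using M1 that by auto
  show "integrable (leb {c<..d}) \<eta>" by (rule bounded_integrable_Ioc[OF \<eta>m]) (use M\<eta> in auto)
 qed
 have i2: "integrable (leb {c<..d}) (%t. \<zeta> t * h t)"
 proof (rule bounded_mult_integrable)
  show "\<zeta> \<in> borel_measurable (leb {c<..d})"
   by (intro continuous_imp_measurable_on_sets_lebesgue test_fun_continuous[OF \<zeta>]) auto
  show "\<bar>\<zeta> t\<bar> \<le> M2" if "t \<in> {c<..d}" for t using M2 that by auto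
  show "integrable (leb {c<..d}) h" by (rule bounded_integrable_Ioc[OF h])
 qed
 have "((%t. deriv \<zeta> t * \<eta> t + \<zeta> t * h t) has_integral (\<zeta> d * \<eta> d - \<zeta> c * \<eta> c)) {c..d}"
 proof (rule fundamental_theorem_of_calculus_interior_strong[OF F cd])
  show "continuous_on {c..d} (%t. \<zeta> t * \<eta> t)" by (intro continuous_intros test_fun_continuous[OF \<zeta>] \<eta>)
  show "((%t. \<zeta> t * \<eta> t) has_vector_derivative deriv \<zeta> t * \<eta> t + \<zeta> t * h t) (at t)" if "t \<in> {c<..<d} - F" for t
   using DERIV_mult[OF test_fun_real(1)[OF \<zeta>, of t] \<eta>'[OF that]]
   by (simp add: has_real_derivative_iff_has_vector_derivative algebra_simps)
 qed
 also have "\<zeta> d * \<eta> d - \<zeta> c * \<eta> c = 0" using test_fun_zero_outside[OF \<zeta>] by simp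
 finally have z: "((%t. deriv \<zeta> t * \<eta> t + \<zeta> t * h t) has_integral 0) {c<..d}"
  by (rule has_integral_spike_set_eq[THEN iffD1, rotated -1]) (auto intro: negligible_subset[of "{c}"])
 have "((%t. deriv \<zeta> t * \<eta> t + \<zeta> t * h t) has_integral (LINT t|leb {c<..d}. deriv \<zeta> t * \<eta> t + \<zeta> t * h t)) {c<..d}"
  by (rule has_integral_integral_lebesgue_on) (use i1 i2 in auto)
 then have "(LINT t|leb {c<..d}. deriv \<zeta> t * \<eta> t + \<zeta> t * h t) = 0"
  using z by (rule has_integral_unique)
 then show ?thesis using i1 i2 by simp
qed

context bounded_domain
begin

lemma Lbochner2_const: "v0 \<in> H10 U ==> (%t. v0) \<in> Lbochner 2 {c<..d} (H10 U) (H1n U)"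
proof -
 assume v0: "v0 \<in> H10 U"
 interpret finite_measure "leb {c<..d}" by (rule finite_measure_lebesgue_on) simp
 have "(%t x. (%t. 1) t * v0 x) \<in> Lbochner 2 {c<..d} (H10 U) (H1n U)"
  by (rule vspace.Lbochner2_scalar[OF vspace_H10 _ _ v0]) auto
 then show ?thesis by simp
qed

lemma Hm1_const_integrable:
 "g \<in> Lbochner 2 {c<..d} (Hm1 U) (Hm1n U) ==> \<phi> \<in> H10 U ==> integrable (leb {c<..d}) (%t. g t \<phi>)"
 using bilinear_pairing.pairing_integrable[OF pairing_Hm1 Ioc_lebesgue _ Lbochner2_const] by blast

lemma test_times_integrable:
 assumes \<zeta>: "\<zeta> \<in> test_fun {c<..<d::real}" and f: "integrable (leb {c<..d}) f"
 shows "integrable (leb {c<..d}) (%t. \<zeta> t * f t)" "integrable (leb {c<..d}) (%t. deriv \<zeta> t * f t)"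
proof -
 obtain M1 where M1: "\<forall>t\<in>{c..d}. \<bar>deriv \<zeta> t\<bar> \<le> M1" using test_fun_real(3)[OF \<zeta>] by blast
 obtain M2 where M2: "\<forall>t\<in>{c..d}. \<bar>\<zeta> t\<bar> \<le> M2" using test_fun_real(4)[OF \<zeta>] by blast
 show "integrable (leb {c<..d}) (%t. \<zeta> t * f t)"
  by (rule bounded_mult_integrable[of _ _ M2, OF continuous_imp_measurable_on_sets_lebesgue[OF test_fun_continuous[OF \<zeta>]] _ f]) (use M2 in auto)
 show "integrable (leb {c<..d}) (%t. deriv \<zeta> t * f t)"
  by (rule bounded_mult_integrable[of _ _ M1, OF continuous_imp_measurable_on_sets_lebesgue[OF test_fun_real(2)[OF \<zeta>]] _ f]) (use M1 in auto)
qed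

text \<open>The exceptional null set may still depend on \<open>\<phi>\<close> here;
  \<open>tderiv_AE\<close> overcomes this.\<close>

lemma has_tderiv_AE:
 assumes g: "has_tderiv U c d v g" and g': "has_tderiv U c d v g'" and \<phi>: "\<phi> \<in> H10 U"
 shows "AE t in leb {c<..d}. g t \<phi> = g' t \<phi>"
proof -
 have i: "integrable (leb {c<..d}) (%t. g t \<phi>)" "integrable (leb {c<..d}) (%t. g' t \<phi>)"
  using g g' \<phi> by (auto simp: has_tderiv_def intro: Hm1_const_integrable)
 have "AE t in leb {c<..d}. g t \<phi> - g' t \<phi> = 0"
 proof (rule fundamental_lemma_Ioc)
  show "integrable (leb {c<..d}) (%t. g t \<phi> - g' t \<phi>)" using i by simp
  fix \<zeta> :: "real \<Rightarrow> real" assume \<zeta>: "\<zeta> \<in> test_fun {c<..<d}"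
  have "(LINT t|leb {c<..d}. \<zeta> t * g t \<phi>) = (LINT t|leb {c<..d}. \<zeta> t * g' t \<phi>)"
  proof -
   have "(LINT t|leb {c<..d}. deriv \<zeta> t * ip U (v t) \<phi>) = - (LINT t|leb {c<..d}. \<zeta> t * g t \<phi>)"
    using g \<phi> \<zeta> by (simp add: has_tderiv_def)
   moreover have "(LINT t|leb {c<..d}. deriv \<zeta> t * ip U (v t) \<phi>) = - (LINT t|leb {c<..d}. \<zeta> t * g' t \<phi>)"
    using g' \<phi> \<zeta> by (simp add: has_tderiv_def)
   ultimately show ?thesis by linarith
  qed
  then show "(LINT t|leb {c<..d}. \<zeta> t * (g t \<phi> - g' t \<phi>)) = 0"
   using test_times_integrable(1)[OF \<zeta> i(1)] test_times_integrable(1)[OF \<zeta> i(2)] by (simp add: right_diff_distrib)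
 qed
 then show ?thesis by simp
qed

text \<open>A time-dependent \<open>\<phi>\<close> needs one null set for all its values. The
  approximating simple functions take countably many values altogether, and continuity of the
  functionals passes to the limit.\<close>

lemma tderiv_AE:
 assumes g: "has_tderiv U c d v g"
  and \<phi>: "strongly_measurable {c<..d} (H10 U) (H1n U) \<phi>" "AE t in leb {c<..d}. \<phi> t \<in> H10 U"
 shows "AE t in leb {c<..d}. tderiv U c d v t (\<phi> t) = g t (\<phi> t)"
proof -
 define g' where "g' = tderiv U c d v"
 have g': "has_tderiv U c d v g'" unfolding g'_def tderiv_def by (rule someI[of "has_tderiv U c d v" g]) (rule g)
 have H: "AE t in leb {c<..d}. g t \<in> Hm1 U" "AE t in leb {c<..d}. g' t \<in> Hm1 U"
  using g g' by (auto simp: has_tderiv_def Lbochner_def)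
 obtain s where s: "\<And>n::nat. simple_function (leb {c<..d}) (s n)" "\<And>n. s n ` {c<..d} \<subseteq> H10 U"
  "AE t in leb {c<..d}. (%n. H1n U (%x. s n t x - \<phi> t x)) ----> 0"
  using \<phi>(1) by (auto simp: strongly_measurable_def)
 have "AE t in leb {c<..d}. \<forall>n. \<forall>w\<in>s n ` {c<..d}. g' t w = g t w"
 proof (subst AE_all_countable, rule allI)
  fix n
  have "finite (s n ` {c<..d})" using s(1)[of n] by (simp add: simple_function_def)
  then show "AE t in leb {c<..d}. \<forall>w\<in>s n ` {c<..d}. g' t w = g t w"
   using has_tderiv_AE[OF g' g] s(2)[of n] by (intro AE_finite_allI) auto
 qed
 moreover have "AE t in leb {c<..d}. t \<in> {c<..d}" by (rule AE_I2) simp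
 ultimately have "AE t in leb {c<..d}. g' t (\<phi> t) = g t (\<phi> t)"
  using H s(3) \<phi>(2)
 proof eventually_elim
  case (elim t)
  have st: "s n t \<in> H10 U" "g' t (s n t) = g t (s n t)" for n using s(2)[of n] elim by auto
  have "(%n. k (s n t)) ----> k (\<phi> t)" if k: "k \<in> Hm1 U" for k
  proof -
   have z: "Hm1n U (%x. k x - k x) = 0" using vspace.N_mult[OF vspace_Hm1 zero_Hm1, of 0] by simp
   show ?thesis
    by (rule bilinear_pairing.B_tendsto[OF pairing_Hm1, where s = "%n. k" and v = k]) (use k st elim z in auto)
  qed
  from this[OF elim(3)] this[OF elim(4)] show ?case
   unfolding st(2) using LIMSEQ_unique by blast
 qed
 then show ?thesis by (simp add: g'_def)
qed

lemma Lbochner_ip_integrable: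
 assumes v: "v \<in> Lbochner 2 {c<..d} (H10 U) (H1n U)" and \<phi>: "\<phi> \<in> H10 U"
 shows "integrable (leb {c<..d}) (%t. ip U (v t) \<phi>)"
 by (rule bilinear_pairing.pairing_integrable[OF pairing_ip Ioc_lebesgue v Lbochner2_const[OF \<phi>]])

lemma has_tderiv_axpy:
 assumes v: "has_tderiv U c d v g" "v \<in> Lbochner 2 {c<..d} (H10 U) (H1n U)"
  and w: "has_tderiv U c d w g'" "w \<in> Lbochner 2 {c<..d} (H10 U) (H1n U)"
 shows "has_tderiv U c d (%t x. v t x + s * w t x) (%t \<phi>. g t \<phi> + s * g' t \<phi>)"
 unfolding has_tderiv_def
proof (intro conjI ballI)
 have g: "g \<in> Lbochner 2 {c<..d} (Hm1 U) (Hm1n U)" "g' \<in> Lbochner 2 {c<..d} (Hm1 U) (Hm1n U)"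
  using v w by (auto simp: has_tderiv_def)
 then show "(%t \<phi>. g t \<phi> + s * g' t \<phi>) \<in> Lbochner 2 {c<..d} (Hm1 U) (Hm1n U)"
  by (intro vspace.Lbochner2_axpy[OF vspace_Hm1]) auto
 fix \<phi> \<zeta> assume \<phi>: "\<phi> \<in> H10 U" and \<zeta>: "\<zeta> \<in> test_fun {c<..<d}"
 note i1 = test_times_integrable(2)[OF \<zeta> Lbochner_ip_integrable[OF v(2) \<phi>]] test_times_integrable(2)[OF \<zeta> Lbochner_ip_integrable[OF w(2) \<phi>]]
 note i2 = test_times_integrable(1)[OF \<zeta> Hm1_const_integrable[OF g(1) \<phi>]] test_times_integrable(1)[OF \<zeta> Hm1_const_integrable[OF g(2) \<phi>]]
 have aev: "AE t in leb {c<..d}. v t \<in> H10 U" "AE t in leb {c<..d}. w t \<in> H10 U"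
  using v w by (auto simp: Lbochner_def)
 have "(LINT t|leb {c<..d}. deriv \<zeta> t * ip U (%x. v t x + s * w t x) \<phi>)
  = (LINT t|leb {c<..d}. deriv \<zeta> t * ip U (v t) \<phi> + s * (deriv \<zeta> t * ip U (w t) \<phi>))"
 proof (rule lebesgue_on_integral_cong_AE[OF Ioc_lebesgue])
  show "AE t in leb {c<..d}. deriv \<zeta> t * ip U (%x. v t x + s * w t x) \<phi> = deriv \<zeta> t * ip U (v t) \<phi> + s * (deriv \<zeta> t * ip U (w t) \<phi>)"
   using aev by eventually_elim (simp add: ip_axpy_left H10_L2 \<phi> algebra_simps)
 qed
 also have "\<dots> = (LINT t|leb {c<..d}. deriv \<zeta> t * ip U (v t) \<phi>) + s * (LINT t|leb {c<..d}. deriv \<zeta> t * ip U (w t) \<phi>)"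
  using i1 by simp
 also have "\<dots> = - (LINT t|leb {c<..d}. \<zeta> t * g t \<phi>) - s * (LINT t|leb {c<..d}. \<zeta> t * g' t \<phi>)"
  using v w \<phi> \<zeta> by (simp add: has_tderiv_def)
 also have "\<dots> = - (LINT t|leb {c<..d}. \<zeta> t * g t \<phi> + s * (\<zeta> t * g' t \<phi>))"
  using i2 by simp
 also have "\<dots> = - (LINT t|leb {c<..d}. \<zeta> t * (g t \<phi> + s * g' t \<phi>))"
  by (simp add: algebra_simps)
 finally show "(LINT t|leb {c<..d}. deriv \<zeta> t * ip U (%x. v t x + s * w t x) \<phi>) = - (LINT t|leb {c<..d}. \<zeta> t * (g t \<phi> + s * g' t \<phi>))" .
qed

lemma has_tderiv_subset:
 assumes v: "has_tderiv U c d v g" and s: "c \<le> c'" "d' \<le> d"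
 shows "has_tderiv U c' d' v g"
 unfolding has_tderiv_def
proof (intro conjI ballI)
 have sub: "{c'<..d'} \<subseteq> {c<..d}" using s by auto
 show "g \<in> Lbochner 2 {c'<..d'} (Hm1 U) (Hm1n U)"
  using v sub by (auto simp: has_tderiv_def intro: Lbochner_subset)
 fix \<phi> \<zeta> assume \<phi>: "\<phi> \<in> H10 U" and \<zeta>: "\<zeta> \<in> test_fun {c'<..<d'}"
 have "{c'<..<d'} \<subseteq> {c<..<d}" using s by auto
 from test_fun_mono[OF this] have "\<zeta> \<in> test_fun {c<..<d}" using \<zeta> by blast
 then have eq: "(LINT t|leb {c<..d}. deriv \<zeta> t * ip U (v t) \<phi>) = - (LINT t|leb {c<..d}. \<zeta> t * g t \<phi>)"
  using v \<phi> by (simp add: has_tderiv_def)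
 have r: "(LINT t|leb {c<..d}. f t) = (LINT t|leb {c'<..d'}. f t)" if "\<And>t. t \<notin> {c'<..<d'} ==> f t = 0" for f :: "real \<Rightarrow> real"
 proof -
  have "f = (%t. if t \<in> {c'<..d'} then f t else 0)" using that by (auto simp: fun_eq_iff)
  then show ?thesis using integral_restrict[OF sub Ioc_lebesgue Ioc_lebesgue, of f] by metis
 qed
 have "(LINT t|leb {c<..d}. deriv \<zeta> t * ip U (v t) \<phi>) = (LINT t|leb {c'<..d'}. deriv \<zeta> t * ip U (v t) \<phi>)"
  by (rule r) (simp add: test_fun_deriv_zero_outside[OF \<zeta>])
 moreover have "(LINT t|leb {c<..d}. \<zeta> t * g t \<phi>) = (LINT t|leb {c'<..d'}. \<zeta> t * g t \<phi>)"
  by (rule r) (simp add: test_fun_zero_outside[OF \<zeta>])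
 ultimately show "(LINT t|leb {c'<..d'}. deriv \<zeta> t * ip U (v t) \<phi>) = - (LINT t|leb {c'<..d'}. \<zeta> t * g t \<phi>)"
  using eq by simp
qed

text \<open>For a separated function the weak derivative reduces to integration by parts of the
  scalar factor, which may have kinks.\<close>

lemma has_tderiv_scalar:
 fixes \<eta> h :: "real \<Rightarrow> real"
 assumes cd: "c \<le> d" and \<eta>: "continuous_on {c..d} \<eta>" and F: "finite F"
  and \<eta>': "\<And>t. t \<in> {c<..<d} - F ==> (\<eta> has_real_derivative h t) (at t)"
  and h: "h \<in> borel_measurable (leb {c<..d})" "\<And>t. t \<in> {c<..d} ==> \<bar>h t\<bar> \<le> M"
  and w: "w \<in> L2 U"
 shows "has_tderiv U c d (%t x. \<eta> t * w x) (%t \<phi>. h t * ip U w \<phi>)"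
 unfolding has_tderiv_def
proof (intro conjI ballI)
 have "integrable (leb {c<..d}) (%t. h t * h t)"
  by (rule bounded_mult_integrable[OF h bounded_integrable_Ioc[OF h]])
 then show "(%t \<phi>. h t * ip U w \<phi>) \<in> Lbochner 2 {c<..d} (Hm1 U) (Hm1n U)"
  by (intro vspace.Lbochner2_scalar[OF vspace_Hm1 h(1) _ ip_Hm1[OF w]]) (simp add: power2_eq_square)
 fix \<phi> \<zeta> assume "\<phi> \<in> H10 U" and \<zeta>: "\<zeta> \<in> test_fun {c<..<d}"
 have "(LINT t|leb {c<..d}. deriv \<zeta> t * ip U (%x. \<eta> t * w x) \<phi>) = (LINT t|leb {c<..d}. deriv \<zeta> t * \<eta> t) * ip U w \<phi>"
  by (simp add: ip_mult_left mult.assoc[symmetric])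
 also have "\<dots> = - (LINT t|leb {c<..d}. \<zeta> t * h t) * ip U w \<phi>"
  using piecewise_C1_by_parts[OF cd \<eta> F \<eta>' h \<zeta>] by simp
 also have "\<dots> = - (LINT t|leb {c<..d}. \<zeta> t * (h t * ip U w \<phi>))"
  by (simp add: mult.assoc[symmetric])
 finally show "(LINT t|leb {c<..d}. deriv \<zeta> t * ip U (%x. \<eta> t * w x) \<phi>) = - (LINT t|leb {c<..d}. \<zeta> t * (h t * ip U w \<phi>))" .
qed

lemma has_tderiv_cong:
 assumes v: "has_tderiv U c d v g" and eq: "\<And>t x. t \<in> {c<..d} ==> x \<in> U ==> v t x = v' t x"
 shows "has_tderiv U c d v' g"
proof -
 have "(LINT t|leb {c<..d}. deriv \<zeta> t * ip U (v' t) \<phi>) = (LINT t|leb {c<..d}. deriv \<zeta> t * ip U (v t) \<phi>)" for \<zeta> \<phi>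
 proof (intro integral_cong refl)
  fix t assume "t \<in> space (leb {c<..d})"
  then have "ip U (v' t) \<phi> = ip U (v t) \<phi>" using eq by (intro ip_cong) auto
  then show "deriv \<zeta> t * ip U (v' t) \<phi> = deriv \<zeta> t * ip U (v t) \<phi>" by simp
 qed
 then show ?thesis using v by (simp add: has_tderiv_def)
qed

lemma has_tderiv_sum:
 assumes fin: "finite A" and v: "\<And>i. i \<in> A ==> has_tderiv U c d (v i) (g i)" "\<And>i. i \<in> A ==> v i \<in> Lbochner 2 {c<..d} (H10 U) (H1n U)"
  and cd: "c \<le> d"
 shows "has_tderiv U c d (%t x. \<Sum>i\<in>A. v i t x) (%t \<phi>. \<Sum>i\<in>A. g i t \<phi>)"
 using fin v
proof (induction A rule: finite_induct)
 case empty
 have "has_tderiv U c d (%t x. 0 * 0) (%t \<phi>. 0 * ip U (%x. 0) \<phi>)"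
  by (rule has_tderiv_scalar[OF cd, where F = "{}" and M = 0]) (auto simp: L2_zero)
 then show ?case by simp
next
 case (insert i A)
 have "(%t x. \<Sum>i\<in>A. v i t x) \<in> Lbochner 2 {c<..d} (H10 U) (H1n U)"
  using insert by (intro vspace.Lbochner2_sum[OF vspace_H10]) auto
 then have "has_tderiv U c d (%t x. (\<Sum>i\<in>A. v i t x) + 1 * v i t x) (%t \<phi>. (\<Sum>i\<in>A. g i t \<phi>) + 1 * g i t \<phi>)"
  using insert by (intro has_tderiv_axpy) auto
 then show ?case using insert by (simp add: add.commute)
qed

text \<open>The limits are choices, and the triangle inequality forces any two candidates to agree
  almost everywhere. Leaving the filter general covers both sides at once.\<close>

lemma one_sided_limit_AE:
 fixes v :: "'t \<Rightarrow> 'a \<Rightarrow> real"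
 assumes w: "w \<in> L2 U" "((%t. L2n U (%x. v t x - w x)) \<longlongrightarrow> 0) F" and nt: "F \<noteq> bot"
  and v: "\<forall>\<^sub>F t in F. v t \<in> L2 U"
  and lim: "u = (SOME w. w \<in> L2 U \<and> ((%t. L2n U (%x. v t x - w x)) \<longlongrightarrow> 0) F)"
 shows "u \<in> L2 U" "AE x in leb U. u x = w x"
proof -
 have u: "u \<in> L2 U \<and> ((%t. L2n U (%x. v t x - u x)) \<longlongrightarrow> 0) F"
  unfolding lim by (rule someI[of _ w]) (use w in blast)
 then show uL: "u \<in> L2 U" by blast
 have "((%t. L2n U (%x. v t x - u x) + L2n U (%x. v t x - w x)) \<longlongrightarrow> 0 + 0) F"
  using u w by (intro tendsto_add) auto
 then have lim0: "((%t. L2n U (%x. v t x - u x) + L2n U (%x. v t x - w x)) \<longlongrightarrow> 0) F" by simp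
 have "\<forall>\<^sub>F t in F. norm (L2n U (%x. u x - w x)) \<le> L2n U (%x. v t x - u x) + L2n U (%x. v t x - w x)"
  using v
 proof eventually_elim
  case (elim t)
  have a: "(%x. (-1) * (v t x - u x)) \<in> L2 U" "(%x. v t x - w x) \<in> L2 U"
   using elim uL w by (auto intro: L2_mult_left L2_diff simp del: mult_minus1)
  have "L2n U (%x. u x - w x) = L2n U (%x. (-1) * (v t x - u x) + (v t x - w x))" by simp
  also have "\<dots> \<le> L2n U (%x. (-1) * (v t x - u x)) + L2n U (%x. v t x - w x)" by (rule L2n_triangle[OF a])
  also have "L2n U (%x. (-1) * (v t x - u x)) = L2n U (%x. v t x - u x)" by (subst L2n_mult) simp
  finally show ?case by (simp add: L2n_nonneg)
 qed
 then have "((%t. L2n U (%x. u x - w x)) \<longlongrightarrow> 0) F"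
  by (rule Lim_null_comparison[OF _ lim0])
 then have "L2n U (%x. u x - w x) = 0" using nt by (simp add: tendsto_const_iff)
 then have "AE x in leb U. u x - w x = 0" by (intro L2n_eq_0 L2_diff uL w)
 then show "AE x in leb U. u x = w x" by simp
qed

lemma rlim_AE:
 assumes "w \<in> L2 U" "((%t. L2n U (%x. v t x - w x)) \<longlongrightarrow> 0) (at_right \<tau>)" "\<forall>\<^sub>F t in at_right \<tau>. v t \<in> L2 U"
 shows "rlim U v \<tau> \<in> L2 U" "AE x in leb U. rlim U v \<tau> x = w x"
 using one_sided_limit_AE[OF assms(1,2) _ assms(3) rlim_def] by auto

lemma llim_AE:
 assumes "w \<in> L2 U" "((%t. L2n U (%x. v t x - w x)) \<longlongrightarrow> 0) (at_left \<tau>)" "\<forall>\<^sub>F t in at_left \<tau>. v t \<in> L2 U"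
 shows "llim U v \<tau> \<in> L2 U" "AE x in leb U. llim U v \<tau> x = w x"
 using one_sided_limit_AE[OF assms(1,2) _ assms(3) llim_def] by auto

end

section \<open>The space-time forms\<close>

lemma integral_Ioc_combine:
 fixes f :: "real \<Rightarrow> real"
 assumes ab: "a \<le> b" "b \<le> c" and f: "integrable (leb {a<..b}) f" "integrable (leb {b<..c}) f"
 shows "integrable (leb {a<..c}) f"
  and "(LINT t|leb {a<..c}. f t) = (LINT t|leb {a<..b}. f t) + (LINT t|leb {b<..c}. f t)"
proof -
 have i: "integrable lebesgue (%t. if t \<in> {a<..b} then f t else 0)" "integrable lebesgue (%t. if t \<in> {b<..c} then f t else 0)"
  using f integrable_restrict_UNIV[OF Ioc_lebesgue, where f = f] by blast+
 have eq: "(%t. if t \<in> {a<..c} then f t else 0) = (%t. (if t \<in> {a<..b} then f t else 0) + (if t \<in> {b<..c} then f t else 0))"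
  using ab by (auto simp: fun_eq_iff)
 have "integrable lebesgue (%t. if t \<in> {a<..c} then f t else 0)" unfolding eq using i by (rule integrable_add)
 then show "integrable (leb {a<..c}) f" using integrable_restrict_UNIV[OF Ioc_lebesgue, where f = f] by blast
 have "(LINT t|lebesgue. (if t \<in> {a<..c} then f t else 0)) = (LINT t|lebesgue. (if t \<in> {a<..b} then f t else 0)) + (LINT t|lebesgue. (if t \<in> {b<..c} then f t else 0))"
  unfolding eq using i by (rule integral_add)
 then show "(LINT t|leb {a<..c}. f t) = (LINT t|leb {a<..b}. f t) + (LINT t|leb {b<..c}. f t)"
  unfolding integral_restrict_UNIV[OF Ioc_lebesgue] .
qed

lemma (in bounded_domain) H1n_cong:
 assumes "\<And>x. x \<in> U ==> v x = w x" shows "H1n U v = H1n U w"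
proof -
 have "L2n U v = L2n U w" unfolding L2n_def using ip_cong[of U v w v w] assms by simp
 then show ?thesis unfolding H1n_def using wgrad_cong[of v w] assms by simp
qed

lemma (in bounded_domain) L2_cong: "(\<And>x. x \<in> U ==> v x = w x) ==> v \<in> L2 U ==> w \<in> L2 U"
 by (rule L2_cong_AE[OF dom_lebesgue]) auto

text \<open>Discrete functions are given by their formula on the closure of the domain only, so
  membership must not depend on values elsewhere.\<close>

lemma (in bounded_domain) H10_cong:
 assumes eq: "\<And>x. x \<in> U ==> v x = w x" and v: "v \<in> H10 U" shows "w \<in> H10 U"
proof -
 have "w \<in> L2 U" using L2_cong[OF eq H10_L2[OF v]] by simp
 moreover have "has_wgrad U w (wgrad U v)"
 proof -
  have "(LINT x|leb U. w x *\<^sub>R grad \<phi> x) = (LINT x|leb U. v x *\<^sub>R grad \<phi> x)" for \<phi>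
   using eq by (intro integral_cong) auto
  then show ?thesis using H1_has_wgrad[OF H10_H1[OF v]] by (simp add: has_wgrad_def)
 qed
 moreover have "H1n U (%x. \<phi> x - w x) = H1n U (%x. \<phi> x - v x)" for \<phi>
  by (rule H1n_cong) (simp add: eq)
 ultimately show ?thesis using v unfolding H10_def H1_def by auto
qed

lemma (in bounded_domain) Lbochner_H10_cong:
 assumes eq: "\<And>t x. t \<in> S ==> x \<in> U ==> v t x = v' t x" and v: "v \<in> Lbochner 2 S (H10 U) (H1n U)"
 shows "v' \<in> Lbochner 2 S (H10 U) (H1n U)"
proof -
 have tS: "AE t in leb S. t \<in> S" by (rule AE_I2) simp
 have "AE t in leb S. v t \<in> H10 U" using v by (simp add: Lbochner_def)
 with tS have "AE t in leb S. v' t \<in> H10 U"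
  by eventually_elim (rule H10_cong[rotated], assumption, simp add: eq)
 moreover have "strongly_measurable S (H10 U) (H1n U) v'"
 proof -
  obtain s where s: "\<And>n::nat. simple_function (leb S) (s n)" "\<And>n. s n ` S \<subseteq> H10 U"
   "AE t in leb S. (%n. H1n U (%x. s n t x - v t x)) ----> 0"
   using v by (auto simp: strongly_measurable_def Lbochner_def)
  from tS s(3) have "AE t in leb S. (%n. H1n U (%x. s n t x - v' t x)) ----> 0"
  proof eventually_elim
   case (elim t)
   have "H1n U (%x. s n t x - v' t x) = H1n U (%x. s n t x - v t x)" for n
    by (rule H1n_cong) (simp add: eq elim)
   then show ?case using elim by simp
  qed
  then show ?thesis using s(1,2) unfolding strongly_measurable_def by (intro exI[of _ s]) blast
 qed
 moreover have "integrable (leb S) (%t. (H1n U (v' t))\<^sup>2)"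
 proof -
  have "integrable (leb S) (%t. (H1n U (v t))\<^sup>2)" using v by (simp add: Lbochner_def)
  moreover have "H1n U (v t) = H1n U (v' t)" if "t \<in> S" for t by (rule H1n_cong) (simp add: eq that)
  ultimately show ?thesis by (subst integrable_cong[OF refl, of _ _ "%t. (H1n U (v t))\<^sup>2"]) auto
 qed
 ultimately show ?thesis by (simp add: Lbochner_def)
qed

section \<open>Time slabs, and the forms slab by slab\<close>

locale st_problem =
 fixes D :: "'a::euclidean_space setting"
 assumes data: "data_ok D" and disc: "discretization_ok D"
begin

abbreviation U where "U \<equiv> Om D"
abbreviation (input) sleb where "sleb m \<equiv> lebesgue_on (slab D m)"
abbreviation nsteps where "nsteps \<equiv> nstep D"

sublocale bounded_domain "Om D"
 by unfold_locales (use data in \<open>auto simp: data_ok_def polyhedral_domain_def\<close>)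

lemma nstep_pos: "1 \<le> nsteps" and node_0: "node D 0 = 0" and node_less: "m < nsteps ==> node D m < node D (Suc m)"
 using disc by (auto simp: discretization_ok_def)

lemma node_mono: "m \<le> n ==> n \<le> nsteps ==> node D m \<le> node D n"
proof (induction n)
 case (Suc n)
 show ?case
 proof (cases "m = Suc n")
  case False
  then have "node D m \<le> node D n" using Suc by simp
  also have "\<dots> < node D (Suc n)" using Suc by (intro node_less) simp
  finally show ?thesis by simp
 qed simp
qed simp

lemma node_strict: "m < n ==> n \<le> nsteps ==> node D m < node D n"
 using node_less[of m] node_mono[of "Suc m" n] by simp

lemma node_nonneg: "m \<le> nsteps ==> 0 \<le> node D m"
 using node_mono[of 0 m] node_0 by simp

lemma node_Tend: "m \<le> nsteps ==> node D m \<le> Tend D"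
 unfolding Tend_def by (rule node_mono) auto

lemma Tend_pos: "0 < Tend D"
 using node_strict[of 0 nsteps] nstep_pos node_0 by (simp add: Tend_def)

lemma slab_less: "m \<in> {1..nsteps} ==> node D (m - 1) < node D m"
 by (intro node_strict) auto

lemma slab_subset: "m \<in> {1..nsteps} ==> slab D m \<subseteq> {0<..Tend D}"
proof -
 assume m: "m \<in> {1..nsteps}"
 have "0 \<le> node D (m - 1)" using m by (intro node_nonneg) auto
 moreover have "node D m \<le> Tend D" using m by (intro node_Tend) auto
 ultimately show ?thesis by (auto simp: slab_def)
qed

lemma slab_lebesgue [simp]: "slab D m \<in> sets lebesgue" by (simp add: slab_def)

definition slab_int :: "(real \<Rightarrow> real) \<Rightarrow> real" where "slab_int f = (\<Sum>m=1..nsteps. LINT t|sleb m. f t)"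
definition slabwise_integrable where "slabwise_integrable f \<longleftrightarrow> (\<forall>m\<in>{1..nsteps}. integrable (sleb m) (f :: real \<Rightarrow> real))"

lemma slab_int_add: "slabwise_integrable f ==> slabwise_integrable g ==> slab_int (%t. f t + g t) = slab_int f + slab_int g"
 unfolding slab_int_def sum.distrib[symmetric] by (intro sum.cong refl) (auto simp: slabwise_integrable_def)

lemma slabwise_integrable_add: "slabwise_integrable f ==> slabwise_integrable g ==> slabwise_integrable (%t. f t + g t)"
 by (auto simp: slabwise_integrable_def)

lemma slabwise_integrable_mult: "slabwise_integrable f ==> slabwise_integrable (%t. c * f t)"
 by (auto simp: slabwise_integrable_def)

lemma slab_int_mult: "slab_int (%t. c * f t) = c * slab_int f"
 by (simp add: slab_int_def sum_distrib_left)

lemma slab_int_cong_AE: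
 assumes "\<And>m. m \<in> {1..nsteps} ==> AE t in sleb m. f t = g t" shows "slab_int f = slab_int g"
 unfolding slab_int_def by (rule sum.cong[OF refl], rule lebesgue_on_integral_cong_AE[OF slab_lebesgue assms])

lemma slab_int_eq_integral:
 assumes "slabwise_integrable f"
 shows "slab_int f = (LINT t|leb {0<..Tend D}. f t)" "integrable (leb {0<..Tend D}) f"
proof -
 have "integrable (leb {0<..node D n}) f \<and> (LINT t|leb {0<..node D n}. f t) = (\<Sum>m=1..n. LINT t|sleb m. f t)"
  if "n \<le> nsteps" for n
  using that
 proof (induction n)
  case 0
  then show ?case by (simp add: node_0)
 next
  case (Suc n)
  have s: "slab D (Suc n) = {node D n<..node D (Suc n)}" by (simp add: slab_def)
  have i: "integrable (leb {node D n<..node D (Suc n)}) f"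
   using assms Suc.prems unfolding slabwise_integrable_def s[symmetric] by auto
  have IH: "integrable (leb {0<..node D n}) f"
   "(LINT t|leb {0<..node D n}. f t) = (\<Sum>m=1..n. LINT t|sleb m. f t)" using Suc by auto
  have o: "0 \<le> node D n" "node D n \<le> node D (Suc n)" using Suc.prems node_nonneg[of n] node_mono[of n "Suc n"] by auto
  show ?case using integral_Ioc_combine[OF o IH(1) i] IH(2) s by simp
 qed
 from this[of nsteps] show "slab_int f = (LINT t|leb {0<..Tend D}. f t)" "integrable (leb {0<..Tend D}) f"
  by (simp_all add: slab_int_def Tend_def)
qed

lemma integrable_imp_slabwise:
 "integrable (leb {0<..Tend D}) f ==> slabwise_integrable f"
 unfolding slabwise_integrable_def
 by (intro ballI, rule lebesgue_on_integrable_subset[OF _ slab_subset]) simp_all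

text \<open>The common class of \<open>X_space\<close>, \<open>Y_space\<close> and the discrete
  space on which the forms are evaluated.\<close>

definition LB where "LB v \<longleftrightarrow> (\<forall>m\<in>{1..nsteps}. v \<in> Lbochner 2 (slab D m) (H10 U) (H1n U))"

lemma LB_slab: "LB v ==> m \<in> {1..nsteps} ==> v \<in> Lbochner 2 (slab D m) (H10 U) (H1n U)"
 by (simp add: LB_def)

lemma LB_AE: "LB v ==> m \<in> {1..nsteps} ==> AE t in sleb m. v t \<in> H10 U"
 by (simp add: LB_def Lbochner_def)

lemma Lbochner_LB: "v \<in> Lbochner 2 {0<..Tend D} (H10 U) (H1n U) ==> LB v"
 unfolding LB_def by (intro ballI, rule Lbochner_subset[OF _ slab_subset]) simp_all

lemma X_LB: "v \<in> X_space D ==> LB v" and Y_LB: "v \<in> Y_space D ==> LB v"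
 by (auto simp: X_space_def Y_space_def intro: Lbochner_LB)

lemma LB_axpy: "LB v ==> LB w ==> LB (%t x. v t x + c * w t x)"
 unfolding LB_def by (auto intro: vspace.Lbochner2_axpy[OF vspace_H10])

lemma vel_measurable: "vel D \<in> borel_measurable (leb U)"
proof (subst borel_measurable_euclidean_space, rule ballI)
 fix i :: 'a assume "i \<in> Basis"
 then have "(%x. vel D x \<bullet> i) \<in> H1 U" using data by (simp add: data_ok_def)
 then show "(%x. vel D x \<bullet> i) \<in> borel_measurable (leb U)" by (intro L2_measurable H1_L2)
qed

lemma vel_bounded: "\<exists>C. AE x in leb U. norm (vel D x) \<le> C"
 using data by (simp add: data_ok_def)

lemma b_grad_L2: "v \<in> H1 U ==> b_grad D v \<in> L2 U"
proof -
 assume v: "v \<in> H1 U"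
 obtain C where "AE x in leb U. norm (vel D x) \<le> C" using vel_bounded by blast
 from L2_bounded_mult(1)[OF dom_lebesgue vel_measurable this wgrad_L2[OF v]] show ?thesis
  by (simp add: b_grad_def[abs_def])
qed

lemma b_grad_axpy: "v \<in> H1 U ==> w \<in> H1 U ==>
  AE x in leb U. b_grad D (%x. v x + c * w x) x = b_grad D v x + c * b_grad D w x"
 using wgrad_axpy[of v w c] by (rule AE_mp[OF _ AE_I2]) (auto simp: b_grad_def inner_add_right)

lemma b_grad_sum:
 "(\<And>i. i \<in> A ==> v i \<in> H1 U) ==> AE x in leb U. b_grad D (%x. \<Sum>i\<in>A. c i * v i x) x = (\<Sum>i\<in>A. c i * b_grad D (v i) x)"
 by (rule AE_mp[OF wgrad_sum[of A v c] AE_I2]) (auto simp: b_grad_def inner_sum_right)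

text \<open>The bilinear form at a fixed time; \<open>a_form\<close> is its integral over
  time.\<close>

definition aT where
 "aT v w = ip U (b_grad D v) w + eps D * ip U (wgrad U v) (wgrad U w) + alp D * ip U v w"

lemma pairing_b_grad: "\<exists>M. bilinear_pairing (H10 U) (H1n U) (H10 U) (H1n U) (%v w. ip U (b_grad D v) w) M"
proof -
 obtain C where C: "AE x in leb U. norm (vel D x) \<le> C" using vel_bounded by blast
 have "bilinear_pairing (H10 U) (H1n U) (H10 U) (H1n U) (%v w. ip U (b_grad D v) w) \<bar>C\<bar>"
 proof (intro bilinear_pairing.intro bilinear_pairing_axioms.intro vspace_H10)
  fix v v' w c assume H: "v \<in> H10 U" "v' \<in> H10 U" "w \<in> H10 U"
  have "ip U (b_grad D (%x. v x + c * v' x)) w = ip U (%x. b_grad D v x + c * b_grad D v' x) w"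
   by (rule ip_cong_AE[OF dom_lebesgue b_grad_axpy]) (use H in \<open>auto intro: H10_H1\<close>)
  then show "ip U (b_grad D (%x. v x + c * v' x)) w = ip U (b_grad D v) w + c * ip U (b_grad D v') w"
   using H by (simp add: ip_axpy_left b_grad_L2 H10_H1 H10_L2)
  show "ip U (b_grad D w) (%x. v x + c * v' x) = ip U (b_grad D w) v + c * ip U (b_grad D w) v'"
   using H by (intro ip_axpy_right b_grad_L2 H10_H1 H10_L2)
 next
  fix v w assume H: "v \<in> H10 U" "w \<in> H10 U"
  have "\<bar>ip U (b_grad D v) w\<bar> \<le> L2n U (b_grad D v) * L2n U w"
   using H by (intro ip_Cauchy_Schwarz b_grad_L2 H10_H1 H10_L2)
  also have "\<dots> \<le> (\<bar>C\<bar> * H1n U v) * H1n U w"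
  proof (intro mult_mono L2n_le_H1n L2n_nonneg mult_nonneg_nonneg H1n_nonneg)
   have "L2n U (b_grad D v) \<le> \<bar>C\<bar> * L2n U (wgrad U v)"
    using L2_bounded_mult(2)[OF dom_lebesgue vel_measurable C wgrad_L2[OF H10_H1[OF H(1)]]] by (simp add: b_grad_def[abs_def])
   also have "\<dots> \<le> \<bar>C\<bar> * H1n U v" by (intro mult_left_mono L2n_le_H1n) simp
   finally show "L2n U (b_grad D v) \<le> \<bar>C\<bar> * H1n U v" .
  qed simp
  finally show "\<bar>ip U (b_grad D v) w\<bar> \<le> \<bar>C\<bar> * H1n U v * H1n U w" .
 qed
 then show ?thesis by blast
qed

lemma pairing_wgrad: "bilinear_pairing (H10 U) (H1n U) (H10 U) (H1n U) (%v w. ip U (wgrad U v) (wgrad U w)) 1"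
proof (intro bilinear_pairing.intro bilinear_pairing_axioms.intro vspace_H10)
 fix v v' w c assume H: "v \<in> H10 U" "v' \<in> H10 U" "w \<in> H10 U"
 have ae: "AE x in leb U. wgrad U (%x. v x + c * v' x) x = wgrad U v x + c *\<^sub>R wgrad U v' x"
  using H by (intro wgrad_axpy H10_H1)
 have "ip U (wgrad U (%x. v x + c * v' x)) (wgrad U w) = ip U (%x. wgrad U v x + c *\<^sub>R wgrad U v' x) (wgrad U w)"
  by (rule ip_cong_AE[OF dom_lebesgue ae]) auto
 then show "ip U (wgrad U (%x. v x + c * v' x)) (wgrad U w) = ip U (wgrad U v) (wgrad U w) + c * ip U (wgrad U v') (wgrad U w)"
  using H by (simp add: ip_lincomb_left wgrad_L2 H10_H1)
 have "ip U (wgrad U w) (wgrad U (%x. v x + c * v' x)) = ip U (wgrad U w) (%x. wgrad U v x + c *\<^sub>R wgrad U v' x)"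
  by (rule ip_cong_AE[OF dom_lebesgue _ ae]) auto
 then show "ip U (wgrad U w) (wgrad U (%x. v x + c * v' x)) = ip U (wgrad U w) (wgrad U v) + c * ip U (wgrad U w) (wgrad U v')"
  using H by (simp add: ip_lincomb_right wgrad_L2 H10_H1)
next
 fix v w assume H: "v \<in> H10 U" "w \<in> H10 U"
 have "\<bar>ip U (wgrad U v) (wgrad U w)\<bar> \<le> L2n U (wgrad U v) * L2n U (wgrad U w)"
  using H by (intro ip_Cauchy_Schwarz wgrad_L2 H10_H1)
 also have "\<dots> \<le> H1n U v * H1n U w" by (intro mult_mono L2n_le_H1n H1n_nonneg L2n_nonneg)
 finally show "\<bar>ip U (wgrad U v) (wgrad U w)\<bar> \<le> 1 * H1n U v * H1n U w" by simp
qed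

lemma LB_integrable:
 assumes "LB v" "LB w"
 shows "slabwise_integrable (%t. ip U (b_grad D (v t)) (w t))" "slabwise_integrable (%t. ip U (wgrad U (v t)) (wgrad U (w t)))"
  "slabwise_integrable (%t. ip U (v t) (w t))"
proof -
 obtain M where M: "bilinear_pairing (H10 U) (H1n U) (H10 U) (H1n U) (%v w. ip U (b_grad D v) w) M" using pairing_b_grad by blast
 show "slabwise_integrable (%t. ip U (b_grad D (v t)) (w t))" "slabwise_integrable (%t. ip U (wgrad U (v t)) (wgrad U (w t)))"
  "slabwise_integrable (%t. ip U (v t) (w t))"
  unfolding slabwise_integrable_def
  using bilinear_pairing.pairing_integrable[OF M slab_lebesgue LB_slab[OF assms(1)] LB_slab[OF assms(2)]]
   bilinear_pairing.pairing_integrable[OF pairing_wgrad slab_lebesgue LB_slab[OF assms(1)] LB_slab[OF assms(2)]]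
   bilinear_pairing.pairing_integrable[OF pairing_ip slab_lebesgue LB_slab[OF assms(1)] LB_slab[OF assms(2)]]
  by auto
qed

lemma aT_integrable: "LB v ==> LB w ==> slabwise_integrable (%t. aT (v t) (w t))"
 unfolding aT_def by (intro slabwise_integrable_add slabwise_integrable_mult LB_integrable)

lemma a_form_eq:
 assumes "LB v" "LB w" shows "a_form D v w = slab_int (%t. aT (v t) (w t))"
proof -
 have "st_ip D (%t. b_grad D (v t)) w = slab_int (%t. ip U (b_grad D (v t)) (w t))"
  unfolding st_ip_def by (rule slab_int_eq_integral(1)[symmetric, OF LB_integrable(1)[OF assms]])
 moreover have "st_ip D (%t x. eps D *\<^sub>R wgrad (Om D) (v t) x) (%t. wgrad (Om D) (w t)) = eps D * slab_int (%t. ip U (wgrad U (v t)) (wgrad U (w t)))"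
  unfolding st_ip_def ip_scaleR_left using slab_int_eq_integral(1)[OF LB_integrable(2)[OF assms]] by simp
 moreover have "st_ip D (%t x. alp D * v t x) w = alp D * slab_int (%t. ip U (v t) (w t))"
  unfolding st_ip_def ip_mult_left using slab_int_eq_integral(1)[OF LB_integrable(3)[OF assms]] by simp
 ultimately show ?thesis
  unfolding a_form_def aT_def using LB_integrable[OF assms]
  by (simp add: slab_int_add slab_int_mult slabwise_integrable_add slabwise_integrable_mult)
qed

lemma aT_axpy_left: "v \<in> H10 U ==> v' \<in> H10 U ==> w \<in> H10 U ==> aT (%x. v x + c * v' x) w = aT v w + c * aT v' w"
proof -
 assume H: "v \<in> H10 U" "v' \<in> H10 U" "w \<in> H10 U"
 obtain M where M: "bilinear_pairing (H10 U) (H1n U) (H10 U) (H1n U) (%v w. ip U (b_grad D v) w) M" using pairing_b_grad by blast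
 show ?thesis unfolding aT_def
  using bilinear_pairing.B_left[OF M H, of c] bilinear_pairing.B_left[OF pairing_wgrad H, of c] bilinear_pairing.B_left[OF pairing_ip H, of c]
  by (simp add: algebra_simps)
qed

lemma aT_axpy_right: "v \<in> H10 U ==> w \<in> H10 U ==> w' \<in> H10 U ==> aT v (%x. w x + c * w' x) = aT v w + c * aT v w'"
proof -
 assume H: "v \<in> H10 U" "w \<in> H10 U" "w' \<in> H10 U"
 obtain M where M: "bilinear_pairing (H10 U) (H1n U) (H10 U) (H1n U) (%v w. ip U (b_grad D v) w) M" using pairing_b_grad by blast
 show ?thesis unfolding aT_def
  using bilinear_pairing.B_right[OF M H, of c] bilinear_pairing.B_right[OF pairing_wgrad H, of c] bilinear_pairing.B_right[OF pairing_ip H, of c]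
  by (simp add: algebra_simps)
qed

lemma rhs_Lbochner: "m \<in> {1..nsteps} ==> (%t \<phi>. ip U (rhs D t) \<phi>) \<in> Lbochner 2 (slab D m) (Hm1 U) (Hm1n U)"
 by (rule Lbochner_subset[OF _ slab_subset, of _ 2]) (use data in \<open>simp_all add: data_ok_def\<close>)

lemma rhs_integrable: "LB w ==> slabwise_integrable (%t. ip U (rhs D t) (w t))"
 unfolding slabwise_integrable_def
 using bilinear_pairing.pairing_integrable[OF pairing_Hm1 slab_lebesgue rhs_Lbochner LB_slab] by auto

lemma F_form_eq: "LB w ==> F_form D w = slab_int (%t. ip U (rhs D t) (w t))"
 unfolding F_form_def st_ip_def by (rule slab_int_eq_integral(1)[symmetric, OF rhs_integrable])

text \<open>Carries explicit derivatives \<open>g m\<close>, one per slab, in place of the choice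
  \<open>tderiv\<close>; \<open>tpairing_eq\<close> exchanges one for the other under the
  integral.\<close>

definition tder where "tder v g \<longleftrightarrow> (\<forall>m\<in>{1..nsteps}. has_tderiv U (node D (m - 1)) (node D m) v (g m))"

lemma tder_Lbochner: "tder v g ==> m \<in> {1..nsteps} ==> g m \<in> Lbochner 2 (slab D m) (Hm1 U) (Hm1n U)"
 unfolding tder_def has_tderiv_def slab_def by blast

lemma tder_integrable:
 assumes "tder v g" "LB w" "m \<in> {1..nsteps}"
 shows "integrable (sleb m) (%t. g m t (w t))"
 by (rule bilinear_pairing.pairing_integrable[OF pairing_Hm1 slab_lebesgue tder_Lbochner[OF assms(1,3)] LB_slab[OF assms(2,3)]])

lemma tpairing_eq:
 assumes "tder v g" "LB w"
 shows "tpairing D v w = (\<Sum>m=1..nsteps. LINT t|sleb m. g m t (w t))"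
 unfolding tpairing_def
proof (intro sum.cong refl lebesgue_on_integral_cong_AE slab_lebesgue)
 fix m assume m: "m \<in> {1..nsteps}"
 have g: "has_tderiv U (node D (m - 1)) (node D m) v (g m)" using assms(1) m by (simp add: tder_def)
 show "AE t in sleb m. tderiv U (node D (m - 1)) (node D m) v t (w t) = g m t (w t)"
  using tderiv_AE[OF g, folded slab_def[of D m]] LB_slab[OF assms(2) m] unfolding Lbochner_def by blast
qed

lemma tder_global: "has_tderiv U 0 (Tend D) v g ==> tder v (%m. g)"
 unfolding tder_def by (intro ballI, rule has_tderiv_subset) (auto intro: node_nonneg node_Tend)

lemma tder_axpy: "tder v g ==> LB v ==> tder w g' ==> LB w ==> tder (%t x. v t x + c * w t x) (%m t \<phi>. g m t \<phi> + c * g' m t \<phi>)"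
 unfolding tder_def LB_def slab_def by (auto intro!: has_tderiv_axpy)

lemma tpairing_axpy_left:
 assumes v: "tder v g" "LB v" and w: "tder w g'" "LB w" and z: "LB z"
 shows "tpairing D (%t x. v t x + c * w t x) z = tpairing D v z + c * tpairing D w z"
 unfolding tpairing_eq[OF tder_axpy[OF v w] z] tpairing_eq[OF v(1) z] tpairing_eq[OF w(1) z] sum_distrib_left sum.distrib[symmetric]
 by (intro sum.cong refl) (use tder_integrable[OF v(1) z] tder_integrable[OF w(1) z] in simp)

lemma tpairing_scale_right:
 assumes v: "tder v g" and z: "LB z"
 shows "tpairing D v (%t x. c * z t x) = c * tpairing D v z"
proof -
 have z': "LB (%t x. c * z t x)" using LB_axpy[OF z z, of "c - 1"] by (simp add: algebra_simps)
 show ?thesis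
  unfolding tpairing_eq[OF v z'] tpairing_eq[OF v z] sum_distrib_left
 proof (intro sum.cong refl)
  fix m assume m: "m \<in> {1..nsteps}"
  have "AE t in sleb m. g m t \<in> Hm1 U"
   using tder_Lbochner[OF v m] unfolding Lbochner_def by blast
  with LB_AE[OF z m] have "AE t in sleb m. g m t (%x. c * z t x) = c * g m t (z t)"
   by eventually_elim (simp add: Hm1_mult)
  then have "(LINT t|sleb m. g m t (%x. c * z t x)) = (LINT t|sleb m. c * g m t (z t))"
   by (rule lebesgue_on_integral_cong_AE[OF slab_lebesgue])
  then show "(LINT t|sleb m. g m t (%x. c * z t x)) = c * (LINT t|sleb m. g m t (z t))" by simp
 qed
qed

lemma a_form_axpy_left:
 assumes "LB v" "LB w" "LB z"
 shows "a_form D (%t x. v t x + c * w t x) z = a_form D v z + c * a_form D w z"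
proof -
 have "slab_int (%t. aT (%x. v t x + c * w t x) (z t)) = slab_int (%t. aT (v t) (z t) + c * aT (w t) (z t))"
 proof (rule slab_int_cong_AE)
  fix m assume m: "m \<in> {1..nsteps}"
  show "AE t in sleb m. aT (%x. v t x + c * w t x) (z t) = aT (v t) (z t) + c * aT (w t) (z t)"
   using LB_AE[OF assms(1) m] LB_AE[OF assms(2) m] LB_AE[OF assms(3) m] by eventually_elim (rule aT_axpy_left)
 qed
 then show ?thesis using assms by (simp add: a_form_eq LB_axpy slab_int_add slab_int_mult aT_integrable slabwise_integrable_mult)
qed

lemma a_form_scale_right:
 assumes "LB v" "LB z"
 shows "a_form D v (%t x. c * z t x) = c * a_form D v z"
proof -
 have z': "LB (%t x. c * z t x)" using LB_axpy[OF assms(2,2), of "c - 1"] by (simp add: algebra_simps)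
 have "slab_int (%t. aT (v t) (%x. c * z t x)) = slab_int (%t. c * aT (v t) (z t))"
 proof (rule slab_int_cong_AE)
  fix m assume m: "m \<in> {1..nsteps}"
  show "AE t in sleb m. aT (v t) (%x. c * z t x) = c * aT (v t) (z t)"
   using LB_AE[OF assms(1) m] LB_AE[OF assms(2) m]
  proof eventually_elim
   case (elim t)
   show ?case using aT_axpy_right[OF elim(1,2,2), of "c - 1"] by (simp add: algebra_simps)
  qed
 qed
 then show ?thesis using assms z' by (simp add: a_form_eq slab_int_mult)
qed

end

section \<open>The Lagrangian\<close>

lemma at_right_within:
 fixes f :: "real \<Rightarrow> real"
 assumes "(f \<longlongrightarrow> l) (at \<tau> within S)" "{\<tau><..<b} \<subseteq> S" "\<tau> < b" shows "(f \<longlongrightarrow> l) (at_right \<tau>)"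
 proof -
 have "at \<tau> within {\<tau><..<b} = at_right \<tau>" by (rule at_within_nhd[of _ "{..<b}"]) (use assms(3) in auto)
 then show ?thesis using tendsto_within_subset[OF assms(1,2)] by simp
qed

lemma at_left_within:
 fixes f :: "real \<Rightarrow> real"
 assumes "(f \<longlongrightarrow> l) (at \<tau> within S)" "{b<..<\<tau>} \<subseteq> S" "b < \<tau>" shows "(f \<longlongrightarrow> l) (at_left \<tau>)"
 proof -
 have "at \<tau> within {b<..<\<tau>} = at_left \<tau>" by (rule at_within_nhd[of _ "{b<..}"]) (use assms(3) in auto)
 then show ?thesis using tendsto_within_subset[OF assms(1,2)] by simp
qed

context st_problem
begin

lemma X_Lbochner: "v \<in> X_space D ==> v \<in> Lbochner 2 {0<..Tend D} (H10 U) (H1n U)"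
 and X_cont: "v \<in> X_space D ==> cont_into (L2 U) (L2n U) {0..Tend D} v"
 and X_tderiv: "v \<in> X_space D ==> \<exists>g. has_tderiv U 0 (Tend D) v g"
 by (auto simp: X_space_def)

lemma X_L2: "v \<in> X_space D ==> t \<in> {0..Tend D} ==> v t \<in> L2 U"
 using X_cont by (auto simp: cont_into_def)

lemma X_rlim:
 assumes v: "v \<in> X_space D" and \<tau>: "0 \<le> \<tau>" "\<tau> < Tend D"
 shows "rlim U v \<tau> \<in> L2 U" "AE x in leb U. rlim U v \<tau> x = v \<tau> x"
proof -
 have l: "((%s. L2n U (%x. v s x - v \<tau> x)) \<longlongrightarrow> 0) (at_right \<tau>)"
  by (rule at_right_within[of _ _ _ "{0..Tend D}" "Tend D"]) (use X_cont[OF v] \<tau> in \<open>auto simp: cont_into_def\<close>)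
 have e: "\<forall>\<^sub>F t in at_right \<tau>. v t \<in> L2 U"
  using eventually_at_right_real[OF \<tau>(2)] by eventually_elim (use X_L2[OF v] \<tau> in auto)
 show "rlim U v \<tau> \<in> L2 U" "AE x in leb U. rlim U v \<tau> x = v \<tau> x"
  using rlim_AE[OF X_L2[OF v] l e] \<tau> by auto
qed

lemma X_llim:
 assumes v: "v \<in> X_space D" and \<tau>: "0 < \<tau>" "\<tau> \<le> Tend D"
 shows "llim U v \<tau> \<in> L2 U" "AE x in leb U. llim U v \<tau> x = v \<tau> x"
proof -
 have l: "((%s. L2n U (%x. v s x - v \<tau> x)) \<longlongrightarrow> 0) (at_left \<tau>)"
  by (rule at_left_within[of _ _ _ "{0..Tend D}" 0]) (use X_cont[OF v] \<tau> in \<open>auto simp: cont_into_def\<close>)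
 have e: "\<forall>\<^sub>F t in at_left \<tau>. v t \<in> L2 U"
  using eventually_at_left_real[OF \<tau>(1)] by eventually_elim (use X_L2[OF v] \<tau> in auto)
 show "llim U v \<tau> \<in> L2 U" "AE x in leb U. llim U v \<tau> x = v \<tau> x"
  using llim_AE[OF X_L2[OF v] l e] \<tau> by auto
qed

lemma tjump_zero:
 assumes v: "AE x in leb U. rlim U v \<tau> x = a x" "AE x in leb U. llim U v \<tau> x = a x"
 shows "ip U (tjump U v \<tau>) w = 0"
proof -
 have "AE x in leb U. tjump U v \<tau> x = 0"
  using v by eventually_elim (simp add: tjump_def)
 then have "ip U (tjump U v \<tau>) w = ip U (%x. 0) w" by (intro ip_cong_AE[OF dom_lebesgue]) auto
 then show ?thesis by simp
qed

lemma node_interior: "m \<in> {2..nsteps} ==> 0 < node D (m - 1) \<and> node D (m - 1) < Tend D"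
 using node_strict[of 0 "m - 1"] node_strict[of "m - 1" nsteps] node_0 by (auto simp: Tend_def)

lemma Y_rep:
 assumes z: "z \<in> Y_space D" and m: "m \<in> {1..nsteps}"
 obtains w where "cont_into (H10 U) (H1n U) {node D (m - 1)..node D m} w" "\<And>t. t \<in> slab D m ==> z t = w t"
proof -
 have "\<forall>m\<in>{1..nsteps}. \<exists>w. cont_into (H10 U) (H1n U) {node D (m - 1)..node D m} w \<and> (\<forall>t\<in>slab D m. z t = w t)"
  using z unfolding Y_space_def by blast
 from bspec[OF this m] show ?thesis using that by blast
qed

lemma Y_H10: "z \<in> Y_space D ==> m \<in> {1..nsteps} ==> t \<in> slab D m ==> z t \<in> H10 U"
proof -
 assume z: "z \<in> Y_space D" and m: "m \<in> {1..nsteps}" and t: "t \<in> slab D m"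
 obtain w where w: "cont_into (H10 U) (H1n U) {node D (m - 1)..node D m} w" "\<And>t. t \<in> slab D m ==> z t = w t"
  by (rule Y_rep[OF z m]) blast
 show ?thesis using w(1) w(2)[OF t] t by (auto simp: cont_into_def slab_def)
qed

text \<open>Slabs are closed on the right, so this includes the nodes: the value of \<open>z\<close>
  at a node belongs to the slab before it.\<close>

lemma Y_left_cont:
 assumes z: "z \<in> Y_space D" and m: "m \<in> {1..nsteps}" and t: "t \<in> slab D m"
 shows "((%s. L2n U (%x. z s x - z t x)) \<longlongrightarrow> 0) (at_left t)"
proof -
 obtain w where w: "cont_into (H10 U) (H1n U) {node D (m - 1)..node D m} w" "\<And>t. t \<in> slab D m ==> z t = w t"
  by (rule Y_rep[OF z m]) blast
 have tt: "node D (m - 1) < t" "t \<le> node D m" using t by (auto simp: slab_def)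
 have "((%s. H1n U (%x. w s x - w t x)) \<longlongrightarrow> 0) (at_left t)"
  by (rule at_left_within[of _ _ _ "{node D (m - 1)..node D m}" "node D (m - 1)"]) (use w(1) tt in \<open>auto simp: cont_into_def\<close>)
 moreover have "\<forall>\<^sub>F s in at_left t. H1n U (%x. w s x - w t x) = H1n U (%x. z s x - z t x)"
  using eventually_at_left_real[OF tt(1)]
 proof eventually_elim
  case (elim s)
  then have "s \<in> slab D m" using tt by (auto simp: slab_def)
  then show ?case using w(2) t by simp
 qed
 ultimately have l: "((%s. H1n U (%x. z s x - z t x)) \<longlongrightarrow> 0) (at_left t)" by (rule Lim_transform_eventually)
 show ?thesis by (rule Lim_null_comparison[OF _ l]) (auto simp: L2n_nonneg L2n_le_H1n intro!: always_eventually)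
qed

text \<open>Time 0 lies in no slab, so \<open>z 0\<close> is not tied to the other values. The limit
  from the right is the value at 0 of the continuous extension from the first slab.\<close>

lemma Y_rlim:
 assumes z: "z \<in> Y_space D"
 shows "\<exists>z0\<in>L2 U. ((%s. L2n U (%x. z s x - z0 x)) \<longlongrightarrow> 0) (at_right 0) \<and> (\<forall>\<^sub>F t in at_right 0. z t \<in> L2 U)"
proof -
 have m: "1 \<in> {1..nsteps}" using nstep_pos by simp
 obtain w where w: "cont_into (H10 U) (H1n U) {node D (1 - 1)..node D 1} w" "\<And>t. t \<in> slab D 1 ==> z t = w t"
  by (rule Y_rep[OF z m]) blast
 have n1: "0 < node D 1" using slab_less[OF m] node_0 by simp
 have "((%s. H1n U (%x. w s x - w 0 x)) \<longlongrightarrow> 0) (at_right 0)"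
  by (rule at_right_within[of _ _ _ "{0..node D 1}" "node D 1"]) (use w(1) n1 in \<open>auto simp: cont_into_def node_0\<close>)
 moreover have ev: "\<forall>\<^sub>F s in at_right 0. s \<in> slab D 1"
  using eventually_at_right_real[OF n1] by eventually_elim (auto simp: slab_def node_0)
 then have "\<forall>\<^sub>F s in at_right 0. H1n U (%x. w s x - w 0 x) = H1n U (%x. z s x - w 0 x)"
  by eventually_elim (simp add: w(2))
 ultimately have l: "((%s. H1n U (%x. z s x - w 0 x)) \<longlongrightarrow> 0) (at_right 0)" by (rule Lim_transform_eventually)
 have "((%s. L2n U (%x. z s x - w 0 x)) \<longlongrightarrow> 0) (at_right 0)"
  by (rule Lim_null_comparison[OF _ l]) (auto simp: L2n_nonneg L2n_le_H1n intro!: always_eventually)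
 moreover have "\<forall>\<^sub>F t in at_right 0. z t \<in> L2 U"
  using ev by eventually_elim (use Y_H10[OF z m] H10_L2 in auto)
 moreover have "w 0 \<in> L2 U" using w(1) n1 by (auto simp: cont_into_def node_0 intro: H10_L2)
 ultimately show ?thesis by blast
qed

lemma Y_rlim_L2: "z \<in> Y_space D ==> rlim U z 0 \<in> L2 U"
 using Y_rlim rlim_AE(1) by blast

lemma Y_rlim_scale:
 assumes z: "z \<in> Y_space D" shows "AE x in leb U. rlim U (%t x. c * z t x) 0 x = c * rlim U z 0 x"
proof -
 obtain z0 where z0: "z0 \<in> L2 U" "((%s. L2n U (%x. z s x - z0 x)) \<longlongrightarrow> 0) (at_right 0)" "\<forall>\<^sub>F t in at_right 0. z t \<in> L2 U"
  using Y_rlim[OF z] by blast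
 have "((%s. \<bar>c\<bar> * L2n U (%x. z s x - z0 x)) \<longlongrightarrow> \<bar>c\<bar> * 0) (at_right 0)" by (intro tendsto_intros z0(2))
 then have l: "((%s. L2n U (%x. c * z s x - c * z0 x)) \<longlongrightarrow> 0) (at_right 0)"
  unfolding right_diff_distrib[symmetric] L2n_mult by simp
 have e: "\<forall>\<^sub>F t in at_right 0. (%x. c * z t x) \<in> L2 U" using z0(3) by eventually_elim (rule L2_mult_left)
 have "AE x in leb U. rlim U (%t x. c * z t x) 0 x = c * z0 x" by (rule rlim_AE(2)[OF L2_mult_left[OF z0(1)] l e])
 moreover have "AE x in leb U. rlim U z 0 x = z0 x" by (rule rlim_AE(2)[OF z0])
 ultimately show ?thesis by eventually_elim simp
qed

lemma X_axpy_tendsto: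
 assumes v: "v \<in> X_space D" and w: "w \<in> X_space D" and t: "\<tau> \<in> {0..Tend D}"
 shows "((%s. L2n U (%x. (v s x + c * w s x) - (v \<tau> x + c * w \<tau> x))) \<longlongrightarrow> 0) (at \<tau> within {0..Tend D})"
proof -
 have l: "((%s. L2n U (%x. v s x - v \<tau> x)) \<longlongrightarrow> 0) (at \<tau> within {0..Tend D})" "((%s. L2n U (%x. w s x - w \<tau> x)) \<longlongrightarrow> 0) (at \<tau> within {0..Tend D})"
  using X_cont[OF v] X_cont[OF w] t by (auto simp: cont_into_def)
 have "((%s. L2n U (%x. v s x - v \<tau> x) + \<bar>c\<bar> * L2n U (%x. w s x - w \<tau> x)) \<longlongrightarrow> 0 + \<bar>c\<bar> * 0) (at \<tau> within {0..Tend D})"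
  by (intro tendsto_intros l)
 then have l0: "((%s. L2n U (%x. v s x - v \<tau> x) + \<bar>c\<bar> * L2n U (%x. w s x - w \<tau> x)) \<longlongrightarrow> 0) (at \<tau> within {0..Tend D})" by simp
 show ?thesis
 proof (rule Lim_null_comparison[OF _ l0])
  show "\<forall>\<^sub>F s in at \<tau> within {0..Tend D}. norm (L2n U (%x. (v s x + c * w s x) - (v \<tau> x + c * w \<tau> x))) \<le> L2n U (%x. v s x - v \<tau> x) + \<bar>c\<bar> * L2n U (%x. w s x - w \<tau> x)"
   unfolding eventually_at_filter
  proof (rule always_eventually, intro allI impI)
   fix s assume s: "s \<in> {0..Tend D}"
   have d: "(%x. v s x - v \<tau> x) \<in> L2 U" "(%x. w s x - w \<tau> x) \<in> L2 U" using X_L2[OF v] X_L2[OF w] s t by (auto intro: L2_diff)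
   have "L2n U (%x. (v s x + c * w s x) - (v \<tau> x + c * w \<tau> x)) = L2n U (%x. (v s x - v \<tau> x) + c * (w s x - w \<tau> x))"
    by (simp add: algebra_simps)
   also have "\<dots> \<le> L2n U (%x. v s x - v \<tau> x) + L2n U (%x. c * (w s x - w \<tau> x))"
    by (rule L2n_triangle[OF d(1) L2_mult_left[OF d(2)]])
   finally show "norm (L2n U (%x. (v s x + c * w s x) - (v \<tau> x + c * w \<tau> x))) \<le> L2n U (%x. v s x - v \<tau> x) + \<bar>c\<bar> * L2n U (%x. w s x - w \<tau> x)"
    by (simp add: L2n_mult L2n_nonneg)
  qed
 qed
qed

lemma X_axpy: "v \<in> X_space D ==> w \<in> X_space D ==> axpy c w v \<in> X_space D"
proof -
 assume v: "v \<in> X_space D" and w: "w \<in> X_space D"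
 obtain gv where gv: "has_tderiv U 0 (Tend D) v gv" using X_tderiv[OF v] by blast
 obtain gw where gw: "has_tderiv U 0 (Tend D) w gw" using X_tderiv[OF w] by blast
 have "cont_into (L2 U) (L2n U) {0..Tend D} (%t x. v t x + c * w t x)"
  unfolding cont_into_def using X_axpy_tendsto[OF v w, where c = c] X_L2[OF v] X_L2[OF w] by (auto intro: L2_axpy)
 moreover have "(%t x. v t x + c * w t x) \<in> Lbochner 2 {0<..Tend D} (H10 U) (H1n U)"
  by (rule vspace.Lbochner2_axpy[OF vspace_H10 Ioc_lebesgue X_Lbochner[OF v] X_Lbochner[OF w]])
 moreover note has_tderiv_axpy[OF gv X_Lbochner[OF v] gw X_Lbochner[OF w], of c]
 ultimately show ?thesis unfolding axpy_def X_space_def by blast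
qed

lemma ini_L2: "ini D \<in> L2 U" using data by (simp add: data_ok_def)

lemma tjump_X: "v \<in> X_space D ==> m \<in> {2..nsteps} ==> ip U (tjump U v (node D (m - 1))) w = 0"
 using node_interior[of m] by (intro tjump_zero[OF X_rlim(2) X_llim(2)]) auto

text \<open>Members of \<open>X_space\<close> are continuous in time with values in
  \<open>L2\<close>: their jumps vanish, and the limit at 0 is the value at 0.\<close>

lemma Lagr_X:
 assumes v: "v \<in> X_space D"
 shows "Lagr D J v z = J v + F_form D z - tpairing D v z - a_form D v z - ip U (%x. v 0 x - ini D x) (rlim U z 0)"
proof -
 have "ip U (%x. rlim U v 0 x - ini D x) (rlim U z 0) = ip U (%x. v 0 x - ini D x) (rlim U z 0)"
 proof (rule ip_cong_AE[OF dom_lebesgue])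
  show "AE x in leb U. rlim U v 0 x - ini D x = v 0 x - ini D x"
   using X_rlim(2)[OF v order_refl Tend_pos] by eventually_elim simp
 qed simp
 then show ?thesis using tjump_X[OF v] by (simp add: Lagr_def)
qed

text \<open>Apart from \<open>J\<close> the Lagrangian is affine in its first argument, so its
  derivative along \<open>\<psi>\<close> can be read off.\<close>

lemma Lagr_axpy:
 assumes u: "u \<in> X_space D" and \<psi>: "\<psi> \<in> X_space D" and z: "z \<in> Y_space D"
 shows "Lagr D J (axpy s \<psi> u) z = J (axpy s \<psi> u) + (Lagr D J u z - J u)
  - s * (tpairing D \<psi> z + a_form D \<psi> z + ip U (\<psi> 0) (rlim U z 0))"
proof -
 obtain gu where gu: "has_tderiv U 0 (Tend D) u gu" using X_tderiv[OF u] by blast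
 obtain g\<psi> where g\<psi>: "has_tderiv U 0 (Tend D) \<psi> g\<psi>" using X_tderiv[OF \<psi>] by blast
 note zL = Y_LB[OF z]
 have zr: "rlim U z 0 \<in> L2 U" by (rule Y_rlim_L2[OF z])
 have u0: "u 0 \<in> L2 U" "\<psi> 0 \<in> L2 U" using X_L2[OF u] X_L2[OF \<psi>] Tend_pos by auto
 have t: "tpairing D (axpy s \<psi> u) z = tpairing D u z + s * tpairing D \<psi> z"
  unfolding axpy_def by (rule tpairing_axpy_left[OF tder_global[OF gu] X_LB[OF u] tder_global[OF g\<psi>] X_LB[OF \<psi>] zL])
 have a: "a_form D (axpy s \<psi> u) z = a_form D u z + s * a_form D \<psi> z"
  unfolding axpy_def by (rule a_form_axpy_left[OF X_LB[OF u] X_LB[OF \<psi>] zL])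
 have j: "ip U (tjump U (axpy s \<psi> u) (node D (m - 1))) w = 0" if "m \<in> {2..nsteps}" for m w
  by (rule tjump_X[OF X_axpy[OF u \<psi>] that])
 have i: "ip U (%x. rlim U (axpy s \<psi> u) 0 x - ini D x) (rlim U z 0) = ip U (%x. u 0 x - ini D x) (rlim U z 0) + s * ip U (\<psi> 0) (rlim U z 0)"
 proof -
  have "ip U (%x. rlim U (axpy s \<psi> u) 0 x - ini D x) (rlim U z 0) = ip U (%x. (u 0 x - ini D x) + s * \<psi> 0 x) (rlim U z 0)"
  proof (rule ip_cong_AE[OF dom_lebesgue])
   show "AE x in leb U. rlim U (axpy s \<psi> u) 0 x - ini D x = (u 0 x - ini D x) + s * \<psi> 0 x"
    using X_rlim(2)[OF X_axpy[OF u \<psi>, of s] order_refl Tend_pos] by eventually_elim (simp add: axpy_def)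
  qed simp
  then show ?thesis using u0 zr ini_L2 by (simp add: ip_axpy_left L2_diff)
 qed
 show ?thesis unfolding Lagr_X[OF u] unfolding Lagr_def t a i using j by (simp add: algebra_simps)
qed

text \<open>Without \<open>J u\<close> the Lagrangian is linear in its second argument, so moving
  \<open>z\<close> along itself multiplies it by \<open>1 + s\<close>. Stationarity will force this
  linear part to vanish.\<close>

lemma Lagr_scale_z:
 assumes u: "u \<in> X_space D" and z: "z \<in> Y_space D"
 shows "Lagr D J u (axpy s z z) = J u + (1 + s) * (Lagr D J u z - J u)"
proof -
 obtain gu where gu: "has_tderiv U 0 (Tend D) u gu" using X_tderiv[OF u] by blast
 note zL = Y_LB[OF z]
 have eq: "axpy s z z = (%t x. (1 + s) * z t x)" by (simp add: axpy_def algebra_simps)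
 have F: "F_form D (axpy s z z) = (1 + s) * F_form D z"
  unfolding eq F_form_def st_ip_def ip_mult_right by simp
 have t: "tpairing D u (axpy s z z) = (1 + s) * tpairing D u z"
  unfolding eq by (rule tpairing_scale_right[OF tder_global[OF gu] zL])
 have a: "a_form D u (axpy s z z) = (1 + s) * a_form D u z"
  unfolding eq by (rule a_form_scale_right[OF X_LB[OF u] zL])
 have i: "ip U (%x. u 0 x - ini D x) (rlim U (axpy s z z) 0) = (1 + s) * ip U (%x. u 0 x - ini D x) (rlim U z 0)"
  unfolding eq ip_mult_right[symmetric] by (rule ip_cong_AE[OF dom_lebesgue _ Y_rlim_scale[OF z]]) simp
 show ?thesis unfolding Lagr_X[OF u] F t a i by (simp add: algebra_simps)
qed

end

section \<open>Expansion of the target functional\<close>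

text \<open>Two integrations by parts give the trapezoidal rule with its error integral. The
  integral of \<open>g2\<close>, which equals \<open>g1 1 - g1 0\<close>, then trades the mean of
  the two end slopes for \<open>g1 1\<close> alone, the slope at the continuous solution, where
  stationarity applies. Henstock-Kurzweil integration lets the fundamental theorem hold without
  continuity of \<open>g3\<close>.\<close>

lemma trapezoidal_expansion:
 fixes g g1 g2 g3 :: "real \<Rightarrow> real"
 assumes g: "\<And>s. (g has_real_derivative g1 s) (at s)" and g1: "\<And>s. (g1 has_real_derivative g2 s) (at s)"
  and g2: "\<And>s. (g2 has_real_derivative g3 s) (at s)"
 shows "g 1 - g 0 = g1 1 + 1 / 2 * integral {0..1} (%s. g3 s * (s * (s - 1))) - 1 / 2 * integral {0..1} g2"
proof -
 have "(g2 has_integral g1 1 - g1 0) {0..1}"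
  by (rule fundamental_theorem_of_calculus)
   (auto simp: has_real_derivative_iff_has_vector_derivative[symmetric] intro: g1 has_field_derivative_at_within)
 then have i1: "integral {0..1} g2 = g1 1 - g1 0" by (rule integral_unique)
 \<comment> \<open>A primitive of the weighted third derivative: the terms with \<open>g1\<close>
   and \<open>g2\<close> cancel on differentiation.\<close>
 define P where "P s = s * (s - 1) * g2 s - (2 * s - 1) * g1 s + 2 * g s" for s
 have "(P has_real_derivative g3 s * (s * (s - 1))) (at s)" for s
  unfolding P_def by (rule derivative_eq_intros g g1 g2 refl | simp add: algebra_simps)+
 then have "((%s. g3 s * (s * (s - 1))) has_integral P 1 - P 0) {0..1}"
  by (intro fundamental_theorem_of_calculus)
   (auto simp: has_real_derivative_iff_has_vector_derivative[symmetric] intro: has_field_derivative_at_within)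
 then have "integral {0..1} (%s. g3 s * (s * (s - 1))) = P 1 - P 0" by (rule integral_unique)
 then show ?thesis unfolding i1 P_def by (simp add: field_simps)
qed

lemma axpy_0 [simp]: "axpy 0 h v = v"
 by (simp add: axpy_def)

text \<open>One statement for all three orders: the index \<open>k\<close> holds the directions
  already inserted, none, one or two, which stay fixed along the line.\<close>

lemma frechet_line_derivative:
 assumes G: "has_frechet_on W N Q om G G'" and N: "seminorm_on W N"
  and W: "\<And>v w c. v \<in> W ==> w \<in> W ==> axpy c w v \<in> W"
  and v: "v \<in> W" and h: "h \<in> W" and k: "k \<in> Q"
 shows "((%s. G (axpy s h v) k) has_real_derivative G' (axpy s h v) h k) (at s)"
proof -
 define p where "p = axpy s h v"
 have p: "p \<in> W" unfolding p_def by (rule W[OF v h])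
 have hr: "(%t x. r * h t x) \<in> W" for r using W[OF h h, of "r - 1"] by (simp add: axpy_def algebra_simps)
 have lin: "G' p (%t x. r * h t x) k = r * G' p h k" for r
 proof -
  have "G' p (axpy (r - 1) h h) k = G' p h k + (r - 1) * G' p h k"
   using G p h k unfolding has_frechet_on_def by blast
  then show ?thesis by (simp add: axpy_def algebra_simps)
 qed
 have Nr: "N (%t x. r * h t x) = \<bar>r\<bar> * N h" for r using N h by (simp add: seminorm_on_def)
 have Nh: "0 \<le> N h" using N h by (simp add: seminorm_on_def)
 show ?thesis
 proof (unfold DERIV_def LIM_eq p_def[symmetric], intro allI impI)
  fix \<epsilon> :: real assume \<epsilon>: "0 < \<epsilon>"
  \<comment> \<open>The 1 avoids a division by 0, since the seminorm of \<open>h\<close> may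
    vanish.\<close>
  define c where "c = N h * \<bar>om k\<bar> + 1"
  have c: "0 < c" unfolding c_def using Nh by (simp add: add_nonneg_pos)
  then have "0 < \<epsilon> / c" using \<epsilon> by simp
  then obtain d where d: "0 < d" and
   dd: "\<And>h k. h \<in> W ==> N h < d ==> k \<in> Q ==> \<bar>G (axpy 1 h p) k - G p k - G' p h k\<bar> \<le> \<epsilon> / c * N h * om k"
   using G p unfolding has_frechet_on_def by meson
  define \<delta> where "\<delta> = d / (N h + 1)"
  have \<delta>: "0 < \<delta>" unfolding \<delta>_def using d Nh by simp
  show "\<exists>s'>0. \<forall>x. x \<noteq> 0 \<and> norm (x - 0) < s' \<longrightarrow> norm ((G (axpy (s + x) h v) k - G p k) / x - G' p h k) < \<epsilon>"
  proof (intro exI[of _ \<delta>] conjI \<delta> allI impI)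
   fix r :: real assume r: "r \<noteq> 0 \<and> norm (r - 0) < \<delta>"
   have "\<bar>r\<bar> * N h \<le> \<bar>r\<bar> * (N h + 1)" by (intro mult_left_mono) auto
   also have "\<dots> < \<delta> * (N h + 1)" using r Nh by (intro mult_strict_right_mono) auto
   also have "\<dots> = d" unfolding \<delta>_def using Nh by simp
   finally have "N (%t x. r * h t x) < d" unfolding Nr .
   from dd[OF hr this k] have "\<bar>G (axpy 1 (%t x. r * h t x) p) k - G p k - r * G' p h k\<bar> \<le> \<epsilon> / c * (\<bar>r\<bar> * N h) * om k"
    unfolding lin Nr .
   moreover have "axpy 1 (%t x. r * h t x) p = axpy (s + r) h v" unfolding p_def by (simp add: axpy_def algebra_simps)
   ultimately have b: "\<bar>G (axpy (s + r) h v) k - G p k - r * G' p h k\<bar> \<le> \<epsilon> / c * (\<bar>r\<bar> * N h) * om k" by simp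
   have "norm ((G (axpy (s + r) h v) k - G p k) / r - G' p h k) = \<bar>G (axpy (s + r) h v) k - G p k - r * G' p h k\<bar> / \<bar>r\<bar>"
    using r by (simp add: abs_divide[symmetric] diff_divide_distrib)
   also have "\<dots> \<le> \<epsilon> / c * (\<bar>r\<bar> * N h) * om k / \<bar>r\<bar>" using b by (rule divide_right_mono) simp
   also have "\<dots> = \<epsilon> / c * (N h * om k)" using r by simp
   also have "\<dots> < \<epsilon> / c * c"
   proof (rule mult_strict_left_mono)
    have "N h * om k \<le> N h * \<bar>om k\<bar>" using Nh by (intro mult_left_mono) auto
    then show "N h * om k < c" unfolding c_def by simp
    show "0 < \<epsilon> / c" using \<epsilon> c by simp
   qed
   also have "\<dots> = \<epsilon>" using c by simp
   finally show "norm ((G (axpy (s + r) h v) k - G p k) / r - G' p h k) < \<epsilon>" .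
  qed
 qed
qed

lemma functional_trapezoidal_expansion:
 assumes J: "thrice_differentiable_on W N J J1 J2 J3"
  and W: "\<And>v w c. v \<in> W ==> w \<in> W ==> axpy c w v \<in> W"
  and v: "v \<in> W" and h: "h \<in> W"
 shows "J (axpy 1 h v) - J v = J1 (axpy 1 h v) h + R_J J3 v h + 1 / 2 * Delta_rho_J J2 v h"
proof -
 have N: "seminorm_on W N" and F: "has_frechet_on W N {()} (%_. 1) (%v _. J v) (%v h _. J1 v h)"
  "has_frechet_on W N W N J1 J2"
  "has_frechet_on W N (W \<times> W) (%(h, k). N h * N k) (%v (h, k). J2 v h k) (%v l (h, k). J3 v l h k)"
  using J by (auto simp: thrice_differentiable_on_def)
 have 1: "((%s. J (axpy s h v)) has_real_derivative J1 (axpy s h v) h) (at s)" for s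
  using frechet_line_derivative[OF F(1) N W v h, of "()"] by simp
 have 2: "((%s. J1 (axpy s h v) h) has_real_derivative J2 (axpy s h v) h h) (at s)" for s
  using frechet_line_derivative[OF F(2) N W v h h] by simp
 have 3: "((%s. J2 (axpy s h v) h h) has_real_derivative J3 (axpy s h v) h h h) (at s)" for s
  using frechet_line_derivative[OF F(3) N W v h, of "(h, h)"] h by simp
 show ?thesis
  using trapezoidal_expansion[OF 1 2 3] by (simp add: R_J_def Delta_rho_J_def)
qed

section \<open>Linear structure of the discrete space and of X + Xkh\<close>

context st_problem
begin

lemma poly_space_axpy: "p \<in> poly_space d ==> q \<in> poly_space d ==> (%x. p x + c * q x) \<in> poly_space d"
proof -
 assume "p \<in> poly_space d" "q \<in> poly_space d"
 then obtain a b where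
  "\<forall>x. p x = (\<Sum>\<beta> | \<beta> \<in> Basis \<rightarrow>\<^sub>E {..d} \<and> sum \<beta> Basis \<le> d. a \<beta> * (\<Prod>i\<in>Basis. (x \<bullet> i) ^ \<beta> i))"
  "\<forall>x. q x = (\<Sum>\<beta> | \<beta> \<in> Basis \<rightarrow>\<^sub>E {..d} \<and> sum \<beta> Basis \<le> d. b \<beta> * (\<Prod>i\<in>Basis. (x \<bullet> i) ^ \<beta> i))"
  unfolding poly_space_def by blast
 then have "\<forall>x. p x + c * q x = (\<Sum>\<beta> | \<beta> \<in> Basis \<rightarrow>\<^sub>E {..d} \<and> sum \<beta> Basis \<le> d. (a \<beta> + c * b \<beta>) * (\<Prod>i\<in>Basis. (x \<bullet> i) ^ \<beta> i))"
  by (simp add: sum_distrib_left sum.distrib algebra_simps)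
 then show ?thesis unfolding poly_space_def by (intro CollectI exI[of _ "%\<beta>. a \<beta> + c * b \<beta>"])
qed

lemma Vh_axpy: "v \<in> Vh U p \<T> ==> w \<in> Vh U p \<T> ==> (%x. v x + c * w x) \<in> Vh U p \<T>"
proof -
 assume v: "v \<in> Vh U p \<T>" and w: "w \<in> Vh U p \<T>"
 have "\<exists>q\<in>poly_space p. \<forall>x\<in>K. v x + c * w x = q x" if "K \<in> \<T>" for K
 proof -
  have "\<forall>K\<in>\<T>. \<exists>q\<in>poly_space p. \<forall>x\<in>K. v x = q x" "\<forall>K\<in>\<T>. \<exists>q\<in>poly_space p. \<forall>x\<in>K. w x = q x"
   using v w by (simp_all add: Vh_def)
  from bspec[OF this(1) that] bspec[OF this(2) that]
  obtain q r where "q \<in> poly_space p" "r \<in> poly_space p" "\<forall>x\<in>K. v x = q x" "\<forall>x\<in>K. w x = r x" by blast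
  then show ?thesis by (intro bexI[OF _ poly_space_axpy[of q p r c]]) auto
 qed
 then show ?thesis using v w by (auto simp: Vh_def intro: H10_axpy intro!: continuous_intros)
qed

lemma Xkh_axpy: "v \<in> Xkh D ==> w \<in> Xkh D ==> axpy c w v \<in> Xkh D"
proof -
 assume v: "v \<in> Xkh D" and w: "w \<in> Xkh D"
 have "\<exists>b. (\<forall>l\<le>tdeg D. b l \<in> Vh U (xdeg D) (msh D m)) \<and>
   (\<forall>t\<in>slab D m. \<forall>x\<in>closure U. axpy c w v t x = (\<Sum>l\<le>tdeg D. t ^ l * b l x))" if m: "m \<in> {1..nsteps}" for m
 proof -
  obtain b where b: "\<forall>l\<le>tdeg D. b l \<in> Vh U (xdeg D) (msh D m)" "\<forall>t\<in>slab D m. \<forall>x\<in>closure U. v t x = (\<Sum>l\<le>tdeg D. t ^ l * b l x)"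
   using v m unfolding Xkh_def by blast
  obtain b' where b': "\<forall>l\<le>tdeg D. b' l \<in> Vh U (xdeg D) (msh D m)" "\<forall>t\<in>slab D m. \<forall>x\<in>closure U. w t x = (\<Sum>l\<le>tdeg D. t ^ l * b' l x)"
   using w m unfolding Xkh_def by blast
  show ?thesis
   by (rule exI[of _ "%l x. b l x + c * b' l x"])
    (use b b' in \<open>auto simp: axpy_def sum_distrib_left sum.distrib algebra_simps intro: Vh_axpy\<close>)
 qed
 moreover have "axpy c w v 0 \<in> Vh U (xdeg D) (msh D 0)"
  unfolding axpy_def by (rule Vh_axpy) (use v w in \<open>auto simp: Xkh_def\<close>)
 ultimately show ?thesis by (simp add: Xkh_def)
qed

lemma X_plus_Xkh_axpy: "v \<in> X_plus_Xkh D ==> w \<in> X_plus_Xkh D ==> axpy c w v \<in> X_plus_Xkh D"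
proof -
 assume "v \<in> X_plus_Xkh D" "w \<in> X_plus_Xkh D"
 then obtain v1 v2 w1 w2 where H: "v1 \<in> X_space D" "v2 \<in> Xkh D" "w1 \<in> X_space D" "w2 \<in> Xkh D" "v = axpy 1 v2 v1" "w = axpy 1 w2 w1"
  unfolding X_plus_Xkh_def by blast
 then have "axpy c w v = axpy 1 (axpy c w2 v2) (axpy c w1 v1)" by (simp add: axpy_def algebra_simps)
 then show ?thesis unfolding X_plus_Xkh_def using X_axpy[OF H(1,3), of c] Xkh_axpy[OF H(2,4), of c] by blast
qed

text \<open>The zero of the other summand is produced as the difference of one of its elements with
  itself.\<close>

lemma X_plus_Xkh_left: "v \<in> X_space D ==> w \<in> Xkh D ==> v \<in> X_plus_Xkh D"
 and X_plus_Xkh_right: "v \<in> X_space D ==> w \<in> Xkh D ==> w \<in> X_plus_Xkh D"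
proof -
 assume v: "v \<in> X_space D" and w: "w \<in> Xkh D"
 have "v = axpy 1 (axpy (-1) w w) v" "w = axpy 1 w (axpy (-1) v v)" by (simp_all add: axpy_def)
 then show "v \<in> X_plus_Xkh D" "w \<in> X_plus_Xkh D"
  unfolding X_plus_Xkh_def using v w X_axpy[OF v v, of "-1"] Xkh_axpy[OF w w, of "-1"] by blast+
qed

end

section \<open>Localization in time\<close>

text \<open>The means run over times before \<open>c\<close>, so the limit of \<open>f\<close> from
  the left determines them.\<close>

lemma left_mean_limit:
 fixes f :: "real \<Rightarrow> real"
 assumes f: "integrable (leb {a<..c}) f" and ac: "a < c" and lim: "(f \<longlongrightarrow> f c) (at_left c)"
 shows "(%n. real n * (LINT t|leb {c - 1 / real n<..c}. f t)) ----> f c"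
proof (rule LIMSEQ_I)
 fix \<epsilon> :: real assume \<epsilon>: "0 < \<epsilon>"
 have "\<forall>\<^sub>F t in at_left c. dist (f t) (f c) < \<epsilon> / 2" using tendstoD[OF lim, of "\<epsilon> / 2"] \<epsilon> by simp
 then obtain b where b: "b < c" "\<And>t. b < t ==> t < c ==> dist (f t) (f c) < \<epsilon> / 2"
  by (auto simp: eventually_at_left[OF ac])
 define b' where "b' = max a b"
 have b': "b' < c" using b ac by (simp add: b'_def)
 obtain N where N: "1 / (c - b') < real N" using reals_Archimedean2 by blast
 show "\<exists>no. \<forall>n\<ge>no. norm (real n * (LINT t|leb {c - 1 / real n<..c}. f t) - f c) < \<epsilon>"
 proof (intro exI[of _ N] allI impI)
  fix n assume n: "N \<le> n"
  have N0: "0 < real N" using N b' by (meson less_trans diff_gt_0_iff_gt zero_less_divide_1_iff)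
  have n0: "0 < real n" using N0 n by linarith
  have "1 / (c - b') < real n" using N n by simp
  then have cb: "b' \<le> c - 1 / real n" using b' n0 by (simp add: field_simps)
  define S where "S = {c - 1 / real n<..c}"
  have fS: "integrable (leb S) f" unfolding S_def
   by (rule lebesgue_on_integrable_subset[OF f]) (use cb in \<open>auto simp: b'_def\<close>)
  interpret finite_measure "leb S" unfolding S_def by (rule finite_measure_lebesgue_on) simp
  have ms: "measure (leb S) (space (leb S)) = 1 / real n"
   using n0 by (simp add: S_def measure_restrict_space)
  have "\<bar>(LINT t|leb S. f t - f c)\<bar> \<le> (LINT t|leb S. \<bar>f t - f c\<bar>)"
   by (rule integral_abs_bound)
  also have "\<dots> \<le> (LINT t|leb S. \<epsilon> / 2)"
  proof (rule integral_mono)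
   fix t assume t: "t \<in> space (leb S)"
   show "\<bar>f t - f c\<bar> \<le> \<epsilon> / 2"
   proof (cases "t = c")
    case False
    then have "dist (f t) (f c) < \<epsilon> / 2" using t cb by (intro b(2)) (auto simp: S_def b'_def)
    then show ?thesis by (simp add: dist_real_def)
   qed (use \<epsilon> in simp)
  qed (use fS in auto)
  finally have "\<bar>(LINT t|leb S. f t - f c)\<bar> \<le> 1 / real n * (\<epsilon> / 2)" using ms by simp
  then have "\<bar>(LINT t|leb S. f t) - 1 / real n * f c\<bar> \<le> 1 / real n * (\<epsilon> / 2)"
   using fS ms by simp
  then have "real n * \<bar>(LINT t|leb S. f t) - 1 / real n * f c\<bar> \<le> real n * (1 / real n * (\<epsilon> / 2))"
   by (rule mult_left_mono) simp
  moreover have "real n * \<bar>(LINT t|leb S. f t) - 1 / real n * f c\<bar> = \<bar>real n * (LINT t|leb S. f t) - f c\<bar>"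
   using n0 abs_mult[of "real n" "(LINT t|leb S. f t) - 1 / real n * f c"] by (simp add: right_diff_distrib)
  ultimately have "\<bar>real n * (LINT t|leb S. f t) - f c\<bar> \<le> \<epsilon> / 2" using n0 by simp
  then show "norm (real n * (LINT t|leb {c - 1 / real n<..c}. f t) - f c) < \<epsilon>"
   using \<epsilon> by (simp add: S_def)
 qed
qed

text \<open>The ramp climbs during the time \<open>1 / n\<close> before \<open>c\<close> and has
  reached 1 at \<open>c\<close>. On this side its derivative averages over times before
  \<open>c\<close>, where continuity up to \<open>c\<close> is at hand.\<close>

definition rise :: "real \<Rightarrow> nat \<Rightarrow> real \<Rightarrow> real" where
 "rise c n t = max 0 (min 1 (real n * (t - c) + 1))"

definition rise' :: "real \<Rightarrow> nat \<Rightarrow> real \<Rightarrow> real" where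
 "rise' c n t = (if t \<in> {c - 1 / real n<..c} then real n else 0)"

lemma rise_continuous: "continuous_on S (rise c n)"
 unfolding rise_def by (intro continuous_intros)

lemma rise_bounds: "0 \<le> rise c n t" "rise c n t \<le> 1"
 by (auto simp: rise_def)

lemma rise_right: "c \<le> t ==> rise c n t = 1"
 by (auto simp: rise_def)

lemma rise_left: "0 < n ==> t \<le> c - 1 / real n ==> rise c n t = 0"
 by (simp add: rise_def field_simps)

lemma rise_mid: "0 < n ==> c - 1 / real n \<le> t ==> t \<le> c ==> rise c n t = real n * (t - c) + 1"
 by (auto simp: rise_def field_simps mult_nonneg_nonpos)

lemma rise_deriv:
 assumes n: "0 < n" and t: "t \<noteq> c" "t \<noteq> c - 1 / real n"
 shows "(rise c n has_real_derivative rise' c n t) (at t)"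
proof -
 have nn: "0 < 1 / real n" using n by simp
 consider "t < c - 1 / real n" | "c - 1 / real n < t" "t < c" | "c < t" using t by linarith
 then show ?thesis
 proof cases
  case 1
  have "((%s. 0) has_real_derivative 0) (at t)" by simp
  then have "(rise c n has_real_derivative 0) (at t)"
   by (rule has_field_derivative_transform_within_open[OF _ open_lessThan]) (use 1 n in \<open>auto simp: rise_left\<close>)
  then show ?thesis using 1 by (simp add: rise'_def)
 next
  case 2
  have "((%s. real n * (s - c) + 1) has_real_derivative real n) (at t)" by (auto intro!: derivative_eq_intros)
  then have "(rise c n has_real_derivative real n) (at t)"
   by (rule has_field_derivative_transform_within_open[OF _ open_greaterThanLessThan]) (use 2 n in \<open>auto simp: rise_mid\<close>)
  then show ?thesis using 2 by (simp add: rise'_def)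
 next
  case 3
  have "((%s. 1) has_real_derivative 0) (at t)" by simp
  then have "(rise c n has_real_derivative 0) (at t)"
   by (rule has_field_derivative_transform_within_open[OF _ open_greaterThan]) (use 3 in \<open>auto simp: rise_right\<close>)
  then show ?thesis using 3 by (simp add: rise'_def)
 qed
qed

text \<open>Multiplying a smooth weight by a steep ramp at c localizes the identity to the times after c.\<close>

lemma localize_in_time:
 fixes Z q \<eta> \<eta>' :: "real \<Rightarrow> real"
 assumes Z: "integrable (leb {0<..T}) Z" and q: "integrable (leb {0<..T}) q"
  and id: "\<And>\<eta> h F M. continuous_on {0..T} \<eta> ==> finite F ==>
    (\<And>t. t \<in> {0<..<T} - F ==> (\<eta> has_real_derivative h t) (at t)) ==>
    h \<in> borel_measurable (leb {0<..T}) ==> (\<And>t. t \<in> {0<..T} ==> \<bar>h t\<bar> \<le> M) ==>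
    (LINT t|leb {0<..T}. h t * Z t + \<eta> t * q t) + \<eta> 0 * Z0 = 0"
  and \<eta>: "\<And>t. (\<eta> has_real_derivative \<eta>' t) (at t)" "continuous_on UNIV \<eta>'"
  and c: "0 < c" "c < T" and lim: "(Z \<longlongrightarrow> Z c) (at_left c)"
 shows "(LINT t|leb {c<..T}. \<eta>' t * Z t + \<eta> t * q t) = - \<eta> c * Z c"
proof -
 have \<eta>c: "continuous_on S \<eta>" for S using \<eta>(1) DERIV_continuous_on has_field_derivative_at_within by blast
 have \<eta>'c: "continuous_on S \<eta>'" for S using \<eta>(2) continuous_on_subset by blast
 have meas: "g \<in> borel_measurable (leb {0<..T})" if "continuous_on {0..T} g" for g :: "real \<Rightarrow> real"
  by (rule continuous_imp_measurable_on_sets_lebesgue[OF continuous_on_subset[OF that]]) auto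
 have bnd: "\<exists>M. \<forall>t\<in>{0..T}. \<bar>g t\<bar> \<le> M" if "continuous_on {0..T} g" for g :: "real \<Rightarrow> real"
  using compact_imp_bounded[OF compact_continuous_image[OF that compact_Icc]] by (auto simp: bounded_iff)
 obtain M1 where M1: "\<And>t. t \<in> {0..T} ==> \<bar>\<eta> t\<bar> \<le> M1" using bnd[OF \<eta>c] by blast
 obtain M2 where M2: "\<And>t. t \<in> {0..T} ==> \<bar>\<eta>' t\<bar> \<le> M2" using bnd[OF \<eta>'c] by blast
 define f where "f t = \<eta>' t * Z t + \<eta> t * q t" for t
 have fi: "integrable (leb {0<..T}) f" unfolding f_def
  by (intro integrable_add bounded_mult_integrable[OF meas[OF \<eta>'c] _ Z, of M2] bounded_mult_integrable[OF meas[OF \<eta>c] _ q, of M1])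
    (use M1 M2 in auto)
 have \<eta>Z: "integrable (leb {0<..T}) (%t. \<eta> t * Z t)"
  by (intro bounded_mult_integrable[OF meas[OF \<eta>c] _ Z, of M1]) (use M1 in auto)
 \<comment> \<open>The identity for \<open>\<eta>\<close> times the ramp. Differentiating the ramp
   contributes \<open>n\<close> times an integral over its climbing part, that is, a mean
   value.\<close>
 have key: "(LINT t|leb {0<..T}. rise c n t * f t) + real n * (LINT t|leb {c - 1 / real n<..c}. \<eta> t * Z t) = 0"
  if n: "1 / c < real n" for n
 proof -
  have n0: "0 < n" using n c by (metis less_trans of_nat_0_less_iff zero_less_divide_1_iff)
  have nc: "1 / real n < c" using n n0 c by (simp add: field_simps)
  define h where "h t = \<eta>' t * rise c n t + \<eta> t * rise' c n t" for t
  have r'm: "rise' c n \<in> borel_measurable (leb {0<..T})"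
  proof -
   have "rise' c n \<in> borel_measurable borel" unfolding rise'_def[abs_def] by measurable
   then have "rise' c n \<in> borel_measurable lebesgue" by (intro measurable_completion) simp
   then show ?thesis by (rule measurable_restrict_space1)
  qed
  have hm: "h \<in> borel_measurable (leb {0<..T})"
   unfolding h_def using meas[OF \<eta>'c] meas[OF \<eta>c] meas[OF rise_continuous] r'm by measurable
  have hb: "\<bar>h t\<bar> \<le> M2 * 1 + M1 * real n" if t: "t \<in> {0<..T}" for t
  proof -
   have "\<bar>h t\<bar> \<le> \<bar>\<eta>' t\<bar> * \<bar>rise c n t\<bar> + \<bar>\<eta> t\<bar> * \<bar>rise' c n t\<bar>"
    unfolding h_def abs_mult[symmetric] by (rule abs_triangle_ineq)
   also have "\<dots> \<le> M2 * 1 + M1 * real n"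
    using t rise_bounds[of c n t] M1[of t] M2[of t] by (intro add_mono mult_mono) (auto simp: rise'_def)
   finally show ?thesis .
  qed
  have "(LINT t|leb {0<..T}. h t * Z t + (\<eta> t * rise c n t) * q t) + (\<eta> 0 * rise c n 0) * Z0 = 0"
  proof (rule id[where F = "{c, c - 1 / real n}"])
   show "continuous_on {0..T} (%t. \<eta> t * rise c n t)" by (intro continuous_intros \<eta>c rise_continuous)
   show "((%t. \<eta> t * rise c n t) has_real_derivative h t) (at t)" if "t \<in> {0<..<T} - {c, c - 1 / real n}" for t
    unfolding h_def using that by (auto intro!: derivative_eq_intros \<eta>(1) rise_deriv n0)
  qed (use hm hb in auto)
  \<comment> \<open>For \<open>n\<close> above \<open>1 / c\<close> the ramp has not started at time
    0, which removes the initial term with \<open>Z0\<close>.\<close>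
  moreover have "rise c n 0 = 0" by (rule rise_left[OF n0]) (use nc in simp)
  ultimately have e: "(LINT t|leb {0<..T}. h t * Z t + (\<eta> t * rise c n t) * q t) = 0" by simp
  have "(%t. h t * Z t + (\<eta> t * rise c n t) * q t) = (%t. rise c n t * f t + rise' c n t * (\<eta> t * Z t))"
   by (simp add: h_def f_def algebra_simps)
  moreover have "integrable (leb {0<..T}) (%t. rise c n t * f t)"
   by (rule bounded_mult_integrable[OF meas[OF rise_continuous] _ fi, where M = 1]) (use rise_bounds[of c n] in auto)
  moreover have "integrable (leb {0<..T}) (%t. rise' c n t * (\<eta> t * Z t))"
   by (rule bounded_mult_integrable[OF r'm _ \<eta>Z, of "real n"]) (auto simp: rise'_def)
  ultimately have "(LINT t|leb {0<..T}. rise c n t * f t) + (LINT t|leb {0<..T}. rise' c n t * (\<eta> t * Z t)) = 0"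
   using e by simp
  moreover have "(LINT t|leb {0<..T}. rise' c n t * (\<eta> t * Z t)) = (LINT t|leb {c - 1 / real n<..c}. real n * (\<eta> t * Z t))"
  proof -
   have "(LINT t|leb {0<..T}. (if t \<in> {c - 1 / real n<..c} then real n * (\<eta> t * Z t) else 0)) = (LINT t|leb {c - 1 / real n<..c}. real n * (\<eta> t * Z t))"
    by (rule integral_restrict) (use nc c in auto)
   moreover have "(%t. rise' c n t * (\<eta> t * Z t)) = (%t. (if t \<in> {c - 1 / real n<..c} then real n * (\<eta> t * Z t) else 0))"
    by (auto simp: rise'_def)
   ultimately show ?thesis by simp
  qed
  ultimately show ?thesis by simp
 qed
 \<comment> \<open>The ramps converge to the indicator of the times after \<open>c\<close>, except
   at \<open>c\<close> itself.\<close>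
 have l1: "(%n. LINT t|leb {0<..T}. rise c n t * f t) ----> (LINT t|leb {0<..T}. (if t \<in> {c<..T} then f t else 0))"
 proof (rule integral_dominated_convergence)
  show "(%t. if t \<in> {c<..T} then f t else 0) \<in> borel_measurable (leb {0<..T})"
   using fi by (intro measurable_If_set) (auto simp: sets_restrict_space_iff)
  show "(%t. rise c n t * f t) \<in> borel_measurable (leb {0<..T})" for n
   using meas[OF rise_continuous] fi by measurable
  show "integrable (leb {0<..T}) (%t. \<bar>f t\<bar>)" using fi by simp
  show "AE t in leb {0<..T}. norm (rise c n t * f t) \<le> \<bar>f t\<bar>" for n
   by (rule AE_I2) (use rise_bounds[of c n] in \<open>auto simp: abs_mult intro: mult_left_le_one_le\<close>)
  have "AE t in lebesgue. t \<notin> {c}" by (rule AE_not_in) (simp add: negligible_iff_null_sets[symmetric])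
  then have "AE t in leb {0<..T}. t \<noteq> c" by (simp add: AE_restrict_space_iff) (auto elim: AE_mp)
  then show "AE t in leb {0<..T}. (%n. rise c n t * f t) ----> (if t \<in> {c<..T} then f t else 0)"
  proof (rule AE_mp[OF _ AE_I2], intro impI)
   fix t assume t: "t \<in> space (leb {0<..T})" "t \<noteq> c"
   show "(%n. rise c n t * f t) ----> (if t \<in> {c<..T} then f t else 0)"
   proof (cases "c < t")
    case True
    then show ?thesis using t by (simp add: rise_right)
   next
    case False
    then have tc: "t < c" using t by simp
    obtain N where N: "1 / (c - t) < real N" using reals_Archimedean2 by blast
    have "\<forall>\<^sub>F n in sequentially. rise c n t * f t = 0"
     using eventually_ge_at_top[of N]
    proof eventually_elim
     case (elim n)
     have n: "1 / (c - t) < real n" using N elim by simp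
     moreover have "0 < 1 / (c - t)" using tc by simp
     ultimately have n0: "0 < n" by (metis less_trans of_nat_0_less_iff)
     have "rise c n t = 0" by (rule rise_left[OF n0]) (use n n0 tc in \<open>simp add: field_simps\<close>)
     then show ?case by simp
    qed
    then have "(%n. rise c n t * f t) ----> 0" by (rule tendsto_eventually)
    then show ?thesis using tc by simp
   qed
  qed
 qed
 have l2: "(%n. real n * (LINT t|leb {c - 1 / real n<..c}. \<eta> t * Z t)) ----> \<eta> c * Z c"
 proof (rule left_mean_limit[of 0 c "%t. \<eta> t * Z t"])
  show "integrable (leb {0<..c}) (%t. \<eta> t * Z t)" by (rule lebesgue_on_integrable_subset[OF \<eta>Z]) (use c in auto)
  have "(\<eta> \<longlongrightarrow> \<eta> c) (at_left c)" using DERIV_isCont[OF \<eta>(1)] by (simp add: isCont_def filterlim_at_split)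
  then show "((%t. \<eta> t * Z t) \<longlongrightarrow> \<eta> c * Z c) (at_left c)" using lim by (rule tendsto_mult)
 qed (use c in auto)
 have "(%n. (LINT t|leb {0<..T}. rise c n t * f t) + real n * (LINT t|leb {c - 1 / real n<..c}. \<eta> t * Z t)) ----> 0"
 proof (rule tendsto_eventually)
  obtain N where N: "1 / c < real N" using reals_Archimedean2 by blast
  show "\<forall>\<^sub>F n in sequentially. (LINT t|leb {0<..T}. rise c n t * f t) + real n * (LINT t|leb {c - 1 / real n<..c}. \<eta> t * Z t) = 0"
   using eventually_ge_at_top[of N] by eventually_elim (rule key, use N in simp)
 qed
 from LIMSEQ_unique[OF this tendsto_add[OF l1 l2]]
 have "(LINT t|leb {0<..T}. (if t \<in> {c<..T} then f t else 0)) = - \<eta> c * Z c" by simp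
 moreover have "(LINT t|leb {0<..T}. (if t \<in> {c<..T} then f t else 0)) = (LINT t|leb {c<..T}. f t)"
  by (rule integral_restrict) (use c in auto)
 ultimately show ?thesis by (simp add: f_def)
qed

section \<open>Discrete functions as polynomials in time on each slab\<close>

context st_problem
begin

definition slab_rep :: "(real \<Rightarrow> 'a \<Rightarrow> real) \<Rightarrow> (nat \<Rightarrow> nat \<Rightarrow> 'a \<Rightarrow> real) \<Rightarrow> bool" where
 "slab_rep v w \<longleftrightarrow> (\<forall>m\<in>{1..nsteps}. (\<forall>l\<le>tdeg D. w m l \<in> Vh U (xdeg D) (msh D m)) \<and>
   (\<forall>t\<in>slab D m. \<forall>x\<in>closure U. v t x = (\<Sum>l\<le>tdeg D. t ^ l * w m l x)))"

lemma Xkh_rep: "v \<in> Xkh D ==> \<exists>w. slab_rep v w"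
 unfolding slab_rep_def by (rule bchoice) (simp add: Xkh_def)

lemma L2n_sum:
 assumes "\<And>l. l \<in> A ==> w l \<in> L2 U"
 shows "L2n U (%x. \<Sum>l\<in>A. c l * w l x) \<le> (\<Sum>l\<in>A. \<bar>c l\<bar> * L2n U (w l :: 'a \<Rightarrow> real))"
 using assms
proof (induction A rule: infinite_finite_induct)
 case (insert a A)
 have "L2n U (%x. c a * w a x + (\<Sum>l\<in>A. c l * w l x)) \<le> L2n U (%x. c a * w a x) + L2n U (%x. \<Sum>l\<in>A. c l * w l x)"
  using insert by (intro L2n_triangle L2_sum L2_mult_left) auto
 then show ?case using insert by (simp add: L2n_mult)
qed (simp_all add: L2n_def)

context
 fixes v w assumes vw: "slab_rep v w"
begin

lemma rep_Vh: "m \<in> {1..nsteps} ==> l \<le> tdeg D ==> w m l \<in> Vh U (xdeg D) (msh D m)"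
 using vw unfolding slab_rep_def by blast

lemma rep_eq: "m \<in> {1..nsteps} ==> t \<in> slab D m ==> x \<in> closure U ==> v t x = (\<Sum>l\<le>tdeg D. t ^ l * w m l x)"
 using vw unfolding slab_rep_def by blast

lemma rep_eq_interior: "m \<in> {1..nsteps} ==> t \<in> slab D m ==> x \<in> U ==> v t x = (\<Sum>l\<le>tdeg D. t ^ l * w m l x)"
 by (rule rep_eq) (use closure_subset in auto)

lemma rep_H10: "m \<in> {1..nsteps} ==> l \<le> tdeg D ==> w m l \<in> H10 U"
 using rep_Vh[of m l] by (simp add: Vh_def)

lemma rep_sum_H10: "m \<in> {1..nsteps} ==> (%x. \<Sum>l\<le>tdeg D. c l * w m l x) \<in> H10 U"
 by (intro H10_sum) (auto intro: rep_H10)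

lemma slab_H10: "m \<in> {1..nsteps} ==> t \<in> slab D m ==> v t \<in> H10 U"
 by (rule H10_cong[OF _ rep_sum_H10[of m "%l. t ^ l"]]) (simp_all add: rep_eq_interior)

lemma monomial_Lbochner:
 assumes m: "m \<in> {1..nsteps}" and l: "l \<le> tdeg D"
 shows "(%t x. t ^ l * w m l x) \<in> Lbochner 2 (slab D m) (H10 U) (H1n U)"
proof (rule vspace.Lbochner2_scalar[OF vspace_H10 _ _ rep_H10[OF m l]])
 have c: "continuous_on {node D (m - 1)..node D m} (%t. t ^ l :: real)" "continuous_on {node D (m - 1)..node D m} (%t. (t ^ l)\<^sup>2 :: real)"
  by (intro continuous_intros)+
 show mm: "(%t. t ^ l) \<in> borel_measurable (sleb m)"
  by (rule continuous_imp_measurable_on_sets_lebesgue[OF continuous_on_subset[OF c(1)]]) (auto simp: slab_def)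
 obtain M where "\<forall>t\<in>{node D (m - 1)..node D m}. \<bar>(t ^ l)\<^sup>2\<bar> \<le> M"
  using compact_imp_bounded[OF compact_continuous_image[OF c(2) compact_Icc]] by (auto simp: bounded_iff)
 then show "integrable (sleb m) (%t. (t ^ l)\<^sup>2)"
  unfolding slab_def by (intro bounded_integrable_Ioc[where M = M]) (use mm in \<open>auto simp: slab_def\<close>)
qed

lemma rep_LB: "LB v"
 unfolding LB_def
proof
 fix m assume m: "m \<in> {1..nsteps}"
 have "(%t x. \<Sum>l\<in>{..tdeg D}. t ^ l * w m l x) \<in> Lbochner 2 (slab D m) (H10 U) (H1n U)"
  by (rule vspace.Lbochner2_sum[OF vspace_H10 slab_lebesgue]) (auto intro: monomial_Lbochner[OF m])
 then show "v \<in> Lbochner 2 (slab D m) (H10 U) (H1n U)"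
  by (rule Lbochner_H10_cong[rotated]) (simp add: rep_eq_interior[OF m])
qed

lemma rep_tder: "tder v (%m t \<phi>. \<Sum>l\<le>tdeg D. (real l * t ^ (l - 1)) * ip U (w m l) \<phi>)"
 unfolding tder_def
proof
 fix m assume m: "m \<in> {1..nsteps}"
 define a b where "a = node D (m - 1)" and "b = node D m"
 have ab: "a \<le> b" using slab_less[OF m] by (simp add: a_def b_def)
 have s: "slab D m = {a<..b}" by (simp add: slab_def a_def b_def)
 have c: "has_tderiv U a b (%t x. t ^ l * w m l x) (%t \<phi>. (real l * t ^ (l - 1)) * ip U (w m l) \<phi>)" if l: "l \<in> {..tdeg D}" for l
 proof -
  have c: "continuous_on {a..b} (%t. t ^ l :: real)" "continuous_on {a..b} (%t. real l * t ^ (l - 1))" by (intro continuous_intros)+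
  obtain M where M: "\<forall>t\<in>{a..b}. \<bar>real l * t ^ (l - 1)\<bar> \<le> M"
   using compact_imp_bounded[OF compact_continuous_image[OF c(2) compact_Icc]] by (auto simp: bounded_iff)
  show ?thesis
  proof (rule has_tderiv_scalar[OF ab c(1), where F = "{}" and M = M])
   show "((%t. t ^ l) has_real_derivative real l * t ^ (l - 1)) (at t)" for t
    by (auto intro!: derivative_eq_intros)
   show "(%t. real l * t ^ (l - 1)) \<in> borel_measurable (leb {a<..b})"
    by (rule continuous_imp_measurable_on_sets_lebesgue[OF continuous_on_subset[OF c(2)]]) auto
   show "w m l \<in> L2 U" using rep_H10[OF m] l by (auto intro: H10_L2)
  qed (use M in auto)
 qed
 have "has_tderiv U a b (%t x. \<Sum>l\<in>{..tdeg D}. t ^ l * w m l x) (%t \<phi>. \<Sum>l\<in>{..tdeg D}. (real l * t ^ (l - 1)) * ip U (w m l) \<phi>)"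
  by (rule has_tderiv_sum[OF _ c _ ab]) (use monomial_Lbochner[OF m] in \<open>auto simp: s\<close>)
 then have "has_tderiv U a b v (%t \<phi>. \<Sum>l\<in>{..tdeg D}. (real l * t ^ (l - 1)) * ip U (w m l) \<phi>)"
  by (rule has_tderiv_cong) (simp add: rep_eq_interior[OF m] s)
 then show "has_tderiv U (node D (m - 1)) (node D m) v (%t \<phi>. \<Sum>l\<le>tdeg D. (real l * t ^ (l - 1)) * ip U (w m l) \<phi>)"
  by (simp add: a_def b_def)
qed

text \<open>The deviation is controlled by the scalars \<open>t ^ l - \<tau> ^ l\<close>. The filter
  stays abstract so that both ends of the slab are covered.\<close>

lemma rep_limit:
 assumes m: "m \<in> {1..nsteps}" and F: "\<forall>\<^sub>F t in F. t \<in> slab D m" "((%t. t) \<longlongrightarrow> \<tau>) F"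
 shows "((%t. L2n U (%x. v t x - (\<Sum>l\<le>tdeg D. \<tau> ^ l * w m l x))) \<longlongrightarrow> 0) F" "\<forall>\<^sub>F t in F. v t \<in> L2 U"
proof -
 have "((%t. \<Sum>l\<le>tdeg D. \<bar>t ^ l - \<tau> ^ l\<bar> * L2n U (w m l)) \<longlongrightarrow> (\<Sum>l\<le>tdeg D. \<bar>\<tau> ^ l - \<tau> ^ l\<bar> * L2n U (w m l))) F"
  by (intro tendsto_intros F)
 then have lim: "((%t. \<Sum>l\<le>tdeg D. \<bar>t ^ l - \<tau> ^ l\<bar> * L2n U (w m l)) \<longlongrightarrow> 0) F" by simp
 have "\<forall>\<^sub>F t in F. norm (L2n U (%x. v t x - (\<Sum>l\<le>tdeg D. \<tau> ^ l * w m l x))) \<le> (\<Sum>l\<le>tdeg D. \<bar>t ^ l - \<tau> ^ l\<bar> * L2n U (w m l))"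
  using F(1)
 proof eventually_elim
  case (elim t)
  have "L2n U (%x. v t x - (\<Sum>l\<le>tdeg D. \<tau> ^ l * w m l x)) = L2n U (%x. \<Sum>l\<le>tdeg D. (t ^ l - \<tau> ^ l) * w m l x)"
   unfolding L2n_def by (intro arg_cong[where f = sqrt] ip_cong) (simp_all add: rep_eq_interior[OF m elim] sum_subtractf left_diff_distrib)
  also have "\<dots> \<le> (\<Sum>l\<le>tdeg D. \<bar>t ^ l - \<tau> ^ l\<bar> * L2n U (w m l))"
   by (rule L2n_sum) (auto intro: H10_L2 rep_H10[OF m])
  finally show ?case by (simp add: L2n_nonneg)
 qed
 then show "((%t. L2n U (%x. v t x - (\<Sum>l\<le>tdeg D. \<tau> ^ l * w m l x))) \<longlongrightarrow> 0) F"
  by (rule Lim_null_comparison[OF _ lim])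
 show "\<forall>\<^sub>F t in F. v t \<in> L2 U"
  using F(1) by eventually_elim (rule H10_L2[OF slab_H10[OF m]])
qed

lemma rep_rlim:
 assumes m: "m \<in> {1..nsteps}"
 shows "AE x in leb U. rlim U v (node D (m - 1)) x = (\<Sum>l\<le>tdeg D. node D (m - 1) ^ l * w m l x)"
proof -
 have "\<forall>\<^sub>F t in at_right (node D (m - 1)). t \<in> slab D m"
  using eventually_at_right_real[OF slab_less[OF m]] by eventually_elim (auto simp: slab_def)
 from rep_limit[OF m this tendsto_ident_at] show ?thesis
  by (intro rlim_AE(2) H10_L2 rep_sum_H10[OF m])
qed

lemma rep_llim:
 assumes m: "m \<in> {1..nsteps}"
 shows "AE x in leb U. llim U v (node D m) x = (\<Sum>l\<le>tdeg D. node D m ^ l * w m l x)"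
proof -
 have "\<forall>\<^sub>F t in at_left (node D m). t \<in> slab D m"
  using eventually_at_left_real[OF slab_less[OF m]] by eventually_elim (auto simp: slab_def)
 from rep_limit[OF m this tendsto_ident_at] show ?thesis
  by (intro llim_AE(2) H10_L2 rep_sum_H10[OF m])
qed

end

end

section \<open>Consequences of stationarity\<close>

locale dual_problem = st_problem D for D :: "'a::euclidean_space setting" +
 fixes NY NX J J1 J2 J3 j and u z :: "real \<Rightarrow> 'a \<Rightarrow> real"
 assumes target: "target_functional D NY NX J J1 J2 J3 j" and stationary: "stationary_point D J u z"
  and Xkh_nonempty: "\<exists>w. w \<in> Xkh D"
begin

lemma u_X: "u \<in> X_space D" and z_Y: "z \<in> Y_space D"
 using stationary by (auto simp: stationary_point_def)

abbreviation "W \<equiv> X_plus_Xkh D"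

lemma X_W: "v \<in> X_space D ==> v \<in> W"
 using Xkh_nonempty X_plus_Xkh_left by blast

lemma Xkh_W: "v \<in> Xkh D ==> v \<in> W"
 using u_X X_plus_Xkh_right by blast

lemma J_W: "thrice_differentiable_on W NX J J1 J2 J3"
 using target by (simp add: target_functional_def)

lemma j_Lbochner: "v \<in> W ==> j v \<in> Lbochner 2 {0<..Tend D} (L2 U) (L2n U)"
 and J1_eq: "v \<in> W ==> \<phi> \<in> W ==> J1 v \<phi> = st_ip D (j v) \<phi>"
 using target by (auto simp: target_functional_def L2_represented_on_def)

lemma J1_axpy: "v \<in> W ==> h \<in> W ==> h' \<in> W ==> J1 v (axpy c h' h) = J1 v h + c * J1 v h'"
proof -
 assume H: "v \<in> W" "h \<in> W" "h' \<in> W"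
 have "has_frechet_on W NX {()} (%_. 1) (%v _. J v) (%v h _. J1 v h)"
  using J_W by (simp add: thrice_differentiable_on_def)
 with H show ?thesis unfolding has_frechet_on_def by blast
qed

lemma zero_Y: "(%t x. 0) \<in> Y_space D"
proof -
 have "cont_into (H10 U) (H1n U) S (%t x. 0)" for S
  by (simp add: cont_into_def zero_H10 zero_H1n)
 then show ?thesis unfolding Y_space_def using Lbochner2_const[OF zero_H10] by blast
qed

lemma zero_X: "(%t x. 0) \<in> X_space D"
 using X_axpy[OF u_X u_X, of "-1"] by (simp add: axpy_def)

text \<open>The zero variation is admissible in the other argument, so the two partial derivatives
  vanish separately.\<close>

lemma Lagr_u_zero: "\<psi> \<in> X_space D ==> Lagr_u D J u z \<psi> = 0"
proof -
 assume "\<psi> \<in> X_space D"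
 then have "Lagr_u D J u z \<psi> + Lagr_z D J u z (%t x. 0) = 0"
  using stationary zero_Y unfolding stationary_point_def by blast
 then show ?thesis by (simp add: Lagr_z_def axpy_def)
qed

lemma Lagr_z_zero: "\<phi> \<in> Y_space D ==> Lagr_z D J u z \<phi> = 0"
proof -
 assume "\<phi> \<in> Y_space D"
 then have "Lagr_u D J u z (%t x. 0) + Lagr_z D J u z \<phi> = 0"
  using stationary zero_X unfolding stationary_point_def by blast
 then show ?thesis using Lagr_u_zero[OF zero_X] by simp
qed

text \<open>Along \<open>\<psi>\<close> the Lagrangian is \<open>J\<close> plus an affine function
  of \<open>s\<close>, so a vanishing derivative is this identity.\<close>

lemma dual_eq:
 assumes \<psi>: "\<psi> \<in> X_space D"
 shows "J1 u \<psi> = tpairing D \<psi> z + a_form D \<psi> z + ip U (\<psi> 0) (rlim U z 0)"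
proof -
 define b where "b = tpairing D \<psi> z + a_form D \<psi> z + ip U (\<psi> 0) (rlim U z 0)"
 have J: "has_frechet_on W NX {()} (%_. 1) (%v _. J v) (%v h _. J1 v h)" "seminorm_on W NX"
  using J_W by (auto simp: thrice_differentiable_on_def)
 have "((%s. J (axpy s \<psi> u)) has_real_derivative J1 (axpy 0 \<psi> u) \<psi>) (at 0)"
  using frechet_line_derivative[OF J X_plus_Xkh_axpy X_W[OF u_X] X_W[OF \<psi>], of "()" 0] by simp
 then have "((%s. J (axpy s \<psi> u) + (Lagr D J u z - J u) - s * b) has_real_derivative J1 u \<psi> - b) (at 0)"
  by (auto intro!: derivative_eq_intros)
 then have "Lagr_u D J u z \<psi> = J1 u \<psi> - b"
  unfolding Lagr_u_def Lagr_axpy[OF u_X \<psi> z_Y] b_def by (rule DERIV_imp_deriv)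
 then show ?thesis using Lagr_u_zero[OF \<psi>] by (simp add: b_def)
qed

text \<open>Stationarity along \<open>z\<close> yields \<open>Lagr D J u z = J u\<close>, the primal
  equation tested with \<open>z\<close>. The dual equation tested with \<open>u\<close> then
  eliminates all other terms that contain \<open>u\<close>.\<close>

lemma J1_u: "J1 u u = F_form D z + ip U (ini D) (rlim U z 0)"
proof -
 have "((%s. J u + (1 + s) * (Lagr D J u z - J u)) has_real_derivative Lagr D J u z - J u) (at 0)"
  by (auto intro!: derivative_eq_intros)
 then have "Lagr_z D J u z z = Lagr D J u z - J u"
  unfolding Lagr_z_def Lagr_scale_z[OF u_X z_Y] by (rule DERIV_imp_deriv)
 then have "Lagr D J u z = J u" using Lagr_z_zero[OF z_Y] by simp
 moreover have "ip U (%x. u 0 x - ini D x) (rlim U z 0) = ip U (u 0) (rlim U z 0) - ip U (ini D) (rlim U z 0)"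
  using X_L2[OF u_X, of 0] Tend_pos by (intro ip_diff_left ini_L2 Y_rlim_L2[OF z_Y]) auto
 ultimately show ?thesis using Lagr_X[OF u_X, of J z] dual_eq[OF u_X] by simp
qed

end

lemma continuous_on_Icc_bounded:
 fixes f :: "real \<Rightarrow> real"
 assumes "continuous_on {a..b} f" obtains M where "\<And>t. t \<in> {a..b} ==> \<bar>f t\<bar> \<le> M"
proof -
 obtain M where "\<forall>t\<in>{a..b}. \<bar>f t\<bar> \<le> M"
  using compact_imp_bounded[OF compact_continuous_image[OF assms compact_Icc]] by (auto simp: bounded_iff)
 then show thesis by (intro that) blast
qed

text \<open>\<open>A m\<close> and \<open>B m\<close> stand for the contributions of the right and
  left ends of slab \<open>m\<close>. Regrouping by nodes pairs the end of one slab with the start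
  of the next, which will produce the jumps.\<close>

lemma sum_shift_difference:
 fixes A B :: "nat \<Rightarrow> real"
 assumes "1 \<le> M" "A M = 0"
 shows "(\<Sum>m=1..M. A m - B m) = (\<Sum>m=2..M. A (m - 1) - B m) - B 1"
proof -
 obtain n where n: "M = Suc n" using assms(1) by (cases M) auto
 have "(\<Sum>m=1..M. A m) = (\<Sum>m=1..n. A m)" using n assms(2) by simp
 also have "\<dots> = (\<Sum>m=2..M. A (m - 1))"
  using sum.shift_bounds_cl_Suc_ivl[of "%m. A (m - 1)" 1 n] by (simp add: n numeral_2_eq_2)
 finally have "(\<Sum>m=1..M. A m) = (\<Sum>m=2..M. A (m - 1))" .
 moreover have "(\<Sum>m=1..M. B m) = B 1 + (\<Sum>m=2..M. B m)"
  using sum.atLeast_Suc_atMost[OF assms(1), of B] by (simp add: numeral_2_eq_2)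
 ultimately show ?thesis by (simp add: sum_subtractf)
qed

context st_problem
begin

lemma aT_cong: "(\<And>x. x \<in> U ==> v x = v' x) ==> aT v w = aT v' w"
proof -
 assume eq: "\<And>x. x \<in> U ==> v x = v' x"
 have "wgrad U v = wgrad U v'" by (rule wgrad_cong) (rule eq)
 moreover have "ip U v w = ip U v' w" by (rule ip_cong) (simp_all add: eq)
 ultimately show ?thesis by (simp add: aT_def b_grad_def[abs_def])
qed

lemma LB_const: "w \<in> H10 U ==> LB (%t. w)"
 unfolding LB_def slab_def by (intro ballI Lbochner2_const)

lemma aT_mult_left: "v \<in> H10 U ==> w \<in> H10 U ==> aT (%x. c * v x) w = c * aT v w"
 using aT_axpy_left[of v v w "c - 1"] by (simp add: algebra_simps)

lemma scalar_mult_X: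
 fixes \<eta> h :: "real \<Rightarrow> real"
 assumes \<eta>: "continuous_on {0..Tend D} \<eta>" and F: "finite F"
  and \<eta>': "\<And>t. t \<in> {0<..<Tend D} - F ==> (\<eta> has_real_derivative h t) (at t)"
  and h: "h \<in> borel_measurable (leb {0<..Tend D})" "\<And>t. t \<in> {0<..Tend D} ==> \<bar>h t\<bar> \<le> M"
  and w: "w \<in> H10 U"
 shows "(%t x. \<eta> t * w x) \<in> X_space D" "has_tderiv U 0 (Tend D) (%t x. \<eta> t * w x) (%t \<phi>. h t * ip U w \<phi>)"
proof -
 note wL = H10_L2[OF w]
 have T: "0 \<le> Tend D" using Tend_pos by simp
 show d: "has_tderiv U 0 (Tend D) (%t x. \<eta> t * w x) (%t \<phi>. h t * ip U w \<phi>)"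
  by (rule has_tderiv_scalar[OF T \<eta> F \<eta>' h wL])
 have \<eta>m: "\<eta> \<in> borel_measurable (leb {0<..Tend D})"
  by (rule continuous_imp_measurable_on_sets_lebesgue[OF continuous_on_subset[OF \<eta>]]) auto
 have \<eta>2: "continuous_on {0..Tend D} (%t. (\<eta> t)\<^sup>2)" by (intro continuous_intros \<eta>)
 obtain B where B: "\<And>t. t \<in> {0..Tend D} ==> \<bar>(\<eta> t)\<^sup>2\<bar> \<le> B" using continuous_on_Icc_bounded[OF \<eta>2] by blast
 have "integrable (leb {0<..Tend D}) (%t. (\<eta> t)\<^sup>2)"
  by (rule bounded_integrable_Ioc[where M = B]) (use B \<eta>m in auto)
 then have L: "(%t x. \<eta> t * w x) \<in> Lbochner 2 {0<..Tend D} (H10 U) (H1n U)"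
  by (rule vspace.Lbochner2_scalar[OF vspace_H10 \<eta>m _ w])
 have "cont_into (L2 U) (L2n U) {0..Tend D} (%t x. \<eta> t * w x)"
  unfolding cont_into_def
 proof (intro ballI conjI L2_mult_left wL)
  fix t assume "t \<in> {0..Tend D}"
  then have "(\<eta> \<longlongrightarrow> \<eta> t) (at t within {0..Tend D})" using \<eta> by (auto simp: continuous_on_def)
  then have "((%s. \<bar>\<eta> s - \<eta> t\<bar> * L2n U w) \<longlongrightarrow> \<bar>\<eta> t - \<eta> t\<bar> * L2n U w) (at t within {0..Tend D})" by (intro tendsto_intros)
  then show "((%s. L2n U (%x. \<eta> s * w x - \<eta> t * w x)) \<longlongrightarrow> 0) (at t within {0..Tend D})"
   by (simp add: left_diff_distrib[symmetric] L2n_mult)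
 qed
 then show "(%t x. \<eta> t * w x) \<in> X_space D" using d L unfolding X_space_def by blast
qed

end

section \<open>The dual equation for discrete functions that jump at the nodes\<close>

context dual_problem
begin

text \<open>Testing the dual equation with \<open>\<eta> t * w x\<close> leaves a scalar identity in
  time: \<open>Zw w\<close> multiplies the derivative of \<open>\<eta>\<close>, and
  \<open>qw w\<close> multiplies \<open>\<eta>\<close>.\<close>

definition "Zw w t = ip U w (z t)"
definition "qw w t = aT w (z t) - ip U (j u t) w"

lemma j_int: "w \<in> H10 U ==> integrable (leb {0<..Tend D}) (%t. ip U (j u t) w)"
proof -
 assume w: "w \<in> H10 U"
 interpret finite_measure "leb {0<..Tend D}" by (rule finite_measure_lebesgue_on) simp
 have "(%t x. (%t. 1) t * w x) \<in> Lbochner 2 {0<..Tend D} (L2 U) (L2n U)"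
  by (rule vspace.Lbochner2_scalar[OF vspace_L2 _ _ H10_L2[OF w]]) auto
 then have c: "(%t. w) \<in> Lbochner 2 {0<..Tend D} (L2 U) (L2n U)" by simp
 show ?thesis by (rule bilinear_pairing.pairing_integrable[OF pairing_L2 Ioc_lebesgue j_Lbochner[OF X_W[OF u_X]] c])
qed

lemma aT_int: "w \<in> H10 U ==> integrable (leb {0<..Tend D}) (%t. aT w (z t))"
 using slab_int_eq_integral(2)[OF aT_integrable[OF LB_const Y_LB[OF z_Y]]] .

lemma Zw_int: "w \<in> H10 U ==> integrable (leb {0<..Tend D}) (Zw w)"
 using slab_int_eq_integral(2)[OF LB_integrable(3)[OF LB_const Y_LB[OF z_Y]]] unfolding Zw_def .

lemma qw_int: "w \<in> H10 U ==> integrable (leb {0<..Tend D}) (qw w)"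
 unfolding qw_def by (intro integrable_diff aT_int j_int)

lemma separated_dual_eq:
 fixes \<eta> h :: "real \<Rightarrow> real"
 assumes w: "w \<in> H10 U" and \<eta>: "continuous_on {0..Tend D} \<eta>" and F: "finite F"
  and \<eta>': "\<And>t. t \<in> {0<..<Tend D} - F ==> (\<eta> has_real_derivative h t) (at t)"
  and h: "h \<in> borel_measurable (leb {0<..Tend D})" "\<And>t. t \<in> {0<..Tend D} ==> \<bar>h t\<bar> \<le> M"
 shows "(LINT t|leb {0<..Tend D}. h t * Zw w t + \<eta> t * qw w t) + \<eta> 0 * ip U w (rlim U z 0) = 0"
proof -
 define \<psi> where "\<psi> = (%t x. \<eta> t * w x)"
 have \<psi>X: "\<psi> \<in> X_space D" and \<psi>d: "has_tderiv U 0 (Tend D) \<psi> (%t \<phi>. h t * ip U w \<phi>)"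
  unfolding \<psi>_def using scalar_mult_X[OF \<eta> F \<eta>' h w] by auto
 note zL = Y_LB[OF z_Y]
 have \<eta>m: "\<eta> \<in> borel_measurable (leb {0<..Tend D})"
  by (rule continuous_imp_measurable_on_sets_lebesgue[OF continuous_on_subset[OF \<eta>]]) auto
 obtain B where B: "\<And>t. t \<in> {0..Tend D} ==> \<bar>\<eta> t\<bar> \<le> B" using continuous_on_Icc_bounded[OF \<eta>] by blast
 have i1: "integrable (leb {0<..Tend D}) (%t. h t * Zw w t)"
  by (rule bounded_mult_integrable[OF h Zw_int[OF w]])
 have i2: "integrable (leb {0<..Tend D}) (%t. \<eta> t * aT w (z t))"
  by (rule bounded_mult_integrable[OF \<eta>m _ aT_int[OF w], of B]) (use B in auto)
 have i3: "integrable (leb {0<..Tend D}) (%t. \<eta> t * ip U (j u t) w)"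
  by (rule bounded_mult_integrable[OF \<eta>m _ j_int[OF w], of B]) (use B in auto)
 have t: "tpairing D \<psi> z = (LINT t|leb {0<..Tend D}. h t * Zw w t)"
  unfolding tpairing_eq[OF tder_global[OF \<psi>d] zL] slab_int_eq_integral(1)[symmetric, OF integrable_imp_slabwise[OF i1]]
  by (simp add: slab_int_def Zw_def)
 have "a_form D \<psi> z = slab_int (%t. aT (\<psi> t) (z t))" by (rule a_form_eq[OF X_LB[OF \<psi>X] zL])
 also have "\<dots> = slab_int (%t. \<eta> t * aT w (z t))"
 proof (rule slab_int_cong_AE)
  fix m assume m: "m \<in> {1..nsteps}"
  show "AE t in sleb m. aT (\<psi> t) (z t) = \<eta> t * aT w (z t)"
   unfolding \<psi>_def using LB_AE[OF zL m] by eventually_elim (rule aT_mult_left[OF w])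
 qed
 also have "\<dots> = (LINT t|leb {0<..Tend D}. \<eta> t * aT w (z t))"
  by (rule slab_int_eq_integral(1)[OF integrable_imp_slabwise[OF i2]])
 finally have a: "a_form D \<psi> z = (LINT t|leb {0<..Tend D}. \<eta> t * aT w (z t))" .
 have j: "J1 u \<psi> = (LINT t|leb {0<..Tend D}. \<eta> t * ip U (j u t) w)"
  unfolding J1_eq[OF X_W[OF u_X] X_W[OF \<psi>X]] st_ip_def by (simp add: \<psi>_def ip_mult_right)
 have b: "ip U (\<psi> 0) (rlim U z 0) = \<eta> 0 * ip U w (rlim U z 0)" by (simp add: \<psi>_def ip_mult_left)
 have "(LINT t|leb {0<..Tend D}. h t * Zw w t + \<eta> t * qw w t) = (LINT t|leb {0<..Tend D}. (h t * Zw w t + \<eta> t * aT w (z t)) - \<eta> t * ip U (j u t) w)"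
  by (simp add: qw_def algebra_simps)
 also have "\<dots> = tpairing D \<psi> z + a_form D \<psi> z - J1 u \<psi>"
  unfolding t a j using i1 i2 i3 by simp
 finally show ?thesis using dual_eq[OF \<psi>X] b by simp
qed

lemma Zw_left_limit:
 assumes w: "w \<in> H10 U" and m: "m \<in> {1..nsteps}" and t: "t \<in> slab D m"
 shows "(Zw w \<longlongrightarrow> Zw w t) (at_left t)"
proof -
 note wL = H10_L2[OF w]
 have "((%s. L2n U w * L2n U (%x. z s x - z t x)) \<longlongrightarrow> L2n U w * 0) (at_left t)"
  by (intro tendsto_intros Y_left_cont[OF z_Y m t])
 then have l: "((%s. L2n U w * L2n U (%x. z s x - z t x)) \<longlongrightarrow> 0) (at_left t)" by simp
 have b: "node D (m - 1) < t" using t by (simp add: slab_def)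
 have "((%s. Zw w s - Zw w t) \<longlongrightarrow> 0) (at_left t)"
 proof (rule Lim_null_comparison[OF _ l])
  show "\<forall>\<^sub>F s in at_left t. norm (Zw w s - Zw w t) \<le> L2n U w * L2n U (%x. z s x - z t x)"
   using eventually_at_left_real[OF b]
  proof eventually_elim
   case (elim s)
   then have s: "s \<in> slab D m" using t by (auto simp: slab_def)
   have H: "z s \<in> L2 U" "z t \<in> L2 U" by (intro H10_L2 Y_H10[OF z_Y m] s t)+
   have "Zw w s - Zw w t = ip U w (%x. z s x - z t x)" unfolding Zw_def using wL H by (simp add: ip_diff_right)
   then show ?case using ip_Cauchy_Schwarz[OF wL L2_diff[OF H]] by simp
  qed
 qed
 then show ?thesis by (simp add: LIM_zero_iff)
qed

text \<open>What the dual equation sees of z at the m-th node: the right-hand limit at time 0, the left-hand value at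
 inner nodes, and nothing at the final time, where the tail of the time interval is empty.\<close>

definition "Zhat m w = (if m = 0 then ip U w (rlim U z 0) else if m = nsteps then 0 else ip U w (z (node D m)))"

lemma monomial_tail:
 assumes w: "w \<in> H10 U" and m: "m \<le> nsteps"
 shows "(LINT t|leb {node D m<..Tend D}. (real l * t ^ (l - 1)) * Zw w t + t ^ l * qw w t) = - (node D m ^ l) * Zhat m w"
proof -
 have d: "((%t. t ^ l) has_real_derivative real l * t ^ (l - 1)) (at t)" for t by (auto intro!: derivative_eq_intros)
 have c: "continuous_on S (%t. t ^ l :: real)" "continuous_on S (%t. real l * t ^ (l - 1))" for S by (intro continuous_intros)+
 consider "m = 0" | "m = nsteps" "m \<noteq> 0" | "0 < m" "m < nsteps" using m by linarith
 then show ?thesis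
 proof cases
  case 1
  obtain M where M: "\<And>t. t \<in> {0..Tend D} ==> \<bar>real l * t ^ (l - 1)\<bar> \<le> M" using continuous_on_Icc_bounded[OF c(2)] by blast
  have "(LINT t|leb {0<..Tend D}. (real l * t ^ (l - 1)) * Zw w t + t ^ l * qw w t) + 0 ^ l * ip U w (rlim U z 0) = 0"
   by (rule separated_dual_eq[OF w c(1) finite.emptyI d continuous_imp_measurable_on_sets_lebesgue[OF c(2)], where M = M]) (use M in auto)
  then show ?thesis using 1 by (simp add: Zhat_def node_0)
 next
  case 2
  then show ?thesis by (simp add: Zhat_def Tend_def)
 next
  case 3
  have mm: "m \<in> {1..nsteps}" "Suc m \<in> {2..nsteps}" using 3 by auto
  have n: "0 < node D m" "node D m < Tend D" using node_interior[OF mm(2)] by auto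
  have s: "node D m \<in> slab D m" using slab_less[OF mm(1)] by (simp add: slab_def)
  have "(LINT t|leb {node D m<..Tend D}. (real l * t ^ (l - 1)) * Zw w t + t ^ l * qw w t) = - (node D m ^ l) * Zw w (node D m)"
   by (rule localize_in_time[OF Zw_int[OF w] qw_int[OF w] separated_dual_eq[OF w] d c(2) n Zw_left_limit[OF w mm(1) s]])
  then show ?thesis using 3 by (simp add: Zhat_def Zw_def)
 qed
qed

lemma monomial_int:
 assumes w: "w \<in> H10 U"
 shows "integrable (leb {0<..Tend D}) (%t. (real l * t ^ (l - 1)) * Zw w t + t ^ l * qw w t)"
proof -
 have c: "continuous_on S (%t. t ^ l :: real)" "continuous_on S (%t. real l * t ^ (l - 1))" for S by (intro continuous_intros)+
 obtain M where M: "\<And>t. t \<in> {0..Tend D} ==> \<bar>real l * t ^ (l - 1)\<bar> \<le> M" using continuous_on_Icc_bounded[OF c(2)] by blast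
 obtain M' where M': "\<And>t. t \<in> {0..Tend D} ==> \<bar>t ^ l\<bar> \<le> M'" using continuous_on_Icc_bounded[OF c(1)] by blast
 show ?thesis
  by (intro integrable_add bounded_mult_integrable[OF continuous_imp_measurable_on_sets_lebesgue[OF c(2)] _ Zw_int[OF w], where M = M]
    bounded_mult_integrable[OF continuous_imp_measurable_on_sets_lebesgue[OF c(1)] _ qw_int[OF w], where M = M'])
   (use M M' in auto)
qed

text \<open>The slab is the difference of two tails of the time interval.\<close>

lemma monomial_slab:
 assumes w: "w \<in> H10 U" and m: "m \<in> {1..nsteps}"
 shows "(LINT t|sleb m. (real l * t ^ (l - 1)) * Zw w t + t ^ l * qw w t)
  = node D m ^ l * Zhat m w - node D (m - 1) ^ l * Zhat (m - 1) w"
proof -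
 have le: "m \<le> nsteps" "m - 1 \<le> nsteps" using m by auto
 have o: "0 \<le> node D (m - 1)" "node D (m - 1) \<le> node D m" "node D m \<le> Tend D"
  using node_nonneg[OF le(2)] slab_less[OF m] node_Tend[OF le(1)] by auto
 have i: "integrable (leb {a<..b}) (%t. (real l * t ^ (l - 1)) * Zw w t + t ^ l * qw w t)" if "0 \<le> a" "b \<le> Tend D" for a b
  by (rule lebesgue_on_integrable_subset[OF monomial_int[OF w]]) (use that in auto)
 have i1: "integrable (leb {node D (m - 1)<..node D m}) (%t. (real l * t ^ (l - 1)) * Zw w t + t ^ l * qw w t)"
  by (rule i) (use o in auto)
 have i2: "integrable (leb {node D m<..Tend D}) (%t. (real l * t ^ (l - 1)) * Zw w t + t ^ l * qw w t)"
  by (rule i) (use o in auto)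
 show ?thesis
  using integral_Ioc_combine(2)[OF o(2,3) i1 i2] unfolding monomial_tail[OF w le(1)] monomial_tail[OF w le(2)] slab_def by simp
qed

lemma Zhat_sum:
 assumes w: "\<And>l. l \<le> n ==> w l \<in> H10 U" and m: "m \<le> nsteps"
 shows "(\<Sum>l\<le>n. c l * Zhat m (w l)) = Zhat m (%x. \<Sum>l\<le>n. c l * w l x)"
proof -
 have g: "(\<Sum>l\<le>n. c l * ip U (w l) v) = ip U (%x. \<Sum>l\<le>n. c l * w l x) v" if "v \<in> L2 U" for v
  using that w by (subst ip_sum_left) (auto simp: ip_mult_left intro!: L2_mult_left intro: H10_L2)
 show ?thesis
 proof (cases "m = 0 \<or> m = nsteps")
  case True
  then show ?thesis using g[OF Y_rlim_L2[OF z_Y]] by (auto simp: Zhat_def)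
 next
  case False
  then have mm: "m \<in> {1..nsteps}" using m by auto
  have "node D m \<in> slab D m" using slab_less[OF mm] by (simp add: slab_def)
  then have "z (node D m) \<in> L2 U" by (intro H10_L2 Y_H10[OF z_Y mm])
  from g[OF this] show ?thesis using False by (simp add: Zhat_def)
 qed
qed

lemma aT_sum_left:
 "(\<And>l. l \<in> A ==> w l \<in> H10 U) ==> v \<in> H10 U ==> aT (%x. \<Sum>l\<in>A. c l * w l x) v = (\<Sum>l\<in>A. c l * aT (w l) v)"
proof (induction A rule: infinite_finite_induct)
 case (insert a A)
 have "(%x. \<Sum>l\<in>A. c l * w l x) \<in> H10 U" by (rule H10_sum) (use insert in auto)
 then have "aT (%x. (\<Sum>l\<in>A. c l * w l x) + c a * w a x) v = aT (%x. \<Sum>l\<in>A. c l * w l x) v + c a * aT (w a) v"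
  using insert by (intro aT_axpy_left) auto
 then show ?case using insert by (simp add: add.commute)
qed (use aT_mult_left[OF zero_H10, of _ 0] in simp_all)

text \<open>On each slab \<open>v\<close> is a sum of powers of \<open>t\<close> times functions in
  \<open>H10\<close>, to each of which the localized dual equation applies. As \<open>j u\<close>
  does not depend on the test function, the slabs add up to \<open>J1 u v\<close>. At an inner node
  the end terms of both adjacent slabs involve the same value of \<open>z\<close>, so they combine
  to the jump of \<open>v\<close>.\<close>

lemma dual_eq_discrete:
 assumes v: "v \<in> Xkh D"
 shows "J1 u v = tpairing D v z + a_form D v z + ip U (rlim U v 0) (rlim U z 0)
  + (\<Sum>m=2..nsteps. ip U (tjump U v (node D (m - 1))) (z (node D (m - 1))))"
proof -
 obtain w where w: "slab_rep v w" using Xkh_rep[OF v] by blast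
 note wH = rep_H10[OF w]
 note zL = Y_LB[OF z_Y]
 define g where "g = (%m t \<phi>. \<Sum>l\<le>tdeg D. (real l * t ^ (l - 1)) * ip U (w m l) \<phi>)"
 have g: "tder v g" unfolding g_def by (rule rep_tder[OF w])
 define L where "L m = (%x. \<Sum>l\<le>tdeg D. node D m ^ l * w m l x)" for m
 define R where "R m = (%x. \<Sum>l\<le>tdeg D. node D (m - 1) ^ l * w m l x)" for m
 \<comment> \<open>The integrand of the localized dual equation; its slab integrals consist of end
   point terms alone.\<close>
 define f where "f m t = (\<Sum>l\<le>tdeg D. (real l * t ^ (l - 1)) * Zw (w m l) t + t ^ l * qw (w m l) t)" for m t
 have aej: "AE t in sleb m. j u t \<in> L2 U" if m: "m \<in> {1..nsteps}" for m
  by (rule AE_lebesgue_on_subset[OF _ slab_subset[OF m]]) (use j_Lbochner[OF X_W[OF u_X]] in \<open>auto simp: Lbochner_def\<close>)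
 have fi: "integrable (sleb m) (f m)"
  and fs: "(LINT t|sleb m. f m t) = Zhat m (L m) - Zhat (m - 1) (R m)" if m: "m \<in> {1..nsteps}" for m
 proof -
  have i: "integrable (sleb m) (%t. (real l * t ^ (l - 1)) * Zw (w m l) t + t ^ l * qw (w m l) t)" if "l \<in> {..tdeg D}" for l
   by (rule lebesgue_on_integrable_subset[OF monomial_int[OF wH[OF m]] slab_subset[OF m]]) (use that in auto)
  then show "integrable (sleb m) (f m)" unfolding f_def by (rule integrable_sum)
  have "(LINT t|sleb m. f m t) = (\<Sum>l\<le>tdeg D. LINT t|sleb m. (real l * t ^ (l - 1)) * Zw (w m l) t + t ^ l * qw (w m l) t)"
   unfolding f_def by (rule integral_sum) (rule i)
  also have "\<dots> = (\<Sum>l\<le>tdeg D. node D m ^ l * Zhat m (w m l) - node D (m - 1) ^ l * Zhat (m - 1) (w m l))"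
   by (rule sum.cong[OF refl], rule monomial_slab[OF wH[OF m] m]) simp
  also have "\<dots> = Zhat m (L m) - Zhat (m - 1) (R m)"
   unfolding sum_subtractf L_def R_def using m by (subst (1 2) Zhat_sum) (auto intro: wH[OF m])
  finally show "(LINT t|sleb m. f m t) = Zhat m (L m) - Zhat (m - 1) (R m)" .
 qed
 \<comment> \<open>Solved for the term with \<open>j u\<close>, so that its integrability is
   inherited from the right-hand side.\<close>
 have ae: "AE t in sleb m. ip U (j u t) (v t) = g m t (z t) + aT (v t) (z t) - f m t" if m: "m \<in> {1..nsteps}" for m
 proof -
  have "AE t in sleb m. t \<in> slab D m" by (rule AE_I2) simp
  then show ?thesis using aej[OF m] LB_AE[OF zL m]
  proof eventually_elim
   case (elim t)
   note eq = rep_eq_interior[OF w m elim(1)]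
   have a: "aT (v t) (z t) = (\<Sum>l\<le>tdeg D. t ^ l * aT (w m l) (z t))"
    by (rule trans[OF aT_cong[OF eq] aT_sum_left]) (auto intro: wH[OF m] elim)
   have "ip U (j u t) (v t) = ip U (j u t) (%x. \<Sum>l\<le>tdeg D. t ^ l * w m l x)" by (rule ip_cong) (simp_all add: eq)
   also have "\<dots> = (\<Sum>l\<le>tdeg D. t ^ l * ip U (j u t) (w m l))"
    by (subst ip_sum_right) (auto simp: ip_mult_right elim intro!: L2_mult_left intro: H10_L2 wH[OF m])
   finally have b: "ip U (j u t) (v t) = (\<Sum>l\<le>tdeg D. t ^ l * ip U (j u t) (w m l))" .
   show ?case unfolding a b g_def f_def Zw_def qw_def
    by (simp add: sum.distrib[symmetric] sum_subtractf[symmetric] algebra_simps)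
  qed
 qed
 have gi: "integrable (sleb m) (%t. g m t (z t))" if m: "m \<in> {1..nsteps}" for m
  by (rule tder_integrable[OF g zL m])
 have ai: "integrable (sleb m) (%t. aT (v t) (z t))" if m: "m \<in> {1..nsteps}" for m
  using aT_integrable[OF rep_LB[OF w] zL] m by (simp add: slabwise_integrable_def)
 have ji: "slabwise_integrable (%t. ip U (j u t) (v t))"
  unfolding slabwise_integrable_def
 proof
  fix m assume m: "m \<in> {1..nsteps}"
  have "integrable (sleb m) (%t. g m t (z t) + aT (v t) (z t) - f m t)"
   by (intro integrable_add integrable_diff gi ai fi m)
  moreover have "AE t in sleb m. g m t (z t) + aT (v t) (z t) - f m t = ip U (j u t) (v t)"
   using ae[OF m] by eventually_elim (rule sym)
  ultimately show "integrable (sleb m) (%t. ip U (j u t) (v t))"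
   by (rule lebesgue_on_integrable_cong_AE[OF slab_lebesgue, rotated])
 qed
 have "J1 u v = slab_int (%t. ip U (j u t) (v t))"
  unfolding J1_eq[OF X_W[OF u_X] Xkh_W[OF v]] st_ip_def by (rule slab_int_eq_integral(1)[OF ji, symmetric])
 also have "\<dots> = (\<Sum>m=1..nsteps. LINT t|sleb m. g m t (z t) + aT (v t) (z t) - f m t)"
  unfolding slab_int_def by (intro sum.cong refl lebesgue_on_integral_cong_AE slab_lebesgue ae)
 also have "\<dots> = (\<Sum>m=1..nsteps. (LINT t|sleb m. g m t (z t)) + (LINT t|sleb m. aT (v t) (z t)) - (Zhat m (L m) - Zhat (m - 1) (R m)))"
 proof (rule sum.cong[OF refl])
  fix m assume m: "m \<in> {1..nsteps}"
  show "(LINT t|sleb m. g m t (z t) + aT (v t) (z t) - f m t) = (LINT t|sleb m. g m t (z t)) + (LINT t|sleb m. aT (v t) (z t)) - (Zhat m (L m) - Zhat (m - 1) (R m))"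
   unfolding integral_diff[OF integrable_add[OF gi[OF m] ai[OF m]] fi[OF m]]
    integral_add[OF gi[OF m] ai[OF m]] fs[OF m] ..
 qed
 also have "\<dots> = tpairing D v z + a_form D v z - (\<Sum>m=1..nsteps. Zhat m (L m) - Zhat (m - 1) (R m))"
  unfolding tpairing_eq[OF g zL] a_form_eq[OF rep_LB[OF w] zL] slab_int_def sum.distrib sum_subtractf ..
 \<comment> \<open>The contribution of the final time is 0 by the definition of \<open>Zhat\<close>;
   the start of the first slab is split off and becomes the initial term.\<close>
 also have "(\<Sum>m=1..nsteps. Zhat m (L m) - Zhat (m - 1) (R m)) = (\<Sum>m=2..nsteps. Zhat (m - 1) (L (m - 1)) - Zhat (m - 1) (R m)) - Zhat (1 - 1) (R 1)"
  by (rule sum_shift_difference) (use nstep_pos in \<open>auto simp: Zhat_def\<close>)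
 also have "(\<Sum>m=2..nsteps. Zhat (m - 1) (L (m - 1)) - Zhat (m - 1) (R m)) = - (\<Sum>m=2..nsteps. ip U (tjump U v (node D (m - 1))) (z (node D (m - 1))))"
  unfolding sum_negf[symmetric]
 proof (rule sum.cong[OF refl])
  fix m assume m2: "m \<in> {2..nsteps}"
  then have m: "m \<in> {1..nsteps}" "m - 1 \<in> {1..nsteps}" "m - 1 \<noteq> 0" "m - 1 \<noteq> nsteps" by auto
  have zz: "z (node D (m - 1)) \<in> L2 U"
   by (intro H10_L2 Y_H10[OF z_Y m(2)]) (use slab_less[OF m(2)] in \<open>simp add: slab_def\<close>)
  have LR: "L (m - 1) \<in> L2 U" "R m \<in> L2 U" unfolding L_def R_def by (intro H10_L2 rep_sum_H10[OF w] m)+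
  have "AE x in leb U. tjump U v (node D (m - 1)) x = R m x - L (m - 1) x"
   using rep_rlim[OF w m(1)] rep_llim[OF w m(2)] by eventually_elim (simp add: tjump_def R_def L_def)
  then have "ip U (tjump U v (node D (m - 1))) (z (node D (m - 1))) = ip U (%x. R m x - L (m - 1) x) (z (node D (m - 1)))"
   by (intro ip_cong_AE[OF dom_lebesgue]) auto
  also have "\<dots> = ip U (R m) (z (node D (m - 1))) - ip U (L (m - 1)) (z (node D (m - 1)))"
   by (rule ip_diff_left[OF LR(2,1) zz])
  finally show "Zhat (m - 1) (L (m - 1)) - Zhat (m - 1) (R m) = - ip U (tjump U v (node D (m - 1))) (z (node D (m - 1)))"
   unfolding Zhat_def using m(3,4) by simp
 qed
 also have "Zhat (1 - 1) (R 1) = ip U (rlim U v 0) (rlim U z 0)"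
 proof -
  have "1 \<in> {1..nsteps}" using nstep_pos by simp
  from rep_rlim[OF w this] have "AE x in leb U. R 1 x = rlim U v 0 x"
   by (simp add: node_0 R_def eq_commute)
  then have "ip U (R 1) (rlim U z 0) = ip U (rlim U v 0) (rlim U z 0)"
   by (intro ip_cong_AE[OF dom_lebesgue]) auto
  then show ?thesis by (simp add: Zhat_def)
 qed
 finally show ?thesis by simp
qed

end

section \<open>The cell-wise residual\<close>

lemma poly_space_Ck: "q \<in> poly_space p ==> Ck k q"
proof -
 assume "q \<in> poly_space p"
 then obtain c where "\<forall>x. q x = (\<Sum>\<beta> | \<beta> \<in> Basis \<rightarrow>\<^sub>E {..p} \<and> sum \<beta> Basis \<le> p. c \<beta> * (\<Prod>i\<in>Basis. (x \<bullet> i) ^ \<beta> i))"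
  unfolding poly_space_def by blast
 then have q: "q = (%x. \<Sum>\<beta> | \<beta> \<in> Basis \<rightarrow>\<^sub>E {..p} \<and> sum \<beta> Basis \<le> p. c \<beta> * (\<Prod>i\<in>Basis. (x \<bullet> i) ^ \<beta> i))" by blast
 have id: "Ck k (%t::real. t)" for k
 proof (cases k)
  case (Suc n)
  show ?thesis unfolding Suc by (rule Ck_SucI[where f' = "%x y. y"]) (auto intro: Ck_const)
 qed simp
 have "Ck k (%x. (x \<bullet> i))" for i :: 'a using Ck_affine[OF id, of k i 0] by (simp add: inner_commute)
 then have pw: "Ck k (%x. (x \<bullet> i) ^ n)" for i :: 'a and n by (induction n) (auto intro: Ck_const Ck_mult)
 have sm: "(\<And>i. i \<in> A ==> Ck k (f i)) ==> Ck k (%x. \<Sum>i\<in>A. f i x)" for A and f :: "('a \<Rightarrow> nat) \<Rightarrow> 'a \<Rightarrow> real"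
  by (induction A rule: infinite_finite_induct) (auto intro: Ck_const Ck_add)
 show ?thesis unfolding q by (intro sm Ck_mult Ck_const Ck_prod pw)
qed

lemma Ck_sum: "(\<And>i. i \<in> A ==> Ck k (f i)) ==> Ck k (%x. \<Sum>i\<in>A. c i * f i x)"
proof (induction A rule: infinite_finite_induct)
 case (insert a A)
 have "Ck k (%x. c a * f a x + (\<Sum>i\<in>A. c i * f i x))"
  by (intro Ck_add Ck_mult Ck_const insert) (use insert in auto)
 then show ?case using insert by simp
qed (auto intro: Ck_const)

lemma grad_sum:
 assumes "\<And>i. i \<in> A ==> C1_grad (f i) (G i)"
 shows "grad (%x. \<Sum>i\<in>A. c i * f i x) x = (\<Sum>i\<in>A. c i *\<^sub>R G i x)"
proof (rule grad_eqI)
 show "((%x. \<Sum>i\<in>A. c i * f i x) has_derivative (\<bullet>) (\<Sum>i\<in>A. c i *\<^sub>R G i x)) (at x)"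
  by (rule has_derivative_eq_rhs[OF has_derivative_sum[OF has_derivative_mult_right[OF C1_grad_deriv[OF assms]]]])
   (auto simp: inner_sum_left)
qed

lemma lap_sum:
 assumes f: "\<And>i. i \<in> A ==> Ck 2 (f i)"
 shows "lap (%x. \<Sum>i\<in>A. c i * f i x) x = (\<Sum>i\<in>A. c i * lap (f i) x)"
proof -
 have "grad (%y. grad (%x. \<Sum>i\<in>A. c i * f i x) y \<bullet> b) x \<bullet> b = (\<Sum>i\<in>A. c i * (grad (%y. grad (f i) y \<bullet> b) x \<bullet> b))"
  if b: "b \<in> Basis" for b
 proof -
  have 1: "(%y. grad (%x. \<Sum>i\<in>A. c i * f i x) y \<bullet> b) = (%y. \<Sum>i\<in>A. c i * (grad (f i) y \<bullet> b))"
   using grad_sum[of A f "%i. grad (f i)" c] Ck2_C1_grad[OF f] by (simp add: inner_sum_left fun_eq_iff)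
  show ?thesis unfolding 1 using grad_sum[of A "%i y. grad (f i) y \<bullet> b" "%i. grad (%y. grad (f i) y \<bullet> b)" c x] Ck_component_C1_grad[OF f b]
   by (simp add: inner_sum_left)
 qed
 then show ?thesis unfolding lap_def sum_distrib_left by (subst sum.swap) simp
qed

text \<open>Derivatives see only a neighbourhood, so agreement of \<open>v\<close> with a smooth
  \<open>q\<close> near \<open>x\<close> is enough.\<close>

lemma divg_grad_transform:
 assumes q: "Ck 2 q" and Q: "open Q" "x \<in> Q" and v: "\<And>y. y \<in> Q ==> v y = q y"
 shows "divg (%y. c *\<^sub>R grad v y) x = c * lap q x"
proof -
 define L where "L h = (\<Sum>b\<in>Basis. (grad (%y. grad q y \<bullet> b) x \<bullet> h) *\<^sub>R b)" for h
 have "(grad q has_derivative L) (at x)"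
 proof (subst has_derivative_componentwise_within, rule ballI)
  fix b :: 'a assume b: "b \<in> Basis"
  have "(%h. L h \<bullet> b) = (\<bullet>) (grad (%y. grad q y \<bullet> b) x)"
   using b by (simp add: L_def fun_eq_iff inner_sum_left inner_Basis if_distrib cong: if_cong)
  then show "((%x. grad q x \<bullet> b) has_derivative (%x. L x \<bullet> b)) (at x)"
   using C1_grad_deriv[OF Ck_component_C1_grad[OF q b]] by simp
 qed
 then have "((%y. c *\<^sub>R grad q y) has_derivative (%h. c *\<^sub>R L h)) (at x)" by (rule has_derivative_scaleR_right)
 then have "((%y. c *\<^sub>R grad v y) has_derivative (%h. c *\<^sub>R L h)) (at x)"
  by (rule has_derivative_transform_within_open[OF _ Q]) (simp add: grad_transform_open[OF Q(1) _ v Ck2_C1_grad[OF q]])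
 then have "frechet_derivative (%y. c *\<^sub>R grad v y) (at x) = (%h. c *\<^sub>R L h)" by (rule frechet_derivative_at[symmetric])
 then show ?thesis unfolding divg_def lap_def sum_distrib_left
  by (intro sum.cong refl) (simp add: L_def inner_sum_left inner_Basis if_distrib cong: if_cong)
qed

context simplicial_mesh
begin

text \<open>The cells cover the domain, their interiors are disjoint subsets of it, and their
  frontiers, being those of convex sets, are negligible.\<close>

lemma sum_ip_cells:
 fixes f g :: "'a \<Rightarrow> 'b::euclidean_space"
 assumes f: "f \<in> L2 U" and g: "g \<in> L2 U"
 shows "(\<Sum>K\<in>T. ip K f g) = ip U f g"
proof -
 define h where "h x = f x \<bullet> g x" for x
 have hi: "integrable (leb U) h" unfolding h_def by (rule L2_inner_integrable[OF f g])
 have i: "integrable lebesgue (%x. if x \<in> interior K then h x else 0)" if "K \<in> T" for K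
  using lebesgue_on_integrable_subset[OF hi interior_mesh_cell[OF that]] integrable_restrict_UNIV[of "interior K" h]
  by (simp add: dom_lebesgue)
 have e: "ip K f g = (LINT x|lebesgue. (if x \<in> interior K then h x else 0))" if "K \<in> T" for K
  unfolding ip_mesh_cell_interior[OF that] unfolding ip_def h_def[symmetric] by (subst integral_restrict_UNIV) simp_all
 have ae: "AE x in lebesgue. x \<notin> (\<Union>K\<in>T. frontier K)"
 proof (rule AE_not_in)
  have "negligible (\<Union>K\<in>T. frontier K)"
   by (rule negligible_Union) (use finite_mesh negligible_convex_frontier mesh_cell_convex in auto)
  then show "(\<Union>K\<in>T. frontier K) \<in> null_sets lebesgue" by (simp add: negligible_iff_null_sets)
 qed
 have "(\<Sum>K\<in>T. ip K f g) = (LINT x|lebesgue. (\<Sum>K\<in>T. if x \<in> interior K then h x else 0))"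
  using e by (subst integral_sum) (auto intro: i)
 also have "\<dots> = (LINT x|lebesgue. (if x \<in> U then h x else 0))"
 proof (rule integral_cong_AE)
  show "(%x. \<Sum>K\<in>T. if x \<in> interior K then h x else 0) \<in> borel_measurable lebesgue"
   by (rule borel_measurable_sum) (use i in auto)
  show "(%x. if x \<in> U then h x else 0) \<in> borel_measurable lebesgue"
   using hi integrable_restrict_UNIV[OF dom_lebesgue, of h] by auto
  show "AE x in lebesgue. (\<Sum>K\<in>T. if x \<in> interior K then h x else 0) = (if x \<in> U then h x else 0)"
   using ae
  proof eventually_elim
   case (elim x)
   show ?case
   proof (cases "x \<in> U")
    case True
    then obtain K where K: "K \<in> T" "x \<in> K" using mesh_Union closure_subset by blast
    then have xK: "x \<in> interior K" using elim closure_subset by (auto simp: frontier_def)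
    have "(\<Sum>K'\<in>T. if x \<in> interior K' then h x else 0) = (\<Sum>K'\<in>T. if K' = K then h x else 0)"
     using interiors_disjoint[OF _ K(1)] xK by (intro sum.cong refl) auto
    then show ?thesis using True K finite_mesh by simp
   next
    case False
    then have "x \<notin> interior K" if "K \<in> T" for K using interior_mesh_cell[OF that] by blast
     then show ?thesis using False by (auto intro!: sum.neutral)
   qed
  qed
 qed
 also have "\<dots> = ip U f g" unfolding ip_def h_def[symmetric] by (rule integral_restrict_UNIV[OF dom_lebesgue])
 finally show ?thesis .
qed

end

context st_problem
begin

lemma simplicial_mesh_slab: "m \<le> nsteps ==> simplicial_mesh U (msh D m)"
 by unfold_locales (use data disc in \<open>auto simp: data_ok_def polyhedral_domain_def discretization_ok_def\<close>)

lemma rep_poly: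
 assumes w: "slab_rep v w" and m: "m \<in> {1..nsteps}"
 obtains q where "\<And>l K. l \<le> tdeg D ==> K \<in> msh D m ==> Ck 2 (q l K)"
  "\<And>l K x. l \<le> tdeg D ==> K \<in> msh D m ==> x \<in> K ==> w m l x = q l K x"
proof -
 have "\<exists>p. l \<le> tdeg D \<longrightarrow> K \<in> msh D m \<longrightarrow> p \<in> poly_space (xdeg D) \<and> (\<forall>x\<in>K. w m l x = p x)" for l K
 proof (cases "l \<le> tdeg D \<and> K \<in> msh D m")
  case True
  then have "\<forall>K\<in>msh D m. \<exists>q\<in>poly_space (xdeg D). \<forall>x\<in>K. w m l x = q x"
   using rep_Vh[OF w m, of l] by (simp add: Vh_def)
  then show ?thesis using True by blast
 qed blast
 then obtain q where "\<And>l K. l \<le> tdeg D \<longrightarrow> K \<in> msh D m \<longrightarrow> q l K \<in> poly_space (xdeg D) \<and> (\<forall>x\<in>K. w m l x = q l K x)"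
  by metis
 then show thesis by (intro that[of q]) (auto intro: poly_space_Ck)
qed

text \<open>Stated for interior times of the slab, because at a node the two-sided derivative would
  see the next slab.\<close>

lemma rep_deriv:
 assumes w: "slab_rep v w" and m: "m \<in> {1..nsteps}" and t: "t \<in> {node D (m - 1)<..<node D m}" and x: "x \<in> closure U"
 shows "deriv (%s. v s x) t = (\<Sum>l\<le>tdeg D. (real l * t ^ (l - 1)) * w m l x)"
proof (rule DERIV_imp_deriv)
 have "((%s. \<Sum>l\<le>tdeg D. s ^ l * w m l x) has_real_derivative (\<Sum>l\<le>tdeg D. (real l * t ^ (l - 1)) * w m l x)) (at t)"
  by (rule DERIV_sum) (auto intro!: derivative_eq_intros)
 then show "((%s. v s x) has_real_derivative (\<Sum>l\<le>tdeg D. (real l * t ^ (l - 1)) * w m l x)) (at t)"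
 proof (rule has_field_derivative_transform_within_open[OF _ open_greaterThanLessThan t])
  fix s assume "s \<in> {node D (m - 1)<..<node D m}"
  then have "s \<in> slab D m" by (auto simp: slab_def)
  then show "(\<Sum>l\<le>tdeg D. s ^ l * w m l x) = v s x" using rep_eq[OF w m _ x] by simp
 qed
qed

text \<open>The polynomial that represents the discrete function on \<open>K\<close> at time
  \<open>t\<close>, continued to the whole space. The divergence theorem is applied to this
  continuation.\<close>

definition "qt q t K x = (\<Sum>l\<le>tdeg D. t ^ l * q l K x)"

context
 fixes v w m q
 assumes w: "slab_rep v w" and m: "m \<in> {1..nsteps}"
  and q: "\<And>l K. l \<le> tdeg D ==> K \<in> msh D m ==> Ck 2 (q l K)"
  and wq: "\<And>l K x. l \<le> tdeg D ==> K \<in> msh D m ==> x \<in> K ==> w m l x = q l K x"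
begin

interpretation M: simplicial_mesh U "msh D m"
 by (rule simplicial_mesh_slab) (use m in auto)

lemma qt_Ck: "K \<in> msh D m ==> Ck 2 (qt q t K)"
 unfolding qt_def[abs_def] by (rule Ck_sum) (auto intro: q)

lemma qt_eq: "K \<in> msh D m ==> t \<in> slab D m ==> x \<in> K ==> v t x = qt q t K x"
 using rep_eq[OF w m, of t x] M.mesh_Union wq by (auto simp: qt_def)

lemma cell_res_interior:
 assumes t: "t \<in> {node D (m - 1)<..<node D m}" and K: "K \<in> msh D m" and x: "x \<in> interior K"
 shows "cell_res D v t x = rhs D t x - (\<Sum>l\<le>tdeg D. (real l * t ^ (l - 1)) * w m l x) - b_grad D (v t) x
  + eps D * lap (qt q t K) x - alp D * v t x"
proof -
 have ts: "t \<in> slab D m" using t by (auto simp: slab_def)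
 have "x \<in> closure U" using M.interior_mesh_cell[OF K] x closure_subset by blast
 then have "deriv (%s. v s x) t = (\<Sum>l\<le>tdeg D. (real l * t ^ (l - 1)) * w m l x)" by (rule rep_deriv[OF w m t])
 moreover have "divg (%y. eps D *\<^sub>R grad (v t) y) x = eps D * lap (qt q t K) x"
  by (rule divg_grad_transform[OF qt_Ck[OF K] open_interior x]) (use qt_eq[OF K ts] interior_subset in auto)
 ultimately show ?thesis unfolding cell_res_def by simp
qed

text \<open>Restricted to the open cell, the global weak gradient remains a weak gradient, and by
  uniqueness it agrees with the classical gradient of the polynomial.\<close>

lemma wgrad_cell:
 assumes t: "t \<in> slab D m" and K: "K \<in> msh D m"
 shows "AE x in leb (interior K). wgrad U (v t) x = grad (qt q t K) x"
proof -
 have sub: "interior K \<subseteq> U" by (rule M.interior_mesh_cell[OF K])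
 have bd: "bounded (interior K)" using bounded_subset[OF bounded_dom sub] .
 interpret I: bounded_domain "interior K" by unfold_locales (use bd in auto)
 have 1: "has_wgrad (interior K) (v t) (wgrad U (v t))"
  by (rule has_wgrad_subset[OF H1_has_wgrad[OF H10_H1[OF slab_H10[OF w m t]]] open_interior sub])
 have 2: "has_wgrad (interior K) (qt q t K) (grad (qt q t K))"
  by (rule C1_has_wgrad[OF Ck2_C1_grad[OF qt_Ck[OF K]] open_interior bd])
 have "(LINT x|leb (interior K). v t x *\<^sub>R grad \<phi> x) = (LINT x|leb (interior K). qt q t K x *\<^sub>R grad \<phi> x)" for \<phi>
  by (intro integral_cong refl) (use qt_eq[OF K t] interior_subset in auto)
 then have "has_wgrad (interior K) (v t) (grad (qt q t K))" using 2 by (simp add: has_wgrad_def)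
 from I.has_wgrad_unique[OF 1 this] show ?thesis .
qed

lemma L2_cell: "K \<in> msh D m ==> f \<in> L2 U ==> f \<in> L2 (interior K)"
 by (rule L2_subset[OF _ M.interior_mesh_cell]) (auto simp: dom_lebesgue)

lemma lap_L2: "K \<in> msh D m ==> Ck 2 f ==> lap f \<in> L2 (interior K)"
 by (rule C1_grad_L2_closed(2)) (use bounded_subset[OF bounded_dom M.interior_mesh_cell] in auto)

lemma ip_cell_res:
 assumes t: "t \<in> {node D (m - 1)<..<node D m}" and r: "rhs D t \<in> L2 U" and K: "K \<in> msh D m" and y: "y \<in> L2 U"
 shows "ip K (cell_res D v t) y = ip K (rhs D t) y - (\<Sum>l\<le>tdeg D. (real l * t ^ (l - 1)) * ip K (w m l) y)
  - ip K (b_grad D (v t)) y + eps D * ip K (lap (qt q t K)) y - alp D * ip K (v t) y"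
  and "cell_res D v t \<in> L2 (interior K)"
proof -
 have ts: "t \<in> slab D m" using t by (auto simp: slab_def)
 note vH = slab_H10[OF w m ts]
 note L = L2_cell[OF K]
 define S where "S = (%x. \<Sum>l\<le>tdeg D. (real l * t ^ (l - 1)) * w m l x)"
 have wL: "w m l \<in> L2 (interior K)" if "l \<le> tdeg D" for l by (rule L[OF H10_L2[OF rep_H10[OF w m that]]])
 have 1: "rhs D t \<in> L2 (interior K)" "b_grad D (v t) \<in> L2 (interior K)" "v t \<in> L2 (interior K)" "y \<in> L2 (interior K)"
  using r b_grad_L2[OF H10_H1[OF vH]] H10_L2[OF vH] y by (auto intro: L)
 have 2: "S \<in> L2 (interior K)" unfolding S_def by (intro L2_sum L2_mult_left wL) simp
 have 3: "lap (qt q t K) \<in> L2 (interior K)" by (rule lap_L2[OF K qt_Ck[OF K]])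
 define R where "R = (%x. rhs D t x - S x - b_grad D (v t) x + eps D * lap (qt q t K) x - alp D * v t x)"
 have eq: "\<And>x. x \<in> interior K ==> cell_res D v t x = R x"
  unfolding R_def S_def by (rule cell_res_interior[OF t K])
 have "R \<in> L2 (interior K)" unfolding R_def by (intro L2_add L2_diff L2_mult_left 1 2 3)
 then show "cell_res D v t \<in> L2 (interior K)" by (rule L2_cong_AE[rotated 2]) (auto simp: eq)
 have "ip (interior K) (cell_res D v t) y = ip (interior K) R y" by (rule ip_cong) (simp_all add: eq)
 also have "\<dots> = ip (interior K) (rhs D t) y - ip (interior K) S y - ip (interior K) (b_grad D (v t)) y
   + eps D * ip (interior K) (lap (qt q t K)) y - alp D * ip (interior K) (v t) y"
  unfolding R_def
  by (simp add: ip_diff_left ip_add_left ip_mult_left L2_add L2_diff L2_mult_left 1 2 3)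
 also have "ip (interior K) S y = (\<Sum>l\<le>tdeg D. (real l * t ^ (l - 1)) * ip (interior K) (w m l) y)"
  unfolding S_def by (subst ip_sum_left) (auto simp: ip_mult_left 1 intro!: L2_mult_left wL)
 finally show "ip K (cell_res D v t) y = ip K (rhs D t) y - (\<Sum>l\<le>tdeg D. (real l * t ^ (l - 1)) * ip K (w m l) y)
  - ip K (b_grad D (v t)) y + eps D * ip K (lap (qt q t K)) y - alp D * ip K (v t) y"
  unfolding M.ip_mesh_cell_interior[OF K] .
qed

text \<open>The Laplacian in the cell residual cancels against the one produced by
  \<open>mesh_ibp\<close>, which leaves the weak diffusion term.\<close>

lemma elementwise_by_parts:
 assumes t: "t \<in> {node D (m - 1)<..<node D m}" and r: "rhs D t \<in> L2 U" and y: "y \<in> H10 U"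
 shows "(\<Sum>K\<in>msh D m. ip K (cell_res D v t) y - edge_pairing D (msh D m) K (v t) y)
  = ip U (rhs D t) y - (\<Sum>l\<le>tdeg D. (real l * t ^ (l - 1)) * ip U (w m l) y) - aT (v t) y"
proof -
 have ts: "t \<in> slab D m" using t by (auto simp: slab_def)
 note vH = slab_H10[OF w m ts]
 note yL = H10_L2[OF y]
 note vw = wgrad_L2[OF H10_H1[OF vH]] and yw = wgrad_L2[OF H10_H1[OF y]]
 have "(\<Sum>K\<in>msh D m. ip K (wgrad U y) (grad (qt q t K))) = (\<Sum>K\<in>msh D m. ip K (wgrad U (v t)) (wgrad U y))"
 proof (rule sum.cong[OF refl])
  fix K assume K: "K \<in> msh D m"
  have "ip (interior K) (wgrad U (v t)) (wgrad U y) = ip (interior K) (grad (qt q t K)) (wgrad U y)"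
   by (rule ip_cong_AE[OF _ wgrad_cell[OF ts K]]) auto
  then show "ip K (wgrad U y) (grad (qt q t K)) = ip K (wgrad U (v t)) (wgrad U y)"
   unfolding M.ip_mesh_cell_interior[OF K] by (simp add: ip_commute)
 qed
 also have "\<dots> = ip U (wgrad U (v t)) (wgrad U y)" by (rule M.sum_ip_cells[OF vw yw])
 finally have g: "(\<Sum>K\<in>msh D m. ip K (wgrad U y) (grad (qt q t K))) = ip U (wgrad U (v t)) (wgrad U y)" .
 have e: "(\<Sum>K\<in>msh D m. edge_pairing D (msh D m) K (v t) y)
   = eps D * (ip U (wgrad U (v t)) (wgrad U y) + (\<Sum>K\<in>msh D m. ip K (lap (qt q t K)) y))"
 proof -
  have "(\<Sum>K\<in>msh D m. edge_pairing D (msh D m) K (v t) y) = eps D * (\<Sum>K\<in>msh D m. ip K (wgrad U y) (grad (qt q t K)) + ip K y (lap (qt q t K)))"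
   by (rule M.mesh_ibp[OF refl qt_Ck qt_eq y]) (use ts in auto)
  then show ?thesis unfolding sum.distrib g by (simp add: ip_commute)
 qed
 have "(\<Sum>K\<in>msh D m. ip K (cell_res D v t) y)
  = (\<Sum>K\<in>msh D m. ip K (rhs D t) y) - (\<Sum>K\<in>msh D m. \<Sum>l\<le>tdeg D. (real l * t ^ (l - 1)) * ip K (w m l) y)
   - (\<Sum>K\<in>msh D m. ip K (b_grad D (v t)) y) + eps D * (\<Sum>K\<in>msh D m. ip K (lap (qt q t K)) y) - alp D * (\<Sum>K\<in>msh D m. ip K (v t) y)"
  using ip_cell_res(1)[OF t r _ yL] by (simp add: sum_subtractf sum.distrib sum_distrib_left)
 also have "(\<Sum>K\<in>msh D m. \<Sum>l\<le>tdeg D. (real l * t ^ (l - 1)) * ip K (w m l) y) = (\<Sum>l\<le>tdeg D. (real l * t ^ (l - 1)) * ip U (w m l) y)"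
  by (subst sum.swap) (simp add: sum_distrib_left[symmetric] M.sum_ip_cells[OF H10_L2[OF rep_H10[OF w m]] yL])
 finally show ?thesis
  unfolding sum_subtractf e aT_def M.sum_ip_cells[OF r yL] M.sum_ip_cells[OF b_grad_L2[OF H10_H1[OF vH]] yL] M.sum_ip_cells[OF H10_L2[OF vH] yL]
  by (simp add: algebra_simps)
qed

end

end

section \<open>Integrating the residuals over time\<close>

context st_problem
begin

lemma rhs_AE: "m \<in> {1..nsteps} ==> AE t in sleb m. rhs D t \<in> L2 U"
 and rhs_Lbochner1: "m \<in> {1..nsteps} ==> rhs D \<in> Lbochner 1 (slab D m) (L2 U) (L2n U)"
proof -
 assume m: "m \<in> {1..nsteps}"
 show L: "rhs D \<in> Lbochner 1 (slab D m) (L2 U) (L2n U)"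
  by (rule Lbochner_subset[OF _ slab_subset[OF m]]) (use data in \<open>simp_all add: data_ok_def\<close>)
 then show "AE t in sleb m. rhs D t \<in> L2 U" unfolding Lbochner_def by blast
qed

lemma AE_slab_interior: "AE t in sleb m. t \<in> {node D (m - 1)<..<node D m}"
 unfolding slab_def by (rule AE_Ioc_Ioo, rule AE_I2) simp

lemma continuous_slab_integrable:
 assumes "continuous_on UNIV (f :: real \<Rightarrow> real)" shows "integrable (sleb m) f"
proof -
 have c: "continuous_on {node D (m - 1)..node D m} f" using assms continuous_on_subset by blast
 obtain M where "\<And>t. t \<in> {node D (m - 1)..node D m} ==> \<bar>f t\<bar> \<le> M" using continuous_on_Icc_bounded[OF c] by blast
 then show ?thesis unfolding slab_def
  by (intro bounded_integrable_Ioc[where M = M] continuous_imp_measurable_on_sets_lebesgue[OF continuous_on_subset[OF c]]) auto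
qed

lemma power_times_slab_integrable:
 assumes f: "integrable (sleb m) f" shows "integrable (sleb m) (%t. t ^ k * f t)"
proof -
 have c: "continuous_on {node D (m - 1)..node D m} (%t. t ^ k :: real)" by (intro continuous_intros)
 obtain M where M: "\<And>t. t \<in> {node D (m - 1)..node D m} ==> \<bar>t ^ k\<bar> \<le> M" using continuous_on_Icc_bounded[OF c] by blast
 show ?thesis
  by (rule bounded_mult_integrable[OF continuous_imp_measurable_on_sets_lebesgue[OF continuous_on_subset[OF c]] _ f, where M = M])
   (use M in \<open>auto simp: slab_def\<close>)
qed

lemma rhs_cell_integrable:
 assumes m: "m \<in> {1..nsteps}" and S: "S \<subseteq> U" "S \<in> sets lebesgue" and y: "y \<in> L2 U"
 shows "integrable (sleb m) (%t. ip S (rhs D t) y)"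
proof -
 have sub: "v \<in> L2 S" if "v \<in> L2 U" for v :: "'a \<Rightarrow> real" by (rule L2_subset[OF that S dom_lebesgue])
 have "bilinear_pairing (L2 U :: ('a \<Rightarrow> real) set) (L2n U) (L2 U) (L2n U) (ip S) 1"
 proof (intro bilinear_pairing.intro bilinear_pairing_axioms.intro vspace_L2 ip_axpy_left ip_axpy_right sub)
  fix v w :: "'a \<Rightarrow> real" assume H: "v \<in> L2 U" "w \<in> L2 U"
  have "\<bar>ip S v w\<bar> \<le> L2n S v * L2n S w" by (intro ip_Cauchy_Schwarz sub H)
  also have "\<dots> \<le> L2n U v * L2n U w" by (intro mult_mono L2n_mono_set H S dom_lebesgue L2n_nonneg)
  finally show "\<bar>ip S v w\<bar> \<le> 1 * L2n U v * L2n U w" by simp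
 qed
 from bilinear_pairing.pairing_integrable_const[OF this slab_lebesgue rhs_Lbochner1[OF m] y] show ?thesis .
qed

lemma rep_b_grad:
 assumes w: "slab_rep v w" and m: "m \<in> {1..nsteps}" and t: "t \<in> slab D m"
 shows "AE x in leb U. b_grad D (v t) x = (\<Sum>l\<le>tdeg D. t ^ l * b_grad D (w m l) x)"
proof -
 have "wgrad U (v t) = wgrad U (%x. \<Sum>l\<le>tdeg D. t ^ l * w m l x)"
  by (rule wgrad_cong) (rule rep_eq_interior[OF w m t])
 then have "b_grad D (v t) = b_grad D (%x. \<Sum>l\<le>tdeg D. t ^ l * w m l x)" by (simp add: b_grad_def[abs_def])
 then show ?thesis using b_grad_sum[of "{..tdeg D}" "w m" "%l. t ^ l"] H10_H1[OF rep_H10[OF w m]] by simp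
qed

text \<open>For almost every time the pairing equals that of \<open>rhs D t\<close> with the fixed
  function \<open>y\<close>, minus a polynomial in \<open>t\<close>.\<close>

lemma cell_res_integrable:
 assumes w: "slab_rep v w" and m: "m \<in> {1..nsteps}" and K: "K \<in> msh D m" and y: "y \<in> L2 U"
 shows "integrable (sleb m) (%t. ip K (cell_res D v t) y)"
proof -
 interpret M: simplicial_mesh U "msh D m" by (rule simplicial_mesh_slab) (use m in auto)
 obtain q where q: "\<And>l K. l \<le> tdeg D ==> K \<in> msh D m ==> Ck 2 (q l K)"
  "\<And>l K x. l \<le> tdeg D ==> K \<in> msh D m ==> x \<in> K ==> w m l x = q l K x"
  by (rule rep_poly[OF w m]) blast
 note H = w m q
 let ?I = "interior K"
 have sub: "?I \<subseteq> U" by (rule M.interior_mesh_cell[OF K])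
 have yI: "y \<in> L2 ?I" by (rule L2_cell[OF H K y])
 define P where "P t = (\<Sum>l\<le>tdeg D. (real l * t ^ (l - 1)) * ip ?I (w m l) y) + (\<Sum>l\<le>tdeg D. t ^ l * ip ?I (b_grad D (w m l)) y)
  - eps D * (\<Sum>l\<le>tdeg D. t ^ l * ip ?I (lap (q l K)) y) + alp D * (\<Sum>l\<le>tdeg D. t ^ l * ip ?I (w m l) y)" for t
 have "integrable (sleb m) (%t. ip ?I (rhs D t) y - P t)"
  by (intro integrable_diff rhs_cell_integrable m sub y continuous_slab_integrable)
   (auto simp: P_def[abs_def] intro!: continuous_intros)
 moreover have "AE t in sleb m. ip ?I (rhs D t) y - P t = ip K (cell_res D v t) y"
  using AE_slab_interior rhs_AE[OF m]
 proof eventually_elim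
  case (elim t)
  then have ts: "t \<in> slab D m" by (auto simp: slab_def)
  have "ip ?I (b_grad D (v t)) y = ip ?I (%x. \<Sum>l\<le>tdeg D. t ^ l * b_grad D (w m l) x) y"
   by (rule ip_cong_AE[OF _ AE_lebesgue_on_subset[OF rep_b_grad[OF w m ts] sub]]) (auto simp: dom_lebesgue)
  also have "\<dots> = (\<Sum>l\<le>tdeg D. t ^ l * ip ?I (b_grad D (w m l)) y)"
   by (subst ip_sum_left) (auto simp: ip_mult_left yI intro!: L2_mult_left L2_cell[OF H K] b_grad_L2 H10_H1 rep_H10[OF w m])
  finally have 1: "ip ?I (b_grad D (v t)) y = (\<Sum>l\<le>tdeg D. t ^ l * ip ?I (b_grad D (w m l)) y)" .
  have "ip ?I (v t) y = ip ?I (%x. \<Sum>l\<le>tdeg D. t ^ l * w m l x) y"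
   by (rule ip_cong) (use rep_eq_interior[OF w m ts] sub in auto)
  also have "\<dots> = (\<Sum>l\<le>tdeg D. t ^ l * ip ?I (w m l) y)"
   by (subst ip_sum_left) (auto simp: ip_mult_left yI intro!: L2_mult_left L2_cell[OF H K] intro: H10_L2 rep_H10[OF w m])
  finally have 2: "ip ?I (v t) y = (\<Sum>l\<le>tdeg D. t ^ l * ip ?I (w m l) y)" .
  have "lap (qt q t K) = (%x. \<Sum>l\<le>tdeg D. t ^ l * lap (q l K) x)"
   unfolding qt_def[abs_def] by (rule ext, rule lap_sum) (use q(1) K in auto)
  then have "ip ?I (lap (qt q t K)) y = ip ?I (%x. \<Sum>l\<le>tdeg D. t ^ l * lap (q l K) x) y" by simp
  also have "\<dots> = (\<Sum>l\<le>tdeg D. t ^ l * ip ?I (lap (q l K)) y)"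
   by (subst ip_sum_left) (auto simp: ip_mult_left yI intro!: L2_mult_left lap_L2[OF H K] q(1) K)
  finally have 3: "ip ?I (lap (qt q t K)) y = (\<Sum>l\<le>tdeg D. t ^ l * ip ?I (lap (q l K)) y)" .
  show ?case
   using ip_cell_res(1)[where q = q, OF H elim K y] unfolding M.ip_mesh_cell_interior[OF K] P_def 1 2 3 by simp
 qed
 ultimately show ?thesis by (rule lebesgue_on_integrable_cong_AE[OF slab_lebesgue, rotated])
qed

text \<open>Expanding \<open>b_grad D (\<phi> t)\<close> in powers of \<open>t\<close> leaves
  pairings with functions constant in time, for which first-power integrability of
  \<open>rhs D\<close> suffices.\<close>

lemma supg_integrable:
 assumes w: "slab_rep v w" and y: "slab_rep \<phi> y" and m: "m \<in> {1..nsteps}" and K: "K \<in> msh D m"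
 shows "integrable (sleb m) (%t. ip K (cell_res D v t) (b_grad D (\<phi> t)))"
proof -
 interpret M: simplicial_mesh U "msh D m" by (rule simplicial_mesh_slab) (use m in auto)
 obtain q where q: "\<And>l K. l \<le> tdeg D ==> K \<in> msh D m ==> Ck 2 (q l K)"
  "\<And>l K x. l \<le> tdeg D ==> K \<in> msh D m ==> x \<in> K ==> w m l x = q l K x"
  by (rule rep_poly[OF w m]) blast
 note H = w m q
 have sub: "interior K \<subseteq> U" by (rule M.interior_mesh_cell[OF K])
 have bL: "b_grad D (y m l) \<in> L2 U" if "l \<le> tdeg D" for l
  by (rule b_grad_L2[OF H10_H1[OF rep_H10[OF y m that]]])
 have "integrable (sleb m) (%t. \<Sum>l\<le>tdeg D. t ^ l * ip K (cell_res D v t) (b_grad D (y m l)))"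
  by (intro integrable_sum power_times_slab_integrable cell_res_integrable[OF w m K] bL) simp
 moreover have "AE t in sleb m. (\<Sum>l\<le>tdeg D. t ^ l * ip K (cell_res D v t) (b_grad D (y m l))) = ip K (cell_res D v t) (b_grad D (\<phi> t))"
  using AE_slab_interior rhs_AE[OF m]
 proof eventually_elim
  case (elim t)
  then have ts: "t \<in> slab D m" by (auto simp: slab_def)
  have r: "cell_res D v t \<in> L2 (interior K)" by (rule ip_cell_res(2)[OF H elim K L2_zero])
  have "ip (interior K) (cell_res D v t) (b_grad D (\<phi> t)) = ip (interior K) (cell_res D v t) (%x. \<Sum>l\<le>tdeg D. t ^ l * b_grad D (y m l) x)"
   by (rule ip_cong_AE[OF _ _ AE_lebesgue_on_subset[OF rep_b_grad[OF y m ts] sub]]) (auto simp: dom_lebesgue)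
  also have "\<dots> = (\<Sum>l\<le>tdeg D. t ^ l * ip (interior K) (cell_res D v t) (b_grad D (y m l)))"
   by (subst ip_sum_right) (auto simp: ip_mult_right r intro!: L2_mult_left L2_cell[OF H K] bL)
  finally show ?case unfolding M.ip_mesh_cell_interior[OF K] by simp
 qed
 ultimately show ?thesis by (rule lebesgue_on_integrable_cong_AE[OF slab_lebesgue, rotated])
qed

lemma rep_rlim_L2: "slab_rep v w ==> m \<in> {1..nsteps} ==> rlim U v (node D (m - 1)) \<in> L2 U"
proof -
 assume w: "slab_rep v w" and m: "m \<in> {1..nsteps}"
 have "AE x in leb U. (\<Sum>l\<le>tdeg D. node D (m - 1) ^ l * w m l x) = rlim U v (node D (m - 1)) x"
  using rep_rlim[OF w m] by eventually_elim (rule sym)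
 then show ?thesis by (rule L2_cong_AE[OF dom_lebesgue _ H10_L2[OF rep_sum_H10[OF w m]]])
qed

lemma rep_llim_L2: "slab_rep v w ==> m \<in> {1..nsteps} ==> llim U v (node D m) \<in> L2 U"
proof -
 assume w: "slab_rep v w" and m: "m \<in> {1..nsteps}"
 have "AE x in leb U. (\<Sum>l\<le>tdeg D. node D m ^ l * w m l x) = llim U v (node D m) x"
  using rep_llim[OF w m] by eventually_elim (rule sym)
 then show ?thesis by (rule L2_cong_AE[OF dom_lebesgue _ H10_L2[OF rep_sum_H10[OF w m]]])
qed

lemma rep_tjump_L2: "slab_rep v w ==> m \<in> {2..nsteps} ==> tjump U v (node D (m - 1)) \<in> L2 U"
proof -
 assume w: "slab_rep v w" and m: "m \<in> {2..nsteps}"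
 have m': "m \<in> {1..nsteps}" "m - 1 \<in> {1..nsteps}" using m by auto
 from L2_diff[OF rep_rlim_L2[OF w m'(1)] rep_llim_L2[OF w m'(2)]] show ?thesis by (simp add: tjump_def[abs_def])
qed

text \<open>For almost every time the integrand is the weak residual of \<open>v\<close> applied to
  \<open>z t - \<phi> t\<close>. Integrability of the cell and edge terms together is read off from
  this identity; the residual is linear, so it splits into its values at \<open>z\<close> and
  \<open>\<phi>\<close>.\<close>

lemma cell_edge_residual:
 assumes w: "slab_rep v w" and z: "LB z" and \<phi>: "LB \<phi>"
 shows "(\<Sum>m=1..nsteps. LINT t|sleb m. (\<Sum>K\<in>msh D m. ip K (cell_res D v t) (%x. z t x - \<phi> t x)
    - edge_pairing D (msh D m) K (v t) (%x. z t x - \<phi> t x)))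
   = (F_form D z - tpairing D v z - a_form D v z) - (F_form D \<phi> - tpairing D v \<phi> - a_form D v \<phi>)"
  and "m \<in> {1..nsteps} ==> integrable (sleb m) (%t. \<Sum>K\<in>msh D m. ip K (cell_res D v t) (%x. z t x - \<phi> t x)
    - edge_pairing D (msh D m) K (v t) (%x. z t x - \<phi> t x))"
proof -
 define g where "g = (%m t \<phi>. \<Sum>l\<le>tdeg D. (real l * t ^ (l - 1)) * ip U (w m l) \<phi>)"
 have g: "tder v g" unfolding g_def by (rule rep_tder[OF w])
 define f where "f m \<psi> t = ip U (rhs D t) (\<psi> t) - g m t (\<psi> t) - aT (v t) (\<psi> t)" for m \<psi> t
 have fi: "integrable (sleb m) (f m \<psi>)"
  and fs: "(LINT t|sleb m. f m \<psi> t) = (LINT t|sleb m. ip U (rhs D t) (\<psi> t))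
    - (LINT t|sleb m. g m t (\<psi> t)) - (LINT t|sleb m. aT (v t) (\<psi> t))"
  if m: "m \<in> {1..nsteps}" and \<psi>: "LB \<psi>" for m \<psi>
 proof -
  have i: "integrable (sleb m) (%t. ip U (rhs D t) (\<psi> t))" "integrable (sleb m) (%t. g m t (\<psi> t))"
   "integrable (sleb m) (%t. aT (v t) (\<psi> t))"
   using rhs_integrable[OF \<psi>] tder_integrable[OF g \<psi> m] aT_integrable[OF rep_LB[OF w] \<psi>] m by (auto simp: slabwise_integrable_def)
  show "integrable (sleb m) (f m \<psi>)" unfolding f_def by (intro integrable_diff i)
  show "(LINT t|sleb m. f m \<psi> t) = (LINT t|sleb m. ip U (rhs D t) (\<psi> t))
    - (LINT t|sleb m. g m t (\<psi> t)) - (LINT t|sleb m. aT (v t) (\<psi> t))"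
   unfolding f_def integral_diff[OF integrable_diff[OF i(1,2)] i(3)] integral_diff[OF i(1,2)] ..
 qed
 have F: "(\<Sum>m=1..nsteps. LINT t|sleb m. f m \<psi> t) = F_form D \<psi> - tpairing D v \<psi> - a_form D v \<psi>" if \<psi>: "LB \<psi>" for \<psi>
  unfolding F_form_eq[OF \<psi>] tpairing_eq[OF g \<psi>] a_form_eq[OF rep_LB[OF w] \<psi>] slab_int_def sum_subtractf[symmetric]
  by (rule sum.cong[OF refl], rule fs[OF _ \<psi>])
 define E where "E m t = (\<Sum>K\<in>msh D m. ip K (cell_res D v t) (%x. z t x - \<phi> t x) - edge_pairing D (msh D m) K (v t) (%x. z t x - \<phi> t x))" for m t
 have ae: "AE t in sleb m. f m z t - f m \<phi> t = E m t" if m: "m \<in> {1..nsteps}" for m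
 proof -
  obtain q where q: "\<And>l K. l \<le> tdeg D ==> K \<in> msh D m ==> Ck 2 (q l K)"
   "\<And>l K x. l \<le> tdeg D ==> K \<in> msh D m ==> x \<in> K ==> w m l x = q l K x"
   by (rule rep_poly[OF w m]) blast
  show ?thesis using AE_slab_interior rhs_AE[OF m] LB_AE[OF z m] LB_AE[OF \<phi> m]
  proof eventually_elim
   case (elim t)
   have ts: "t \<in> slab D m" using elim(1) by (auto simp: slab_def)
   have g': "g m t (%x. z t x - \<phi> t x) = g m t (z t) - g m t (\<phi> t)"
    unfolding g_def sum_subtractf[symmetric] right_diff_distrib[symmetric]
    by (rule sum.cong[OF refl], subst ip_diff_right) (auto intro: H10_L2 elim rep_H10[OF w m])
   have a': "aT (v t) (%x. z t x - \<phi> t x) = aT (v t) (z t) - aT (v t) (\<phi> t)"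
    using aT_axpy_right[OF slab_H10[OF w m ts] elim(3,4), of "-1"] by simp
   have r': "ip U (rhs D t) (%x. z t x - \<phi> t x) = ip U (rhs D t) (z t) - ip U (rhs D t) (\<phi> t)"
    by (rule ip_diff_right) (intro elim H10_L2)+
   have "E m t = ip U (rhs D t) (%x. z t x - \<phi> t x) - g m t (%x. z t x - \<phi> t x) - aT (v t) (%x. z t x - \<phi> t x)"
    unfolding E_def g_def by (rule elementwise_by_parts[OF w m q elim(1,2) H10_diff[OF elim(3,4)]])
   then show ?case unfolding f_def g' a' r' by simp
  qed
 qed
 have Ei: "integrable (sleb m) (E m)" if m: "m \<in> {1..nsteps}" for m
  by (rule lebesgue_on_integrable_cong_AE[OF slab_lebesgue ae[OF m] integrable_diff[OF fi[OF m z] fi[OF m \<phi>]]])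
 then show "m \<in> {1..nsteps} ==> integrable (sleb m) (%t. \<Sum>K\<in>msh D m. ip K (cell_res D v t) (%x. z t x - \<phi> t x)
    - edge_pairing D (msh D m) K (v t) (%x. z t x - \<phi> t x))"
  unfolding E_def .
 have "(LINT t|sleb m. E m t) = (LINT t|sleb m. f m z t) - (LINT t|sleb m. f m \<phi> t)" if m: "m \<in> {1..nsteps}" for m
  unfolding lebesgue_on_integral_cong_AE[OF slab_lebesgue ae[OF m], symmetric] by (rule integral_diff[OF fi[OF m z] fi[OF m \<phi>]])
 then have "(\<Sum>m=1..nsteps. LINT t|sleb m. E m t) = (\<Sum>m=1..nsteps. (LINT t|sleb m. f m z t) - (LINT t|sleb m. f m \<phi> t))"
  by (rule sum.cong[OF refl])
 then show "(\<Sum>m=1..nsteps. LINT t|sleb m. (\<Sum>K\<in>msh D m. ip K (cell_res D v t) (%x. z t x - \<phi> t x)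
    - edge_pairing D (msh D m) K (v t) (%x. z t x - \<phi> t x)))
   = (F_form D z - tpairing D v z - a_form D v z) - (F_form D \<phi> - tpairing D v \<phi> - a_form D v \<phi>)"
  unfolding E_def sum_subtractf F[OF z] F[OF \<phi>] .
qed

end

theorem theorem3p6:
  fixes D :: "'a::euclidean_space setting"
    and J :: "(real \<Rightarrow> 'a \<Rightarrow> real) \<Rightarrow> real"
    and u z ukh zkh \<phi>kh :: "real \<Rightarrow> 'a \<Rightarrow> real"
  assumes "DIM('a) = 2 \<or> DIM('a) = 3"
    and "data_ok D" and "discretization_ok D"
    and "target_functional D NY NX J J1 J2 J3 j"
    and "stationary_point D J u z"
    and "discrete_primal_solution D ukh"
    and "discrete_dual_solution D J1 j ukh zkh"
    and "\<phi>kh \<in> Xkh D"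
  defines "e \<equiv> axpy (-1) ukh u"
  shows "J u - J ukh =
     (\<Sum>m=1..nstep D. \<integral>t. (\<Sum>K\<in>msh D m.
          ip K (cell_res D ukh t) (\<lambda>x. z t x - \<phi>kh t x)
          - dlt D m K * ip K (cell_res D ukh t) (b_grad D (\<phi>kh t))
          - edge_pairing D (msh D m) K (ukh t) (\<lambda>x. z t x - \<phi>kh t x)) \<partial>lebesgue_on (slab D m))
     - ip (Om D) (\<lambda>x. rlim (Om D) ukh 0 x - ini D x) (\<lambda>x. rlim (Om D) z 0 x - rlim (Om D) \<phi>kh 0 x)
     - (\<Sum>m=2..nstep D. ip (Om D) (tjump (Om D) ukh (node D (m - 1)))
          (\<lambda>x. z (node D (m - 1)) x - rlim (Om D) \<phi>kh (node D (m - 1)) x))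
     + (\<Sum>K\<in>msh D 1. dlt D 1 K *
          ip K (\<lambda>x. rlim (Om D) ukh 0 x - ini D x) (b_grad D (rlim (Om D) \<phi>kh 0)))
     + (\<Sum>m=2..nstep D. \<Sum>K\<in>msh D m. dlt D m K *
          ip K (tjump (Om D) ukh (node D (m - 1))) (b_grad D (rlim (Om D) \<phi>kh (node D (m - 1)))))
     + R_J J3 ukh e + 1 / 2 * Delta_rho_J J2 ukh e"
proof -
 interpret dual_problem D NY NX J J1 J2 J3 j u z
  by unfold_locales (use assms in auto)
 have ukh: "ukh \<in> Xkh D" using assms(6) by (simp add: discrete_primal_solution_def)
 obtain w where w: "slab_rep ukh w" using Xkh_rep[OF ukh] by blast
 obtain y where y: "slab_rep \<phi>kh y" using Xkh_rep[OF assms(8)] by blast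
 have LB: "LB z" "LB \<phi>kh" by (rule Y_LB[OF z_Y], rule rep_LB[OF y])
 have one: "1 \<in> {1..nsteps}" using nstep_pos by simp
 define r0 where "r0 = rlim U ukh 0"
 define p0 where "p0 = rlim U \<phi>kh 0"
 define z0 where "z0 = rlim U z 0"
 define jmp where "jmp m = tjump U ukh (node D (m - 1))" for m
 define pr where "pr m = rlim U \<phi>kh (node D (m - 1))" for m
 define zn where "zn m = z (node D (m - 1))" for m
 have L0: "r0 \<in> L2 U" "p0 \<in> L2 U" "z0 \<in> L2 U"
  using rep_rlim_L2[OF w one] rep_rlim_L2[OF y one] Y_rlim_L2[OF z_Y] by (simp_all add: node_0 r0_def p0_def z0_def)
 have Lm: "jmp m \<in> L2 U" "pr m \<in> L2 U" "zn m \<in> L2 U" if m: "m \<in> {2..nsteps}" for m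
 proof -
  have m': "m \<in> {1..nsteps}" "m - 1 \<in> {1..nsteps}" using m by auto
  show "jmp m \<in> L2 U" "pr m \<in> L2 U" unfolding jmp_def pr_def by (rule rep_tjump_L2[OF w m], rule rep_rlim_L2[OF y m'(1)])
  have "node D (m - 1) \<in> slab D (m - 1)" using slab_less[OF m'(2)] by (simp add: slab_def)
  then show "zn m \<in> L2 U" unfolding zn_def by (intro H10_L2 Y_H10[OF z_Y m'(2)])
 qed
 define G where "G \<psi> = F_form D \<psi> - tpairing D ukh \<psi> - a_form D ukh \<psi>" for \<psi>
 define B where "B m t = (\<Sum>K\<in>msh D m. dlt D m K * ip K (cell_res D ukh t) (b_grad D (\<phi>kh t)))" for m t
 define E where "E m t = (\<Sum>K\<in>msh D m. ip K (cell_res D ukh t) (%x. z t x - \<phi>kh t x)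
    - edge_pairing D (msh D m) K (ukh t) (%x. z t x - \<phi>kh t x))" for m t
 define S2 where "S2 = (\<Sum>m=2..nsteps. \<Sum>K\<in>msh D m. dlt D m K * ip K (jmp m) (b_grad D (pr m)))"
 define S3 where "S3 = (\<Sum>K\<in>msh D 1. dlt D 1 K * ip K (%x. r0 x - ini D x) (b_grad D p0))"
 have Bi: "integrable (sleb m) (B m)" if "m \<in> {1..nsteps}" for m
  unfolding B_def by (intro integrable_sum integrable_mult_right supg_integrable[OF w y that])
 have Ei: "integrable (sleb m) (E m)" if "m \<in> {1..nsteps}" for m
  unfolding E_def by (rule cell_edge_residual(2)[OF w LB that])
 have Es: "(\<Sum>m=1..nsteps. LINT t|sleb m. E m t) = G z - G \<phi>kh"
  unfolding E_def G_def by (rule cell_edge_residual(1)[OF w LB])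
 \<comment> \<open>The stabilization part is integrable by itself, so it can be separated from the
   cell and edge residuals.\<close>
 have split: "(\<Sum>m=1..nsteps. LINT t|sleb m. (\<Sum>K\<in>msh D m.
     ip K (cell_res D ukh t) (%x. z t x - \<phi>kh t x)
     - dlt D m K * ip K (cell_res D ukh t) (b_grad D (\<phi>kh t))
     - edge_pairing D (msh D m) K (ukh t) (%x. z t x - \<phi>kh t x)))
   = G z - G \<phi>kh - (\<Sum>m=1..nsteps. LINT t|sleb m. B m t)"
  unfolding Es[symmetric] sum_subtractf[symmetric]
 proof (rule sum.cong[OF refl])
  fix m assume m: "m \<in> {1..nsteps}"
  have "(%t. \<Sum>K\<in>msh D m. ip K (cell_res D ukh t) (%x. z t x - \<phi>kh t x)
     - dlt D m K * ip K (cell_res D ukh t) (b_grad D (\<phi>kh t))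
     - edge_pairing D (msh D m) K (ukh t) (%x. z t x - \<phi>kh t x)) = (%t. E m t - B m t)"
   by (rule ext) (simp add: E_def B_def sum_subtractf)
  then show "(LINT t|sleb m. (\<Sum>K\<in>msh D m. ip K (cell_res D ukh t) (%x. z t x - \<phi>kh t x)
     - dlt D m K * ip K (cell_res D ukh t) (b_grad D (\<phi>kh t))
     - edge_pairing D (msh D m) K (ukh t) (%x. z t x - \<phi>kh t x)))
   = (LINT t|sleb m. E m t) - (LINT t|sleb m. B m t)"
   using integral_diff[OF Ei[OF m] Bi[OF m]] by simp
 qed
 \<comment> \<open>\<open>supg_res\<close> is the negative of \<open>cell_res\<close>, so the volume
   part of \<open>S_form\<close> appears with the opposite sign.\<close>
 have S: "S_form D ukh \<phi>kh = - (\<Sum>m=1..nsteps. LINT t|sleb m. B m t) + S2 + S3"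
 proof -
  have "supg_res D ukh t = (%x. - cell_res D ukh t x)" for t
   by (simp add: supg_res_def cell_res_def fun_eq_iff)
  then have "(\<Sum>K\<in>msh D m. dlt D m K * ip K (supg_res D ukh t) (b_grad D (\<phi>kh t))) = - B m t" for m t
   by (simp add: B_def ip_uminus_left sum_negf)
  then show ?thesis unfolding S_form_def S2_def S3_def jmp_def pr_def r0_def p0_def by (simp add: sum_negf)
 qed
 have "A_form D ukh \<phi>kh + S_form D ukh \<phi>kh + ip U r0 p0 = F_form D \<phi>kh + ip U (ini D) p0"
  using assms(6,8) unfolding discrete_primal_solution_def r0_def p0_def by blast
 \<comment> \<open>The discrete equation expresses the residual \<open>G\<close> at
   \<open>\<phi>kh\<close> by jump, initial and stabilization terms, which are those with
   \<open>\<phi>kh\<close> in the claim.\<close>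
 then have primal: "G \<phi>kh = (\<Sum>m=2..nsteps. ip U (jmp m) (pr m)) + S_form D ukh \<phi>kh + ip U r0 p0 - ip U (ini D) p0"
  unfolding A_form_def G_def jmp_def pr_def by simp
 \<comment> \<open>All terms in \<open>u\<close> have disappeared; what is left is the residual of
   \<open>ukh\<close> at \<open>z\<close>, together with initial and jump terms tested with the
   values of \<open>z\<close>.\<close>
 have dual: "J1 u u - J1 u ukh = G z + ip U (ini D) z0 - ip U r0 z0 - (\<Sum>m=2..nsteps. ip U (jmp m) (zn m))"
  unfolding J1_u dual_eq_discrete[OF ukh] G_def z0_def r0_def jmp_def zn_def by simp
 have i0: "ip U (%x. r0 x - ini D x) (%x. z0 x - p0 x) = ip U r0 z0 - ip U r0 p0 - ip U (ini D) z0 + ip U (ini D) p0"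
  using L0 ini_L2 by (simp add: ip_diff_left ip_diff_right L2_diff)
 have im: "(\<Sum>m=2..nsteps. ip U (jmp m) (%x. zn m x - pr m x)) = (\<Sum>m=2..nsteps. ip U (jmp m) (zn m)) - (\<Sum>m=2..nsteps. ip U (jmp m) (pr m))"
  unfolding sum_subtractf[symmetric] by (intro sum.cong refl ip_diff_right Lm)
 have eW: "e \<in> W" unfolding e_def by (intro X_plus_Xkh_axpy X_W[OF u_X] Xkh_W[OF ukh])
 have ue: "axpy 1 e ukh = u" by (simp add: e_def axpy_def)
 \<comment> \<open>The expansion starts at \<open>ukh\<close>, but its first derivative is taken at
   \<open>u\<close>, where stationarity determines it.\<close>
 have J: "J u - J ukh = J1 u e + R_J J3 ukh e + 1 / 2 * Delta_rho_J J2 ukh e"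
  using functional_trapezoidal_expansion[OF J_W X_plus_Xkh_axpy Xkh_W[OF ukh] eW] unfolding ue .
 have "J1 u e = J1 u u - J1 u ukh"
  unfolding e_def using J1_axpy[OF X_W[OF u_X] X_W[OF u_X] Xkh_W[OF ukh], of "-1"] by simp
 then show ?thesis
  unfolding J split using dual primal S i0 im unfolding S2_def S3_def jmp_def pr_def zn_def r0_def p0_def z0_def by linarith
qed

end
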